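(* Let $1<p<+\infty$, $\omega\in\mathbb R$, and let $Y\in\mathbb E_2$ with $Y\neq 0$. Then the set $\mathcal O^+_{Y}$ is stable in $L^p$ norm of the absolute vorticity: for any $\varepsilon>0$ there exists $\delta>0$ such that for any smooth solution $\zeta$ of the vorticity equation $(V_\omega)$, $$\min_{f\in\mathcal O^+_{Y}}\|f-\zeta_0\|_{L^p(\mathbb S^2)}<\delta\quad\Longrightarrow\quad \min_{f\in\mathcal O^+_{Y}}\|f-\zeta_t\|_{L^p(\mathbb S^2)}<\varepsilon\quad\forall\,t>0.$$
   Context: $\mathbb S^2$ is the unit sphere in $\mathbb R^3$ with the standard metric and area measure $\sigma$, with spherical coordinates $(\varphi,\theta)\mapsto(\cos\theta\cos\varphi,\cos\theta\sin\varphi,\sin\theta)$; thus $\sin\theta=x_3$. All functions are real-valued. $\mathring L^p(\mathbb S^2)$ is the space of $L^p$ functions with zero mean. For $1<r<\infty$ and $f\in\mathring L^r(\mathbb S^2)$, $\mathcal Gf$ is the unique zero-mean function in $W^{2,r}(\mathbb S^2)$ with $-\Delta(\mathcal Gf)=f$ ($\Delta$ the Laplace-Beltrami operator). $J$ is the anticlockwise rotation by $\pi/2$ in the tangent planes, i.e. $J\mathbf v=\mathbf x\times\mathbf v$ at $\mathbf x\in\mathbb S^2$; in coordinates $J\nabla f=-\partial_\theta f\,\mathbf e_\varphi+\frac1{\cos\theta}\partial_\varphi f\,\mathbf e_\theta$. For a fixed rotation speed $\omega\in\mathbb R$, the vorticity equation $(V_\omega)$ for the absolute vorticity $\zeta$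 is $$\partial_t\zeta+J\nabla(\omega\sin\theta-\mathcal G\zeta)\cdot\nabla\zeta=0\quad\text{on }\mathbb S^2,\ t>0.$$ A smooth solution is a smooth function $\zeta$ on $\mathbb S^2\times[0,\infty)$, of zero mean on $\mathbb S^2$ at each time, satisfying this equation; $\zeta_t:=\zeta(\cdot,t)$. $\mathbb E_2$ is the space of real functions $Y$ on $\mathbb S^2$ with $-\Delta Y=6Y$. For $f:\mathbb S^2\to\mathbb R$, $\mathcal O^+_f=\{f\circ\mathsf g\mid\mathsf g\in\mathbf{SO}(3)\}$. *)

theory Defs
  imports "HOL-Analysis.Analysis"
begin

section \<open>Smooth functions\<close>

text \<open>\<open>Ck_on k U f\<close> is meaningful for open \<open>U\<close> only.\<close>

primrec Ck_on :: "nat \<Rightarrow> 'a::euclidean_space set \<Rightarrow> ('a \<Rightarrow> real) \<Rightarrow> bool" where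
  "Ck_on 0 U f \<longleftrightarrow> continuous_on U f"
| "Ck_on (Suc k) U f \<longleftrightarrow> f differentiable_on U \<and>
     (\<forall>b\<in>Basis. Ck_on k U (\<lambda>x. frechet_derivative f (at x) b))"

text \<open>Smoothness on an arbitrary subset of a Euclidean space, in the usual sense: the function
  extends locally to smooth functions on open sets. The values of \<open>f\<close> off \<open>S\<close> are irrelevant.
  On \<open>\<S>\<^sup>2 \<times> [0,\<infinity>)\<close> this is smoothness up to and including \<open>t = 0\<close>.\<close>

definition smooth_on :: "'a::euclidean_space set \<Rightarrow> ('a \<Rightarrow> real) \<Rightarrow> bool" where
  "smooth_on S f \<longleftrightarrow> (\<forall>x\<in>S. \<exists>U F. open U \<and> x \<in> U \<and> (\<forall>k. Ck_on k U F) \<and> (\<forall>y\<in>S \<inter> U. F y = f y))"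


section \<open>The unit sphere and its area measure\<close>

text \<open>Functions on the sphere are represented by functions on \<open>real^3\<close> of which only the
  values on \<open>S2\<close> matter.\<close>

abbreviation S2 :: "(real^3) set" where
  "S2 \<equiv> sphere 0 1"

definition sphere_coord :: "real \<times> real \<Rightarrow> real^3" where
  "sphere_coord = (\<lambda>(\<phi>, \<theta>). vector [cos \<theta> * cos \<phi>, cos \<theta> * sin \<phi>, sin \<theta>])"

text \<open>In these coordinates the area element is \<open>cos \<theta> d\<phi> d\<theta>\<close>.\<close>

definition sphere_measure :: "(real^3) measure" where
  "sphere_measure =
     distr
       (density lborel
         (\<lambda>(\<phi>, \<theta>). ennreal (cos \<theta>) * indicator ({-pi..pi} \<times> {-pi/2..pi/2}) (\<phi>, \<theta>)))
       (restrict_space borel S2)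
       sphere_coord"

definition Lp :: "real \<Rightarrow> (real^3 \<Rightarrow> real) set" where
  "Lp p = {f \<in> borel_measurable sphere_measure. integrable sphere_measure (\<lambda>x. \<bar>f x\<bar> powr p)}"

definition Lp_norm :: "real \<Rightarrow> (real^3 \<Rightarrow> real) \<Rightarrow> real" where
  "Lp_norm p f = (LINT x|sphere_measure. \<bar>f x\<bar> powr p) powr (1 / p)"

definition zero_mean :: "(real^3 \<Rightarrow> real) \<Rightarrow> bool" where
  "zero_mean f \<longleftrightarrow> (LINT x|sphere_measure. f x) = 0"


section \<open>Differential operators on the sphere\<close>

text \<open>\<open>sphere_deriv F x v\<close> is the derivative at \<open>x \<in> S2\<close> along the tangential part of \<open>v\<close>: the
  extension of \<open>F\<close> that is constant on rays from the origin has zero derivative in the normal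
  direction. Hence its gradient is the Riemannian gradient on \<open>S2\<close>. Since the Levi-Civita
  connection is the tangential part of the ambient derivative, the Riemannian divergence of a
  tangent field is the trace of \<open>sphere_deriv V x\<close>.\<close>

definition sphere_deriv :: "(real^3 \<Rightarrow> 'b::real_normed_vector) \<Rightarrow> real^3 \<Rightarrow> real^3 \<Rightarrow> 'b" where
  "sphere_deriv F x = frechet_derivative (\<lambda>y. F (y /\<^sub>R norm y)) (at x)"

definition sphere_grad :: "(real^3 \<Rightarrow> real) \<Rightarrow> real^3 \<Rightarrow> real^3" where
  "sphere_grad f x = (\<Sum>b\<in>Basis. sphere_deriv f x b *\<^sub>R b)"

definition sphere_div :: "(real^3 \<Rightarrow> real^3) \<Rightarrow> real^3 \<Rightarrow> real" where
  "sphere_div V x = (\<Sum>b\<in>Basis. sphere_deriv V x b \<bullet> b)"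

definition laplace_beltrami :: "(real^3 \<Rightarrow> real) \<Rightarrow> real^3 \<Rightarrow> real" where
  "laplace_beltrami f = sphere_div (sphere_grad f)"

text \<open>The Hilbert-Schmidt norm of the covariant Hessian.\<close>

definition sphere_hess_norm :: "(real^3 \<Rightarrow> real) \<Rightarrow> real^3 \<Rightarrow> real" where
  "sphere_hess_norm f x =
     sqrt (\<Sum>b\<in>Basis. let w = sphere_deriv (sphere_grad f) x b in (norm (w - (x \<bullet> w) *\<^sub>R x))\<^sup>2)"

definition rot_J :: "real^3 \<Rightarrow> real^3 \<Rightarrow> real^3" where
  "rot_J x v = cross3 x v"


section \<open>The inverse Laplacian\<close>

definition W2_norm :: "real \<Rightarrow> (real^3 \<Rightarrow> real) \<Rightarrow> real" where
  "W2_norm r f = Lp_norm r f + Lp_norm r (\<lambda>x. norm (sphere_grad f x)) + Lp_norm r (sphere_hess_norm f)"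

text \<open>\<open>W\<^sup>2\<^sup>,\<^sup>r\<close> as the completion of the smooth functions, realised inside \<open>L\<^sup>r\<close>.\<close>

definition W2 :: "real \<Rightarrow> (real^3 \<Rightarrow> real) set" where
  "W2 r = {u \<in> Lp r. \<exists>U. (\<forall>n::nat. smooth_on S2 (U n)) \<and>
     (\<lambda>n. Lp_norm r (\<lambda>x. U n x - u x)) \<longlonglongrightarrow> 0 \<and>
     (\<forall>e>0. \<exists>N. \<forall>m\<ge>N. \<forall>n\<ge>N. W2_norm r (\<lambda>x. U m x - U n x) < e)}"

text \<open>Equality \<open>-\<Delta>u = f\<close> in the sense of distributions.\<close>

definition weak_poisson :: "(real^3 \<Rightarrow> real) \<Rightarrow> (real^3 \<Rightarrow> real) \<Rightarrow> bool" where
  "weak_poisson f u \<longleftrightarrow> (\<forall>\<phi>. smooth_on S2 \<phi> \<longrightarrow>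
     (LINT x|sphere_measure. u x * (- laplace_beltrami \<phi> x)) = (LINT x|sphere_measure. f x * \<phi> x))"

text \<open>Elements of \<open>W\<^sup>2\<^sup>,\<^sup>r\<close>, \<open>r > 1\<close>, are determined almost everywhere only; as the sphere is
  two-dimensional, each has exactly one continuous representative, which is the one selected here
  (set to \<open>0\<close> off the sphere). The solution does not depend on the exponent \<open>r\<close> with
  \<open>f \<in> L\<^sup>r\<close>.\<close>

definition green :: "(real^3 \<Rightarrow> real) \<Rightarrow> real^3 \<Rightarrow> real" where
  "green f = (THE u. continuous_on S2 u \<and> (\<forall>x. x \<notin> S2 \<longrightarrow> u x = 0) \<and>
     zero_mean u \<and> (\<exists>r>1. f \<in> Lp r \<and> u \<in> W2 r) \<and> weak_poisson f u)"


section \<open>The vorticity equation\<close>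

definition smooth_vorticity_solution :: "real \<Rightarrow> (real \<Rightarrow> real^3 \<Rightarrow> real) \<Rightarrow> bool" where
  "smooth_vorticity_solution \<omega> \<zeta> \<longleftrightarrow>
     smooth_on (S2 \<times> {0..}) (\<lambda>(x, t). \<zeta> t x) \<and>
     (\<forall>t\<ge>0. zero_mean (\<zeta> t)) \<and>
     (\<forall>t>0. \<forall>x\<in>S2.
        deriv (\<lambda>s. \<zeta> s x) t
        + rot_J x (sphere_grad (\<lambda>y. \<omega> * y $ 3 - green (\<zeta> t) y) x) \<bullet> sphere_grad (\<zeta> t) x = 0)"


section \<open>Degree-2 spherical harmonics and rotation orbits\<close>

definition E2 :: "(real^3 \<Rightarrow> real) set" where
  "E2 = {Y. smooth_on S2 Y \<and> (\<forall>x\<in>S2. - laplace_beltrami Y x = 6 * Y x)}"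

definition rot_orbit :: "(real^3 \<Rightarrow> real) \<Rightarrow> (real^3 \<Rightarrow> real) set" where
  "rot_orbit f = {f \<circ> (\<lambda>x. A *v x) | A :: real^3^3. rotation_matrix A}"

text \<open>The minimum is attained for continuous \<open>Y\<close> and \<open>g\<close>, since the rotation group is compact.\<close>

definition orbit_dist :: "real \<Rightarrow> (real^3 \<Rightarrow> real) \<Rightarrow> (real^3 \<Rightarrow> real) \<Rightarrow> real" where
  "orbit_dist p Y g = (LEAST d. d \<in> (\<lambda>f. Lp_norm p (\<lambda>x. f x - g x)) ` rot_orbit Y)"

end

theory Submission
  imports Defs
begin

text \<open>A solution conserves the energy \<open>\<integral> \<zeta> \<G>\<zeta>\<close>, the Casimir functionals \<open>\<integral> G(\<zeta>)\<close> and the norm of the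
  angular momentum \<open>\<integral> x \<zeta>\<close>, which precesses about the axis of rotation. On zero-mean functions the
  largest eigenvalues of the Green operator are \<open>1/2\<close> (linear functions) and \<open>1/6\<close> (the space \<open>\<bbbE>\<^sub>2\<close>), so
  for small momentum \<open>\<integral> f\<^sup>2 / 6 - \<integral> f \<G>f\<close> controls the squared distance from \<open>f\<close> to \<open>\<bbbE>\<^sub>2\<close>. As the energy
  and \<open>\<integral> \<zeta>\<^sup>2\<close> are conserved, a solution starting near the orbit of \<open>Y\<close> stays near some \<open>h\<close> in \<open>\<bbbE>\<^sub>2\<close>. Such an
  \<open>h\<close> is a traceless quadratic form on the sphere; up to rotation it is given by its sorted eigenvalues,
  and these are determined by \<open>\<integral> h\<^sup>2\<close> and \<open>\<integral> h\<^sup>3\<close>, which are nearly those of \<open>Y\<close>. Since the \<open>L\<^sup>p\<close> norm need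
  not control these powers, the argument is applied to the truncation of \<open>\<zeta>\<close> to \<open>[-M, M]\<close> with
  \<open>M \<ge> sup |Y|\<close>, whose distribution is conserved as well.\<close>


section \<open>Functions of class Ck\<close>

text \<open>Why two Casimirs: fixing the integral of h^2 leaves a sphere in the five-dimensional
  space \<open>E2\<close>, while orbits of rotations have dimension at most three; the cubic
  integral is the missing invariant. Why the momentum: the form "integral of f^2 / 6 minus energy"
  is negative on linear functions, where the Green operator has eigenvalue 1/2, so their component
  must be kept small by a conserved quantity of its own. In degrees at least 3 the form is at least
  1/6 - 1/12 = 1/12 times the square integral; this gap gives the constants 12 and 24. The energy
  tolerates truncation because the logarithmic kernel lies in every L^q with q finite: near a
  bounded function the energy is Lipschitz in L^1 once the L^p distance is at most 1. All constants
  are uniform over solutions, so delta is chosen from p, Y and epsilon alone. The calculus rests on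
  one identity, the vanishing integral of a derivative along a rotation field, and on zonal
  functions \<open>h (a \<bullet> x)\<close>, where the Laplacian becomes the Legendre
  operator.\<close>

lemma frechet_derivative_cong_open:
  assumes "open U" "x \<in> U" "\<And>y. y \<in> U \<Longrightarrow> f y = g y"
  shows "frechet_derivative f (at x) = frechet_derivative g (at x)"
proof -
  have "(f has_derivative D) (at x) \<longleftrightarrow> (g has_derivative D) (at x)" for D
    using assms by (metis has_derivative_transform_within_open)
  then show ?thesis by (simp add: frechet_derivative_def)
qed

lemma Ck_on_Suc_iff:
  assumes "open U"
  shows "Ck_on (Suc k) U f \<longleftrightarrow>
    (\<forall>x\<in>U. (f has_derivative frechet_derivative f (at x)) (at x)) \<and>
    (\<forall>b\<in>Basis. Ck_on k U (\<lambda>x. frechet_derivative f (at x) b))"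
  using assms by (auto simp: differentiable_on_eq_differentiable_at frechet_derivative_works)

lemma Ck_on_cong:
  assumes "open U" "\<And>x. x \<in> U \<Longrightarrow> f x = g x"
  shows "Ck_on k U f \<longleftrightarrow> Ck_on k U g"
  using assms(2)
proof (induction k arbitrary: f g)
  case 0 then show ?case by (simp cong: continuous_on_cong)
next
  case (Suc k)
  have e: "frechet_derivative f (at x) = frechet_derivative g (at x)" if "x \<in> U" for x
    using frechet_derivative_cong_open[OF assms(1) that] Suc.prems by blast
  have "(f has_derivative D) (at x) \<longleftrightarrow> (g has_derivative D) (at x)" if "x \<in> U" for D x
    using assms(1) that Suc.prems by (metis has_derivative_transform_within_open)
  moreover have "Ck_on k U (\<lambda>x. frechet_derivative f (at x) b) \<longleftrightarrow>
      Ck_on k U (\<lambda>x. frechet_derivative g (at x) b)" for b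
    by (rule Suc.IH) (simp add: e)
  ultimately show ?case unfolding Ck_on_Suc_iff[OF assms(1)] using e by simp
qed

lemma Ck_on_SucI:
  assumes "open U" "\<And>x. x \<in> U \<Longrightarrow> (f has_derivative f' x) (at x)"
    and "\<And>b. b \<in> Basis \<Longrightarrow> Ck_on k U (\<lambda>x. f' x b)"
  shows "Ck_on (Suc k) U f"
proof -
  have e: "frechet_derivative f (at x) = f' x" if "x \<in> U" for x
    using frechet_derivative_at[OF assms(2)[OF that]] by simp
  have "Ck_on k U (\<lambda>x. frechet_derivative f (at x) b)" if "b \<in> Basis" for b
    using assms(3)[OF that] e Ck_on_cong[OF assms(1), of "\<lambda>x. frechet_derivative f (at x) b" "\<lambda>x. f' x b"] by simp
  then show ?thesis unfolding Ck_on_Suc_iff[OF assms(1)] using assms(2) e by simp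
qed

lemma Ck_on_subset: "Ck_on k U f \<Longrightarrow> V \<subseteq> U \<Longrightarrow> Ck_on k V f"
  by (induction k arbitrary: f) (auto intro: continuous_on_subset differentiable_on_subset)

lemma Ck_on_has_derivative:
  "Ck_on (Suc k) U f \<Longrightarrow> open U \<Longrightarrow> x \<in> U \<Longrightarrow> (f has_derivative frechet_derivative f (at x)) (at x)"
  using Ck_on_Suc_iff by blast

lemma Ck_on_SucD: "Ck_on (Suc k) U f \<Longrightarrow> Ck_on k U f"
  by (induction k arbitrary: f) (auto intro: differentiable_imp_continuous_on)

lemma Ck_on_le: "Ck_on k U f \<Longrightarrow> j \<le> k \<Longrightarrow> Ck_on j U f"
  by (induction k) (auto simp: le_Suc_eq dest: Ck_on_SucD simp del: Ck_on.simps)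

lemma Ck_on_imp_continuous_on: "Ck_on k U f \<Longrightarrow> continuous_on U f"
  using Ck_on_le[of k U f 0] by simp

text \<open>Smoothness on a subset hands out a different extension near every point, so regularity
  has to be assembled from neighbourhoods.\<close>

lemma Ck_on_local:
  assumes "open U" "\<And>x. x \<in> U \<Longrightarrow> \<exists>W. open W \<and> x \<in> W \<and> Ck_on k W f"
  shows "Ck_on k U f"
  using assms(2)
proof (induction k arbitrary: f)
  case 0
  then have "\<forall>x\<in>U. isCont f x"
    by (metis Ck_on.simps(1) continuous_on_eq_continuous_at)
  then show ?case by (simp add: continuous_at_imp_continuous_on)
next
  case (Suc k)
  have "(f has_derivative frechet_derivative f (at x)) (at x)" if "x \<in> U" for x
    using Suc.prems[OF that] Ck_on_has_derivative by blast
  moreover have "Ck_on k U (\<lambda>x. frechet_derivative f (at x) b)" if "b \<in> Basis" for b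
  proof (rule Suc.IH)
    fix x assume "x \<in> U"
    then obtain W where "open W" "x \<in> W" "Ck_on (Suc k) W f" using Suc.prems by blast
    then show "\<exists>W. open W \<and> x \<in> W \<and> Ck_on k W (\<lambda>a. frechet_derivative f (at a) b)"
      using that by auto
  qed
  ultimately show ?case unfolding Ck_on_Suc_iff[OF assms(1)] by blast
qed

lemma Ck_on_const: "open U \<Longrightarrow> Ck_on k U (\<lambda>x. c)"
  by (induction k arbitrary: c) (auto intro!: Ck_on_SucI[where f' = "\<lambda>_ _. 0"] simp del: Ck_on.simps(2))

lemma Ck_on_bounded_linear: "open U \<Longrightarrow> bounded_linear f \<Longrightarrow> Ck_on k U f"
  by (cases k) (auto intro!: Ck_on_SucI[where f' = "\<lambda>_. f"] bounded_linear_imp_has_derivative Ck_on_const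
      linear_continuous_on simp del: Ck_on.simps(2))

lemma Ck_on_add:
  assumes "open U"
  shows "Ck_on k U f \<Longrightarrow> Ck_on k U g \<Longrightarrow> Ck_on k U (\<lambda>x. f x + g x)"
proof (induction k arbitrary: f g)
  case 0 then show ?case by (auto intro: continuous_intros)
next
  case (Suc k)
  show ?case
    by (rule Ck_on_SucI[OF assms, where f' = "\<lambda>x b. frechet_derivative f (at x) b + frechet_derivative g (at x) b"])
      (use Suc.IH Suc.prems in \<open>auto intro!: has_derivative_add Ck_on_has_derivative[OF _ assms] simp del: Ck_on.simps(2) simp: Ck_on_Suc_iff[OF assms]\<close>)
qed

lemma Ck_on_mult:
  assumes "open U"
  shows "Ck_on k U f \<Longrightarrow> Ck_on k U g \<Longrightarrow> Ck_on k U (\<lambda>x. f x * g x)"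
proof (induction k arbitrary: f g)
  case 0 then show ?case by (auto intro: continuous_intros)
next
  case (Suc k)
  note P = Suc.prems[unfolded Ck_on_Suc_iff[OF assms]] and D = Suc.prems[THEN Ck_on_SucD]
  show ?case
    by (rule Ck_on_SucI[OF assms, where f' = "\<lambda>x b. f x * frechet_derivative g (at x) b + frechet_derivative f (at x) b * g x"])
      (use P D in \<open>auto intro!: has_derivative_mult Ck_on_add assms Suc.IH simp del: Ck_on.simps(2)\<close>)
qed

lemma Ck_on_cmult: "open U \<Longrightarrow> Ck_on k U f \<Longrightarrow> Ck_on k U (\<lambda>x. c * f x)"
  by (intro Ck_on_mult Ck_on_const)

lemma Ck_on_uminus: "open U \<Longrightarrow> Ck_on k U f \<Longrightarrow> Ck_on k U (\<lambda>x. - f x)"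
  using Ck_on_cmult[of U k f "-1"] by simp

lemma Ck_on_diff: "open U \<Longrightarrow> Ck_on k U f \<Longrightarrow> Ck_on k U g \<Longrightarrow> Ck_on k U (\<lambda>x. f x - g x)"
  using Ck_on_add[of U k f "\<lambda>x. - g x"] Ck_on_uminus[of U k g] by simp

lemma Ck_on_sum: "open U \<Longrightarrow> (\<And>i. i \<in> I \<Longrightarrow> Ck_on k U (f i)) \<Longrightarrow> Ck_on k U (\<lambda>x. \<Sum>i\<in>I. f i x)"
  by (induction I rule: infinite_finite_induct) (auto intro: Ck_on_const Ck_on_add)

lemma Ck_on_power: "open U \<Longrightarrow> Ck_on k U f \<Longrightarrow> Ck_on k U (\<lambda>x. f x ^ n)"
  by (induction n) (auto intro: Ck_on_const Ck_on_mult)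

text \<open>By the chain rule each partial derivative of the composite is a sum of products of a
  partial of \<open>g\<close> with a partial of \<open>f\<close> taken at \<open>g x\<close>. The
  induction therefore varies \<open>f\<close> and keeps \<open>g\<close>, which is only lowered by
  one order.\<close>

lemma Ck_on_compose:
  fixes f :: "'b::euclidean_space \<Rightarrow> real" and g :: "'a::euclidean_space \<Rightarrow> 'b"
  assumes "open U" "open V" "g ` U \<subseteq> V"
  shows "Ck_on k V f \<Longrightarrow> (\<And>c. c \<in> Basis \<Longrightarrow> Ck_on k U (\<lambda>x. g x \<bullet> c)) \<Longrightarrow> Ck_on k U (\<lambda>x. f (g x))"
proof (induction k arbitrary: f)
  case 0
  then have "continuous_on U g" by (auto intro: continuous_on_componentwise[THEN iffD2])
  then show ?case using 0 assms(3) by (auto intro: continuous_on_compose2)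
next
  case (Suc k)
  define g' where "g' = (\<lambda>x v. \<Sum>c\<in>Basis. frechet_derivative (\<lambda>x. g x \<bullet> c) (at x) v *\<^sub>R c)"
  have g': "(g has_derivative g' x) (at x)" if "x \<in> U" for x
    unfolding has_derivative_componentwise_within[of g] g'_def
    using Ck_on_has_derivative[OF Suc.prems(2) assms(1) that] 
    by (simp add: inner_sum_left inner_Basis if_distrib cong: if_cong)
  have f': "(f has_derivative frechet_derivative f (at (g x))) (at (g x))" if "x \<in> U" for x
    using Ck_on_has_derivative[OF Suc.prems(1) assms(2)] that assms(3) by blast
  have lin: "frechet_derivative f (at (g x)) (g' x b) =
     (\<Sum>c\<in>Basis. frechet_derivative (\<lambda>x. g x \<bullet> c) (at x) b * frechet_derivative f (at (g x)) c)" if "x \<in> U" for x b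
  proof -
    interpret linear "frechet_derivative f (at (g x))"
      using f'[OF that] has_derivative_linear by blast
    show ?thesis by (simp add: g'_def sum scaleR)
  qed
  show ?case
  proof (rule Ck_on_SucI[OF assms(1), where f' = "\<lambda>x v. frechet_derivative f (at (g x)) (g' x v)"])
    show "((\<lambda>x. f (g x)) has_derivative (\<lambda>v. frechet_derivative f (at (g x)) (g' x v))) (at x)" if "x \<in> U" for x
      using diff_chain_at[OF g'[OF that] f'[OF that]] by (simp add: o_def)
    fix b :: 'a assume b: "b \<in> Basis"
    have "Ck_on k U (\<lambda>x. \<Sum>c\<in>Basis. frechet_derivative (\<lambda>x. g x \<bullet> c) (at x) b * frechet_derivative f (at (g x)) c)"
    proof (intro Ck_on_sum Ck_on_mult assms(1))
      fix c :: 'b assume c: "c \<in> Basis"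
      show "Ck_on k U (\<lambda>x. frechet_derivative (\<lambda>x. g x \<bullet> c) (at x) b)"
        using Suc.prems(2)[OF c] b by simp
      show "Ck_on k U (\<lambda>x. frechet_derivative f (at (g x)) c)"
      proof (rule Suc.IH)
        show "Ck_on k V (\<lambda>y. frechet_derivative f (at y) c)" using Suc.prems(1) c by simp
        show "Ck_on k U (\<lambda>x. g x \<bullet> c)" if "c \<in> Basis" for c
          using Suc.prems(2)[OF that] by (rule Ck_on_SucD)
      qed
    qed
    then show "Ck_on k U (\<lambda>x. frechet_derivative f (at (g x)) (g' x b))"
      using Ck_on_cong[OF assms(1), of "\<lambda>x. frechet_derivative f (at (g x)) (g' x b)"] lin by (metis (no_types, lifting))
  qed
qed

lemma Ck_on_compose_real:
  fixes f :: "real \<Rightarrow> real" and g :: "'a::euclidean_space \<Rightarrow> real"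
  assumes "open U" "open V" "g ` U \<subseteq> V" "Ck_on k V f" "Ck_on k U g"
  shows "Ck_on k U (\<lambda>x. f (g x))"
  by (rule Ck_on_compose[OF assms(1-4)]) (use assms(5) in simp)

lemma Ck_on_real_SucI:
  fixes f :: "real \<Rightarrow> real"
  assumes "open U" "\<And>x. x \<in> U \<Longrightarrow> (f has_real_derivative f' x) (at x)" "Ck_on k U f'"
  shows "Ck_on (Suc k) U f"
  by (rule Ck_on_SucI[where f' = "\<lambda>x v. f' x * v"]) (use assms in \<open>auto simp: has_field_derivative_def\<close>)

text \<open>Derivatives of powers are again powers up to a factor, so a single induction over all
  exponents covers the reciprocal and the square root; the logarithm follows after one
  differentiation.\<close>

lemma Ck_on_powr: "Ck_on k {0<..} (\<lambda>x::real. x powr s)"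
proof (induction k arbitrary: s)
  case 0 show ?case by (auto intro!: continuous_intros)
next
  case (Suc k)
  show ?case
    by (rule Ck_on_real_SucI[where f' = "\<lambda>x. s * x powr (s - 1)"])
      (auto intro!: has_real_derivative_powr Ck_on_cmult Suc)
qed

lemma Ck_on_ln: "Ck_on k {0<..} (ln :: real \<Rightarrow> real)"
proof (cases k)
  case (Suc j)
  have "Ck_on j {0<..} (\<lambda>x::real. inverse x)"
    using Ck_on_powr[of j "-1"] Ck_on_cong[of "{0<..}" "\<lambda>x::real. x powr -1" inverse j] by (simp add: powr_minus)
  then show ?thesis unfolding Suc
    by (rule Ck_on_real_SucI[where f' = inverse, rotated 2]) (auto intro!: DERIV_ln)
qed (auto intro!: continuous_intros)

lemma Ck_on_inverse:
  assumes "open U" "Ck_on k U f" "\<And>x. x \<in> U \<Longrightarrow> f x > 0"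
  shows "Ck_on k U (\<lambda>x. inverse (f x))"
proof -
  have "Ck_on k U (\<lambda>x. f x powr -1)"
    by (rule Ck_on_compose_real[OF assms(1) _ _ Ck_on_powr assms(2)]) (use assms(3) in auto)
  then show ?thesis
    using Ck_on_cong[OF assms(1), of "\<lambda>x. f x powr -1" "\<lambda>x. inverse (f x)" k] assms(3)
    by (simp add: powr_minus less_imp_le)
qed

lemma Ck_on_inner: "open U \<Longrightarrow> Ck_on k U (\<lambda>x. x \<bullet> c)"
  by (intro Ck_on_bounded_linear bounded_linear_inner_left)

lemma Ck_on_norm: "Ck_on k (- {0}) (norm :: 'a::euclidean_space \<Rightarrow> real)"
proof -
  have e: "(\<Sum>b\<in>Basis. (x \<bullet> b) ^ 2) = (norm x)\<^sup>2" for x :: 'a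
    unfolding power2_norm_eq_inner euclidean_inner[of x x] by (simp add: power2_eq_square)
  have "Ck_on k (- {0}) (\<lambda>x::'a. \<Sum>b\<in>Basis. (x \<bullet> b) ^ 2)"
    by (intro Ck_on_sum Ck_on_power Ck_on_inner) auto
  then have "Ck_on k (- {0}) (\<lambda>x::'a. (\<Sum>b\<in>Basis. (x \<bullet> b) ^ 2) powr (1/2))"
    by (rule Ck_on_compose_real[OF _ _ _ Ck_on_powr, rotated 3]) (auto simp: e)
  moreover have "(\<lambda>x::'a. (\<Sum>b\<in>Basis. (x \<bullet> b) ^ 2) powr (1/2)) = norm"
    by (rule ext) (metis e powr_half_sqrt zero_le_power2 real_sqrt_abs abs_norm_cancel)
  ultimately show ?thesis by (simp only:)
qed

lemma Ck_on_inner_normalize: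
  "Ck_on k (- {0}) (\<lambda>y::'a::euclidean_space. (y /\<^sub>R norm y) \<bullet> c)"
  unfolding inner_scaleR_left
  by (intro Ck_on_mult Ck_on_inverse Ck_on_norm Ck_on_inner) auto


section \<open>Integration over the sphere\<close>

lemma sphere_coord_eq:
  "sphere_coord (\<phi>, \<theta>) = (cos \<theta> * cos \<phi>) *\<^sub>R axis 1 1 + (cos \<theta> * sin \<phi>) *\<^sub>R axis 2 1 + sin \<theta> *\<^sub>R axis 3 1"
  by (simp add: sphere_coord_def vec_eq_iff forall_3 axis_def)

lemma sphere_coord_in_S2: "sphere_coord v \<in> S2"
proof (cases v)
  case (Pair \<phi> \<theta>)
  have "(cos \<theta> * cos \<phi>)\<^sup>2 + (cos \<theta> * sin \<phi>)\<^sup>2 + (sin \<theta>)\<^sup>2 = (cos \<theta>)\<^sup>2 * ((cos \<phi>)\<^sup>2 + (sin \<phi>)\<^sup>2) + (sin \<theta>)\<^sup>2"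
    by (simp only: power_mult_distrib distrib_left)
  then have "(cos \<theta> * cos \<phi>)\<^sup>2 + (cos \<theta> * sin \<phi>)\<^sup>2 + (sin \<theta>)\<^sup>2 = 1"
    by simp
  then show ?thesis
    by (simp add: Pair sphere_coord_def norm_vec_def L2_set_def sum_3)
qed

lemma continuous_on_sphere_coord: "continuous_on B sphere_coord"
proof -
  have "continuous_on B (\<lambda>v. (cos (snd v) * cos (fst v)) *\<^sub>R (axis 1 1 :: real^3) + (cos (snd v) * sin (fst v)) *\<^sub>R axis 2 1 + sin (snd v) *\<^sub>R axis 3 1)"
    by (intro continuous_intros)
  moreover have "sphere_coord = (\<lambda>v. (cos (snd v) * cos (fst v)) *\<^sub>R axis 1 1 + (cos (snd v) * sin (fst v)) *\<^sub>R axis 2 1 + sin (snd v) *\<^sub>R axis 3 1)"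
    using sphere_coord_eq by (simp add: fun_eq_iff)
  ultimately show ?thesis by (simp only:)
qed

lemma space_sphere_measure [simp]: "space sphere_measure = S2"
  by (simp add: sphere_measure_def space_restrict_space)

lemma sets_sphere_measure [simp, measurable_cong]: "sets sphere_measure = sets (restrict_space borel S2)"
  by (simp add: sphere_measure_def)

lemma borel_measurable_sphere_measure: "continuous_on S2 f \<Longrightarrow> f \<in> borel_measurable sphere_measure"
  by (simp add: borel_measurable_continuous_on_restrict cong: measurable_cong_sets)

abbreviation coord_box :: "(real \<times> real) set" where
  "coord_box \<equiv> cbox (- pi, - pi/2) (pi, pi/2)"

text \<open>With the indicator moved inside, the weight is one nonnegative real function, as the
  density rules for Bochner integrals ask for; \<open>cos\<close> alone is negative at some points
  outside the coordinate box.\<close>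

lemma sphere_measure_alt:
  "sphere_measure = distr (density lborel (\<lambda>v. ennreal (indicator coord_box v * cos (snd v)))) (restrict_space borel S2) sphere_coord"
proof -
  have "ennreal (cos \<theta>) * indicator ({-pi..pi} \<times> {-pi/2..pi/2}) (\<phi>, \<theta>) = ennreal (indicator coord_box (\<phi>, \<theta>) * cos \<theta>)" for \<phi> \<theta>
    by (auto simp: indicator_def cbox_Pair_eq)
  then show ?thesis unfolding sphere_measure_def by (simp add: case_prod_beta')
qed

lemma cos_coord_box: "v \<in> coord_box \<Longrightarrow> 0 \<le> cos (snd v)"
  using cos_ge_zero[of "snd v"] by (cases v) (simp add: cbox_Pair_eq)

lemma measurable_sphere_coord [measurable]: "sphere_coord \<in> measurable borel (restrict_space borel S2)"
  using borel_measurable_continuous_onI[OF continuous_on_sphere_coord] sphere_coord_in_S2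
  by (intro measurable_restrict_space2) blast+

lemma
  fixes f :: "real^3 \<Rightarrow> real"
  assumes "continuous_on S2 f"
  shows integrable_sphere_measure: "integrable sphere_measure f"
    and sphere_integral_coord: "(LINT x|sphere_measure. f x) = integral coord_box (\<lambda>v. cos (snd v) * f (sphere_coord v))"
proof -
  have m: "f \<in> borel_measurable (restrict_space borel S2)"
    using assms by (rule borel_measurable_continuous_on_restrict)
  have c: "continuous_on coord_box (\<lambda>v. cos (snd v) * f (sphere_coord v))"
    by (intro continuous_intros continuous_on_compose2[OF assms continuous_on_sphere_coord])
      (auto intro: sphere_coord_in_S2)
  have i: "set_integrable lborel coord_box (\<lambda>v. cos (snd v) * f (sphere_coord v))"
    unfolding set_integrable_def by (rule borel_integrable_compact[OF compact_cbox c])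
  have fm: "(\<lambda>v. f (sphere_coord v)) \<in> borel_measurable lborel"
    using measurable_compose[OF measurable_sphere_coord m] by simp
  have nn: "AE v in lborel. 0 \<le> indicator coord_box v * cos (snd v)"
    using cos_coord_box by (auto simp: indicator_def)
  have wm: "(\<lambda>v::real\<times>real. indicator coord_box v * cos (snd v)) \<in> borel_measurable lborel"
    by measurable (auto intro!: borel_measurable_continuous_onI continuous_intros)
  have "integrable (density lborel (\<lambda>v. ennreal (indicator coord_box v * cos (snd v)))) (\<lambda>v. f (sphere_coord v))"
    using i by (subst integrable_density[OF fm wm nn]) (simp add: set_integrable_def mult.assoc)
  then show "integrable sphere_measure f"
    unfolding sphere_measure_alt by (subst integrable_distr_eq[OF _ m]) auto
  have "(LINT x|sphere_measure. f x) = (LINT v|density lborel (\<lambda>v. ennreal (indicator coord_box v * cos (snd v))). f (sphere_coord v))"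
    unfolding sphere_measure_alt by (subst integral_distr[OF _ m]) auto
  also have "\<dots> = (LINT v|lborel. (indicator coord_box v * cos (snd v)) *\<^sub>R f (sphere_coord v))"
    by (rule integral_density[OF fm wm nn])
  also have "\<dots> = integral coord_box (\<lambda>v. cos (snd v) * f (sphere_coord v))"
    using set_borel_integral_eq_integral(2)[OF i] by (simp add: set_lebesgue_integral_def mult.assoc)
  finally show "(LINT x|sphere_measure. f x) = integral coord_box (\<lambda>v. cos (snd v) * f (sphere_coord v))" .
qed

lemma finite_measure_sphere: "finite_measure sphere_measure"
proof (rule finite_measureI)
  have "(\<integral>\<^sup>+ x. ennreal (norm (1::real)) \<partial>sphere_measure) < \<infinity>"
    using integrable_sphere_measure[of "\<lambda>_. 1"] unfolding integrable_iff_bounded by auto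
  then show "emeasure sphere_measure (space sphere_measure) \<noteq> \<infinity>" by simp
qed

interpretation sphere: finite_measure sphere_measure
  by (rule finite_measure_sphere)

text \<open>Kept as a symbol: the kernels are normalised by it, and the moments of the sphere are
  later read off from it instead of being integrated in coordinates.\<close>

definition area :: real where "area = measure sphere_measure S2"

lemma area_pos: "area > 0"
proof -
  have "area = (LINT x|sphere_measure. 1)" by (simp add: area_def)
  also have "\<dots> = integral coord_box (\<lambda>v. cos (snd v))"
    by (subst sphere_integral_coord) auto
  also have "\<dots> = integral (cbox (-pi) pi) (\<lambda>\<phi>. integral (cbox (-pi/2) (pi/2)) cos)"
    by (subst integral_prod_continuous) (auto intro!: continuous_intros)
  also have "integral (cbox (-pi/2) (pi/2)) cos = sin (pi/2) - sin (-pi/2)"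
    unfolding cbox_interval
    by (intro integral_unique fundamental_theorem_of_calculus)
      (auto intro!: derivative_eq_intros simp flip: has_real_derivative_iff_has_vector_derivative)
  finally have "area = 4 * pi" by simp
  then show ?thesis using pi_gt_zero by linarith
qed

section \<open>Weighted integrals and their dependence on a parameter\<close>

lemma sphere_integrable_mult:
  fixes k f :: "real^3 \<Rightarrow> real"
  assumes "integrable sphere_measure k" "continuous_on S2 f"
  shows "integrable sphere_measure (\<lambda>x. k x * f x)"
proof -
  have "bounded (f ` S2)"
    using compact_imp_bounded[OF compact_continuous_image[OF assms(2) compact_sphere]] .
  then obtain M where M: "\<forall>x\<in>S2. norm (f x) \<le> M" unfolding bounded_iff by blast
  have [measurable]: "f \<in> borel_measurable sphere_measure" "k \<in> borel_measurable sphere_measure"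
    using assms borel_measurable_sphere_measure by auto
  have "integrable sphere_measure (\<lambda>x. norm (k x) * M)"
    using assms(1) by (intro integrable_mult_left integrable_norm) auto
  then show ?thesis
  proof (rule Bochner_Integration.integrable_bound)
    show "AE x in sphere_measure. norm (k x * f x) \<le> norm (norm (k x) * M)"
    proof (rule AE_I2)
      fix x assume "x \<in> space sphere_measure"
      then have "norm (f x) \<le> M" using M by auto
      then show "norm (k x * f x) \<le> norm (norm (k x) * M)"
        by (auto simp: abs_mult intro!: mult_left_mono)
    qed
  qed measurable
qed

lemma sphere_integral_abs_le:
  fixes k f :: "real^3 \<Rightarrow> real"
  assumes "integrable sphere_measure k" "continuous_on S2 f" "\<And>x. x \<in> S2 \<Longrightarrow> \<bar>f x\<bar> \<le> M"
  shows "\<bar>LINT x|sphere_measure. k x * f x\<bar> \<le> (LINT x|sphere_measure. \<bar>k x\<bar>) * M"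
proof -
  have "\<bar>LINT x|sphere_measure. k x * f x\<bar> \<le> (LINT x|sphere_measure. \<bar>k x * f x\<bar>)"
    using integral_norm_bound[of sphere_measure "\<lambda>x. k x * f x"] by simp
  also have "\<dots> \<le> (LINT x|sphere_measure. \<bar>k x\<bar> * M)"
  proof (rule integral_mono)
    show "integrable sphere_measure (\<lambda>x. \<bar>k x * f x\<bar>)"
      by (intro integrable_abs sphere_integrable_mult assms(1,2))
    show "integrable sphere_measure (\<lambda>x. \<bar>k x\<bar> * M)"
      by (intro integrable_mult_left integrable_abs assms(1))
    show "\<bar>k x * f x\<bar> \<le> \<bar>k x\<bar> * M" if "x \<in> space sphere_measure" for x
      using assms(3)[of x] that by (auto simp: abs_mult intro!: mult_left_mono)
  qed
  finally show ?thesis by simp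
qed

text \<open>The weight \<open>k\<close> is only integrable, with the singular logarithmic kernel in
  view; all dependence on the parameter sits in the continuous factor \<open>h\<close>, which varies
  uniformly in \<open>y\<close> by compactness of the sphere.\<close>

lemma continuous_on_sphere_integral:
  fixes h :: "'a::topological_space \<times> (real^3) \<Rightarrow> real"
  assumes k: "integrable sphere_measure k" and h: "continuous_on (U \<times> S2) h"
  shows "continuous_on U (\<lambda>x. LINT y|sphere_measure. k y * h (x, y))"
  unfolding continuous_on_def
proof (intro ballI tendstoI)
  fix x0 and e :: real assume x0: "x0 \<in> U" and e: "e > 0"
  \<comment> \<open>The summand 1 keeps \<open>C\<close> positive when the weight vanishes almost
    everywhere.\<close>
  define C where "C = (LINT x|sphere_measure. \<bar>k x\<bar>) + 1"
  have C: "C > 0" unfolding C_def by (intro add_nonneg_pos integral_nonneg) auto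
  have cy: "continuous_on S2 (\<lambda>y. h (x, y))" if "x \<in> U" for x
    by (rule continuous_on_compose2[OF h]) (use that in \<open>auto intro!: continuous_intros\<close>)
  obtain X where X: "x0 \<in> X" "open X" "\<forall>x\<in>X \<inter> U. \<forall>y\<in>S2. dist (h (x, y)) (h (x0, y)) \<le> e / (2 * C)"
    by (rule continuous_on_prod_compactE[OF h compact_sphere x0, of "e / (2*C)"]) (use e C in auto)
  have "dist (LINT y|sphere_measure. k y * h (x, y)) (LINT y|sphere_measure. k y * h (x0, y)) < e" if x: "x \<in> X" "x \<in> U" for x
  proof -
    have "(LINT y|sphere_measure. k y * h (x, y)) - (LINT y|sphere_measure. k y * h (x0, y))
       = (LINT y|sphere_measure. k y * (h (x, y) - h (x0, y)))"
      by (subst Bochner_Integration.integral_diff[symmetric]) (auto intro!: sphere_integrable_mult k cy x x0 simp: algebra_simps)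
    moreover have "\<bar>LINT y|sphere_measure. k y * (h (x, y) - h (x0, y))\<bar> \<le> (LINT x|sphere_measure. \<bar>k x\<bar>) * (e / (2 * C))"
      by (rule sphere_integral_abs_le[OF k]) (use X x x0 cy in \<open>auto intro!: continuous_intros simp: dist_real_def\<close>)
    moreover have "(LINT x|sphere_measure. \<bar>k x\<bar>) * (e / (2 * C)) \<le> C * (e / (2 * C))"
      by (rule mult_right_mono) (use e C in \<open>auto simp: C_def\<close>)
    moreover have "C * (e / (2 * C)) < e" using C e by simp
    ultimately show ?thesis by (simp add: dist_real_def)
  qed
  then show "\<forall>\<^sub>F x in at x0 within U. dist (LINT y|sphere_measure. k y * h (x, y)) (LINT y|sphere_measure. k y * h (x0, y)) < e"
    using X unfolding eventually_at_topological by blast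
qed

text \<open>Differentiation under the integral sign for an integrable weight. The linearisation
  error is bounded uniformly in \<open>y\<close> through the mean value inequality, so that only the
  integral of the absolute weight enters.\<close>

lemma has_derivative_sphere_integral:
  fixes h :: "'a::euclidean_space \<Rightarrow> real^3 \<Rightarrow> real"
  assumes k: "integrable sphere_measure k" and U: "open U" "x0 \<in> U"
    and h: "\<And>x. x \<in> U \<Longrightarrow> continuous_on S2 (h x)"
    and d: "\<And>x y. x \<in> U \<Longrightarrow> y \<in> S2 \<Longrightarrow> ((\<lambda>x. h x y) has_derivative h' x y) (at x)"
    and c: "\<And>b. b \<in> Basis \<Longrightarrow> continuous_on (U \<times> S2) (\<lambda>(x, y). h' x y b)"
  shows "((\<lambda>x. LINT y|sphere_measure. k y * h x y) has_derivative (\<lambda>v. LINT y|sphere_measure. k y * h' x0 y v)) (at x0)"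
proof -
  have ex: "h' x y v = (\<Sum>b\<in>Basis. (v \<bullet> b) * h' x y b)" if "x \<in> U" "y \<in> S2" for x y v
  proof -
    interpret linear "h' x y" using d[OF that] has_derivative_linear by blast
    have "h' x y v = h' x y (\<Sum>b\<in>Basis. (v \<bullet> b) *\<^sub>R b)" by (simp add: euclidean_representation)
    then show ?thesis by (simp only: sum scaleR real_scaleR_def)
  qed
  have cb: "continuous_on S2 (\<lambda>y. h' x y b)" if "x \<in> U" "b \<in> Basis" for x b
  proof -
    have "continuous_on S2 (\<lambda>y. (\<lambda>(x, y). h' x y b) (x, y))"
      by (rule continuous_on_compose2[OF c[OF that(2)]]) (use that in \<open>auto intro!: continuous_intros\<close>)
    then show ?thesis by simp
  qed
  have c': "continuous_on S2 (\<lambda>y. h' x y v)" if "x \<in> U" for x v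
  proof -
    have "continuous_on S2 (\<lambda>y. \<Sum>b\<in>Basis. (v \<bullet> b) * h' x y b)"
      using cb[OF that] by (intro continuous_intros) auto
    then show ?thesis by (rule continuous_on_eq) (simp add: ex that)
  qed
  define C where "C = (LINT x|sphere_measure. \<bar>k x\<bar>) + 1"
  have C: "C > 0" unfolding C_def by (intro add_nonneg_pos integral_nonneg) auto
  have lin: "linear (\<lambda>v. LINT y|sphere_measure. k y * h' x0 y v)"
  proof (rule linearI)
    have l: "linear (h' x0 y)" if "y \<in> S2" for y using d[OF U(2) that] has_derivative_linear by blast
    fix v w :: 'a and r :: real
    have "(LINT y|sphere_measure. k y * h' x0 y (v + w)) = (LINT y|sphere_measure. k y * h' x0 y v + k y * h' x0 y w)"
      by (rule Bochner_Integration.integral_cong) (use l in \<open>auto simp: linear_add algebra_simps\<close>)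
    then show "(LINT y|sphere_measure. k y * h' x0 y (v + w)) = (LINT y|sphere_measure. k y * h' x0 y v) + (LINT y|sphere_measure. k y * h' x0 y w)"
      by (simp add: sphere_integrable_mult k c' U)
    have "(LINT y|sphere_measure. k y * h' x0 y (r *\<^sub>R v)) = (LINT y|sphere_measure. r * (k y * h' x0 y v))"
      by (rule Bochner_Integration.integral_cong) (use l in \<open>auto simp: linear_cmul algebra_simps\<close>)
    then show "(LINT y|sphere_measure. k y * h' x0 y (r *\<^sub>R v)) = r *\<^sub>R (LINT y|sphere_measure. k y * h' x0 y v)"
      by simp
  qed
  show ?thesis unfolding has_derivative_at_alt
  proof (intro conjI allI impI)
    show "bounded_linear (\<lambda>v. LINT y|sphere_measure. k y * h' x0 y v)"
      using lin by (rule linear_conv_bounded_linear[THEN iffD1])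
    fix e :: real assume e: "e > 0"
    \<comment> \<open>A change of at most \<open>e'\<close> on every basis vector changes the
      derivative by at most \<open>DIM('a) * e'\<close> in operator norm, and the weight contributes
      a factor at most \<open>C\<close>.\<close>
    define e' where "e' = e / (C * DIM('a))"
    have e': "e' > 0" using e C by (simp add: e'_def)
    have "\<forall>\<^sub>F x in nhds x0. \<forall>b\<in>Basis. x \<in> U \<and> (\<forall>y\<in>S2. \<bar>h' x y b - h' x0 y b\<bar> \<le> e')"
    proof (rule eventually_ball_finite[OF finite_Basis], rule ballI)
      fix b :: 'a assume b: "b \<in> Basis"
      obtain X where "x0 \<in> X" "open X" "\<forall>x\<in>X \<inter> U. \<forall>y\<in>S2. dist ((\<lambda>(x, y). h' x y b) (x, y)) ((\<lambda>(x, y). h' x y b) (x0, y)) \<le> e'"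
        by (rule continuous_on_prod_compactE[OF c[OF b] compact_sphere U(2) e'])
      then show "\<forall>\<^sub>F x in nhds x0. x \<in> U \<and> (\<forall>y\<in>S2. \<bar>h' x y b - h' x0 y b\<bar> \<le> e')"
        unfolding eventually_nhds using U by (intro exI[of _ "X \<inter> U"]) (auto simp: dist_real_def)
    qed
    then obtain \<delta> where \<delta>: "\<delta> > 0" "\<And>x b y. dist x x0 < \<delta> \<Longrightarrow> b \<in> Basis \<Longrightarrow> x \<in> U \<and> (y \<in> S2 \<longrightarrow> \<bar>h' x y b - h' x0 y b\<bar> \<le> e')"
      unfolding eventually_nhds_metric by blast
    have U': "x \<in> U" if "dist x x0 < \<delta>" for x using \<delta>(2)[OF that] nonempty_Basis by blast
    show "\<exists>d>0. \<forall>x. norm (x - x0) < d \<longrightarrow>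
        norm ((LINT y|sphere_measure. k y * h x y) - (LINT y|sphere_measure. k y * h x0 y) - (LINT y|sphere_measure. k y * h' x0 y (x - x0))) \<le> e * norm (x - x0)"
    proof (intro exI[of _ \<delta>] conjI allI impI \<delta>(1))
      fix x assume x: "norm (x - x0) < \<delta>"
      then have xU: "x \<in> U" using U' by (simp add: dist_norm)
      have b: "norm (h x y - h x0 y - h' x0 y (x - x0)) \<le> norm (x - x0) * (DIM('a) * e')" if y: "y \<in> S2" for y
      proof (rule differentiable_bound_linearization[where S = "ball x0 \<delta>"])
        show "x0 + t *\<^sub>R (x - x0) \<in> ball x0 \<delta>" if "t \<in> {0..1}" for t
        proof -
          have "norm (t *\<^sub>R (x - x0)) \<le> 1 * norm (x - x0)" unfolding norm_scaleR
            by (rule mult_right_mono) (use that in auto)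
          then have "dist x0 (x0 + t *\<^sub>R (x - x0)) < \<delta>" using x by (simp add: dist_norm)
          then show ?thesis by simp
        qed
        show "((\<lambda>x. h x y) has_derivative h' z y) (at z within ball x0 \<delta>)" if "z \<in> ball x0 \<delta>" for z
        proof -
          have "z \<in> U" using U' that by (simp add: dist_commute)
          from has_derivative_at_withinI[OF d[OF this y]] show ?thesis .
        qed
        show "onorm (h' z y - h' x0 y) \<le> DIM('a) * e'" if z: "z \<in> ball x0 \<delta>" for z
        proof (rule onorm_le)
          fix v :: 'a
          have zU: "z \<in> U" "dist z x0 < \<delta>" using z U' by (auto simp: dist_commute)
          have "norm ((h' z y - h' x0 y) v) = \<bar>\<Sum>b\<in>Basis. (v \<bullet> b) * (h' z y b - h' x0 y b)\<bar>"
            unfolding minus_apply ex[OF zU(1) y, of v] ex[OF U(2) y, of v] by (simp add: sum_subtractf algebra_simps)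
          also have "\<dots> \<le> (\<Sum>b\<in>(Basis::'a set). norm v * e')"
            by (rule order.trans[OF sum_abs], rule sum_mono)
              (use \<delta>(2)[OF zU(2)] y in \<open>auto simp: abs_mult intro!: mult_mono Basis_le_norm\<close>)
          also have "\<dots> = DIM('a) * e' * norm v" by simp
          finally show "norm ((h' z y - h' x0 y) v) \<le> DIM('a) * e' * norm v" .
        qed
        show "x0 \<in> ball x0 \<delta>" using \<delta> by simp
      qed
      have "(LINT y|sphere_measure. k y * h x y) - (LINT y|sphere_measure. k y * h x0 y) - (LINT y|sphere_measure. k y * h' x0 y (x - x0))
        = (LINT y|sphere_measure. k y * (h x y - h x0 y - h' x0 y (x - x0)))"
        by (simp add: right_diff_distrib sphere_integrable_mult[OF k] h c' xU U)
      also have "\<bar>\<dots>\<bar> \<le> (LINT y|sphere_measure. \<bar>k y\<bar>) * (norm (x - x0) * (DIM('a) * e'))"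
        by (rule sphere_integral_abs_le[OF k]) (use b h c' xU U in \<open>auto intro!: continuous_intros\<close>)
      also have "\<dots> \<le> C * (norm (x - x0) * (DIM('a) * e'))"
        by (rule mult_right_mono) (use e' in \<open>auto simp: C_def\<close>)
      also have "\<dots> = e * norm (x - x0)" using C by (simp add: e'_def)
      finally show "norm ((LINT y|sphere_measure. k y * h x y) - (LINT y|sphere_measure. k y * h x0 y) - (LINT y|sphere_measure. k y * h' x0 y (x - x0))) \<le> e * norm (x - x0)"
        by simp
    qed
  qed
qed

lemma has_real_derivative_sphere_integral:
  fixes h :: "real \<Rightarrow> real^3 \<Rightarrow> real"
  assumes k: "integrable sphere_measure k" and U: "open U" "t \<in> U"
    and h: "\<And>t. t \<in> U \<Longrightarrow> continuous_on S2 (h t)"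
    and d: "\<And>t y. t \<in> U \<Longrightarrow> y \<in> S2 \<Longrightarrow> ((\<lambda>t. h t y) has_real_derivative h' t y) (at t)"
    and c: "continuous_on (U \<times> S2) (\<lambda>(t, y). h' t y)"
  shows "((\<lambda>t. LINT y|sphere_measure. k y * h t y) has_real_derivative (LINT y|sphere_measure. k y * h' t y)) (at t)"
proof -
  have "((\<lambda>t. LINT y|sphere_measure. k y * h t y) has_derivative (\<lambda>v. LINT y|sphere_measure. k y * (h' t y * v))) (at t)"
    by (rule has_derivative_sphere_integral[OF k U h]) (use d c in \<open>auto simp: has_field_derivative_def\<close>)
  moreover have "(\<lambda>v. LINT y|sphere_measure. k y * (h' t y * v)) = (*) (LINT y|sphere_measure. k y * h' t y)"
    by (rule ext) (simp flip: mult.assoc)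
  ultimately show ?thesis by (simp add: has_field_derivative_def)
qed

text \<open>The open neighbourhood \<open>V\<close> of the sphere appears because
  \<open>Ck_on\<close> is meaningful on open sets. A partial derivative in the first variable gives
  an integral of the same kind one order lower, which drives the induction.\<close>

lemma Ck_on_sphere_integral:
  fixes h :: "'a::euclidean_space \<times> (real^3) \<Rightarrow> real"
  assumes k: "integrable sphere_measure k" and U: "open U" "open V" "S2 \<subseteq> V"
  shows "Ck_on n (U \<times> V) h \<Longrightarrow> Ck_on n U (\<lambda>x. LINT y|sphere_measure. k y * h (x, y))"
proof (induction n arbitrary: h)
  case 0
  then show ?case using continuous_on_sphere_integral[OF k, of U h] U(3)
    by (auto intro: continuous_on_subset)
next
  case (Suc n)
  have UV: "open (U \<times> V)" using U by (intro open_Times)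
  define h' where "h' = (\<lambda>x y v. frechet_derivative h (at (x, y)) (v, 0))"
  have hd: "(h has_derivative frechet_derivative h (at (x, y))) (at (x, y))" if "x \<in> U" "y \<in> V" for x y
    using Ck_on_has_derivative[OF Suc.prems UV] that by blast
  have d: "((\<lambda>x. h (x, y)) has_derivative h' x y) (at x)" if "x \<in> U" "y \<in> S2" for x y
  proof -
    have "((\<lambda>x. (x, y)) has_derivative (\<lambda>v. (v, 0))) (at x)"
      by (auto intro!: derivative_eq_intros)
    from diff_chain_at[OF this hd] show ?thesis using that U(3) by (auto simp: o_def h'_def)
  qed
  have cb: "Ck_on n (U \<times> V) (\<lambda>z. frechet_derivative h (at z) (b, 0))" if "b \<in> Basis" for b
    using Suc.prems that by (auto simp: Basis_prod_def)
  have c: "continuous_on (U \<times> S2) (\<lambda>(x, y). h' x y b)" if "b \<in> Basis" for b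
    using continuous_on_subset[OF Ck_on_imp_continuous_on[OF cb[OF that]], of "U \<times> S2"] U(3) by (auto simp: h'_def case_prod_beta')
  have h: "continuous_on S2 (\<lambda>y. h (x, y))" if "x \<in> U" for x
    by (rule continuous_on_compose2[OF Ck_on_imp_continuous_on[OF Suc.prems]]) (use that U(3) in \<open>auto intro!: continuous_intros\<close>)
  show ?case
  proof (rule Ck_on_SucI[OF U(1)])
    show "((\<lambda>x. LINT y|sphere_measure. k y * h (x, y)) has_derivative (\<lambda>v. LINT y|sphere_measure. k y * h' x y v)) (at x)" if "x \<in> U" for x
      by (rule has_derivative_sphere_integral[OF k U(1) that h d c])
    show "Ck_on n U (\<lambda>x. LINT y|sphere_measure. k y * h' x y b)" if "b \<in> Basis" for b
      using Suc.IH[OF cb[OF that]] by (simp add: h'_def)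
  qed
qed


section \<open>Rotations\<close>

text \<open>Rotation fields are divergence free, and the later integrations by parts on the sphere
  go back to this. Multiplied by the area weight \<open>cos \<theta>\<close>, the integrand becomes
  \<open>P' - Q'\<close>, a derivative in \<phi> minus a derivative in \<theta> whose second-order
  terms cancel. The first integrates to 0 by periodicity, the second because \<open>c\<phi>\<close>,
  the velocity along parallels, vanishes at both poles.\<close>

lemma sphere_integral_tangential:
  fixes f :: "real^3 \<Rightarrow> real"
  assumes "open W" "S2 \<subseteq> W" "Ck_on 1 W f"
  shows "(LINT x|sphere_measure. frechet_derivative f (at x) (cross3 a x)) = 0"
proof -
  define f' where "f' = (\<lambda>x. frechet_derivative f (at x))"
  define c where "c = (\<lambda>\<phi> \<theta>. (cos \<theta> * cos \<phi>) *\<^sub>R axis 1 1 + (cos \<theta> * sin \<phi>) *\<^sub>R axis 2 1 + sin \<theta> *\<^sub>R (axis 3 1 :: real^3))"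
  define c\<phi> where "c\<phi> = (\<lambda>\<phi> \<theta>. (- cos \<theta> * sin \<phi>) *\<^sub>R axis 1 1 + (cos \<theta> * cos \<phi>) *\<^sub>R (axis 2 1 :: real^3))"
  define c\<theta> where "c\<theta> = (\<lambda>\<phi> \<theta>. (- sin \<theta> * cos \<phi>) *\<^sub>R axis 1 1 + (- sin \<theta> * sin \<phi>) *\<^sub>R axis 2 1 + cos \<theta> *\<^sub>R (axis 3 1 :: real^3))"
  define c\<theta>\<phi> where "c\<theta>\<phi> = (\<lambda>\<phi> \<theta>. (sin \<theta> * sin \<phi>) *\<^sub>R axis 1 1 + (- sin \<theta> * cos \<phi>) *\<^sub>R (axis 2 1 :: real^3))"
  note cdefs = c_def c\<phi>_def c\<theta>_def c\<theta>\<phi>_def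
  have c: "sphere_coord (\<phi>, \<theta>) = c \<phi> \<theta>" for \<phi> \<theta> by (simp add: sphere_coord_eq c_def)
  have cS: "c \<phi> \<theta> \<in> S2" for \<phi> \<theta> using sphere_coord_in_S2[of "(\<phi>, \<theta>)"] by (simp only: c)
  have cW: "c \<phi> \<theta> \<in> W" for \<phi> \<theta> using cS assms(2) by blast
  have d\<phi>: "((\<lambda>\<phi>. c \<phi> \<theta>) has_vector_derivative c\<phi> \<phi> \<theta>) (at \<phi>)" for \<phi> \<theta>
    unfolding cdefs by (auto intro!: derivative_eq_intros simp: algebra_simps)
  have d\<theta>: "((\<lambda>\<theta>. c \<phi> \<theta>) has_vector_derivative c\<theta> \<phi> \<theta>) (at \<theta>)" for \<phi> \<theta>
    unfolding cdefs by (auto intro!: derivative_eq_intros simp: algebra_simps)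
  have d\<theta>\<phi>: "((\<lambda>\<phi>. a \<bullet> c\<theta> \<phi> \<theta>) has_real_derivative a \<bullet> c\<theta>\<phi> \<phi> \<theta>) (at \<phi>)" for \<phi> \<theta>
    unfolding cdefs inner_simps by (auto intro!: derivative_eq_intros simp: algebra_simps)
  have d\<phi>\<theta>: "((\<lambda>\<theta>. a \<bullet> c\<phi> \<phi> \<theta>) has_real_derivative a \<bullet> c\<theta>\<phi> \<phi> \<theta>) (at \<theta>)" for \<phi> \<theta>
    unfolding cdefs inner_simps by (auto intro!: derivative_eq_intros simp: algebra_simps)
  have fd: "(f has_derivative f' x) (at x)" if "x \<in> W" for x
    using Ck_on_has_derivative[of 0 W f x] assms that by (simp add: f'_def)
  have lin: "linear (f' x)" if "x \<in> W" for x using fd[OF that] has_derivative_linear by blast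
  have f\<phi>: "((\<lambda>\<phi>. f (c \<phi> \<theta>)) has_real_derivative f' (c \<phi> \<theta>) (c\<phi> \<phi> \<theta>)) (at \<phi>)" for \<phi> \<theta>
    using vector_derivative_diff_chain_within[of "\<lambda>\<phi>. c \<phi> \<theta>", OF d\<phi> has_derivative_at_withinI[OF fd[OF cW]]]
    by (simp add: o_def has_real_derivative_iff_has_vector_derivative)
  have f\<theta>: "((\<lambda>\<theta>. f (c \<phi> \<theta>)) has_real_derivative f' (c \<phi> \<theta>) (c\<theta> \<phi> \<theta>)) (at \<theta>)" for \<phi> \<theta>
    using vector_derivative_diff_chain_within[of "\<lambda>\<theta>. c \<phi> \<theta>", OF d\<theta> has_derivative_at_withinI[OF fd[OF cW]]]
    by (simp add: o_def has_real_derivative_iff_has_vector_derivative)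
  define P' where "P' = (\<lambda>\<phi> \<theta>. (a \<bullet> c\<theta>\<phi> \<phi> \<theta>) * f (c \<phi> \<theta>) + (a \<bullet> c\<theta> \<phi> \<theta>) * f' (c \<phi> \<theta>) (c\<phi> \<phi> \<theta>))"
  define Q' where "Q' = (\<lambda>\<phi> \<theta>. (a \<bullet> c\<theta>\<phi> \<phi> \<theta>) * f (c \<phi> \<theta>) + (a \<bullet> c\<phi> \<phi> \<theta>) * f' (c \<phi> \<theta>) (c\<theta> \<phi> \<theta>))"
  have P: "((\<lambda>\<phi>. (a \<bullet> c\<theta> \<phi> \<theta>) * f (c \<phi> \<theta>)) has_vector_derivative P' \<phi> \<theta>) (at \<phi>)" for \<phi> \<theta>
    unfolding has_real_derivative_iff_has_vector_derivative[symmetric] P'_def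
    using DERIV_mult[OF d\<theta>\<phi> f\<phi>] by (simp add: algebra_simps)
  have Q: "((\<lambda>\<theta>. (a \<bullet> c\<phi> \<phi> \<theta>) * f (c \<phi> \<theta>)) has_vector_derivative Q' \<phi> \<theta>) (at \<theta>)" for \<phi> \<theta>
    unfolding has_real_derivative_iff_has_vector_derivative[symmetric] Q'_def
    using DERIV_mult[OF d\<phi>\<theta> f\<theta>] by (simp add: algebra_simps)
  have f'ex: "f' x v = (\<Sum>b\<in>Basis. (v \<bullet> b) * f' x b)" if "x \<in> W" for x v
  proof -
    interpret linear "f' x" by (rule lin[OF that])
    have "f' x v = f' x (\<Sum>b\<in>Basis. (v \<bullet> b) *\<^sub>R b)" by (simp add: euclidean_representation)
    then show ?thesis by (simp only: sum scaleR real_scaleR_def)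
  qed
  have cb: "continuous_on W (\<lambda>x. f' x b)" if "b \<in> Basis" for b
    using assms(3) that by (simp add: f'_def)
  have cf: "continuous_on W f" using Ck_on_imp_continuous_on[OF assms(3)] .
  have cc: "continuous_on B (\<lambda>v. c (fst v) (snd v))" "continuous_on B (\<lambda>v. c\<phi> (fst v) (snd v))"
      "continuous_on B (\<lambda>v. c\<theta> (fst v) (snd v))" "continuous_on B (\<lambda>v. c\<theta>\<phi> (fst v) (snd v))" for B
    unfolding cdefs by (intro continuous_intros)+
  have cfc: "continuous_on B (\<lambda>v. f (c (fst v) (snd v)))" for B
    by (rule continuous_on_compose2[OF cf cc(1)]) (use cW in auto)
  have cf': "continuous_on B (\<lambda>v. f' (c (fst v) (snd v)) (g v))" if "continuous_on B g" for B g
  proof -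
    have "continuous_on B (\<lambda>v. \<Sum>b\<in>Basis. (g v \<bullet> b) * f' (c (fst v) (snd v)) b)"
      using that by (intro continuous_intros continuous_on_compose2[OF cb cc(1)]) (use cW in auto)
    then show ?thesis by (rule continuous_on_eq) (rule f'ex[OF cW, symmetric])
  qed
  have cP: "continuous_on B (\<lambda>v. P' (fst v) (snd v))" and cQ: "continuous_on B (\<lambda>v. Q' (fst v) (snd v))" for B
    unfolding P'_def Q'_def by (intro continuous_intros cc cfc cf')+
  have IP: "integral coord_box (\<lambda>v. P' (fst v) (snd v)) = 0"
  proof -
    have z: "integral (cbox (- pi) pi) (\<lambda>\<phi>. P' \<phi> \<theta>) = 0" for \<theta>
    proof -
      have "((\<lambda>\<phi>. P' \<phi> \<theta>) has_integral ((a \<bullet> c\<theta> pi \<theta>) * f (c pi \<theta>) - (a \<bullet> c\<theta> (-pi) \<theta>) * f (c (-pi) \<theta>))) {-pi..pi}"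
        by (rule fundamental_theorem_of_calculus) (simp, rule has_vector_derivative_at_within[OF P])
      moreover have "c pi \<theta> = c (-pi) \<theta>" "c\<theta> pi \<theta> = c\<theta> (-pi) \<theta>" by (simp_all add: cdefs)
      ultimately show ?thesis by (simp add: integral_unique)
    qed
    have "integral coord_box (\<lambda>v. P' (fst v) (snd v)) = integral (cbox (-pi) pi) (\<lambda>\<phi>. integral (cbox (-pi/2) (pi/2)) (\<lambda>\<theta>. P' \<phi> \<theta>))"
      using integral_prod_continuous[OF cP] by simp
    also have "\<dots> = integral (cbox (-pi/2) (pi/2)) (\<lambda>\<theta>. integral (cbox (-pi) pi) (\<lambda>\<phi>. P' \<phi> \<theta>))"
      by (rule integral_swap_continuous) (use cP in \<open>simp add: case_prod_beta'\<close>)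
    finally show ?thesis by (simp only: z integral_0)
  qed
  have IQ: "integral coord_box (\<lambda>v. Q' (fst v) (snd v)) = 0"
  proof -
    have z: "integral (cbox (-pi/2) (pi/2)) (\<lambda>\<theta>. Q' \<phi> \<theta>) = 0" for \<phi>
    proof -
      have "((\<lambda>\<theta>. Q' \<phi> \<theta>) has_integral ((a \<bullet> c\<phi> \<phi> (pi/2)) * f (c \<phi> (pi/2)) - (a \<bullet> c\<phi> \<phi> (-pi/2)) * f (c \<phi> (-pi/2)))) {-pi/2..pi/2}"
        by (rule fundamental_theorem_of_calculus) (simp, rule has_vector_derivative_at_within[OF Q])
      moreover have "c\<phi> \<phi> (pi/2) = 0" "c\<phi> \<phi> (-pi/2) = 0" by (simp_all add: cdefs)
      ultimately show ?thesis by (simp add: integral_unique)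
    qed
    have "integral coord_box (\<lambda>v. Q' (fst v) (snd v)) = integral (cbox (-pi) pi) (\<lambda>\<phi>. integral (cbox (-pi/2) (pi/2)) (\<lambda>\<theta>. Q' \<phi> \<theta>))"
      using integral_prod_continuous[OF cQ] by simp
    then show ?thesis by (simp only: z integral_0)
  qed
  have cos2: "cos \<phi> * (cos \<phi> * u) = u - sin \<phi> * (sin \<phi> * u)" for \<phi> u :: real
    using arg_cong[OF sin_cos_squared_add3[of \<phi>], of "\<lambda>v. v * u"] by (simp only: algebra_simps mult_1_left)
  \<comment> \<open>The cross product of \<open>c\<phi>\<close> and \<open>c\<theta>\<close> is
    \<open>cos \<theta>\<close> times the position, so this is the expansion of a vector triple
    product.\<close>
  have key: "cos \<theta> *\<^sub>R (cross3 a (c \<phi> \<theta>)) = (a \<bullet> c\<theta> \<phi> \<theta>) *\<^sub>R c\<phi> \<phi> \<theta> - (a \<bullet> c\<phi> \<phi> \<theta>) *\<^sub>R c\<theta> \<phi> \<theta>" for \<phi> \<theta>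
    unfolding cdefs
    by (simp add: vec_eq_iff forall_3 cross3_def inner_vec_def sum_3 axis_def algebra_simps cos2)
  have e: "cos (snd v) * f' (c (fst v) (snd v)) (cross3 a (c (fst v) (snd v))) = P' (fst v) (snd v) - Q' (fst v) (snd v)" for v
  proof -
    interpret linear "f' (c (fst v) (snd v))" by (rule lin[OF cW])
    have "cos (snd v) * f' (c (fst v) (snd v)) (cross3 a (c (fst v) (snd v))) = f' (c (fst v) (snd v)) (cos (snd v) *\<^sub>R (cross3 a (c (fst v) (snd v))))"
      by (simp add: scaleR)
    then show ?thesis unfolding key by (simp add: diff scaleR P'_def Q'_def)
  qed
  have ct: "continuous_on S2 (\<lambda>x. f' x (cross3 a x))"
  proof -
    have "continuous_on S2 (\<lambda>x. \<Sum>b\<in>Basis. ((cross3 a x) \<bullet> b) * f' x b)"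
      by (intro continuous_intros continuous_on_cross continuous_on_subset[OF cb assms(2)])
    then show ?thesis by (rule continuous_on_eq) (rule f'ex[symmetric], use assms(2) in blast)
  qed
  have "(LINT x|sphere_measure. f' x (cross3 a x)) = integral coord_box (\<lambda>v. P' (fst v) (snd v) - Q' (fst v) (snd v))"
    unfolding sphere_integral_coord[OF ct] e[symmetric] by (simp add: c[symmetric])
  also have "\<dots> = 0"
    using integral_diff[OF integrable_continuous[OF cP] integrable_continuous[OF cQ]] IP IQ by simp
  finally show ?thesis by (simp add: f'_def)
qed

text \<open>Rodrigues' formula for the rotation by the angle \<open>s\<close> about a unit axis
  \<open>a\<close>.\<close>

definition axis_rot :: "real^3 \<Rightarrow> real \<Rightarrow> real^3 \<Rightarrow> real^3" where
  "axis_rot a s x = cos s *\<^sub>R x + sin s *\<^sub>R (cross3 a x) + ((1 - cos s) * (a \<bullet> x)) *\<^sub>R a"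

lemma axis_rot_0 [simp]: "axis_rot a 0 x = x"
  by (simp add: axis_rot_def)

lemma linear_axis_rot: "linear (axis_rot a s)"
  by (rule linearI) (auto simp: axis_rot_def cross_add_right cross_mult_right inner_simps algebra_simps)

lemma continuous_on_axis_rot: "continuous_on B (axis_rot a s)"
  by (intro linear_continuous_on linear_conv_bounded_linear[THEN iffD1] linear_axis_rot)

lemma norm_axis_rot:
  assumes "norm a = 1"
  shows "norm (axis_rot a s x) = norm x"
proof -
  have a: "a \<bullet> a = 1" using assms by (simp add: dot_square_norm)
  have n: "(cross3 a x) \<bullet> (cross3 a x) = x \<bullet> x - (a \<bullet> x)\<^sup>2"
    unfolding dot_cross by (simp add: a power2_eq_square inner_commute)
  have "axis_rot a s x \<bullet> axis_rot a s x = x \<bullet> x"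
    unfolding axis_rot_def inner_add_left inner_add_right inner_scaleR_left inner_scaleR_right
      n a dot_cross_self inner_commute[of x a]
    using sin_cos_squared_add[of s] by algebra
  then show ?thesis by (simp add: norm_eq_sqrt_inner)
qed

lemma axis_rot_cross:
  assumes "norm a = 1"
  shows "axis_rot a s (cross3 a x) = cross3 a (axis_rot a s x)"
  by (simp add: axis_rot_def cross_add_right cross_mult_right dot_cross_self)

lemma axis_rot_deriv:
  assumes "norm a = 1"
  shows "((\<lambda>s. axis_rot a s x) has_vector_derivative cross3 a (axis_rot a s x)) (at s)"
proof -
  have a: "a \<bullet> a = 1" using assms by (simp add: dot_square_norm)
  have "cross3 a (axis_rot a s x) = - sin s *\<^sub>R x + cos s *\<^sub>R (cross3 a x) + (sin s * (a \<bullet> x)) *\<^sub>R a"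
    unfolding axis_rot_def cross_add_right cross_mult_right Lagrange a cross_refl by (simp add: algebra_simps)
  then show ?thesis unfolding axis_rot_def
    by (auto intro!: derivative_eq_intros simp: algebra_simps)
qed

lemma Ck_on_real_polynomial_function:
  fixes f :: "'a::euclidean_space \<Rightarrow> real"
  shows "real_polynomial_function f \<Longrightarrow> Ck_on k UNIV f"
  by (induction rule: real_polynomial_function.induct)
    (auto intro: Ck_on_bounded_linear Ck_on_const Ck_on_add Ck_on_mult simp del: Ck_on.simps)

text \<open>As \<open>s\<close> varies, the derivative of the integral is the integral of a
  rotational derivative of the rotated function, hence zero. This uses that a rotation about
  \<open>a\<close> commutes with the cross product with \<open>a\<close>.\<close>

lemma sphere_integral_axis_rot_smooth:
  assumes a: "norm a = 1" and f: "Ck_on 1 UNIV f"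
  shows "(LINT x|sphere_measure. f (axis_rot a s x)) = (LINT x|sphere_measure. f x)"
proof -
  define f' where "f' = (\<lambda>x. frechet_derivative f (at x))"
  have fd: "(f has_derivative f' x) (at x)" for x
    using Ck_on_has_derivative[of 0 UNIV f x] f by (simp add: f'_def)
  have cf: "continuous_on UNIV f" using Ck_on_imp_continuous_on[OF f] .
  have lin: "linear (f' x)" for x using fd has_derivative_linear by blast
  have f'ex: "f' x v = (\<Sum>b\<in>Basis. (v \<bullet> b) * f' x b)" for x v
  proof -
    interpret linear "f' x" by (rule lin)
    have "f' x v = f' x (\<Sum>b\<in>Basis. (v \<bullet> b) *\<^sub>R b)" by (simp add: euclidean_representation)
    then show ?thesis by (simp only: sum scaleR real_scaleR_def)
  qed
  have cb: "continuous_on UNIV (\<lambda>x. f' x b)" if "b \<in> Basis" for b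
    using f that by (simp add: f'_def)
  have cr: "continuous_on (UNIV \<times> S2) (\<lambda>(s, x). axis_rot a s x)"
    unfolding axis_rot_def case_prod_beta' by (intro continuous_intros continuous_on_cross)
  have d: "((\<lambda>s. f (axis_rot a s x)) has_real_derivative f' (axis_rot a s x) (cross3 a (axis_rot a s x))) (at s)" for s x
    using vector_derivative_diff_chain_within[of "\<lambda>s. axis_rot a s x", OF axis_rot_deriv[OF a] has_derivative_at_withinI[OF fd]]
    by (simp add: o_def has_real_derivative_iff_has_vector_derivative)
  have c: "continuous_on (UNIV \<times> S2) (\<lambda>(s, x). f' (axis_rot a s x) (cross3 a (axis_rot a s x)))"
  proof -
    have "continuous_on (UNIV \<times> S2) (\<lambda>z. \<Sum>b\<in>Basis. ((cross3 a ((\<lambda>(s, x). axis_rot a s x) z)) \<bullet> b) * f' ((\<lambda>(s, x). axis_rot a s x) z) b)"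
      by (intro continuous_intros continuous_on_cross cr continuous_on_compose2[OF cb cr]) auto
    then show ?thesis by (rule continuous_on_eq) (auto intro: f'ex[symmetric])
  qed
  have z: "(LINT x|sphere_measure. f' (axis_rot a s x) (cross3 a (axis_rot a s x))) = 0" for s
  proof -
    define g where "g = (\<lambda>x. f (axis_rot a s x))"
    have g: "(g has_derivative (\<lambda>v. f' (axis_rot a s x) (axis_rot a s v))) (at x)" for x
      using diff_chain_at[OF linear_imp_has_derivative[OF linear_axis_rot] fd] by (simp add: g_def o_def)
    have "Ck_on 1 UNIV g"
      unfolding g_def
    proof (rule Ck_on_compose[OF _ _ _ f])
      show "Ck_on 1 UNIV (\<lambda>x. axis_rot a s x \<bullet> c)" for c
        by (intro Ck_on_bounded_linear open_UNIV bounded_linear_compose[OF bounded_linear_inner_left]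
            linear_conv_bounded_linear[THEN iffD1] linear_axis_rot)
    qed auto
    from sphere_integral_tangential[OF open_UNIV subset_UNIV this, of a]
    show ?thesis by (simp add: frechet_derivative_at[OF g, symmetric] axis_rot_cross[OF a])
  qed
  have D: "((\<lambda>s. LINT x|sphere_measure. 1 * f (axis_rot a s x)) has_real_derivative (LINT x|sphere_measure. 1 * f' (axis_rot a s x) (cross3 a (axis_rot a s x)))) (at s)" for s
    by (rule has_real_derivative_sphere_integral[OF _ open_UNIV UNIV_I])
      (auto intro: integrable_sphere_measure continuous_on_compose2[OF cf continuous_on_axis_rot] d c)
  have "\<forall>s. ((\<lambda>s. LINT x|sphere_measure. 1 * f (axis_rot a s x)) has_real_derivative 0) (at s)"
    using D by (simp add: z)
  from DERIV_isconst_all[OF this, of s 0] show ?thesis by simp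
qed

section \<open>Invariance of the area measure under rotations about an axis\<close>

lemma axis_rot_in_S2: "norm a = 1 \<Longrightarrow> axis_rot a s x \<in> S2 \<longleftrightarrow> x \<in> S2"
  by (simp add: norm_axis_rot)

lemma sphere_integral_axis_rot_continuous:
  fixes f :: "real^3 \<Rightarrow> real"
  assumes a: "norm a = 1" and f: "continuous_on S2 f"
  shows "(LINT x|sphere_measure. f (axis_rot a s x)) = (LINT x|sphere_measure. f x)"
proof -
  have im: "axis_rot a s ` S2 \<subseteq> S2" by (auto simp: norm_axis_rot[OF a])
  have fr: "continuous_on S2 (\<lambda>x. f (axis_rot a s x))"
    by (rule continuous_on_compose2[OF f continuous_on_axis_rot im])
  have "\<bar>(LINT x|sphere_measure. f (axis_rot a s x)) - (LINT x|sphere_measure. f x)\<bar> \<le> e" if e: "e > 0" for e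
  proof -
    have "e / (2 * area) > 0" using e area_pos by simp
    then obtain g where g: "real_polynomial_function g" "\<And>x. x \<in> S2 \<Longrightarrow> \<bar>f x - g x\<bar> < e / (2 * area)"
      using Stone_Weierstrass_real_polynomial_function[OF compact_sphere f] by blast
    have G: "(LINT x|sphere_measure. g (axis_rot a s x)) = (LINT x|sphere_measure. g x)"
      by (rule sphere_integral_axis_rot_smooth[OF a Ck_on_real_polynomial_function[OF g(1)]])
    have cg: "continuous_on S2 g"
      using Ck_on_imp_continuous_on[OF Ck_on_real_polynomial_function[OF g(1), of 0]] continuous_on_subset by blast
    have cgr: "continuous_on S2 (\<lambda>x. g (axis_rot a s x))"
      by (rule continuous_on_compose2[OF cg continuous_on_axis_rot im])
    have b: "\<bar>LINT x|sphere_measure. h x\<bar> \<le> e / 2" if "continuous_on S2 h" "\<And>x. x \<in> S2 \<Longrightarrow> \<bar>h x\<bar> \<le> e / (2 * area)" for h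
      using sphere_integral_abs_le[OF integrable_sphere_measure[of "\<lambda>_. 1"] that] area_pos
      by (simp add: area_def[symmetric])
    have "\<bar>LINT x|sphere_measure. f (axis_rot a s x) - g (axis_rot a s x)\<bar> \<le> e / 2"
    proof (rule b)
      show "continuous_on S2 (\<lambda>x. f (axis_rot a s x) - g (axis_rot a s x))" by (intro continuous_intros fr cgr)
      show "\<bar>f (axis_rot a s x) - g (axis_rot a s x)\<bar> \<le> e / (2 * area)" if "x \<in> S2" for x
        using g(2)[of "axis_rot a s x"] im that by (simp add: image_subset_iff less_imp_le)
    qed
    moreover have "\<bar>LINT x|sphere_measure. f x - g x\<bar> \<le> e / 2"
    proof (rule b)
      show "continuous_on S2 (\<lambda>x. f x - g x)" by (intro continuous_intros f cg)
      show "\<bar>f x - g x\<bar> \<le> e / (2 * area)" if "x \<in> S2" for x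
        using g(2)[OF that] by simp
    qed
    ultimately show ?thesis
    proof -
      have tri: "\<bar>X - F\<bar> \<le> e" if "\<bar>X - H\<bar> \<le> e / 2" "\<bar>F - H\<bar> \<le> e / 2" for X F H :: real
        using that by linarith
      assume "\<bar>LINT x|sphere_measure. f (axis_rot a s x) - g (axis_rot a s x)\<bar> \<le> e / 2"
        "\<bar>LINT x|sphere_measure. f x - g x\<bar> \<le> e / 2"
      then show ?thesis
        by (intro tri[of _ "LINT x|sphere_measure. g x"])
          (simp_all add: integrable_sphere_measure f cg fr cgr G)
    qed
  qed
  then have "\<bar>(LINT x|sphere_measure. f (axis_rot a s x)) - (LINT x|sphere_measure. f x)\<bar> \<le> 0"
    by (rule field_le_epsilon[where y = 0, simplified])
  then show ?thesis by simp
qed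

text \<open>The ramps \<open>max 0 (1 - real n * infdist x C)\<close> are continuous and decrease to
  the indicator of a closed set; closed sets are stable under intersection and generate the Borel
  sets.\<close>

lemma finite_borel_measure_eqI:
  fixes M N :: "'a::metric_space measure"
  assumes fin: "finite_measure M" "finite_measure N" and sets: "sets M = sets borel" "sets N = sets borel"
    and eq: "\<And>f :: 'a \<Rightarrow> real. continuous_on UNIV f \<Longrightarrow> (LINT x|M. f x) = (LINT x|N. f x)"
  shows "M = N"
proof -
  have lim: "(\<lambda>n. LINT x|M. max 0 (1 - real n * infdist x C)) \<longlonglongrightarrow> Sigma_Algebra.measure M C"
    if "closed C" "C \<noteq> {}" "finite_measure M" "sets M = sets borel" for C and M :: "'a measure"
  proof -
    interpret finite_measure M by fact
    have [measurable]: "C \<in> sets M" using that by auto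
    have [measurable_cong]: "sets M = sets borel" by fact
    have "(\<lambda>n. LINT x|M. max 0 (1 - real n * infdist x C)) \<longlonglongrightarrow> (LINT x|M. indicator C x)"
    proof (rule integral_dominated_convergence[where w = "\<lambda>_. 1"])
      show "AE x in M. (\<lambda>n. max 0 (1 - real n * infdist x C)) \<longlonglongrightarrow> indicator C x"
      proof (rule AE_I2)
        fix x
        show "(\<lambda>n. max 0 (1 - real n * infdist x C)) \<longlonglongrightarrow> indicator C x"
        proof (cases "x \<in> C")
          case True then show ?thesis by simp
        next
          case False
          then have d: "infdist x C > 0" using that(1,2) infdist_pos_not_in_closed by blast
          obtain m :: nat where m: "1 / infdist x C \<le> real m" using real_arch_simple by blast
          have "max 0 (1 - real n * infdist x C) = 0" if "n \<ge> m" for n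
          proof -
            have "1 / infdist x C \<le> real n" using m that by (meson of_nat_mono order.trans)
            then show ?thesis using d by (simp add: divide_le_eq)
          qed
          then show ?thesis using False
            by (intro tendsto_eventually) (auto simp: eventually_sequentially)
        qed
      qed
      show "(\<lambda>x. max 0 (1 - real n * infdist x C)) \<in> borel_measurable M" for n
        unfolding measurable_cong_sets[OF that(4) refl]
        by (intro borel_measurable_continuous_onI continuous_intros)
    qed (auto intro!: AE_I2 simp: infdist_nonneg)
    then show ?thesis by (simp add: measure_def)
  qed
  have closed_eq: "emeasure M C = emeasure N C" if C: "closed C" for C
  proof (cases "C = {}")
    case False
    have "Sigma_Algebra.measure M C = Sigma_Algebra.measure N C"
    proof (rule LIMSEQ_unique)
      show "(\<lambda>n. LINT x|M. max 0 (1 - real n * infdist x C)) \<longlonglongrightarrow> Sigma_Algebra.measure M C"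
        by (rule lim) (use C False fin sets in auto)
      have "(\<lambda>n. LINT x|N. max 0 (1 - real n * infdist x C)) \<longlonglongrightarrow> Sigma_Algebra.measure N C"
        by (rule lim) (use C False fin sets in auto)
      moreover have "(LINT x|M. max 0 (1 - real n * infdist x C)) = (LINT x|N. max 0 (1 - real n * infdist x C))" for n
        by (rule eq) (intro continuous_intros)
      ultimately show "(\<lambda>n. LINT x|M. max 0 (1 - real n * infdist x C)) \<longlonglongrightarrow> Sigma_Algebra.measure N C" by simp
    qed
    then show ?thesis using fin by (simp add: finite_measure.emeasure_eq_measure)
  qed simp
  show ?thesis
  proof (rule measure_eqI_generator_eq[where E = "{C. closed C}" and \<Omega> = UNIV and A = "\<lambda>_. UNIV"])
    show "Int_stable {C::'a set. closed C}" by (auto simp: Int_stable_def)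
    show "sets M = sigma_sets UNIV {C. closed C}" "sets N = sigma_sets UNIV {C. closed C}"
      using sets by (auto simp: borel_eq_closed)
    show "emeasure M UNIV \<noteq> \<infinity>"
      using fin(1) by (simp add: finite_measure.emeasure_eq_measure)
  qed (auto intro: closed_eq)
qed

text \<open>Invariance of the measure itself, and not only of integrals of continuous functions, is
  what later allows the unbounded logarithmic kernel to be rotated. The uniqueness lemma speaks of
  Borel measures on the whole space, so both measures are first pushed forward there.\<close>

lemma distr_sphere_measure_axis_rot:
  assumes a: "norm a = 1"
  shows "distr sphere_measure sphere_measure (axis_rot a s) = sphere_measure"
proof -
  have Rb: "axis_rot a s \<in> borel_measurable borel"
    by (rule borel_measurable_continuous_onI[OF continuous_on_axis_rot])
  have R: "axis_rot a s \<in> measurable sphere_measure sphere_measure"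
    using Rb axis_rot_in_S2[OF a]
    by (auto simp: measurable_cong_sets[OF sets_sphere_measure sets_sphere_measure] intro!: measurable_restrict_space3)
  have I: "id \<in> measurable sphere_measure borel" and R': "axis_rot a s \<in> measurable sphere_measure borel"
    using Rb by (auto simp: measurable_cong_sets[OF sets_sphere_measure refl] intro: measurable_restrict_space1)
  have eq: "distr sphere_measure borel (axis_rot a s) = distr sphere_measure borel id"
  proof (rule finite_borel_measure_eqI)
    fix f :: "real^3 \<Rightarrow> real" assume f: "continuous_on UNIV f"
    show "(LINT x|distr sphere_measure borel (axis_rot a s). f x) = (LINT x|distr sphere_measure borel id. f x)"
      using sphere_integral_axis_rot_continuous[OF a continuous_on_subset[OF f], of s]
      by (simp add: integral_distr[OF R' borel_measurable_continuous_onI[OF f]] integral_distr[OF I borel_measurable_continuous_onI[OF f]])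
  qed (auto intro: sphere.finite_measure_distr R' I)
  show ?thesis
  proof (rule measure_eqI)
    fix X assume "X \<in> sets (distr sphere_measure sphere_measure (axis_rot a s))"
    then have X: "X \<in> sets sphere_measure" by simp
    then have Xb: "X \<in> sets borel" "X \<subseteq> S2" by (auto simp: sets_restrict_space_iff)
    have "emeasure (distr sphere_measure sphere_measure (axis_rot a s)) X = emeasure (distr sphere_measure borel (axis_rot a s)) X"
      by (simp add: emeasure_distr[OF R X] emeasure_distr[OF R' Xb(1)])
    also have "\<dots> = emeasure sphere_measure X"
      unfolding eq using Xb by (simp add: emeasure_distr I Int_absorb2)
    finally show "emeasure (distr sphere_measure sphere_measure (axis_rot a s)) X = emeasure sphere_measure X" .
  qed simp
qed

lemma sphere_integral_axis_rot:
  fixes f :: "real^3 \<Rightarrow> real"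
  assumes "norm a = 1" "f \<in> borel_measurable sphere_measure"
  shows "(LINT x|sphere_measure. f (axis_rot a s x)) = (LINT x|sphere_measure. f x)"
proof -
  have "axis_rot a s \<in> measurable sphere_measure sphere_measure"
    using borel_measurable_continuous_onI[OF continuous_on_axis_rot] axis_rot_in_S2[OF assms(1)]
    by (auto simp: measurable_cong_sets[OF sets_sphere_measure sets_sphere_measure] intro!: measurable_restrict_space3)
  from integral_distr[OF this assms(2)] show ?thesis
    by (simp add: distr_sphere_measure_axis_rot[OF assms(1)])
qed

section \<open>Half turns and the decomposition of rotation matrices\<close>

lemma axis_rot_pi: "axis_rot a pi x = (2 * (a \<bullet> x)) *\<^sub>R a - x"
  by (simp add: axis_rot_def)

lemma axis_rot_pi_involution: "norm a = 1 \<Longrightarrow> axis_rot a pi (axis_rot a pi x) = x"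
  by (simp add: axis_rot_pi inner_simps dot_square_norm)

lemma axis_rot_pi_cross:
  assumes "norm a = 1"
  shows "cross3 (axis_rot a pi x) (axis_rot a pi y) = axis_rot a pi (cross3 x y)"
proof -
  have "(a \<bullet> a) *\<^sub>R cross3 x y = (a \<bullet> cross3 x y) *\<^sub>R a + (a \<bullet> x) *\<^sub>R cross3 a y + (a \<bullet> y) *\<^sub>R cross3 x a"
    by (simp add: cross3_simps forall_3)
  then have "cross3 x y = (a \<bullet> cross3 x y) *\<^sub>R a + (a \<bullet> x) *\<^sub>R cross3 a y + (a \<bullet> y) *\<^sub>R cross3 x a"
    using assms by (simp add: dot_square_norm)
  then have "2 *\<^sub>R cross3 x y = 2 *\<^sub>R ((a \<bullet> cross3 x y) *\<^sub>R a + (a \<bullet> x) *\<^sub>R cross3 a y + (a \<bullet> y) *\<^sub>R cross3 x a)"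
    by (rule arg_cong)
  then show ?thesis
    by (simp add: axis_rot_pi Cross3.left_diff_distrib Cross3.right_diff_distrib cross_mult_left cross_mult_right scaleR_2
        scaleR_add_right algebra_simps)
qed

text \<open>The half turn about the bisector of two unit vectors exchanges them; antipodal vectors
  have no bisector, but any axis perpendicular to them does the same.\<close>

lemma exists_axis_rot_pi:
  assumes "norm u = 1" "norm c = 1"
  obtains a where "norm a = 1" "axis_rot a pi u = c"
proof (cases "u + c = 0")
  case True
  then have c: "c = - u" by (simp add: eq_neg_iff_add_eq_0 add.commute)
  have "u \<noteq> 0" using assms by auto
  then obtain i where i: "cross3 u (axis i 1) \<noteq> 0" using cross_basis_nonzero by blast
  define a where "a = cross3 u (axis i 1) /\<^sub>R norm (cross3 u (axis i 1))"
  show ?thesis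
    by (rule that[of a]) (use i in \<open>simp_all add: a_def axis_rot_pi c dot_cross_self\<close>)
next
  case False
  define a where "a = (u + c) /\<^sub>R norm (u + c)"
  have n: "(norm (u + c))\<^sup>2 = 2 * ((u + c) \<bullet> u)"
    unfolding power2_norm_eq_inner inner_add_left inner_add_right using assms
    by (simp add: dot_square_norm inner_commute[of c u])
  have "(2 * (a \<bullet> u)) *\<^sub>R a = (2 * ((u + c) \<bullet> u) / (norm (u + c))\<^sup>2) *\<^sub>R (u + c)"
    by (simp add: a_def power2_eq_square divide_simps)
  also have "\<dots> = u + c" using False n[symmetric] by simp
  finally show ?thesis
    by (intro that[of a]) (use False in \<open>simp_all add: a_def axis_rot_pi\<close>)
qed

text \<open>A half turn brings the image of the third axis back; what remains fixes that axis and is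
  a planar rotation whose angle is read off from the image of the first axis. Invariance under axis
  rotations thus extends to all of SO(3).\<close>

lemma rotation_matrix_imp_axis_rots:
  assumes A: "rotation_matrix A"
  obtains a s where "norm a = 1" "\<And>x. A *v x = axis_rot a pi (axis_rot (axis 3 1) s x)"
proof -
  let ?e = "\<lambda>i. axis i 1 :: real^3"
  have oA: "orthogonal_transformation ((*v) A)"
    using A by (simp add: rotation_matrix_def orthogonal_transformation_matrix)
  have "norm (A *v ?e 3) = 1" using oA by (simp add: orthogonal_transformation_norm)
  then obtain a where a: "norm a = 1" "axis_rot a pi (A *v ?e 3) = ?e 3"
    using exists_axis_rot_pi[of "A *v ?e 3" "?e 3"] by auto
  define B where "B = (\<lambda>x. axis_rot a pi (A *v x))"
  have lB: "linear B" unfolding B_def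
    using linear_compose[OF matrix_vector_mul_linear[of A] linear_axis_rot[of a pi]] by (simp add: o_def)
  have nB: "norm (B x) = norm x" for x
    using oA by (simp add: B_def norm_axis_rot[OF a(1)] orthogonal_transformation_norm)
  have oB: "orthogonal_transformation B" unfolding orthogonal_transformation using lB nB by simp
  have cB: "B (cross3 x y) = cross3 (B x) (B y)" for x y
    by (simp add: B_def axis_rot_pi_cross[OF a(1)] cross_rotation_matrix[OF A])
  have B3: "B (?e 3) = ?e 3" using a by (simp add: B_def)
  have "B (?e 1) \<bullet> ?e 3 = 0"
  proof -
    have "B (?e 1) \<bullet> B (?e 3) = ?e 1 \<bullet> ?e 3" using oB by (simp add: orthogonal_transformation_def)
    then show ?thesis by (simp add: B3 inner_axis_axis)
  qed
  then have z: "B (?e 1) $ 3 = 0" by (simp add: inner_axis)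
  have "(B (?e 1) $ 1)\<^sup>2 + (B (?e 1) $ 2)\<^sup>2 = 1"
    using nB[of "?e 1"] z by (simp add: norm_vec_def L2_set_def sum_3 axis_def)
  then obtain s where s: "B (?e 1) $ 1 = cos s" "B (?e 1) $ 2 = sin s"
    using sincos_total_2pi by metis
  have c31: "cross3 (?e 3) (?e 1) = ?e 2" by (rule cross_basis)
  have R1: "axis_rot (?e 3) s (?e 1) = B (?e 1)"
    using z s by (simp add: axis_rot_def cross3_def vec_eq_iff forall_3 axis_def inner_vec_def sum_3)
  have R2: "axis_rot (?e 3) s (?e 2) = B (?e 2)"
    unfolding c31[symmetric] cB B3 R1[symmetric] by (rule axis_rot_cross) simp
  have R3: "axis_rot (?e 3) s (?e 3) = B (?e 3)"
    by (simp add: B3 axis_rot_def inner_axis_axis algebra_simps)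
  have "axis_rot (?e 3) s = B"
  proof (rule linear_eq_stdbasis[OF linear_axis_rot lB])
    fix b :: "real^3" assume "b \<in> Basis"
    then obtain i where "b = ?e i" by (auto simp: Basis_vec_def)
    then show "axis_rot (?e 3) s b = B b" using exhaust_3[of i] R1 R2 R3 by auto
  qed
  then have "A *v x = axis_rot a pi (axis_rot (?e 3) s x)" for x
    by (simp add: B_def axis_rot_pi_involution[OF a(1)])
  then show ?thesis using that a by blast
qed

lemma sphere_integral_rotation_matrix:
  fixes f :: "real^3 \<Rightarrow> real"
  assumes "rotation_matrix A" "continuous_on S2 f"
  shows "(LINT x|sphere_measure. f (A *v x)) = (LINT x|sphere_measure. f x)"
proof -
  obtain a s where a: "norm a = 1" "\<And>x. A *v x = axis_rot a pi (axis_rot (axis 3 1) s x)"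
    using rotation_matrix_imp_axis_rots[OF assms(1)] by metis
  have "continuous_on S2 (\<lambda>x. f (axis_rot a pi x))"
    by (rule continuous_on_compose2[OF assms(2) continuous_on_axis_rot]) (auto simp: norm_axis_rot[OF a(1)])
  from sphere_integral_axis_rot_continuous[OF _ this, of "axis 3 1" s]
    sphere_integral_axis_rot_continuous[OF a(1) assms(2), of pi]
  show ?thesis by (simp add: a(2) norm_axis_1)
qed


section \<open>Tangential calculus on the sphere\<close>

lemma normalize_in_S2: "y \<noteq> 0 \<Longrightarrow> y /\<^sub>R norm y \<in> S2" for y :: "real^3"
  by simp

text \<open>The extension constant along rays is a canonical witness: composing any local extension
  with the normalisation shows that this one function is smooth on the punctured space. Closure
  properties on the sphere then reduce to those of \<open>Ck_on\<close>.\<close>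

lemma smooth_on_S2_iff:
  "smooth_on S2 f \<longleftrightarrow> (\<forall>k. Ck_on k (- {0}) (\<lambda>y. f (y /\<^sub>R norm y)))"
proof
  assume f: "smooth_on S2 f"
  show "\<forall>k. Ck_on k (- {0}) (\<lambda>y. f (y /\<^sub>R norm y))"
  proof
    fix k
    show "Ck_on k (- {0}) (\<lambda>y. f (y /\<^sub>R norm y))"
    proof (rule Ck_on_local)
      fix x :: "real^3" assume x: "x \<in> - {0}"
      have "x /\<^sub>R norm x \<in> S2" using x by (intro normalize_in_S2) simp
      then have "\<exists>U F. open U \<and> x /\<^sub>R norm x \<in> U \<and> (\<forall>k. Ck_on k U F) \<and> (\<forall>y\<in>S2 \<inter> U. F y = f y)"
        using f unfolding smooth_on_def by (rule bspec[rotated])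
      then obtain U F where U: "open U" "x /\<^sub>R norm x \<in> U" "\<forall>k. Ck_on k U F" "\<forall>y\<in>S2 \<inter> U. F y = f y"
        by blast
      define W where "W = (- {0}) \<inter> (\<lambda>y::real^3. y /\<^sub>R norm y) -` U"
      have W: "open W" unfolding W_def
        by (rule continuous_open_preimage[OF _ _ U(1)]) (auto intro!: continuous_intros)
      have "Ck_on k W (\<lambda>y. F (y /\<^sub>R norm y))"
      proof (rule Ck_on_compose[OF W U(1) _ U(3)[rule_format]])
        show "(\<lambda>y. y /\<^sub>R norm y) ` W \<subseteq> U" by (auto simp: W_def)
        show "Ck_on k W (\<lambda>y. (y /\<^sub>R norm y) \<bullet> c)" for c
          by (rule Ck_on_subset[OF Ck_on_inner_normalize]) (auto simp: W_def)
      qed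
      moreover have "F (y /\<^sub>R norm y) = f (y /\<^sub>R norm y)" if "y \<in> W" for y
        using that U(4) normalize_in_S2[of y] by (simp add: W_def)
      ultimately have "Ck_on k W (\<lambda>y. f (y /\<^sub>R norm y))"
        using Ck_on_cong[OF W, of "\<lambda>y. F (y /\<^sub>R norm y)" "\<lambda>y. f (y /\<^sub>R norm y)" k] by blast
      then show "\<exists>W. open W \<and> x \<in> W \<and> Ck_on k W (\<lambda>y. f (y /\<^sub>R norm y))"
        using W x U(2) by (intro exI[of _ W]) (auto simp: W_def)
    qed auto
  qed
next
  assume "\<forall>k. Ck_on k (- {0}) (\<lambda>y. f (y /\<^sub>R norm y))"
  then show "smooth_on S2 f" unfolding smooth_on_def
    by (intro ballI exI[of _ "- {0}"] exI[of _ "\<lambda>y. f (y /\<^sub>R norm y)"]) auto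
qed

lemma smooth_on_S2D: "smooth_on S2 f \<Longrightarrow> Ck_on k (- {0}) (\<lambda>y. f (y /\<^sub>R norm y))"
  by (simp add: smooth_on_S2_iff)

lemma smooth_on_S2_Ck: "open W \<Longrightarrow> S2 \<subseteq> W \<Longrightarrow> (\<And>k. Ck_on k W f) \<Longrightarrow> smooth_on S2 f"
  unfolding smooth_on_def by blast

lemma smooth_on_S2_cong: "(\<And>x. x \<in> S2 \<Longrightarrow> f x = g x) \<Longrightarrow> smooth_on S2 f \<longleftrightarrow> smooth_on S2 g"
  unfolding smooth_on_def by auto

lemma smooth_on_S2_const: "smooth_on S2 (\<lambda>x. c)"
  by (rule smooth_on_S2_Ck[OF open_UNIV]) (auto intro: Ck_on_const)

lemma smooth_on_S2_inner: "smooth_on S2 (\<lambda>x. a \<bullet> x)"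
  by (rule smooth_on_S2_Ck[OF open_UNIV]) (auto intro: Ck_on_bounded_linear bounded_linear_inner_right)

lemma smooth_on_S2_inner': "smooth_on S2 (\<lambda>x. x \<bullet> a)"
  using smooth_on_S2_inner[of a] by (simp add: inner_commute)

lemma smooth_on_S2_nth: "smooth_on S2 (\<lambda>x. x $ i)"
  using smooth_on_S2_inner'[of "axis i 1"] by (simp add: inner_axis)

lemma smooth_on_S2_add: "smooth_on S2 f \<Longrightarrow> smooth_on S2 g \<Longrightarrow> smooth_on S2 (\<lambda>x. f x + g x)"
  unfolding smooth_on_S2_iff by (auto intro: Ck_on_add)

lemma smooth_on_S2_diff: "smooth_on S2 f \<Longrightarrow> smooth_on S2 g \<Longrightarrow> smooth_on S2 (\<lambda>x. f x - g x)"
  unfolding smooth_on_S2_iff by (auto intro: Ck_on_diff)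

lemma smooth_on_S2_mult: "smooth_on S2 f \<Longrightarrow> smooth_on S2 g \<Longrightarrow> smooth_on S2 (\<lambda>x. f x * g x)"
  unfolding smooth_on_S2_iff by (auto intro: Ck_on_mult)

lemma smooth_on_S2_cmult: "smooth_on S2 f \<Longrightarrow> smooth_on S2 (\<lambda>x. c * f x)"
  by (intro smooth_on_S2_mult smooth_on_S2_const)

lemma smooth_on_S2_uminus: "smooth_on S2 f \<Longrightarrow> smooth_on S2 (\<lambda>x. - f x)"
  unfolding smooth_on_S2_iff by (auto intro: Ck_on_uminus)

lemma smooth_on_S2_sum: "(\<And>i. i \<in> I \<Longrightarrow> smooth_on S2 (f i)) \<Longrightarrow> smooth_on S2 (\<lambda>x. \<Sum>i\<in>I. f i x)"
  unfolding smooth_on_S2_iff by (auto intro: Ck_on_sum)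

lemma smooth_on_S2_power: "smooth_on S2 f \<Longrightarrow> smooth_on S2 (\<lambda>x. f x ^ n)"
  unfolding smooth_on_S2_iff by (auto intro: Ck_on_power)

lemma smooth_on_S2_compose:
  fixes g :: "real \<Rightarrow> real"
  assumes "open V" "f ` S2 \<subseteq> V" "\<And>k. Ck_on k V g" "smooth_on S2 f"
  shows "smooth_on S2 (\<lambda>x. g (f x))"
  unfolding smooth_on_S2_iff
proof
  fix k
  show "Ck_on k (- {0}) (\<lambda>y. g (f (y /\<^sub>R norm y)))"
    by (rule Ck_on_compose_real[OF _ assms(1) _ assms(3) smooth_on_S2D[OF assms(4)]])
      (use assms(2) normalize_in_S2 in blast)+
qed

lemmas smooth_intros = smooth_on_S2_const smooth_on_S2_inner smooth_on_S2_inner' smooth_on_S2_nth smooth_on_S2_add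
  smooth_on_S2_diff smooth_on_S2_mult smooth_on_S2_uminus smooth_on_S2_sum smooth_on_S2_power

lemma smooth_on_S2_continuous: "smooth_on S2 f \<Longrightarrow> continuous_on S2 f"
proof -
  assume "smooth_on S2 f"
  then have "continuous_on S2 (\<lambda>y. f (y /\<^sub>R norm y))"
    using continuous_on_subset[OF Ck_on_imp_continuous_on[OF smooth_on_S2D], of f S2] by auto
  then show ?thesis by (rule continuous_on_eq) simp
qed

lemma sphere_deriv_cong:
  assumes "\<And>x. x \<in> S2 \<Longrightarrow> f x = g x" "x \<noteq> 0"
  shows "sphere_deriv f x = sphere_deriv g x"
  unfolding sphere_deriv_def
  by (rule frechet_derivative_cong_open[of "- {0}"]) (use assms normalize_in_S2 in auto)

lemma has_sphere_deriv:
  "smooth_on S2 f \<Longrightarrow> x \<noteq> 0 \<Longrightarrow> ((\<lambda>y. f (y /\<^sub>R norm y)) has_derivative sphere_deriv f x) (at x)"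
  unfolding sphere_deriv_def by (rule Ck_on_has_derivative[OF smooth_on_S2D[of f "Suc 0"]]) auto

lemma sphere_derivI:
  "((\<lambda>y. f (y /\<^sub>R norm y)) has_derivative f') (at x) \<Longrightarrow> sphere_deriv f x = f'"
  unfolding sphere_deriv_def by (rule frechet_derivative_at[symmetric])

lemma linear_sphere_deriv: "smooth_on S2 f \<Longrightarrow> x \<noteq> 0 \<Longrightarrow> linear (sphere_deriv f x)"
  using has_sphere_deriv has_derivative_linear by blast

text \<open>The extension constant along rays is homogeneous of degree 0, its derivative therefore
  of degree -1. This factor has to be undone to see that the derivative in a fixed direction is
  again smooth on the sphere.\<close>

lemma sphere_deriv_scale:
  assumes f: "smooth_on S2 f" and x: "x \<noteq> 0" and r: "r > 0"
  shows "sphere_deriv f (r *\<^sub>R x) v = sphere_deriv f x v / r"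
proof -
  have "((\<lambda>y. f ((r *\<^sub>R y) /\<^sub>R norm (r *\<^sub>R y))) has_derivative (\<lambda>v. sphere_deriv f (r *\<^sub>R x) (r *\<^sub>R v))) (at x)"
    using diff_chain_at[OF has_derivative_scaleR_right[OF has_derivative_ident, of r] has_sphere_deriv[OF f]] x r
    by (simp add: o_def)
  moreover have "(r *\<^sub>R y) /\<^sub>R norm (r *\<^sub>R y) = y /\<^sub>R norm y" for y :: "real^3"
    using r by simp
  ultimately have "sphere_deriv f x = (\<lambda>v. sphere_deriv f (r *\<^sub>R x) (r *\<^sub>R v))"
    by (intro sphere_derivI) (simp only:)
  then have "sphere_deriv f x v = sphere_deriv f (r *\<^sub>R x) (r *\<^sub>R v)" by metis
  also have "\<dots> = r * sphere_deriv f (r *\<^sub>R x) v"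
    using linear_cmul[OF linear_sphere_deriv[OF f, of "r *\<^sub>R x"]] x r by simp
  finally show ?thesis using r by (simp add: field_simps)
qed

lemma smooth_on_S2_sphere_deriv_Basis:
  assumes f: "smooth_on S2 f" and b: "b \<in> Basis"
  shows "smooth_on S2 (\<lambda>x. sphere_deriv f x b)"
  unfolding smooth_on_S2_iff
proof
  fix k
  have "Ck_on k (- {0}) (\<lambda>y. norm y * sphere_deriv f y b)"
    using smooth_on_S2D[OF f, of "Suc k"] b by (intro Ck_on_mult Ck_on_norm) (auto simp: sphere_deriv_def)
  moreover have "norm y * sphere_deriv f y b = sphere_deriv f (y /\<^sub>R norm y) b" if "y \<in> - {0}" for y
    using sphere_deriv_scale[OF f, of y "inverse (norm y)" b] that by (simp add: divide_inverse mult.commute)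
  ultimately show "Ck_on k (- {0}) (\<lambda>y. sphere_deriv f (y /\<^sub>R norm y) b)"
    using Ck_on_cong[of "- {0}" "\<lambda>y. norm y * sphere_deriv f y b" "\<lambda>y. sphere_deriv f (y /\<^sub>R norm y) b" k] by auto
qed

lemma sphere_deriv_expand:
  assumes "smooth_on S2 f" "x \<noteq> 0"
  shows "sphere_deriv f x v = (\<Sum>b\<in>Basis. (v \<bullet> b) * sphere_deriv f x b)"
proof -
  interpret linear "sphere_deriv f x" by (rule linear_sphere_deriv[OF assms])
  have "sphere_deriv f x v = sphere_deriv f x (\<Sum>b\<in>Basis. (v \<bullet> b) *\<^sub>R b)" by (simp add: euclidean_representation)
  then show ?thesis by (simp only: sum scaleR real_scaleR_def)
qed

lemma S2_nonzero: "x \<in> S2 \<Longrightarrow> x \<noteq> 0" by auto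

lemma smooth_on_S2_sphere_deriv:
  assumes f: "smooth_on S2 f" and v: "\<And>b. b \<in> Basis \<Longrightarrow> smooth_on S2 (\<lambda>x. v x \<bullet> b)"
  shows "smooth_on S2 (\<lambda>x. sphere_deriv f x (v x))"
proof -
  have "smooth_on S2 (\<lambda>x. \<Sum>b\<in>Basis. (v x \<bullet> b) * sphere_deriv f x b)"
    by (intro smooth_on_S2_sum smooth_on_S2_mult v smooth_on_S2_sphere_deriv_Basis f)
  then show ?thesis
    by (rule smooth_on_S2_cong[THEN iffD1, rotated]) (rule sphere_deriv_expand[OF f S2_nonzero, symmetric])
qed

lemma sphere_deriv_radial:
  assumes f: "smooth_on S2 f" and x: "x \<in> S2"
  shows "sphere_deriv f x x = 0"
proof -
  have "((\<lambda>t::real. t *\<^sub>R x) has_vector_derivative x) (at 1)"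
    by (auto intro!: derivative_eq_intros)
  from vector_derivative_diff_chain_within[OF this, of "\<lambda>y. f (y /\<^sub>R norm y)" "sphere_deriv f x"]
  have "((\<lambda>t. f ((t *\<^sub>R x) /\<^sub>R norm (t *\<^sub>R x))) has_vector_derivative sphere_deriv f x x) (at 1)"
    using has_sphere_deriv[OF f S2_nonzero[OF x]] has_derivative_at_withinI by (auto simp: o_def)
  moreover have "((\<lambda>t::real. f ((t *\<^sub>R x) /\<^sub>R norm (t *\<^sub>R x))) has_vector_derivative 0) (at 1)"
  proof (rule has_vector_derivative_transform_within_open[where S = "{0<..}" and f = "\<lambda>_. f x"])
    show "f x = f ((t *\<^sub>R x) /\<^sub>R norm (t *\<^sub>R x))" if "t \<in> {0<..}" for t
      using that x by simp
  qed (auto intro: derivative_intros)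
  ultimately show ?thesis by (metis vector_derivative_unique_at)
qed

lemma sphere_deriv_add:
  assumes "smooth_on S2 f" "smooth_on S2 g" "x \<noteq> 0"
  shows "sphere_deriv (\<lambda>x. f x + g x) x v = sphere_deriv f x v + sphere_deriv g x v"
  using sphere_derivI[OF has_derivative_add[OF has_sphere_deriv has_sphere_deriv, OF assms(1,3,2,3)]] by simp

lemma sphere_deriv_diff:
  assumes "smooth_on S2 f" "smooth_on S2 g" "x \<noteq> 0"
  shows "sphere_deriv (\<lambda>x. f x - g x) x v = sphere_deriv f x v - sphere_deriv g x v"
  using sphere_derivI[OF has_derivative_diff[OF has_sphere_deriv has_sphere_deriv, OF assms(1,3,2,3)]] by simp

lemma sphere_deriv_mult:
  assumes "smooth_on S2 f" "smooth_on S2 g" "x \<in> S2"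
  shows "sphere_deriv (\<lambda>x. f x * g x) x v = f x * sphere_deriv g x v + sphere_deriv f x v * g x"
  using sphere_derivI[OF has_derivative_mult[OF has_sphere_deriv has_sphere_deriv, OF assms(1) _ assms(2)]] assms(3)
  by (auto simp: S2_nonzero)

lemma sphere_deriv_const: "sphere_deriv (\<lambda>x. c) x v = 0"
  using sphere_derivI[of "\<lambda>x. c" "\<lambda>_. 0" x] by simp

lemma sphere_deriv_cmult:
  assumes "smooth_on S2 f" "x \<in> S2"
  shows "sphere_deriv (\<lambda>x. c * f x) x v = c * sphere_deriv f x v"
  using sphere_deriv_mult[OF smooth_on_S2_const assms] by (simp add: sphere_deriv_const)

lemma sphere_deriv_sum:
  assumes "\<And>i. i \<in> I \<Longrightarrow> smooth_on S2 (f i)" "x \<noteq> 0"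
  shows "sphere_deriv (\<lambda>x. \<Sum>i\<in>I. f i x) x v = (\<Sum>i\<in>I. sphere_deriv (f i) x v)"
  using assms(1)
proof (induction I rule: infinite_finite_induct)
  case (insert i I)
  then show ?case by (simp add: sphere_deriv_add[OF _ smooth_on_S2_sum assms(2)])
qed (simp_all add: sphere_deriv_const)

lemma sphere_deriv_inner:
  assumes "x \<in> S2"
  shows "sphere_deriv (\<lambda>x. a \<bullet> x) x v = a \<bullet> v - (a \<bullet> x) * (x \<bullet> v)"
proof -
  have n: "x \<noteq> 0" "norm x = 1" using assms by auto
  have "((\<lambda>y. a \<bullet> (y /\<^sub>R norm y)) has_derivative (\<lambda>v. a \<bullet> v - (a \<bullet> x) * (x \<bullet> v))) (at x)"
    using n has_derivative_norm[OF n(1)]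
    by (auto intro!: derivative_eq_intros simp: sgn_div_norm inner_simps algebra_simps inner_commute[of x] fun_eq_iff)
  from sphere_derivI[OF this] show ?thesis by simp
qed

lemma sphere_deriv_chain:
  fixes g :: "real \<Rightarrow> real"
  assumes "smooth_on S2 f" "x \<in> S2" "(g has_real_derivative g') (at (f x))"
  shows "sphere_deriv (\<lambda>x. g (f x)) x v = g' * sphere_deriv f x v"
proof -
  have n: "x \<noteq> 0" "norm x = 1" using assms(2) by auto
  have "(g has_derivative (*) g') (at (f (x /\<^sub>R norm x)))"
    using assms(3) n by (simp add: has_field_derivative_def)
  from diff_chain_at[OF has_sphere_deriv[OF assms(1) n(1)] this]
  have "((\<lambda>y. g (f (y /\<^sub>R norm y))) has_derivative (\<lambda>v. g' * sphere_deriv f x v)) (at x)"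
    by (simp add: o_def)
  from sphere_derivI[OF this] show ?thesis by simp
qed

lemma sphere_integral_rotational:
  assumes "smooth_on S2 f"
  shows "(LINT x|sphere_measure. sphere_deriv f x (cross3 a x)) = 0"
  unfolding sphere_deriv_def
  by (rule sphere_integral_tangential[OF _ _ smooth_on_S2D[OF assms]]) auto

lemma smooth_on_S2_cross: "smooth_on S2 (\<lambda>x. cross3 a x \<bullet> b)"
  using smooth_on_S2_inner[of "cross3 b a"] by (metis (no_types, lifting) cross_triple smooth_on_S2_cong)

lemma sphere_integrable_smooth: "smooth_on S2 f \<Longrightarrow> integrable sphere_measure f"
  by (intro integrable_sphere_measure smooth_on_S2_continuous)

lemma sphere_integral_cong: "(\<And>x. x \<in> S2 \<Longrightarrow> f x = g x) \<Longrightarrow> (LINT x|sphere_measure. f x) = (LINT x|sphere_measure. g x)" for f g :: "real^3 \<Rightarrow> real"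
  by (rule Bochner_Integration.integral_cong) auto

lemma sphere_integral_rotational_mult:
  assumes "smooth_on S2 f" "smooth_on S2 g"
  shows "(LINT x|sphere_measure. f x * sphere_deriv g x (cross3 a x)) = - (LINT x|sphere_measure. g x * sphere_deriv f x (cross3 a x))"
proof -
  have "0 = (LINT x|sphere_measure. sphere_deriv (\<lambda>x. f x * g x) x (cross3 a x))"
    by (rule sphere_integral_rotational[symmetric]) (intro smooth_on_S2_mult assms)
  also have "\<dots> = (LINT x|sphere_measure. f x * sphere_deriv g x (cross3 a x) + g x * sphere_deriv f x (cross3 a x))"
    by (rule sphere_integral_cong) (simp add: sphere_deriv_mult[OF assms] mult.commute)
  also have "\<dots> = (LINT x|sphere_measure. f x * sphere_deriv g x (cross3 a x)) + (LINT x|sphere_measure. g x * sphere_deriv f x (cross3 a x))"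
    by (intro Bochner_Integration.integral_add sphere_integrable_smooth smooth_on_S2_mult assms smooth_on_S2_sphere_deriv smooth_on_S2_cross)
  finally show ?thesis by simp
qed

text \<open>The factor 2 is the mean curvature of the sphere: \<open>v - (v \<bullet> x) x = - (v \<times> x) \<times> x\<close> splits into
  rotational derivatives, whose integrals vanish.\<close>

lemma sphere_integral_sphere_deriv:
  assumes f: "smooth_on S2 f"
  shows "(LINT x|sphere_measure. sphere_deriv f x v) = 2 * (LINT x|sphere_measure. (v \<bullet> x) * f x)"
proof -
  define h where "h = (\<lambda>i x. cross3 i v \<bullet> x)"
  have h: "smooth_on S2 (h i)" for i unfolding h_def by (rule smooth_on_S2_inner)
  have B: "(\<Sum>i\<in>(Basis::(real^3) set). F i) = F (axis 1 1) + F (axis 2 1) + F (axis 3 1)" for F :: "real^3 \<Rightarrow> real"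
  proof -
    have E: "(Basis::(real^3) set) = {axis 1 1, axis 2 1, axis 3 1}"
      by (auto simp: Basis_vec_def) (metis exhaust_3)
    show ?thesis unfolding E by (simp add: axis_eq_axis)
  qed
  have e: "(\<Sum>i\<in>Basis. sphere_deriv (\<lambda>x. h i x * f x) x (cross3 i x)) = 2 * ((v \<bullet> x) * f x) - sphere_deriv f x v" if x: "x \<in> S2" for x
  proof -
    interpret linear "sphere_deriv f x" by (rule linear_sphere_deriv[OF f S2_nonzero[OF x]])
    have "sphere_deriv (\<lambda>x. h i x * f x) x (cross3 i x) = h i x * sphere_deriv f x (cross3 i x) + (cross3 i v \<bullet> cross3 i x) * f x" for i
      unfolding sphere_deriv_mult[OF h f x] unfolding h_def sphere_deriv_inner[OF x] by (simp add: dot_cross_self)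
    then have "(\<Sum>i\<in>Basis. sphere_deriv (\<lambda>x. h i x * f x) x (cross3 i x)) =
       sphere_deriv f x (\<Sum>i\<in>Basis. h i x *\<^sub>R cross3 i x) + (\<Sum>i\<in>Basis. cross3 i v \<bullet> cross3 i x) * f x"
      by (simp add: sum.distrib sum scaleR sum_distrib_right)
    also have "(\<Sum>i\<in>Basis. h i x *\<^sub>R cross3 i x) = (x \<bullet> v) *\<^sub>R x - (x \<bullet> x) *\<^sub>R v"
    proof (rule euclidean_eqI)
      fix b :: "real^3" assume "b \<in> Basis"
      then obtain j where "b = axis j 1" by (auto simp: Basis_vec_def)
      then show "(\<Sum>i\<in>Basis. h i x *\<^sub>R cross3 i x) \<bullet> b = ((x \<bullet> v) *\<^sub>R x - (x \<bullet> x) *\<^sub>R v) \<bullet> b"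
        using exhaust_3[of j] unfolding inner_sum_left B
        by (auto simp: h_def inner_axis cross3_def inner_vec_def sum_3 axis_def algebra_simps)
    qed
    also have "(\<Sum>i\<in>Basis. cross3 i v \<bullet> cross3 i x) = 2 * (v \<bullet> x)"
      unfolding B by (simp add: cross3_def inner_vec_def sum_3 axis_def algebra_simps)
    also have "sphere_deriv f x ((x \<bullet> v) *\<^sub>R x - (x \<bullet> x) *\<^sub>R v) = - sphere_deriv f x v"
      using x by (simp add: diff scaleR sphere_deriv_radial[OF f x] dot_square_norm)
    finally show ?thesis by simp
  qed
  have "0 = (\<Sum>i\<in>Basis. LINT x|sphere_measure. sphere_deriv (\<lambda>x. h i x * f x) x (cross3 i x))"
    by (simp add: sphere_integral_rotational smooth_on_S2_mult h f)
  also have "\<dots> = (LINT x|sphere_measure. (\<Sum>i\<in>Basis. sphere_deriv (\<lambda>x. h i x * f x) x (cross3 i x)))"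
    by (intro Bochner_Integration.integral_sum[symmetric] sphere_integrable_smooth smooth_on_S2_sphere_deriv smooth_on_S2_cross smooth_on_S2_mult h f)
  also have "\<dots> = (LINT x|sphere_measure. 2 * ((v \<bullet> x) * f x) - sphere_deriv f x v)"
    by (rule sphere_integral_cong) (rule e)
  also have "\<dots> = 2 * (LINT x|sphere_measure. (v \<bullet> x) * f x) - (LINT x|sphere_measure. sphere_deriv f x v)"
    by (subst Bochner_Integration.integral_diff)
      (auto intro!: sphere_integrable_smooth smooth_intros smooth_on_S2_sphere_deriv f)
  finally show ?thesis by simp
qed

lemma sphere_grad_inner:
  assumes "smooth_on S2 f" "x \<in> S2"
  shows "sphere_grad f x \<bullet> w = sphere_deriv f x w"
  unfolding sphere_deriv_expand[OF assms(1) S2_nonzero[OF assms(2)], of w]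
  unfolding sphere_grad_def inner_sum_left inner_scaleR_left by (simp add: inner_commute mult.commute)

text \<open>Reduces the divergence of the vector-valued gradient to iterated scalar derivatives, for
  which the product and chain rules are available.\<close>

lemma laplace_beltrami_eq:
  assumes f: "smooth_on S2 f" and x: "x \<in> S2"
  shows "laplace_beltrami f x = (\<Sum>b\<in>Basis. sphere_deriv (\<lambda>y. sphere_deriv f y b) x b)"
proof -
  define G where "G = (\<lambda>y. sphere_grad f (y /\<^sub>R norm y))"
  define D where "D = (\<lambda>v. \<Sum>b\<in>Basis. sphere_deriv (\<lambda>y. sphere_deriv f y b) x v *\<^sub>R (b::real^3))"
  have G: "G = (\<lambda>y. \<Sum>b\<in>Basis. sphere_deriv f (y /\<^sub>R norm y) b *\<^sub>R b)"
    by (simp add: G_def sphere_grad_def)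
  have "(G has_derivative D) (at x)" unfolding G D_def
    by (intro has_derivative_sum has_derivative_scaleR_left has_sphere_deriv[of "\<lambda>y. sphere_deriv f y b" for b]
        smooth_on_S2_sphere_deriv_Basis f S2_nonzero x)
  then have "sphere_deriv (sphere_grad f) x = D"
    unfolding sphere_deriv_def G_def by (rule frechet_derivative_at[symmetric])
  then show ?thesis
    by (simp add: laplace_beltrami_def sphere_div_def D_def inner_sum_left inner_Basis if_distrib cong: if_cong)
qed

lemma smooth_on_S2_laplace_beltrami:
  assumes "smooth_on S2 f" shows "smooth_on S2 (laplace_beltrami f)"
proof -
  have "smooth_on S2 (\<lambda>x. \<Sum>b\<in>Basis. sphere_deriv (\<lambda>y. sphere_deriv f y b) x b)"
    by (intro smooth_on_S2_sum smooth_on_S2_sphere_deriv_Basis assms)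
  then show ?thesis by (rule smooth_on_S2_cong[THEN iffD1, rotated]) (simp add: laplace_beltrami_eq assms)
qed

text \<open>Green's first identity. When the divergence identity is applied to the components of
  \<open>g\<close> times the gradient of \<open>f\<close>, the curvature terms add up to
  \<open>g\<close> times the radial derivative of \<open>f\<close>, which is 0.\<close>

lemma sphere_integral_laplace_beltrami_mult:
  assumes f: "smooth_on S2 f" and g: "smooth_on S2 g"
  shows "(LINT x|sphere_measure. g x * laplace_beltrami f x) = - (LINT x|sphere_measure. (\<Sum>b\<in>Basis. sphere_deriv g x b * sphere_deriv f x b))"
proof -
  note sm = smooth_on_S2_sum smooth_on_S2_mult smooth_on_S2_sphere_deriv_Basis smooth_on_S2_inner f g
  have s: "smooth_on S2 (\<lambda>x. g x * sphere_deriv f x b)" if "b \<in> Basis" for b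
    by (intro sm that)
  have "(LINT x|sphere_measure. g x * laplace_beltrami f x) + (LINT x|sphere_measure. (\<Sum>b\<in>Basis. sphere_deriv g x b * sphere_deriv f x b))
     = (LINT x|sphere_measure. g x * laplace_beltrami f x + (\<Sum>b\<in>Basis. sphere_deriv g x b * sphere_deriv f x b))"
    by (intro Bochner_Integration.integral_add[symmetric] sphere_integrable_smooth sm smooth_on_S2_laplace_beltrami)
  also have "\<dots> = (LINT x|sphere_measure. (\<Sum>b\<in>Basis. sphere_deriv (\<lambda>x. g x * sphere_deriv f x b) x b))"
    by (rule sphere_integral_cong)
      (simp add: laplace_beltrami_eq[OF f] sphere_deriv_mult[OF g smooth_on_S2_sphere_deriv_Basis[OF f]] sum.distrib sum_distrib_left)
  also have "\<dots> = (\<Sum>b\<in>Basis. LINT x|sphere_measure. sphere_deriv (\<lambda>x. g x * sphere_deriv f x b) x b)"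
    by (intro Bochner_Integration.integral_sum sphere_integrable_smooth smooth_on_S2_sphere_deriv_Basis s)
  also have "\<dots> = (\<Sum>b\<in>Basis. 2 * (LINT x|sphere_measure. (b \<bullet> x) * (g x * sphere_deriv f x b)))"
    by (intro sum.cong refl sphere_integral_sphere_deriv s)
  also have "\<dots> = 2 * (LINT x|sphere_measure. (\<Sum>b\<in>Basis. (b \<bullet> x) * (g x * sphere_deriv f x b)))"
    unfolding sum_distrib_left[symmetric]
    by (intro arg_cong[where f = "(*) 2"] Bochner_Integration.integral_sum[symmetric] sphere_integrable_smooth sm)
  also have "(LINT x|sphere_measure. (\<Sum>b\<in>Basis. (b \<bullet> x) * (g x * sphere_deriv f x b))) = (LINT x|sphere_measure. 0)"
  proof (rule sphere_integral_cong)
    fix x assume x: "x \<in> S2"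
    have "(\<Sum>b\<in>Basis. (b \<bullet> x) * (g x * sphere_deriv f x b)) = g x * sphere_deriv f x x"
      unfolding sphere_deriv_expand[OF f S2_nonzero[OF x], of x] by (simp add: sum_distrib_left inner_commute mult_ac)
    then show "(\<Sum>b\<in>Basis. (b \<bullet> x) * (g x * sphere_deriv f x b)) = 0" by (simp add: sphere_deriv_radial[OF f x])
  qed
  finally show ?thesis by simp
qed

lemma laplace_beltrami_self_adjoint:
  assumes "smooth_on S2 f" "smooth_on S2 g"
  shows "(LINT x|sphere_measure. g x * laplace_beltrami f x) = (LINT x|sphere_measure. f x * laplace_beltrami g x)"
  using sphere_integral_laplace_beltrami_mult[OF assms] sphere_integral_laplace_beltrami_mult[OF assms(2,1)]
  by (simp add: mult.commute)

lemma laplace_beltrami_const: "x \<in> S2 \<Longrightarrow> laplace_beltrami (\<lambda>x. c) x = 0"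
  by (simp add: laplace_beltrami_eq[OF smooth_on_S2_const] sphere_deriv_const)

lemma sphere_integral_laplace_beltrami:
  assumes "smooth_on S2 f"
  shows "(LINT x|sphere_measure. laplace_beltrami f x) = 0"
proof -
  have "(LINT x|sphere_measure. 1 * laplace_beltrami f x) = (LINT x|sphere_measure. f x * laplace_beltrami (\<lambda>x. 1) x)"
    by (rule laplace_beltrami_self_adjoint[OF assms smooth_on_S2_const])
  also have "\<dots> = (LINT x|sphere_measure. 0)"
    by (rule sphere_integral_cong) (simp add: laplace_beltrami_const)
  finally show ?thesis by simp
qed

lemma laplace_beltrami_sum:
  assumes "\<And>i. i \<in> I \<Longrightarrow> smooth_on S2 (f i)" "x \<in> S2"
  shows "laplace_beltrami (\<lambda>x. \<Sum>i\<in>I. f i x) x = (\<Sum>i\<in>I. laplace_beltrami (f i) x)"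
proof -
  have "sphere_deriv (\<lambda>y. sphere_deriv (\<lambda>x. \<Sum>i\<in>I. f i x) y b) x b = (\<Sum>i\<in>I. sphere_deriv (\<lambda>y. sphere_deriv (f i) y b) x b)"
    if b: "b \<in> Basis" for b
  proof -
    have "sphere_deriv (\<lambda>y. sphere_deriv (\<lambda>x. \<Sum>i\<in>I. f i x) y b) x b = sphere_deriv (\<lambda>y. \<Sum>i\<in>I. sphere_deriv (f i) y b) x b"
      by (rule fun_cong[OF sphere_deriv_cong]) (use assms in \<open>auto intro!: sphere_deriv_sum\<close>)
    also have "\<dots> = (\<Sum>i\<in>I. sphere_deriv (\<lambda>y. sphere_deriv (f i) y b) x b)"
      by (rule sphere_deriv_sum) (use assms b in \<open>auto intro!: smooth_on_S2_sphere_deriv_Basis\<close>)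
    finally show ?thesis .
  qed
  then have "(\<Sum>b\<in>Basis. sphere_deriv (\<lambda>y. sphere_deriv (\<lambda>x. \<Sum>i\<in>I. f i x) y b) x b) = (\<Sum>b\<in>Basis. \<Sum>i\<in>I. sphere_deriv (\<lambda>y. sphere_deriv (f i) y b) x b)"
    by (intro sum.cong) auto
  also have "\<dots> = (\<Sum>i\<in>I. \<Sum>b\<in>Basis. sphere_deriv (\<lambda>y. sphere_deriv (f i) y b) x b)"
    by (rule sum.swap)
  also have "\<dots> = (\<Sum>i\<in>I. laplace_beltrami (f i) x)"
    using assms by (intro sum.cong) (auto simp: laplace_beltrami_eq)
  finally show ?thesis
    using laplace_beltrami_eq[OF smooth_on_S2_sum assms(2), of I f] assms(1) by simp
qed

lemma laplace_beltrami_cmult: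
  assumes f: "smooth_on S2 f" and x: "x \<in> S2"
  shows "laplace_beltrami (\<lambda>x. c * f x) x = c * laplace_beltrami f x"
proof -
  have "sphere_deriv (\<lambda>y. sphere_deriv (\<lambda>x. c * f x) y b) x b = c * sphere_deriv (\<lambda>y. sphere_deriv f y b) x b"
    if b: "b \<in> Basis" for b
  proof -
    have "sphere_deriv (\<lambda>y. sphere_deriv (\<lambda>x. c * f x) y b) x b = sphere_deriv (\<lambda>y. c * sphere_deriv f y b) x b"
      by (rule fun_cong[OF sphere_deriv_cong]) (use sphere_deriv_cmult[OF f] x in auto)
    also have "\<dots> = c * sphere_deriv (\<lambda>y. sphere_deriv f y b) x b"
      by (rule sphere_deriv_cmult) (use x b f in \<open>auto intro!: smooth_on_S2_sphere_deriv_Basis\<close>)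
    finally show ?thesis .
  qed
  then show ?thesis
    by (simp add: laplace_beltrami_eq[OF smooth_on_S2_cmult[OF f] x] laplace_beltrami_eq[OF f x] sum_distrib_left)
qed


section \<open>Poisson brackets and ridge functions\<close>

text \<open>The transport term of the vorticity equation: differentiation of \<open>g\<close> along
  the velocity field with stream function \<open>f\<close>.\<close>

definition poisson_bracket :: "(real^3 \<Rightarrow> real) \<Rightarrow> (real^3 \<Rightarrow> real) \<Rightarrow> real^3 \<Rightarrow> real" where
  "poisson_bracket f g x = rot_J x (sphere_grad f x) \<bullet> sphere_grad g x"

lemma poisson_bracket_expand:
  assumes "smooth_on S2 f" "smooth_on S2 g" "x \<in> S2"
  shows "poisson_bracket f g x = (\<Sum>b\<in>Basis. sphere_deriv f x (cross3 b x) * sphere_deriv g x b)"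
proof -
  have "poisson_bracket f g x = (\<Sum>b\<in>Basis. (cross3 x (sphere_grad f x) \<bullet> b) * (sphere_grad g x \<bullet> b))"
    unfolding poisson_bracket_def rot_J_def by (rule euclidean_inner)
  also have "\<dots> = (\<Sum>b\<in>Basis. sphere_deriv f x (cross3 b x) * sphere_deriv g x b)"
  proof (rule sum.cong[OF refl])
    fix b :: "real^3"
    have "cross3 x (sphere_grad f x) \<bullet> b = sphere_grad f x \<bullet> cross3 b x"
      by (metis cross_triple inner_commute)
    then show "cross3 x (sphere_grad f x) \<bullet> b * (sphere_grad g x \<bullet> b) = sphere_deriv f x (cross3 b x) * sphere_deriv g x b"
      by (simp add: sphere_grad_inner[OF assms(1,3)] sphere_grad_inner[OF assms(2,3)])
  qed
  finally show ?thesis .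
qed

lemma smooth_on_S2_poisson_bracket:
  assumes "smooth_on S2 f" "smooth_on S2 g"
  shows "smooth_on S2 (poisson_bracket f g)"
proof -
  have "smooth_on S2 (\<lambda>x. \<Sum>b\<in>Basis. sphere_deriv f x (cross3 b x) * sphere_deriv g x b)"
    by (intro smooth_on_S2_sum smooth_on_S2_mult smooth_on_S2_sphere_deriv smooth_on_S2_cross smooth_on_S2_sphere_deriv_Basis assms)
  then show ?thesis by (rule smooth_on_S2_cong[THEN iffD1, rotated]) (simp add: poisson_bracket_expand assms)
qed

lemma poisson_bracket_antisym: "poisson_bracket f g x = - poisson_bracket g f x"
  unfolding poisson_bracket_def rot_J_def
  by (metis cross_triple cross_skew inner_commute inner_minus_left)

lemma poisson_bracket_mult_right:
  assumes "smooth_on S2 f" "smooth_on S2 g" "smooth_on S2 h" "x \<in> S2"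
  shows "poisson_bracket f (\<lambda>x. g x * h x) x = g x * poisson_bracket f h x + h x * poisson_bracket f g x"
  unfolding poisson_bracket_expand[OF assms(1) smooth_on_S2_mult[OF assms(2,3)] assms(4)]
    poisson_bracket_expand[OF assms(1,2,4)] poisson_bracket_expand[OF assms(1,3,4)] sphere_deriv_mult[OF assms(2,3,4)]
  by (simp add: sum.distrib sum_distrib_left algebra_simps)

lemma poisson_bracket_diff_left:
  assumes "smooth_on S2 f" "smooth_on S2 g" "smooth_on S2 h" "x \<in> S2"
  shows "poisson_bracket (\<lambda>x. f x - g x) h x = poisson_bracket f h x - poisson_bracket g h x"
  unfolding poisson_bracket_expand[OF smooth_on_S2_diff[OF assms(1,2)] assms(3,4)]
    poisson_bracket_expand[OF assms(1,3,4)] poisson_bracket_expand[OF assms(2,3,4)]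
    sphere_deriv_diff[OF assms(1,2) S2_nonzero[OF assms(4)]]
  by (simp add: sum_subtractf algebra_simps)

lemma poisson_bracket_cmult_left:
  assumes "smooth_on S2 f" "smooth_on S2 g" "x \<in> S2"
  shows "poisson_bracket (\<lambda>x. c * f x) g x = c * poisson_bracket f g x"
  unfolding poisson_bracket_expand[OF smooth_on_S2_cmult[OF assms(1)] assms(2,3)]
    poisson_bracket_expand[OF assms] sphere_deriv_cmult[OF assms(1,3)]
  by (simp add: sum_distrib_left algebra_simps)

lemma poisson_bracket_power_right:
  assumes "smooth_on S2 f" "smooth_on S2 g" "x \<in> S2"
  shows "poisson_bracket f (\<lambda>x. g x ^ n) x = real n * g x ^ (n - 1) * poisson_bracket f g x"
proof -
  have d: "((\<lambda>t. t ^ n) has_real_derivative real n * g x ^ (n - 1)) (at (g x))"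
    by (auto intro!: derivative_eq_intros)
  show ?thesis
    unfolding poisson_bracket_expand[OF assms(1) smooth_on_S2_power[OF assms(2)] assms(3)]
      poisson_bracket_expand[OF assms] sphere_deriv_chain[OF assms(2,3) d]
    by (simp add: sum_distrib_left algebra_simps)
qed

text \<open>Linear stream functions generate rigid rotations. This turns the planetary rotation into
  a rotational derivative and, by antisymmetry, also serves the momentum law.\<close>

lemma poisson_bracket_inner_left:
  assumes "smooth_on S2 g" "x \<in> S2"
  shows "poisson_bracket (\<lambda>x. a \<bullet> x) g x = - sphere_deriv g x (cross3 a x)"
proof -
  have "poisson_bracket (\<lambda>x. a \<bullet> x) g x = (\<Sum>b\<in>Basis. (cross3 x a \<bullet> b) * sphere_deriv g x b)"
    unfolding poisson_bracket_expand[OF smooth_on_S2_inner assms] sphere_deriv_inner[OF assms(2)]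
    by (simp add: dot_cross_self) (metis (no_types, lifting) cross_triple inner_commute)
  also have "\<dots> = sphere_deriv g x (- cross3 a x)"
    using sphere_deriv_expand[OF assms(1) S2_nonzero[OF assms(2)], of "cross3 x a"] cross_skew[of x a] by simp
  also have "\<dots> = - sphere_deriv g x (cross3 a x)"
    by (rule linear_neg[OF linear_sphere_deriv[OF assms(1) S2_nonzero[OF assms(2)]]])
  finally show ?thesis .
qed

section \<open>Zonal functions\<close>

lemma Ck_on_real_SucD:
  fixes h h' :: "real \<Rightarrow> real"
  assumes "open V" "Ck_on (Suc k) V h" "\<And>z. z \<in> V \<Longrightarrow> (h has_real_derivative h' z) (at z)"
  shows "Ck_on k V h'"
proof -
  have "Ck_on k V (\<lambda>x. frechet_derivative h (at x) 1)" using assms(2) by simp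
  moreover have "frechet_derivative h (at x) 1 = h' x" if "x \<in> V" for x
    using frechet_derivative_at[OF assms(3)[OF that, unfolded has_field_derivative_def]] by (metis mult.right_neutral)
  ultimately show ?thesis using Ck_on_cong[OF assms(1), of "\<lambda>x. frechet_derivative h (at x) 1" h' k] by blast
qed

lemma inner_S2_in: "norm a = 1 \<Longrightarrow> x \<in> S2 \<Longrightarrow> a \<bullet> x \<in> {-1..1}" for a :: "real^3"
  using Cauchy_Schwarz_ineq2[of a x] by (auto simp: abs_le_iff)

text \<open>Profiles \<open>h\<close> of the height \<open>a \<bullet> x\<close>. The profile lives
  on an open set around [-1,1], so that a singularity just outside this range is allowed, as for the
  kernels below.\<close>

locale ridge =
  fixes V :: "real set" and h h' h'' :: "real \<Rightarrow> real" and a :: "real^3"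
  assumes V: "open V" "{-1..1} \<subseteq> V" and a: "norm a = 1"
    and Ck: "\<And>k. Ck_on k V h"
    and h': "\<And>z. z \<in> V \<Longrightarrow> (h has_real_derivative h' z) (at z)"
    and h'': "\<And>z. z \<in> V \<Longrightarrow> (h' has_real_derivative h'' z) (at z)"
begin

lemma inV: "x \<in> S2 \<Longrightarrow> a \<bullet> x \<in> V"
  using inner_S2_in[OF a] V by blast

lemma Ck': "Ck_on k V h'"
  using Ck_on_real_SucD[OF V(1) Ck h'] .

lemma smooth: "smooth_on S2 (\<lambda>x. h (a \<bullet> x))"
  by (rule smooth_on_S2_compose[OF V(1) _ Ck smooth_on_S2_inner]) (use inV in blast)

lemma smooth': "smooth_on S2 (\<lambda>x. h' (a \<bullet> x))"
  by (rule smooth_on_S2_compose[OF V(1) _ Ck' smooth_on_S2_inner]) (use inV in blast)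

lemma deriv: "x \<in> S2 \<Longrightarrow> sphere_deriv (\<lambda>x. h (a \<bullet> x)) x v = h' (a \<bullet> x) * (a \<bullet> v - (a \<bullet> x) * (v \<bullet> x))"
  using sphere_deriv_chain[OF smooth_on_S2_inner _ h', of x a] sphere_deriv_inner[of x a v] inV by (simp add: inner_commute)

lemma deriv': "x \<in> S2 \<Longrightarrow> sphere_deriv (\<lambda>x. h' (a \<bullet> x)) x v = h'' (a \<bullet> x) * (a \<bullet> v - (a \<bullet> x) * (v \<bullet> x))"
  using sphere_deriv_chain[OF smooth_on_S2_inner _ h'', of x a] sphere_deriv_inner[of x a v] inV by (simp add: inner_commute)

text \<open>The result is the Legendre operator in z = a . x. Summing over the ambient basis, the
  only inputs are that \<open>a\<close> and \<open>x\<close> are unit vectors with inner product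
  z.\<close>

lemma laplace:
  assumes x: "x \<in> S2"
  shows "laplace_beltrami (\<lambda>x. h (a \<bullet> x)) x = (1 - (a \<bullet> x)\<^sup>2) * h'' (a \<bullet> x) - 2 * (a \<bullet> x) * h' (a \<bullet> x)"
proof -
  define z where "z = a \<bullet> x"
  have xx: "x \<bullet> x = 1" "a \<bullet> a = 1" using x a by (simp_all add: dot_square_norm)
  have e: "sphere_deriv (\<lambda>y. sphere_deriv (\<lambda>x. h (a \<bullet> x)) y b) x b
     = h'' z * (a \<bullet> b - z * (x \<bullet> b))\<^sup>2 - h' z * ((a \<bullet> b - z * (x \<bullet> b)) * (x \<bullet> b) + z * (1 - (x \<bullet> b)\<^sup>2))"
    if b: "b \<in> Basis" for b
  proof -
    have s: "smooth_on S2 (\<lambda>y. a \<bullet> b - (a \<bullet> y) * (b \<bullet> y))" by (intro smooth_intros)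
    have "sphere_deriv (\<lambda>y. sphere_deriv (\<lambda>x. h (a \<bullet> x)) y b) x b = sphere_deriv (\<lambda>y. h' (a \<bullet> y) * (a \<bullet> b - (a \<bullet> y) * (b \<bullet> y))) x b"
      by (rule fun_cong[OF sphere_deriv_cong]) (use x deriv in auto)
    also have "\<dots> = h' z * sphere_deriv (\<lambda>y. a \<bullet> b - (a \<bullet> y) * (b \<bullet> y)) x b + h'' z * (a \<bullet> b - z * (b \<bullet> x)) * (a \<bullet> b - z * (b \<bullet> x))"
      unfolding sphere_deriv_mult[OF smooth' s x] deriv'[OF x] by (simp add: z_def)
    also have "sphere_deriv (\<lambda>y. a \<bullet> b - (a \<bullet> y) * (b \<bullet> y)) x b = - sphere_deriv (\<lambda>y. (a \<bullet> y) * (b \<bullet> y)) x b"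
      by (subst sphere_deriv_diff) (use x in \<open>auto intro!: smooth_intros simp: sphere_deriv_const\<close>)
    also have "sphere_deriv (\<lambda>y. (a \<bullet> y) * (b \<bullet> y)) x b = z * (1 - (x \<bullet> b)\<^sup>2) + (a \<bullet> b - z * (x \<bullet> b)) * (x \<bullet> b)"
      by (subst sphere_deriv_mult[OF smooth_on_S2_inner smooth_on_S2_inner x])
        (use b in \<open>simp add: sphere_deriv_inner[OF x] z_def power2_eq_square inner_commute[of b x] inner_Basis\<close>)
    finally show ?thesis by (simp add: inner_commute[of b x] power2_eq_square algebra_simps)
  qed
  have s1: "(\<Sum>b\<in>Basis. (a \<bullet> b) * (x \<bullet> b)) = z" "(\<Sum>b\<in>Basis. (x \<bullet> b)\<^sup>2) = 1" "(\<Sum>b\<in>Basis. (a \<bullet> b)\<^sup>2) = 1"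
    using euclidean_inner[of a x] euclidean_inner[of x x] euclidean_inner[of a a] xx by (simp_all add: z_def power2_eq_square)
  have s2: "(\<Sum>b\<in>Basis. (a \<bullet> b - z * (x \<bullet> b))\<^sup>2) = 1 - z\<^sup>2"
  proof -
    have "(\<Sum>b\<in>Basis. (a \<bullet> b - z * (x \<bullet> b))\<^sup>2) = (\<Sum>b\<in>Basis. (a \<bullet> b)\<^sup>2 - 2 * z * ((a \<bullet> b) * (x \<bullet> b)) + z\<^sup>2 * (x \<bullet> b)\<^sup>2)"
      by (intro sum.cong refl) (simp add: power2_eq_square algebra_simps)
    also have "\<dots> = 1 - 2 * z * z + z\<^sup>2 * 1"
      unfolding sum.distrib sum_subtractf sum_distrib_left[symmetric] s1 ..
    finally show ?thesis by (simp add: power2_eq_square)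
  qed
  have s3: "(\<Sum>b\<in>Basis. (a \<bullet> b - z * (x \<bullet> b)) * (x \<bullet> b) + z * (1 - (x \<bullet> b)\<^sup>2)) = 2 * z"
  proof -
    have "(\<Sum>b\<in>Basis. (a \<bullet> b - z * (x \<bullet> b)) * (x \<bullet> b) + z * (1 - (x \<bullet> b)\<^sup>2)) = (\<Sum>b\<in>(Basis::(real^3) set). (a \<bullet> b) * (x \<bullet> b) - 2 * z * (x \<bullet> b)\<^sup>2 + z)"
      by (intro sum.cong refl) (simp add: power2_eq_square algebra_simps)
    also have "\<dots> = z - 2 * z * 1 + 3 * z"
      unfolding sum.distrib sum_subtractf sum_distrib_left[symmetric] s1 by simp
    finally show ?thesis by simp
  qed
  have "laplace_beltrami (\<lambda>x. h (a \<bullet> x)) x = (\<Sum>b\<in>Basis. h'' z * (a \<bullet> b - z * (x \<bullet> b))\<^sup>2 - h' z * ((a \<bullet> b - z * (x \<bullet> b)) * (x \<bullet> b) + z * (1 - (x \<bullet> b)\<^sup>2)))"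
    unfolding laplace_beltrami_eq[OF smooth x] by (intro sum.cong refl e)
  also have "\<dots> = h'' z * (1 - z\<^sup>2) - h' z * (2 * z)"
    unfolding sum_subtractf sum_distrib_left[symmetric] s2 s3 ..
  finally show ?thesis by (simp add: z_def mult_ac)
qed

text \<open>The bracket with a function of \<open>a \<bullet> x\<close> is \<open>h'\<close> times
  the derivative along the rotation about \<open>a\<close>, and \<open>h' (a \<bullet> x)\<close> is
  constant along that rotation. This special case comes first because the general one is deduced
  from it.\<close>

lemma poisson_bracket_integral:
  assumes f: "smooth_on S2 f"
  shows "(LINT x|sphere_measure. poisson_bracket f (\<lambda>x. h (a \<bullet> x)) x) = 0"
proof -
  have "(LINT x|sphere_measure. poisson_bracket f (\<lambda>x. h (a \<bullet> x)) x) = (LINT x|sphere_measure. h' (a \<bullet> x) * sphere_deriv f x (cross3 a x))"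
  proof (rule sphere_integral_cong)
    fix x assume x: "x \<in> S2"
    have "poisson_bracket (\<lambda>x. h (a \<bullet> x)) f x = h' (a \<bullet> x) * poisson_bracket (\<lambda>x. a \<bullet> x) f x"
      unfolding poisson_bracket_expand[OF smooth f x] poisson_bracket_expand[OF smooth_on_S2_inner f x]
        deriv[OF x] sphere_deriv_inner[OF x] sum_distrib_left
      by (simp add: inner_commute[of x] mult.assoc)
    then show "poisson_bracket f (\<lambda>x. h (a \<bullet> x)) x = h' (a \<bullet> x) * sphere_deriv f x (cross3 a x)"
      using poisson_bracket_antisym[of f "\<lambda>x. h (a \<bullet> x)" x] by (simp add: poisson_bracket_inner_left[OF f x])
  qed
  also have "\<dots> = - (LINT x|sphere_measure. f x * sphere_deriv (\<lambda>x. h' (a \<bullet> x)) x (cross3 a x))"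
    by (rule sphere_integral_rotational_mult[OF smooth' f])
  also have "(LINT x|sphere_measure. f x * sphere_deriv (\<lambda>x. h' (a \<bullet> x)) x (cross3 a x)) = (LINT x|sphere_measure. 0)"
    by (rule sphere_integral_cong) (simp add: deriv' dot_cross_self)
  finally show ?thesis by simp
qed

end

text \<open>At \<open>e = 0\<close> and on zero-mean functions this is the Green kernel of minus the
  Laplacian, up to an additive constant; \<open>e > 0\<close> moves the logarithmic singularity off
  the range of \<open>x \<bullet> y\<close>.\<close>

definition log_kernel :: "real \<Rightarrow> real \<Rightarrow> real" where
  "log_kernel e z = - ln (1 + e - z) / area"

definition delta_kernel :: "real \<Rightarrow> real \<Rightarrow> real" where
  "delta_kernel e z = (2 * e + e\<^sup>2) / (area * (1 + e - z)\<^sup>2)"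

lemma Ck_on_log_kernel: "Ck_on k {..<1 + e} (log_kernel e)"
proof -
  have "Ck_on k {..<1 + e} (\<lambda>z. (- 1 / area) * ln (1 + e - z))"
    by (intro Ck_on_cmult Ck_on_compose_real[OF _ _ _ Ck_on_ln] Ck_on_diff Ck_on_const Ck_on_bounded_linear)
      auto
  then show ?thesis by (simp add: log_kernel_def[abs_def])
qed

lemma ridge_log_kernel:
  assumes "e > 0" "norm a = 1"
  shows "ridge {..<1 + e} (log_kernel e) (\<lambda>z. 1 / (area * (1 + e - z))) (\<lambda>z. 1 / (area * (1 + e - z)\<^sup>2)) a"
proof
  show "{- 1..1} \<subseteq> {..<1 + e}" using assms by auto
  show "Ck_on k {..<1 + e} (log_kernel e)" for k by (rule Ck_on_log_kernel)
  fix z assume "z \<in> {..<1 + e}"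
  then have z: "1 + e - z > 0" by simp
  show "(log_kernel e has_real_derivative 1 / (area * (1 + e - z))) (at z)"
    unfolding log_kernel_def[abs_def] using z area_pos
    by (auto intro!: derivative_eq_intros simp: mult.commute)
  show "((\<lambda>z. 1 / (area * (1 + e - z))) has_real_derivative 1 / (area * (1 + e - z)\<^sup>2)) (at z)"
    using z area_pos
    by (auto intro!: derivative_eq_intros simp: power2_eq_square) 
qed (use assms in auto)

lemma has_real_derivative_inverse_power:
  assumes "b \<noteq> z" "k \<noteq> (0::real)"
  shows "((\<lambda>z. c / (k * (b - z) ^ n)) has_real_derivative c * real n / (k * (b - z) ^ Suc n)) (at z)"
proof (cases n)
  case (Suc m)
  define u where "u = b - z"
  have u: "u \<noteq> 0" using assms by (simp add: u_def)
  have "((\<lambda>z. c / (k * (b - z) ^ n)) has_real_derivative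
      - (c * (k * (real n * u ^ m * - 1))) / ((k * u ^ n) * (k * u ^ n))) (at z)"
  proof -
    have "((\<lambda>z. (b - z) ^ n) has_real_derivative real n * (-1 * u ^ m)) (at z)"
    proof -
      have "((\<lambda>z. b - z) has_real_derivative -1) (at z)" by (auto intro!: derivative_eq_intros)
      from DERIV_power_Suc[OF this, of m] show ?thesis by (simp add: u_def Suc)
    qed
    from DERIV_cmult[OF this, of k]
    have "((\<lambda>z. k * (b - z) ^ n) has_real_derivative k * (real n * u ^ m * - 1)) (at z)"
      by simp
    from DERIV_divide[OF DERIV_const this, of c] show ?thesis
      using u assms by (simp add: u_def)
  qed
  moreover have "- (c * (k * (real n * u ^ m * - 1))) / ((k * u ^ n) * (k * u ^ n)) = c * real n / (k * u ^ Suc n)"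
    using u assms by (simp add: Suc divide_simps) 
  ultimately show ?thesis by (simp add: u_def)
qed (auto intro!: derivative_eq_intros)

lemma ridge_delta_kernel:
  assumes "e > 0" "norm a = 1"
  shows "ridge {..<1 + e} (delta_kernel e) (\<lambda>z. 2 * (2 * e + e\<^sup>2) / (area * (1 + e - z) ^ 3))
    (\<lambda>z. 6 * (2 * e + e\<^sup>2) / (area * (1 + e - z) ^ 4)) a"
proof
  show "{- 1..1} \<subseteq> {..<1 + e}" using assms by auto
  show "Ck_on k {..<1 + e} (delta_kernel e)" for k
  proof -
    have "Ck_on k {..<1 + e} (\<lambda>z. ((2 * e + e\<^sup>2) / area) * inverse ((1 + e - z)\<^sup>2))"
      by (intro Ck_on_cmult Ck_on_inverse Ck_on_power Ck_on_diff Ck_on_const Ck_on_bounded_linear bounded_linear_ident open_lessThan)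
        auto
    then show ?thesis by (simp add: delta_kernel_def[abs_def] divide_inverse mult.assoc)
  qed
  fix z assume "z \<in> {..<1 + e}"
  then have z: "1 + e - z \<noteq> 0" "area \<noteq> 0" using area_pos by auto
  show "(delta_kernel e has_real_derivative 2 * (2 * e + e\<^sup>2) / (area * (1 + e - z) ^ 3)) (at z)"
    unfolding delta_kernel_def[abs_def]
    using has_real_derivative_inverse_power[of "1 + e" z area "2 * e + e\<^sup>2" 2] z by (simp add: mult.commute eval_nat_numeral)
  show "((\<lambda>z. 2 * (2 * e + e\<^sup>2) / (area * (1 + e - z) ^ 3)) has_real_derivative 6 * (2 * e + e\<^sup>2) / (area * (1 + e - z) ^ 4)) (at z)"
    using has_real_derivative_inverse_power[of "1 + e" z area "2 * (2 * e + e\<^sup>2)" 3] z by (simp add: mult.commute eval_nat_numeral)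
qed (use assms in auto)

text \<open>With D = 1 + e - z, minus the Legendre operator has the numerator 2 z D - (1 - z^2) = (2
  e + e^2) - D^2 over area D^2. Completing this square is where \<open>2 * e + e\<^sup>2\<close> in
  \<open>delta_kernel\<close> comes from.\<close>

lemma log_kernel_laplace:
  assumes "e > 0" "norm a = 1" "x \<in> S2"
  shows "- laplace_beltrami (\<lambda>x. log_kernel e (a \<bullet> x)) x = delta_kernel e (a \<bullet> x) - 1 / area"
proof -
  have z: "1 + e - a \<bullet> x > 0" using inner_S2_in[OF assms(2,3)] assms(1) by auto
  show ?thesis
    unfolding ridge.laplace[OF ridge_log_kernel[OF assms(1,2)] assms(3)] delta_kernel_def
    using z area_pos by (simp add: divide_simps) (simp add: power2_eq_square algebra_simps)
qed

lemma smooth_log_kernel: "e > 0 \<Longrightarrow> norm a = 1 \<Longrightarrow> smooth_on S2 (\<lambda>x. log_kernel e (a \<bullet> x))"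
  by (rule ridge.smooth[OF ridge_log_kernel])

lemma delta_kernel_nonneg: "e > 0 \<Longrightarrow> delta_kernel e z \<ge> 0"
  using area_pos by (simp add: delta_kernel_def)

lemma continuous_on_delta_kernel:
  assumes "e > 0" "norm a = 1" shows "continuous_on S2 (\<lambda>y. delta_kernel e (a \<bullet> y))"
proof -
  have "1 + e - a \<bullet> y \<noteq> 0" if "y \<in> S2" for y using inner_S2_in[OF assms(2) that] assms(1) by auto
  then show ?thesis unfolding delta_kernel_def using area_pos by (intro continuous_intros) auto
qed

text \<open>A Laplacian integrates to 0, so by \<open>log_kernel_laplace\<close> the total mass is
  the integral of 1 / area.\<close>

lemma delta_kernel_integral:
  assumes "e > 0" "norm a = 1"
  shows "(LINT x|sphere_measure. delta_kernel e (a \<bullet> x)) = 1"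
proof -
  have "0 = (LINT x|sphere_measure. laplace_beltrami (\<lambda>x. log_kernel e (a \<bullet> x)) x)"
    using sphere_integral_laplace_beltrami[OF smooth_log_kernel[OF assms]] by simp
  also have "\<dots> = (LINT x|sphere_measure. 1 / area - delta_kernel e (a \<bullet> x))"
  proof (rule sphere_integral_cong)
    fix x assume "x \<in> S2"
    from log_kernel_laplace[OF assms this]
    show "laplace_beltrami (\<lambda>x. log_kernel e (a \<bullet> x)) x = 1 / area - delta_kernel e (a \<bullet> x)" by linarith
  qed
  also have "\<dots> = 1 - (LINT x|sphere_measure. delta_kernel e (a \<bullet> x))"
    using area_pos by (simp add: integrable_sphere_measure continuous_on_delta_kernel assms area_def[symmetric])
  finally show ?thesis by simp
qed

lemma norm_diff_S2: "norm x = 1 \<Longrightarrow> norm y = 1 \<Longrightarrow> (dist x y)\<^sup>2 = 2 * (1 - x \<bullet> y)" for x y :: "'a::real_inner"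
  unfolding dist_norm power2_norm_eq_inner inner_diff_left inner_diff_right inner_commute[of y x]
  by (simp add: dot_square_norm)

lemma sphere_integral_mono:
  fixes f g :: "real^3 \<Rightarrow> real"
  assumes "continuous_on S2 f" "continuous_on S2 g" "\<And>x. x \<in> S2 \<Longrightarrow> f x \<le> g x"
  shows "(LINT x|sphere_measure. f x) \<le> (LINT x|sphere_measure. g x)"
  by (rule integral_mono) (use assms in \<open>auto intro: integrable_sphere_measure\<close>)

definition eps :: "nat \<Rightarrow> real" where "eps n = 1 / (real n + 1)"

lemma eps_pos: "eps n > 0" by (simp add: eps_def)

lemma eps_le_1: "eps n \<le> 1" by (simp add: eps_def)

lemma eps_tendsto: "eps \<longlonglongrightarrow> 0"
  unfolding eps_def[abs_def] using LIMSEQ_inverse_real_of_nat by (simp add: inverse_eq_divide add.commute)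

text \<open>An approximate identity: near \<open>x\<close> continuity of \<open>W\<close> is used;
  at chordal distance at least \<open>r\<close> the denominator is bounded below, because the
  squared chord is twice 1 - x . y, and there the kernel is of order \<open>e\<close>.\<close>

lemma delta_kernel_tendsto:
  assumes W: "continuous_on S2 W" and x: "x \<in> S2"
  shows "(\<lambda>n. LINT y|sphere_measure. W y * delta_kernel (eps n) (x \<bullet> y)) \<longlonglongrightarrow> W x"
proof (rule LIMSEQ_I)
  fix \<eta> :: real assume \<eta>: "\<eta> > 0"
  have nx: "norm x = 1" using x by simp
  have "bounded (W ` S2)" using compact_imp_bounded[OF compact_continuous_image[OF W compact_sphere]] .
  then obtain M where M: "\<forall>y\<in>S2. norm (W y) \<le> M" unfolding bounded_iff by blast
  have M0: "M \<ge> 0" using order_trans[OF norm_ge_zero bspec[OF M x]] .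
  have "\<exists>r>0. \<forall>y\<in>S2. dist y x < r \<longrightarrow> dist (W y) (W x) < \<eta> / 2"
    by (rule bspec[OF W[unfolded continuous_on_iff] x, THEN spec, THEN mp]) (use \<eta> in simp)
  then obtain r where r0: "r > 0" and r1: "\<forall>y\<in>S2. dist y x < r \<longrightarrow> dist (W y) (W x) < \<eta> / 2" by blast
  have r: "r > 0" "\<bar>W y - W x\<bar> < \<eta> / 2" if "y \<in> S2" "dist y x < r" for y
    using r0 r1 that unfolding dist_real_def by blast+
  \<comment> \<open>Far from \<open>x\<close> the values of \<open>W\<close> differ by at most 2 M,
    and the denominator is at least area times
    \<open>(r\<^sup>2 / 2)\<^sup>2 = r ^ 4 / 4\<close>.\<close>
  define C where "C = 2 * M * 4 / r ^ 4"
  have C: "C \<ge> 0" using M0 by (simp add: C_def)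
  have pw: "\<bar>(W y - W x) * delta_kernel e (x \<bullet> y)\<bar> \<le> \<eta> / 2 * delta_kernel e (x \<bullet> y) + C * (2 * e + e\<^sup>2) / area"
    if e: "e > 0" and y: "y \<in> S2" for e y
  proof (cases "dist y x < r")
    case True
    have "\<bar>(W y - W x) * delta_kernel e (x \<bullet> y)\<bar> \<le> \<eta> / 2 * delta_kernel e (x \<bullet> y)"
      using mult_right_mono[OF less_imp_le[OF r(2)[OF y True]] delta_kernel_nonneg[OF e, of "x \<bullet> y"]]
        delta_kernel_nonneg[OF e, of "x \<bullet> y"] by (simp add: abs_mult)
    moreover have "C * (2 * e + e\<^sup>2) / area \<ge> 0" using C e area_pos by simp
    ultimately show ?thesis by linarith
  next
    case False
    then have "r\<^sup>2 \<le> (dist x y)\<^sup>2" using r0 by (intro power_mono) (auto simp: dist_commute)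
    then have "r\<^sup>2 / 2 \<le> 1 + e - x \<bullet> y" using norm_diff_S2[OF nx, of y] y e by simp
    then have le: "(r\<^sup>2 / 2)\<^sup>2 \<le> (1 + e - x \<bullet> y)\<^sup>2" by (intro power_mono) auto
    have "delta_kernel e (x \<bullet> y) \<le> (2 * e + e\<^sup>2) / (area * (r\<^sup>2 / 2)\<^sup>2)"
      unfolding delta_kernel_def
    proof (rule divide_left_mono)
      have q: "(r\<^sup>2 / 2)\<^sup>2 > 0" using r0 by simp
      show "area * (r\<^sup>2 / 2)\<^sup>2 \<le> area * (1 + e - x \<bullet> y)\<^sup>2" using le area_pos by simp
      show "0 < area * (1 + e - x \<bullet> y)\<^sup>2 * (area * (r\<^sup>2 / 2)\<^sup>2)"
        using q order.strict_trans2[OF q le] area_pos by (intro mult_pos_pos)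
    qed (use e in simp)
    moreover have "\<bar>W y - W x\<bar> \<le> 2 * M" using bspec[OF M x] bspec[OF M y] by (simp add: abs_le_iff)
    ultimately have "\<bar>W y - W x\<bar> * delta_kernel e (x \<bullet> y) \<le> (2 * M) * ((2 * e + e\<^sup>2) / (area * (r\<^sup>2 / 2)\<^sup>2))"
      using M0 delta_kernel_nonneg[OF e] by (intro mult_mono) auto
    also have "\<dots> = C * (2 * e + e\<^sup>2) / area" 
    proof -
      have q: "(r\<^sup>2 / 2)\<^sup>2 = r ^ 4 / 4" by (simp add: power_divide flip: power_mult)
      show ?thesis unfolding q C_def by (simp add: algebra_simps)
    qed
    finally have "\<bar>(W y - W x) * delta_kernel e (x \<bullet> y)\<bar> \<le> C * (2 * e + e\<^sup>2) / area"
      using delta_kernel_nonneg[OF e, of "x \<bullet> y"] by (simp add: abs_mult)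
    moreover have "0 \<le> \<eta> / 2 * delta_kernel e (x \<bullet> y)"
      using delta_kernel_nonneg[OF e, of "x \<bullet> y"] \<eta> by simp
    ultimately show ?thesis by linarith
  qed
  have bd: "\<bar>(LINT y|sphere_measure. W y * delta_kernel e (x \<bullet> y)) - W x\<bar> \<le> \<eta> / 2 + C * (2 * e + e\<^sup>2)" if e: "e > 0" for e
  proof -
    note cd = continuous_on_delta_kernel[OF e nx]
    have "(LINT y|sphere_measure. W y * delta_kernel e (x \<bullet> y)) - W x = (LINT y|sphere_measure. (W y - W x) * delta_kernel e (x \<bullet> y))"
      using delta_kernel_integral[OF e nx] by (simp add: left_diff_distrib integrable_sphere_measure continuous_on_mult W cd)
    also have "\<bar>\<dots>\<bar> \<le> (LINT y|sphere_measure. \<bar>(W y - W x) * delta_kernel e (x \<bullet> y)\<bar>)"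
      using integral_norm_bound[of sphere_measure "\<lambda>y. (W y - W x) * delta_kernel e (x \<bullet> y)"] by simp
    also have "\<dots> \<le> (LINT y|sphere_measure. \<eta> / 2 * delta_kernel e (x \<bullet> y) + C * (2 * e + e\<^sup>2) / area)"
    proof (rule sphere_integral_mono)
      show "continuous_on S2 (\<lambda>y. \<bar>(W y - W x) * delta_kernel e (x \<bullet> y)\<bar>)"
        by (intro continuous_intros W cd)
      show "continuous_on S2 (\<lambda>y. \<eta> / 2 * delta_kernel e (x \<bullet> y) + C * (2 * e + e\<^sup>2) / area)"
        using area_pos by (intro continuous_intros cd) simp
    qed (rule pw[OF e])
    also have "\<dots> = \<eta> / 2 + C * (2 * e + e\<^sup>2)"
      using delta_kernel_integral[OF e nx] area_pos by (simp add: integrable_sphere_measure cd area_def[symmetric])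
    finally show ?thesis .
  qed
  have "(\<lambda>n. C * (2 * eps n + (eps n)\<^sup>2)) \<longlonglongrightarrow> C * (2 * 0 + 0\<^sup>2)"
    by (intro tendsto_intros eps_tendsto)
  from LIMSEQ_D[OF this, of "\<eta> / 2"] \<eta>
  obtain N where N: "\<forall>n\<ge>N. \<bar>C * (2 * eps n + (eps n)\<^sup>2)\<bar> < \<eta> / 2" by auto
  show "\<exists>N. \<forall>n\<ge>N. norm ((LINT y|sphere_measure. W y * delta_kernel (eps n) (x \<bullet> y)) - W x) < \<eta>"
  proof (intro exI[of _ N] allI impI)
    fix n assume "n \<ge> N"
    then have "\<bar>C * (2 * eps n + (eps n)\<^sup>2)\<bar> < \<eta> / 2" using N by blast
    then show "norm ((LINT y|sphere_measure. W y * delta_kernel (eps n) (x \<bullet> y)) - W x) < \<eta>"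
      using bd[OF eps_pos[of n]] by simp
  qed
qed

lemma zero_if_delta_kernel_integrals_zero:
  assumes "continuous_on S2 W" "x \<in> S2" "\<And>n. (LINT y|sphere_measure. W y * delta_kernel (eps n) (x \<bullet> y)) = 0"
  shows "W x = 0"
  using delta_kernel_tendsto[OF assms(1,2)] assms(3) by (simp add: LIMSEQ_const_iff)

text \<open>Integrating by parts moves all derivatives onto \<open>f\<close>; the resulting weight is orthogonal to all ridge
  functions and therefore vanishes. This replaces the symmetry of second derivatives.\<close>

lemma poisson_bracket_integral:
  assumes f: "smooth_on S2 f" and g: "smooth_on S2 g"
  shows "(LINT x|sphere_measure. poisson_bracket f g x) = 0"
proof -
  define w where "w = (\<lambda>b x. sphere_deriv f x (cross3 b x))"
  define W where "W = (\<lambda>x. \<Sum>b\<in>Basis. sphere_deriv (w b) x b)"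
  have w: "smooth_on S2 (w b)" for b unfolding w_def by (intro smooth_on_S2_sphere_deriv smooth_on_S2_cross f)
  have W: "smooth_on S2 W" unfolding W_def by (intro smooth_on_S2_sum smooth_on_S2_sphere_deriv_Basis w)
  have parts: "(LINT x|sphere_measure. poisson_bracket f g x) = - (LINT x|sphere_measure. g x * W x)" if g: "smooth_on S2 g" for g
  proof -
    note sm = smooth_on_S2_sum smooth_on_S2_mult smooth_on_S2_sphere_deriv_Basis smooth_on_S2_inner w g W
    have "(LINT x|sphere_measure. poisson_bracket f g x) + (LINT x|sphere_measure. g x * W x) =
        (LINT x|sphere_measure. poisson_bracket f g x + g x * W x)"
      by (intro Bochner_Integration.integral_add[symmetric] sphere_integrable_smooth sm smooth_on_S2_poisson_bracket f)
    also have "\<dots> = (LINT x|sphere_measure. (\<Sum>b\<in>Basis. sphere_deriv (\<lambda>x. w b x * g x) x b))"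
    proof (rule sphere_integral_cong)
      fix x assume x: "x \<in> S2"
      have "poisson_bracket f g x = (\<Sum>b\<in>Basis. w b x * sphere_deriv g x b)"
        unfolding poisson_bracket_expand[OF f g x] w_def ..
      then show "poisson_bracket f g x + g x * W x = (\<Sum>b\<in>Basis. sphere_deriv (\<lambda>x. w b x * g x) x b)"
        unfolding sphere_deriv_mult[OF w g x] by (simp add: W_def sum.distrib sum_distrib_left mult.commute)
    qed
    also have "\<dots> = (\<Sum>b\<in>Basis. LINT x|sphere_measure. sphere_deriv (\<lambda>x. w b x * g x) x b)"
      by (intro Bochner_Integration.integral_sum sphere_integrable_smooth sm)
    also have "\<dots> = (\<Sum>b\<in>Basis. 2 * (LINT x|sphere_measure. (b \<bullet> x) * (w b x * g x)))"
      by (intro sum.cong refl sphere_integral_sphere_deriv sm)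
    also have "\<dots> = 2 * (LINT x|sphere_measure. (\<Sum>b\<in>Basis. (b \<bullet> x) * (w b x * g x)))"
      unfolding sum_distrib_left[symmetric]
      by (intro arg_cong[where f = "(*) 2"] Bochner_Integration.integral_sum[symmetric] sphere_integrable_smooth sm)
    also have "(LINT x|sphere_measure. (\<Sum>b\<in>Basis. (b \<bullet> x) * (w b x * g x))) = (LINT x|sphere_measure. 0)"
    proof (rule sphere_integral_cong)
      fix x assume x: "x \<in> S2"
      interpret linear "sphere_deriv f x" by (rule linear_sphere_deriv[OF f S2_nonzero[OF x]])
      have "(\<Sum>b\<in>Basis. (b \<bullet> x) * w b x) = sphere_deriv f x (\<Sum>b\<in>Basis. (b \<bullet> x) *\<^sub>R cross3 b x)"
        by (simp add: w_def sum scaleR)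
      also have "(\<Sum>b\<in>Basis. (b \<bullet> x) *\<^sub>R cross3 b x) = cross3 (\<Sum>b\<in>Basis. (x \<bullet> b) *\<^sub>R b) x"
        by (simp add: linear_sum[OF linearI[of "\<lambda>v. cross3 v x"]] cross_add_left cross_mult_left inner_commute)
      also have "\<dots> = 0" by (simp add: euclidean_representation)
      finally have "(\<Sum>b\<in>Basis. (b \<bullet> x) * w b x) * g x = 0" by (simp add: zero)
      then show "(\<Sum>b\<in>Basis. (b \<bullet> x) * (w b x * g x)) = 0" by (simp add: sum_distrib_right mult.assoc)
    qed
    finally show ?thesis by simp
  qed
  have W0: "W x = 0" if x: "x \<in> S2" for x
  proof -
    have nx: "norm x = 1" using x by simp
    show ?thesis
    proof (rule zero_if_delta_kernel_integrals_zero[OF smooth_on_S2_continuous[OF W] x])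
      fix n
      note R = ridge_delta_kernel[OF eps_pos nx, of n]
      show "(LINT y|sphere_measure. W y * delta_kernel (eps n) (x \<bullet> y)) = 0"
        using parts[OF ridge.smooth[OF R]] ridge.poisson_bracket_integral[OF R f] by (simp add: mult.commute)
    qed
  qed
  have "(LINT x|sphere_measure. g x * W x) = (LINT x|sphere_measure. 0)"
    by (rule sphere_integral_cong) (simp add: W0)
  then show ?thesis using parts[OF g] by simp
qed


section \<open>The Green operator\<close>

lemma log_kernel_measurable [measurable]: "log_kernel e \<in> borel_measurable borel"
  unfolding log_kernel_def by measurable

lemma inner_measurable_sphere: "(\<lambda>y. x \<bullet> y) \<in> borel_measurable sphere_measure" for x :: "real^3"
  by (intro borel_measurable_sphere_measure continuous_intros)

lemma log_kernel_inner_measurable: "(\<lambda>y. log_kernel e (x \<bullet> y)) \<in> borel_measurable sphere_measure"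
  using measurable_compose[OF inner_measurable_sphere log_kernel_measurable] .

lemma ridge_sqrt:
  assumes "e > 0" "norm a = 1"
  shows "ridge {..<1 + e} (\<lambda>z. (1 + e - z) powr (1/2)) (\<lambda>z. - (1/2) * (1 + e - z) powr (-1/2))
    (\<lambda>z. - (1/4) * (1 + e - z) powr (-3/2)) a"
proof
  show "{- 1..1} \<subseteq> {..<1 + e}" using assms by auto
  show "Ck_on k {..<1 + e} (\<lambda>z. (1 + e - z) powr (1/2))" for k
    by (intro Ck_on_compose_real[OF _ _ _ Ck_on_powr] Ck_on_diff Ck_on_const Ck_on_bounded_linear bounded_linear_ident)
      auto
  fix z assume "z \<in> {..<1 + e}"
  then have z: "1 + e - z > 0" by simp
  have d: "((\<lambda>z. 1 + e - z) has_real_derivative -1) (at z)" by (auto intro!: derivative_eq_intros)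
  show "((\<lambda>z. (1 + e - z) powr (1/2)) has_real_derivative - (1/2) * (1 + e - z) powr (-1/2)) (at z)"
    using DERIV_fun_powr[OF d z, of "1/2"] by simp
  show "((\<lambda>z. - (1/2) * (1 + e - z) powr (-1/2)) has_real_derivative - (1/4) * (1 + e - z) powr (-3/2)) (at z)"
    using DERIV_cmult[OF DERIV_fun_powr[OF d z, of "-1/2"], of "- (1/2)"] by simp
qed (use assms in auto)

text \<open>A barrier argument: the Laplacian of the square root of 1 + e - a . x is at least half
  the integrand minus 2, and it integrates to 0. The point is that the bound is independent of
  \<open>e\<close>.\<close>

lemma sphere_integral_inverse_sqrt_le:
  assumes e: "0 < e" "e \<le> 1" and a: "norm a = 1"
  shows "(LINT x|sphere_measure. (1 + e - a \<bullet> x) powr (-1/2)) \<le> 4 * area"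
proof -
  interpret ridge "{..<1 + e}" "\<lambda>z. (1 + e - z) powr (1/2)" "\<lambda>z. - (1/2) * (1 + e - z) powr (-1/2)"
    "\<lambda>z. - (1/4) * (1 + e - z) powr (-3/2)" a by (rule ridge_sqrt[OF e(1) a])
  have lap: "(1 + e - a \<bullet> x) powr (-1/2) / 2 - 2 \<le> laplace_beltrami (\<lambda>x. (1 + e - a \<bullet> x) powr (1/2)) x" if x: "x \<in> S2" for x
  proof -
    define z where "z = a \<bullet> x"
    define D where "D = 1 + e - z"
    have z: "-1 \<le> z" "z \<le> 1" using inner_S2_in[OF a x] by (auto simp: z_def)
    have D: "D > 0" "1 - z \<le> D" using z e by (auto simp: D_def)
    define s where "s = D powr (-1/2)"
    have s: "s > 0" using D by (simp add: s_def)
    have Ds: "D * D powr (-3/2) = s" using powr_add[of D 1 "-3/2"] D by (simp add: s_def)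
    have D3: "D powr (-3/2) \<ge> 0" by simp
    have "(1 - z) * D powr (-3/2) \<le> s" using mult_right_mono[OF D(2) D3] Ds by simp
    then have "(1 + z) * ((1 - z) * D powr (-3/2)) \<le> 2 * s" using z s D3 by (intro mult_mono) auto
    then have 1: "(1 - z\<^sup>2) * D powr (-3/2) \<le> 2 * s" by (simp add: power2_eq_square algebra_simps)
    have "s * s = D powr (-1)" unfolding s_def powr_add[symmetric] by simp
    then have "s * s = 1 / D" using powr_neg_one[OF D(1)] by simp
    then have "(D * s)\<^sup>2 = D" using D by (simp add: power2_eq_square field_simps)
    moreover have "D \<le> 2\<^sup>2" using z e by (simp add: D_def)
    ultimately have "(D * s)\<^sup>2 \<le> 2\<^sup>2" by (simp only:)
    then have "D * s \<le> 2" by (rule power2_le_imp_le) simp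
    then have 2: "(1 - z) * s \<le> 2" using mult_right_mono[OF D(2), of s] s by linarith
    have "laplace_beltrami (\<lambda>x. (1 + e - a \<bullet> x) powr (1/2)) x = - (1/4) * ((1 - z\<^sup>2) * D powr (-3/2)) + z * s"
      unfolding laplace[OF x] by (simp add: z_def D_def s_def)
    moreover have "z * s = s - (1 - z) * s" by (simp add: algebra_simps)
    ultimately show ?thesis using 1 2 by (simp add: s_def D_def z_def)
  qed
  have c: "continuous_on S2 (\<lambda>x. (1 + e - a \<bullet> x) powr (-1/2))"
    using inner_S2_in[OF a] e by (intro continuous_intros) force
  have "(LINT x|sphere_measure. (1 + e - a \<bullet> x) powr (-1/2) / 2 - 2) \<le> (LINT x|sphere_measure. laplace_beltrami (\<lambda>x. (1 + e - a \<bullet> x) powr (1/2)) x)"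
    by (rule sphere_integral_mono[OF _ smooth_on_S2_continuous[OF smooth_on_S2_laplace_beltrami[OF smooth]] lap])
      (intro continuous_intros c, simp)
  moreover have "(LINT x|sphere_measure. (1 + e - a \<bullet> x) powr (-1/2) / 2 - 2) = (LINT x|sphere_measure. (1 + e - a \<bullet> x) powr (-1/2) / 2) - (LINT x|sphere_measure. 2)"
    by (intro Bochner_Integration.integral_diff integrable_sphere_measure continuous_on_divide c continuous_on_const) simp
  ultimately show ?thesis
    using sphere_integral_laplace_beltrami[OF smooth] by (simp add: area_def[symmetric])
qed

text \<open>At the point \<open>a\<close> the integrand of the preceding bound equals e^(-1/2), so
  the point has mass at most 4 area e^(1/2).\<close>

lemma sphere_singleton_null:
  assumes a: "norm a = 1" shows "emeasure sphere_measure {a} = 0"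
proof -
  have aS: "{a} \<in> sets sphere_measure" using a by (simp add: sets_restrict_space_iff)
  have m: "measure sphere_measure {a} \<le> 4 * area * e powr (1/2)" if e: "0 < e" "e \<le> 1" for e
  proof -
    have c: "continuous_on S2 (\<lambda>x. (1 + e - a \<bullet> x) powr (-1/2))"
      using inner_S2_in[OF a] e by (intro continuous_intros) force
    have "(LINT x|sphere_measure. indicator {a} x * e powr (-1/2)) \<le> (LINT x|sphere_measure. (1 + e - a \<bullet> x) powr (-1/2))"
    proof (rule integral_mono)
      show "integrable sphere_measure (\<lambda>x. indicator {a} x * e powr (- 1 / 2))"
        using aS by (intro integrable_mult_left) (simp add: sphere.emeasure_finite less_top[symmetric])
      show "indicator {a} x * e powr (- 1 / 2) \<le> (1 + e - a \<bullet> x) powr (- 1 / 2)" if "x \<in> space sphere_measure" for x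
        using a by (auto simp: indicator_def dot_square_norm)
    qed (rule integrable_sphere_measure[OF c])
    also have "\<dots> \<le> 4 * area" by (rule sphere_integral_inverse_sqrt_le[OF e a])
    finally have "measure sphere_measure {a} * e powr (-1/2) \<le> 4 * area"
      using aS a by (simp add: Int_absorb2)
    then show ?thesis using e by (simp add: powr_minus divide_simps)
  qed
  have "measure sphere_measure {a} \<le> 0"
  proof (rule LIMSEQ_le_const)
    have "(\<lambda>n. 4 * area * (eps n) powr (1/2)) \<longlonglongrightarrow> 4 * area * 0 powr (1/2)"
      by (intro tendsto_intros eps_tendsto tendsto_powr'[where a = 0, simplified]) (auto simp: eps_pos less_imp_le)
    then show "(\<lambda>n. 4 * area * (eps n) powr (1/2)) \<longlonglongrightarrow> 0" by simp
    show "\<exists>N. \<forall>n\<ge>N. measure sphere_measure {a} \<le> 4 * area * (eps n) powr (1/2)"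
      using m[OF eps_pos eps_le_1] by blast
  qed
  then show ?thesis by (simp add: sphere.emeasure_eq_measure measure_le_0_iff)
qed

text \<open>Fatou's lemma carries the bound, uniform in the regularisation, over to the singular
  integrand.\<close>

lemma sphere_integrable_inverse_sqrt:
  assumes a: "norm a = 1"
  shows "integrable sphere_measure (\<lambda>x. (1 - a \<bullet> x) powr (-1/2))"
    and "(LINT x|sphere_measure. (1 - a \<bullet> x) powr (-1/2)) \<le> 4 * area"
proof -
  have cn: "continuous_on S2 (\<lambda>x. (1 + eps n - a \<bullet> x) powr (-1/2))" for n
    using inner_S2_in[OF a] eps_pos[of n] by (intro continuous_intros) force
  have m: "(\<lambda>x. (1 - a \<bullet> x) powr (-1/2)) \<in> borel_measurable sphere_measure"
    using inner_measurable_sphere[of a] by measurable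
  have le: "(\<integral>\<^sup>+ x. ennreal ((1 - a \<bullet> x) powr (-1/2)) \<partial>sphere_measure) \<le> ennreal (4 * area)"
  proof -
    have "(\<integral>\<^sup>+ x. ennreal ((1 - a \<bullet> x) powr (-1/2)) \<partial>sphere_measure) \<le> (\<integral>\<^sup>+ x. liminf (\<lambda>n. ennreal ((1 + eps n - a \<bullet> x) powr (-1/2))) \<partial>sphere_measure)"
    proof (rule nn_integral_mono)
      fix x assume "x \<in> space sphere_measure"
      show "ennreal ((1 - a \<bullet> x) powr (-1/2)) \<le> liminf (\<lambda>n. ennreal ((1 + eps n - a \<bullet> x) powr (-1/2)))"
      \<comment> \<open>At the pole the left side is 0, by the convention for \<open>powr\<close>
        with base 0.\<close>
      proof (cases "1 - a \<bullet> x = 0")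
        case False
        have "(\<lambda>n. (1 + eps n - a \<bullet> x) powr (-1/2)) \<longlonglongrightarrow> (1 + 0 - a \<bullet> x) powr (-1/2)"
          by (intro tendsto_intros eps_tendsto) (use False in simp)
        then have "(\<lambda>n. ennreal ((1 + eps n - a \<bullet> x) powr (-1/2))) \<longlonglongrightarrow> ennreal ((1 - a \<bullet> x) powr (-1/2))"
          by (intro tendsto_ennrealI) simp
        then show ?thesis using lim_imp_Liminf[OF sequentially_bot] by (metis order_refl)
      qed simp
    qed
    also have "\<dots> \<le> liminf (\<lambda>n. \<integral>\<^sup>+ x. ennreal ((1 + eps n - a \<bullet> x) powr (-1/2)) \<partial>sphere_measure)"
      by (rule nn_integral_liminf) (use borel_measurable_sphere_measure[OF cn] in measurable)
    also have "\<dots> \<le> ennreal (4 * area)"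
    proof -
      have "(\<integral>\<^sup>+ x. ennreal ((1 + eps n - a \<bullet> x) powr (-1/2)) \<partial>sphere_measure) \<le> ennreal (4 * area)" for n
        using sphere_integral_inverse_sqrt_le[OF eps_pos eps_le_1 a, of n]
        by (subst nn_integral_eq_integral[OF integrable_sphere_measure[OF cn]]) (auto intro: ennreal_leI)
      then show ?thesis by (intro Liminf_le) auto
    qed
    finally show ?thesis .
  qed
  show i: "integrable sphere_measure (\<lambda>x. (1 - a \<bullet> x) powr (-1/2))"
  proof (rule integrableI_bounded[OF m])
    show "(\<integral>\<^sup>+ x. ennreal (norm ((1 - a \<bullet> x) powr (-1/2))) \<partial>sphere_measure) < \<infinity>"
      using le by (simp add: order.strict_trans1)
  qed
  show "(LINT x|sphere_measure. (1 - a \<bullet> x) powr (-1/2)) \<le> 4 * area"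
    using le area_pos by (subst (asm) nn_integral_eq_integral[OF i]) (auto simp: ennreal_le_iff)
qed

text \<open>Every power of the logarithm is dominated by the inverse square root, so a single
  integral bound gives all L^q norms of the kernel. At \<open>w = 0\<close> both sides are 0 by the
  conventions for \<open>ln\<close> and \<open>powr\<close>.\<close>

lemma abs_ln_powr_le:
  fixes w q :: real
  assumes w: "0 \<le> w" "w \<le> 2" and q: "q \<ge> 1"
  shows "\<bar>ln w\<bar> powr q \<le> ((2 * q) powr q + 2) * w powr (-1/2)"
proof -
  consider "w = 0" | "0 < w" "w \<le> 1" | "1 < w" using w by linarith
  then show ?thesis
  proof cases
    case 2
    have "ln w \<le> 0" using 2 by simp
    then have l: "\<bar>ln w\<bar> = - ln w" by simp
    \<comment> \<open>The exponent 1 / (2 q) is chosen so that raising to the power q restores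
      w^(-1/2).\<close>
    have "ln (w powr (- 1 / (2 * q))) \<le> w powr (- 1 / (2 * q)) - 1"
      by (rule ln_le_minus_one) (use 2 in simp)
    then have "- ln w / (2 * q) \<le> w powr (- 1 / (2 * q))" using 2 by (simp add: ln_powr)
    then have "- ln w \<le> (2 * q) * w powr (- 1 / (2 * q))" 
    proof -
      have "- ln w = 2 * q * (- ln w / (2 * q))" using q by simp
      also have "\<dots> \<le> (2 * q) * w powr (- 1 / (2 * q))"
        using q \<open>- ln w / (2 * q) \<le> _\<close> by (intro mult_left_mono) auto
      finally show ?thesis .
    qed
    then have "\<bar>ln w\<bar> powr q \<le> ((2 * q) * w powr (- 1 / (2 * q))) powr q"
      using q \<open>ln w \<le> 0\<close> by (intro powr_mono2) (auto simp: l)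
    also have "\<dots> = (2 * q) powr q * w powr (-1/2)"
      using q by (simp add: powr_mult powr_powr)
    also have "\<dots> \<le> ((2 * q) powr q + 2) * w powr (-1/2)" by (intro mult_right_mono) auto
    finally show ?thesis .
  next
    case 3
    have "ln w \<le> w - 1" by (rule ln_le_minus_one) (use 3 in simp)
    then have "\<bar>ln w\<bar> \<le> 1" using 3 w ln_gt_zero[of w] by linarith
    then have "\<bar>ln w\<bar> powr q \<le> 1 powr q" using q by (intro powr_mono2) auto
    then have "\<bar>ln w\<bar> powr q \<le> 1" by simp
    moreover have "1 \<le> 2 * w powr (-1/2)"
    proof -
      have "(w powr (1/2))\<^sup>2 = w" using 3 by (simp add: powr_half_sqrt)
      then have "(w powr (1/2))\<^sup>2 \<le> 2\<^sup>2" using w by simp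
      then have "w powr (1/2) \<le> 2" by (rule power2_le_imp_le) simp
      then show ?thesis using 3 by (simp add: powr_minus divide_simps)
    qed
    moreover have "2 * w powr (-1/2) \<le> ((2 * q) powr q + 2) * w powr (-1/2)" by (intro mult_right_mono) auto
    ultimately show ?thesis by linarith
  qed simp
qed

lemma log_kernel_powr_integrable:
  assumes a: "norm a = 1" and q: "q \<ge> 1"
  shows "integrable sphere_measure (\<lambda>x. \<bar>log_kernel 0 (a \<bullet> x)\<bar> powr q)"
    and "(LINT x|sphere_measure. \<bar>log_kernel 0 (a \<bullet> x)\<bar> powr q) \<le> ((2 * q) powr q + 2) / area powr q * (4 * area)"
proof -
  define C where "C = ((2 * q) powr q + 2) / area powr q"
  have C: "C \<ge> 0" by (simp add: C_def)
  note I = sphere_integrable_inverse_sqrt[OF a]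
  have le: "\<bar>log_kernel 0 (a \<bullet> x)\<bar> powr q \<le> C * (1 - a \<bullet> x) powr (-1/2)" if "x \<in> S2" for x
  proof -
    have "a \<bullet> x \<in> {-1..1}" by (rule inner_S2_in[OF a that])
    then have "\<bar>ln (1 - a \<bullet> x)\<bar> powr q \<le> ((2 * q) powr q + 2) * (1 - a \<bullet> x) powr (-1/2)"
      by (intro abs_ln_powr_le q) auto
    then show ?thesis using area_pos
      by (simp add: log_kernel_def C_def powr_divide divide_right_mono)
  qed
  show i: "integrable sphere_measure (\<lambda>x. \<bar>log_kernel 0 (a \<bullet> x)\<bar> powr q)"
  proof (rule Bochner_Integration.integrable_bound[OF integrable_mult_right[OF I(1), of C]])
    show "(\<lambda>x. \<bar>log_kernel 0 (a \<bullet> x)\<bar> powr q) \<in> borel_measurable sphere_measure"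
      using log_kernel_inner_measurable[of 0 a] by measurable
    show "AE x in sphere_measure. norm (\<bar>log_kernel 0 (a \<bullet> x)\<bar> powr q) \<le> norm (C * (1 - a \<bullet> x) powr (- 1 / 2))"
      by (rule AE_I2) (use le in \<open>auto intro: order.trans[OF _ abs_ge_self]\<close>)
  qed
  have "(LINT x|sphere_measure. \<bar>log_kernel 0 (a \<bullet> x)\<bar> powr q) \<le> (LINT x|sphere_measure. C * (1 - a \<bullet> x) powr (-1/2))"
    by (rule integral_mono[OF i integrable_mult_right[OF I(1)]]) (use le in auto)
  also have "\<dots> \<le> C * (4 * area)" using I(2) C by (simp add: mult_left_mono)
  finally show "(LINT x|sphere_measure. \<bar>log_kernel 0 (a \<bullet> x)\<bar> powr q) \<le> ((2 * q) powr q + 2) / area powr q * (4 * area)"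
    by (simp add: C_def)
qed

lemma log_kernel_integrable:
  assumes "norm a = 1"
  shows "integrable sphere_measure (\<lambda>x. log_kernel 0 (a \<bullet> x))"
proof -
  have "integrable sphere_measure (\<lambda>x. \<bar>log_kernel 0 (a \<bullet> x)\<bar>)"
    using log_kernel_powr_integrable(1)[OF assms, of 1] by simp
  then show ?thesis using integrable_abs_cancel[OF _ log_kernel_inner_measurable] by blast
qed

text \<open>Dominated convergence: for 0 < w \<le> 2 and a shift of at most 1, the logarithm grows
  in absolute value by at most 2. The pole is excluded as a null set, since there
  \<open>log_kernel 0\<close> has the value coming from \<open>ln 0 = 0\<close> while the
  regularised kernels tend to infinity.\<close>

lemma log_kernel_tendsto:
  assumes a: "norm a = 1" and g: "continuous_on S2 g"
  shows "(\<lambda>n. LINT x|sphere_measure. log_kernel (eps n) (a \<bullet> x) * g x) \<longlonglongrightarrow> (LINT x|sphere_measure. log_kernel 0 (a \<bullet> x) * g x)"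
proof (rule integral_dominated_convergence[where w = "\<lambda>x. (\<bar>log_kernel 0 (a \<bullet> x)\<bar> + 2 / area) * \<bar>g x\<bar>"])
  have gm: "g \<in> borel_measurable sphere_measure" by (rule borel_measurable_sphere_measure[OF g])
  show "(\<lambda>x. log_kernel 0 (a \<bullet> x) * g x) \<in> borel_measurable sphere_measure"
    "(\<lambda>x. log_kernel (eps n) (a \<bullet> x) * g x) \<in> borel_measurable sphere_measure" for n
    by (intro borel_measurable_times log_kernel_inner_measurable gm)+
  show "integrable sphere_measure (\<lambda>x. (\<bar>log_kernel 0 (a \<bullet> x)\<bar> + 2 / area) * \<bar>g x\<bar>)"
    by (intro sphere_integrable_mult Bochner_Integration.integrable_add integrable_abs log_kernel_integrable[OF a])
      (auto intro!: continuous_intros g)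
  have ae: "AE x in sphere_measure. x \<noteq> a"
    using sphere_singleton_null[OF a] a by (intro AE_I[of _ _ "{a}"]) (auto simp: sets_restrict_space_iff)
  have lt: "a \<bullet> x < 1" if "x \<in> S2" "x \<noteq> a" for x
  proof -
    have pos: "(dist a x)\<^sup>2 > 0" using that by simp
    have e: "(dist a x)\<^sup>2 = 2 * (1 - a \<bullet> x)" using that by (intro norm_diff_S2 a) simp
    show ?thesis using pos[unfolded e] by simp
  qed
  show "AE x in sphere_measure. (\<lambda>n. log_kernel (eps n) (a \<bullet> x) * g x) \<longlonglongrightarrow> log_kernel 0 (a \<bullet> x) * g x"
    using ae
  proof (rule AE_mp, intro AE_I2 impI)
    fix x assume "x \<in> space sphere_measure" "x \<noteq> a"
    then have "a \<bullet> x < 1" using lt by simp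
    then have "(\<lambda>n. - ln (1 + eps n - a \<bullet> x) / area * g x) \<longlonglongrightarrow> - ln (1 + 0 - a \<bullet> x) / area * g x"
      using area_pos by (intro tendsto_intros eps_tendsto) auto
    then show "(\<lambda>n. log_kernel (eps n) (a \<bullet> x) * g x) \<longlonglongrightarrow> log_kernel 0 (a \<bullet> x) * g x"
      by (simp add: log_kernel_def)
  qed
  show "AE x in sphere_measure. norm (log_kernel (eps n) (a \<bullet> x) * g x) \<le> (\<bar>log_kernel 0 (a \<bullet> x)\<bar> + 2 / area) * \<bar>g x\<bar>" for n
    using ae
  proof (rule AE_mp, intro AE_I2 impI)
    fix x assume x: "x \<in> space sphere_measure" "x \<noteq> a"
    define w where "w = 1 - a \<bullet> x"
    have w: "0 < w" "w \<le> 2" using lt[of x] inner_S2_in[OF a, of x] x by (auto simp: w_def)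
    have "\<bar>ln (w + eps n)\<bar> \<le> \<bar>ln w\<bar> + 2"
    proof (cases "w + eps n \<ge> 1")
      case True
      then have "ln (w + eps n) \<le> w + eps n - 1" using w eps_pos[of n] by (intro ln_le_minus_one) simp
      moreover have "0 \<le> ln (w + eps n)" using True by simp
      ultimately show ?thesis using w eps_le_1[of n] by linarith
    next
      case False
      then have "ln w \<le> ln (w + eps n)" "ln (w + eps n) \<le> 0" using w eps_pos[of n] by auto
      then show ?thesis by linarith
    qed
    then have "\<bar>ln (w + eps n)\<bar> / area \<le> (\<bar>ln w\<bar> + 2) / area" using area_pos by (simp add: divide_right_mono)
    then have "\<bar>log_kernel (eps n) (a \<bullet> x)\<bar> \<le> \<bar>log_kernel 0 (a \<bullet> x)\<bar> + 2 / area"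
      using area_pos by (simp add: log_kernel_def w_def add_divide_distrib algebra_simps)
    then show "norm (log_kernel (eps n) (a \<bullet> x) * g x) \<le> (\<bar>log_kernel 0 (a \<bullet> x)\<bar> + 2 / area) * \<bar>g x\<bar>"
      by (simp add: abs_mult mult_right_mono)
  qed
qed

text \<open>On zero-mean functions this inverts minus the Laplacian; on constants it acts with an
  eigenvalue that depends on the additive normalisation of the kernel.\<close>

definition log_potential :: "(real^3 \<Rightarrow> real) \<Rightarrow> real^3 \<Rightarrow> real" where
  "log_potential f x = (LINT y|sphere_measure. log_kernel 0 (x \<bullet> y) * f y)"

text \<open>All derivatives stay on the smooth side: for the regularised kernel, self-adjointness
  turns the integral into one against \<open>delta_kernel\<close> minus the mean of
  \<open>f\<close>, and then the regularisation is removed.\<close>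

lemma log_potential_laplace:
  assumes f: "smooth_on S2 f" and x: "x \<in> S2"
  shows "log_potential (\<lambda>y. - laplace_beltrami f y) x = f x - (LINT y|sphere_measure. f y) / area"
proof (rule LIMSEQ_unique)
  have nx: "norm x = 1" using x by simp
  note sL = smooth_on_S2_laplace_beltrami[OF f]
  show "(\<lambda>n. LINT y|sphere_measure. log_kernel (eps n) (x \<bullet> y) * - laplace_beltrami f y) \<longlonglongrightarrow> log_potential (\<lambda>y. - laplace_beltrami f y) x"
    unfolding log_potential_def
    by (intro log_kernel_tendsto[OF nx] smooth_on_S2_continuous smooth_on_S2_uminus sL)
  have "(LINT y|sphere_measure. log_kernel (eps n) (x \<bullet> y) * - laplace_beltrami f y)
      = (LINT y|sphere_measure. f y * delta_kernel (eps n) (x \<bullet> y)) - (LINT y|sphere_measure. f y) / area" for n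
  proof -
    note sK = smooth_log_kernel[OF eps_pos nx, of n]
    have "(LINT y|sphere_measure. log_kernel (eps n) (x \<bullet> y) * - laplace_beltrami f y)
      = - (LINT y|sphere_measure. log_kernel (eps n) (x \<bullet> y) * laplace_beltrami f y)" by simp
    also have "\<dots> = - (LINT y|sphere_measure. f y * laplace_beltrami (\<lambda>y. log_kernel (eps n) (x \<bullet> y)) y)"
      using laplace_beltrami_self_adjoint[OF f sK] by simp
    also have "\<dots> = (LINT y|sphere_measure. f y * - laplace_beltrami (\<lambda>y. log_kernel (eps n) (x \<bullet> y)) y)" by simp
    also have "\<dots> = (LINT y|sphere_measure. f y * delta_kernel (eps n) (x \<bullet> y) - f y / area)"
      by (rule sphere_integral_cong) (simp only: log_kernel_laplace[OF eps_pos nx] right_diff_distrib, simp)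
    also have "\<dots> = (LINT y|sphere_measure. f y * delta_kernel (eps n) (x \<bullet> y)) - (LINT y|sphere_measure. f y) / area"
      using smooth_on_S2_continuous[OF f] continuous_on_delta_kernel[OF eps_pos nx] area_pos
      by (subst Bochner_Integration.integral_diff) (auto intro!: integrable_sphere_measure continuous_intros)
    finally show ?thesis .
  qed
  moreover have "(\<lambda>n. (LINT y|sphere_measure. f y * delta_kernel (eps n) (x \<bullet> y)) - (LINT y|sphere_measure. f y) / area) \<longlonglongrightarrow> f x - (LINT y|sphere_measure. f y) / area"
    by (intro tendsto_intros delta_kernel_tendsto smooth_on_S2_continuous f x)
  ultimately show "(\<lambda>n. LINT y|sphere_measure. log_kernel (eps n) (x \<bullet> y) * - laplace_beltrami f y) \<longlonglongrightarrow> f x - (LINT y|sphere_measure. f y) / area"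
    by simp
qed

section \<open>Regularity and symmetry of the logarithmic potential\<close>

lemma axis_rot_pi_symmetric: "axis_rot a pi x \<bullet> y = x \<bullet> axis_rot a pi y"
  by (simp add: axis_rot_pi inner_simps inner_commute[of x a])

lemma log_potential_axis_rot_pi:
  assumes a: "norm a = 1" and f: "continuous_on S2 f"
  shows "log_potential f (axis_rot a pi x) = (LINT y|sphere_measure. log_kernel 0 (x \<bullet> y) * f (axis_rot a pi y))"
proof -
  have m: "(\<lambda>y. log_kernel 0 (axis_rot a pi x \<bullet> y) * f y) \<in> borel_measurable sphere_measure"
    by (intro borel_measurable_times log_kernel_inner_measurable borel_measurable_sphere_measure f)
  show ?thesis
    unfolding log_potential_def sphere_integral_axis_rot[OF a m, of pi, symmetric]
    by (simp add: axis_rot_pi_symmetric axis_rot_pi_involution[OF a])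
qed

text \<open>Half turns act transitively on the sphere and the kernel is invariant under them. The
  value \<open>k\<close> is left open; it reflects the additive constant of the kernel.\<close>

lemma log_potential_const:
  obtains k where "\<And>x. x \<in> S2 \<Longrightarrow> log_potential (\<lambda>_. 1) x = k"
proof -
  have "log_potential (\<lambda>_. 1) x = log_potential (\<lambda>_. 1) (axis 1 1)" if x: "x \<in> S2" for x
  proof -
    obtain a where a: "norm a = 1" "axis_rot a pi (axis 1 1) = x"
      using exists_axis_rot_pi[of "axis 1 1" x] x by (auto simp: norm_axis_1)
    from log_potential_axis_rot_pi[OF a(1), of "\<lambda>_. 1" "axis 1 1"] show ?thesis
      unfolding a(2) by (simp add: log_potential_def)
  qed
  then show ?thesis using that by blast
qed

text \<open>The half turn about the line through \<open>v\<close>, written without normalising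
  \<open>v\<close>, so that it is visibly smooth in \<open>v\<close> away from 0.\<close>

definition half_turn :: "real^3 \<Rightarrow> real^3 \<Rightarrow> real^3" where
  "half_turn v y = (2 * (v \<bullet> y) / (v \<bullet> v)) *\<^sub>R v - y"

lemma half_turn_eq: "v \<noteq> 0 \<Longrightarrow> half_turn v = axis_rot (v /\<^sub>R norm v) pi"
  by (rule ext) (simp add: half_turn_def axis_rot_pi dot_square_norm power2_eq_square divide_simps)

lemma norm_half_turn: "v \<noteq> 0 \<Longrightarrow> norm (half_turn v y) = norm y"
  by (simp add: half_turn_eq norm_axis_rot)

lemma half_turn_swap:
  assumes "norm x = 1" "norm z = 1" "x + z \<noteq> 0"
  shows "half_turn (x + z) z = x"
proof -
  have e: "2 * ((x + z) \<bullet> z) = (x + z) \<bullet> (x + z)"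
    unfolding inner_add_left inner_add_right using assms by (simp add: dot_square_norm inner_commute)
  have "(x + z) \<bullet> (x + z) \<noteq> 0" using assms by simp
  then show ?thesis unfolding half_turn_def e by simp
qed

text \<open>The half turn about \<open>x + z\<close> exchanges \<open>x\<close> and
  \<open>z\<close>. Substituting it moves the pole of the kernel from the variable point
  \<open>x\<close> to the fixed point \<open>z\<close>, and the dependence on \<open>x\<close>
  passes to the regular factor \<open>f\<close>. Regularity of the potential becomes differentiation
  under the integral sign, as long as \<open>x\<close> is not antipodal to \<open>z\<close>.\<close>

lemma log_potential_half_turn:
  assumes f: "continuous_on S2 f" and x: "x \<in> S2" and z: "z \<in> S2" "x + z \<noteq> 0"
  shows "log_potential f x = (LINT y|sphere_measure. log_kernel 0 (z \<bullet> y) * f (half_turn (x + z) y))"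
proof -
  have "half_turn (x + z) z = x" using x z by (intro half_turn_swap) auto
  then have "log_potential f x = log_potential f (axis_rot ((x + z) /\<^sub>R norm (x + z)) pi z)"
    using half_turn_eq[OF z(2)] by simp
  also have "\<dots> = (LINT y|sphere_measure. log_kernel 0 (z \<bullet> y) * f (half_turn (x + z) y))"
    unfolding half_turn_eq[OF z(2)] by (rule log_potential_axis_rot_pi[OF _ f]) (use z in simp)
  finally show ?thesis .
qed

lemma continuous_on_half_turn:
  fixes g h :: "'a::topological_space \<Rightarrow> real^3"
  assumes "continuous_on U g" "continuous_on U h" "\<And>u. u \<in> U \<Longrightarrow> g u \<noteq> 0"
  shows "continuous_on U (\<lambda>u. half_turn (g u) (h u))"
  unfolding half_turn_def using assms by (intro continuous_intros) auto

lemma continuous_on_local: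
  fixes f :: "'a::t2_space \<Rightarrow> 'b::topological_space"
  assumes "\<And>z. z \<in> S \<Longrightarrow> \<exists>W. open W \<and> z \<in> W \<and> continuous_on (S \<inter> W) f"
  shows "continuous_on S f"
  unfolding continuous_on_eq_continuous_within
proof
  fix z assume z: "z \<in> S"
  then obtain W where W: "open W" "z \<in> W" "continuous_on (S \<inter> W) f" using assms by blast
  have "at z within (S \<inter> W) = at z within S"
    by (rule at_within_nhd[OF W(2,1)]) blast
  moreover have "continuous (at z within (S \<inter> W)) f"
    using W z by (simp add: continuous_on_eq_continuous_within)
  ultimately show "continuous (at z within S) f" by simp
qed

lemma S2_double_nonzero: "z \<in> S2 \<Longrightarrow> z + z \<noteq> 0" for z :: "real^3"
  unfolding scaleR_2[symmetric] by auto

text \<open>Joint continuity in position and time: near each position \<open>z\<close> the pole is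
  moved to \<open>z\<close>, and the weight no longer depends on the parameters.\<close>

lemma continuous_on_log_potential_param:
  fixes f :: "real \<Rightarrow> real^3 \<Rightarrow> real"
  assumes f: "continuous_on (S2 \<times> T) (\<lambda>(x, t). f t x)"
  shows "continuous_on (S2 \<times> T) (\<lambda>(x, t). log_potential (f t) x)"
proof (rule continuous_on_local)
  fix u assume u: "u \<in> S2 \<times> T"
  define z where "z = fst u"
  have z: "z \<in> S2" using u by (auto simp: z_def)
  define W where "W = {x. x + z \<noteq> 0} \<times> (UNIV::real set)"
  have "open {x. x + z \<noteq> 0}" by (intro open_Collect_neq continuous_intros)
  then have W: "open W" unfolding W_def by (intro open_Times) auto
  have "z + z \<noteq> 0" using z by (rule S2_double_nonzero)
  then have uW: "u \<in> W" by (cases u) (simp add: W_def z_def)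
  let ?U = "(S2 \<times> T) \<inter> W"
  have "continuous_on (?U \<times> S2) (\<lambda>v. (\<lambda>(x, t). f t x) (half_turn (fst (fst v) + z) (snd v), snd (fst v)))"
  proof (rule continuous_on_compose2[OF f])
    show "continuous_on (?U \<times> S2) (\<lambda>v. (half_turn (fst (fst v) + z) (snd v), snd (fst v)))"
      by (intro continuous_intros continuous_on_half_turn) (auto simp: W_def)
    show "(\<lambda>v. (half_turn (fst (fst v) + z) (snd v), snd (fst v))) ` (?U \<times> S2) \<subseteq> S2 \<times> T"
      by (auto simp: W_def norm_half_turn)
  qed
  then have c: "continuous_on (?U \<times> S2) (\<lambda>v. f (snd (fst v)) (half_turn (fst (fst v) + z) (snd v)))" by simp
  have "continuous_on ?U (\<lambda>v. LINT y|sphere_measure. log_kernel 0 (z \<bullet> y) * f (snd v) (half_turn (fst v + z) y))"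
    using continuous_on_sphere_integral[OF log_kernel_integrable c] z by simp
  then have "continuous_on ?U (\<lambda>(x, t). log_potential (f t) x)"
  proof (rule continuous_on_eq)
    fix v assume v: "v \<in> ?U"
    have "continuous_on S2 (\<lambda>x. (\<lambda>(x, t). f t x) (x, snd v))"
      by (rule continuous_on_compose2[OF f]) (use v in \<open>auto intro!: continuous_intros\<close>)
    then have "continuous_on S2 (f (snd v))" by simp
    from log_potential_half_turn[OF this, of "fst v" z] v z
    show "(LINT y|sphere_measure. log_kernel 0 (z \<bullet> y) * f (snd v) (half_turn (fst v + z) y)) = (\<lambda>(x, t). log_potential (f t) x) v"
      by (auto simp: W_def case_prod_beta')
  qed
  then show "\<exists>W. open W \<and> u \<in> W \<and> continuous_on ((S2 \<times> T) \<inter> W) (\<lambda>(x, t). log_potential (f t) x)"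
    using W uW by blast
qed

lemma continuous_on_log_potential:
  assumes "continuous_on S2 f" shows "continuous_on S2 (log_potential f)"
proof -
  have "continuous_on (S2 \<times> {0::real}) (\<lambda>(x, t). f x)"
    unfolding case_prod_beta' by (rule continuous_on_compose2[OF assms]) (auto intro!: continuous_intros)
  note H = continuous_on_log_potential_param[OF this]
  have "continuous_on S2 (\<lambda>x::real^3. (x, 0::real))" by (intro continuous_intros)
  from continuous_on_compose2[OF H this] show ?thesis by (simp add: image_subset_iff)
qed

text \<open>Near \<open>z\<close> the weight is the fixed integrable kernel with pole
  \<open>z\<close>, and the remaining factor is smooth in both variables.\<close>

lemma smooth_on_S2_log_potential:
  assumes f: "smooth_on S2 f"
  shows "smooth_on S2 (log_potential f)"
  unfolding smooth_on_def
proof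
  fix z :: "real^3" assume z: "z \<in> S2"
  define U where "U = {x. x + z \<noteq> 0}"
  \<comment> \<open>The normalisation keeps the integrand smooth for \<open>y\<close> in the whole
    punctured space, an open neighbourhood of the sphere as \<open>Ck_on_sphere_integral\<close>
    requires.\<close>
  define F where "F = (\<lambda>x. LINT y|sphere_measure. log_kernel 0 (z \<bullet> y) * (\<lambda>v. f (half_turn (fst v + z) (snd v) /\<^sub>R norm (half_turn (fst v + z) (snd v)))) (x, y))"
  have U: "open U" unfolding U_def by (intro open_Collect_neq continuous_intros)
  have zU: "z \<in> U" unfolding U_def using S2_double_nonzero[OF z] by simp
  have nz: "norm z = 1" using z by simp
  have UV: "open (U \<times> (- {0::real^3}))" using U by (intro open_Times) auto
  have bl: "Ck_on k (U \<times> (- {0::real^3})) (\<lambda>v. fst v \<bullet> b)" "Ck_on k (U \<times> (- {0::real^3})) (\<lambda>v. snd v \<bullet> b)" for k b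
    by (intro Ck_on_bounded_linear UV bounded_linear_inner_left_comp bounded_linear_fst bounded_linear_snd)+
  have "Ck_on k U F" for k
  proof -
    have oV: "open (- {0::real^3})" by auto
    have im: "(\<lambda>v. half_turn (fst v + z) (snd v)) ` (U \<times> (- {0})) \<subseteq> - {0}"
    proof (rule image_subsetI)
      fix v assume "v \<in> U \<times> (- {0::real^3})"
      then have "norm (half_turn (fst v + z) (snd v)) \<noteq> 0"
        by (subst norm_half_turn) (auto simp: U_def)
      then show "half_turn (fst v + z) (snd v) \<in> - {0}" by auto
    qed
    have comp: "Ck_on k (U \<times> (- {0})) (\<lambda>v. half_turn (fst v + z) (snd v) \<bullet> c)" for c :: "real^3"
    proof -
      have vv: "Ck_on k (U \<times> (- {0::real^3})) (\<lambda>v. (fst v + z) \<bullet> b)" for b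
        unfolding inner_add_left by (intro Ck_on_add bl UV Ck_on_const)
      have i1: "(fst v + z) \<bullet> snd v = (\<Sum>b\<in>Basis. ((fst v + z) \<bullet> b) * (snd v \<bullet> b))" for v :: "(real^3) \<times> (real^3)"
        by (rule euclidean_inner)
      have i2: "(fst v + z) \<bullet> (fst v + z) = (\<Sum>b\<in>Basis. ((fst v + z) \<bullet> b) * ((fst v + z) \<bullet> b))" for v :: "(real^3) \<times> (real^3)"
        by (rule euclidean_inner)
      have C1: "Ck_on k (U \<times> (- {0})) (\<lambda>v. (fst v + z) \<bullet> snd v)"
        unfolding i1 by (intro Ck_on_sum Ck_on_mult vv bl UV)
      have C2: "Ck_on k (U \<times> (- {0::real^3})) (\<lambda>v. (fst v + z) \<bullet> (fst v + z))"
        unfolding i2 by (intro Ck_on_sum Ck_on_mult vv UV)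
      have C3: "Ck_on k (U \<times> (- {0::real^3})) (\<lambda>v. inverse ((fst v + z) \<bullet> (fst v + z)))"
        by (rule Ck_on_inverse[OF UV C2]) (auto simp: U_def)
      have "Ck_on k (U \<times> (- {0})) (\<lambda>v. (2 * ((fst v + z) \<bullet> snd v) * inverse ((fst v + z) \<bullet> (fst v + z))) * ((fst v + z) \<bullet> c) - snd v \<bullet> c)"
        by (intro Ck_on_diff Ck_on_mult Ck_on_const UV C1 C3 vv bl)
      then show "Ck_on k (U \<times> (- {0})) (\<lambda>v. half_turn (fst v + z) (snd v) \<bullet> c)"
        by (simp add: half_turn_def inner_diff_left divide_inverse)
    qed
    from Ck_on_sphere_integral[OF log_kernel_integrable[OF nz] U oV _ Ck_on_compose[OF UV oV im smooth_on_S2D[OF f] comp]]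
    show ?thesis unfolding F_def by auto
  qed
  moreover have "F x = log_potential f x" if x: "x \<in> S2 \<inter> U" for x
  proof -
    have "log_potential f x = (LINT y|sphere_measure. log_kernel 0 (z \<bullet> y) * f (half_turn (x + z) y))"
      using x by (intro log_potential_half_turn smooth_on_S2_continuous f z) (auto simp: U_def)
    also have "\<dots> = F x" unfolding F_def
      by (rule sphere_integral_cong) (use x in \<open>simp add: U_def norm_half_turn\<close>)
    finally show ?thesis by simp
  qed
  ultimately show "\<exists>U F. open U \<and> z \<in> U \<and> (\<forall>k. Ck_on k U F) \<and> (\<forall>y\<in>S2 \<inter> U. F y = log_potential f y)"
    using U zU by blast
qed

interpretation sphere_pair: pair_sigma_finite sphere_measure sphere_measure
  by (intro pair_sigma_finite.intro sphere.sigma_finite_measure_axioms)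

text \<open>Fubini for a symmetric kernel. Integrability on the product comes from a bound on the
  L^1 norm of the kernel that is the same for every pole.\<close>

lemma log_potential_symmetric:
  assumes f: "continuous_on S2 f" and g: "continuous_on S2 g"
  shows "(LINT x|sphere_measure. log_potential f x * g x) = (LINT x|sphere_measure. f x * log_potential g x)"
proof -
  define M where "M = sphere_measure \<Otimes>\<^sub>M sphere_measure"
  have bd: "\<exists>B. \<forall>x\<in>S2. \<bar>f x\<bar> \<le> B" if f: "continuous_on S2 f" for f :: "real^3 \<Rightarrow> real"
    using compact_imp_bounded[OF compact_continuous_image[OF f compact_sphere]] by (auto simp: bounded_iff)
  obtain Bf Bg where B: "\<forall>x\<in>S2. \<bar>f x\<bar> \<le> Bf" "\<forall>x\<in>S2. \<bar>g x\<bar> \<le> Bg" using bd[OF f] bd[OF g] by blast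
  have idm: "(\<lambda>x. x) \<in> measurable sphere_measure borel"
    by (simp add: measurable_cong_sets[OF sets_sphere_measure refl] measurable_restrict_space1)
  have fm: "(\<lambda>z. f (fst z)) \<in> borel_measurable M" "(\<lambda>z. f (snd z)) \<in> borel_measurable M" if "continuous_on S2 f" for f :: "real^3 \<Rightarrow> real"
    unfolding M_def using measurable_compose[OF measurable_fst borel_measurable_sphere_measure[OF that]]
      measurable_compose[OF measurable_snd borel_measurable_sphere_measure[OF that]] by blast+
  have "(\<lambda>z. fst z \<bullet> snd z) \<in> borel_measurable M"
    unfolding M_def using measurable_compose[OF measurable_fst idm] measurable_compose[OF measurable_snd idm]
    by (intro borel_measurable_inner)
  then have Km: "(\<lambda>z. log_kernel 0 (fst z \<bullet> snd z)) \<in> borel_measurable M"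
    using log_kernel_measurable by (rule measurable_compose)
  have Ki: "integrable M (\<lambda>z. log_kernel 0 (fst z \<bullet> snd z))"
    unfolding M_def
  proof (rule sphere_pair.Fubini_integrable)
    show "(\<lambda>z. log_kernel 0 (fst z \<bullet> snd z)) \<in> borel_measurable (sphere_measure \<Otimes>\<^sub>M sphere_measure)"
      using Km by (simp add: M_def)
    define C :: real where "C = ((2 * 1) powr 1 + 2) / area powr 1 * (4 * area)"
    have Cb: "(LINT y|sphere_measure. \<bar>log_kernel 0 (x \<bullet> y)\<bar>) \<le> C" if "x \<in> S2" for x
      using log_kernel_powr_integrable(2)[of x 1] that by (simp add: C_def)
    show "integrable sphere_measure (\<lambda>x. LINT y|sphere_measure. norm (log_kernel 0 (fst (x, y) \<bullet> snd (x, y))))"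
    proof (rule sphere.integrable_const_bound[where B = C])
      show "AE x in sphere_measure. norm (LINT y|sphere_measure. norm (log_kernel 0 (fst (x, y) \<bullet> snd (x, y)))) \<le> C"
        by (rule AE_I2) (use Cb in simp)
      show "(\<lambda>x. LINT y|sphere_measure. norm (log_kernel 0 (fst (x, y) \<bullet> snd (x, y)))) \<in> borel_measurable sphere_measure"
        using Km unfolding M_def by measurable
    qed
    show "AE x in sphere_measure. integrable sphere_measure (\<lambda>y. log_kernel 0 (fst (x, y) \<bullet> snd (x, y)))"
      by (rule AE_I2) (simp add: log_kernel_integrable)
  qed
  have I: "integrable M (\<lambda>z. log_kernel 0 (fst z \<bullet> snd z) * (f (snd z) * g (fst z)))"
  proof (rule Bochner_Integration.integrable_bound[OF integrable_mult_left[OF integrable_abs[OF Ki], of "Bf * Bg"]])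
    show "(\<lambda>z. log_kernel 0 (fst z \<bullet> snd z) * (f (snd z) * g (fst z))) \<in> borel_measurable M"
      by (intro borel_measurable_times Km fm f g)
    show "AE z in M. norm (log_kernel 0 (fst z \<bullet> snd z) * (f (snd z) * g (fst z))) \<le> norm (\<bar>log_kernel 0 (fst z \<bullet> snd z)\<bar> * (Bf * Bg))"
    proof (rule AE_I2)
      fix z assume "z \<in> space M"
      then have z: "fst z \<in> S2" "snd z \<in> S2" by (auto simp: M_def space_pair_measure)
      have "\<bar>f (snd z)\<bar> * \<bar>g (fst z)\<bar> \<le> Bf * Bg"
        using B z order.trans[OF abs_ge_zero bspec[OF B(1) z(1)]] by (intro mult_mono) auto
      then have "\<bar>log_kernel 0 (fst z \<bullet> snd z)\<bar> * (\<bar>f (snd z)\<bar> * \<bar>g (fst z)\<bar>) \<le> \<bar>log_kernel 0 (fst z \<bullet> snd z)\<bar> * (Bf * Bg)"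
        by (rule mult_left_mono) simp
      also have "\<dots> \<le> norm (\<bar>log_kernel 0 (fst z \<bullet> snd z)\<bar> * (Bf * Bg))"
        unfolding real_norm_def by (rule abs_ge_self)
      finally show "norm (log_kernel 0 (fst z \<bullet> snd z) * (f (snd z) * g (fst z))) \<le> norm (\<bar>log_kernel 0 (fst z \<bullet> snd z)\<bar> * (Bf * Bg))"
        by (simp only: real_norm_def abs_mult)
    qed
  qed
  have "(LINT x|sphere_measure. log_potential f x * g x) = (LINT x|sphere_measure. (LINT y|sphere_measure. log_kernel 0 (x \<bullet> y) * (f y * g x)))"
    by (simp add: log_potential_def mult.assoc[symmetric])
  also have "\<dots> = (LINT y|sphere_measure. (LINT x|sphere_measure. log_kernel 0 (x \<bullet> y) * (f y * g x)))"
    using sphere_pair.Fubini_integral[of "\<lambda>x y. log_kernel 0 (x \<bullet> y) * (f y * g x)"] I unfolding M_def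
    by (simp add: case_prod_beta')
  also have "\<dots> = (LINT y|sphere_measure. f y * log_potential g y)"
  proof (rule sphere_integral_cong)
    fix y
    have "(LINT x|sphere_measure. log_kernel 0 (x \<bullet> y) * (f y * g x)) = (LINT x|sphere_measure. f y * (log_kernel 0 (y \<bullet> x) * g x))"
      by (simp add: inner_commute[of _ y] mult_ac)
    then show "(LINT x|sphere_measure. log_kernel 0 (x \<bullet> y) * (f y * g x)) = f y * log_potential g y"
      by (simp add: log_potential_def)
  qed
  finally show ?thesis .
qed

section \<open>Identification of the Green operator with the logarithmic potential\<close>

lemma log_potential_diff:
  assumes "continuous_on S2 f" "continuous_on S2 g" "x \<in> S2"
  shows "log_potential (\<lambda>y. f y - g y) x = log_potential f x - log_potential g x"
  using assms by (simp add: log_potential_def right_diff_distrib sphere_integrable_mult log_kernel_integrable)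

lemma Lp_norm_zero: "Lp_norm r (\<lambda>x. 0) = 0"
  by (simp add: Lp_norm_def)

lemma W2_norm_zero: "W2_norm r (\<lambda>x. 0) = 0"
proof -
  have d: "sphere_deriv (\<lambda>x. 0::real) x v = 0" for x v by (rule sphere_deriv_const)
  have g: "sphere_grad (\<lambda>x. 0) = (\<lambda>x. 0)" by (rule ext) (simp add: sphere_grad_def d)
  have h: "sphere_deriv (\<lambda>x. 0::real^3) x v = 0" for x v
    unfolding sphere_deriv_def by simp
  have "sphere_hess_norm (\<lambda>x. 0) = (\<lambda>x. 0)" by (rule ext) (simp add: sphere_hess_norm_def g h Let_def)
  then show ?thesis by (simp add: W2_norm_def g Lp_norm_zero)
qed

lemma continuous_on_abs_powr:
  fixes f :: "'a::topological_space \<Rightarrow> real"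
  assumes "continuous_on U f" "p > 0"
  shows "continuous_on U (\<lambda>x. \<bar>f x\<bar> powr p)"
  using assms by (intro continuous_on_powr' continuous_intros) simp_all

lemma Lp_continuous:
  assumes "continuous_on S2 f" "1 \<le> p" shows "f \<in> Lp p"
  unfolding Lp_def
  using borel_measurable_sphere_measure[OF assms(1)] integrable_sphere_measure[OF continuous_on_abs_powr[OF assms(1), of p]] assms(2)
  by simp

lemma zero_mean_log_potential:
  assumes f: "continuous_on S2 f" "zero_mean f"
  shows "(LINT x|sphere_measure. log_potential f x) = 0"
proof -
  obtain k where k: "\<And>x. x \<in> S2 \<Longrightarrow> log_potential (\<lambda>_. 1) x = k" using log_potential_const by blast
  have "(LINT x|sphere_measure. log_potential f x * 1) = (LINT x|sphere_measure. f x * log_potential (\<lambda>_. 1) x)"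
    by (rule log_potential_symmetric[OF f(1)]) simp
  also have "\<dots> = (LINT x|sphere_measure. f x * k)" by (rule sphere_integral_cong) (simp add: k)
  finally show ?thesis using f(2) by (simp add: zero_mean_def)
qed

text \<open>Regularised logarithmic kernels are admissible test functions; minus their Laplacian is
  \<open>delta_kernel\<close> minus a constant, and the zero mean removes the constant. Hence the
  difference of two solutions has vanishing \<open>delta_kernel\<close> integrals.\<close>

lemma weak_poisson_unique:
  assumes u: "continuous_on S2 u" "zero_mean u" and v: "continuous_on S2 v" "zero_mean v"
    and w: "weak_poisson f u" "weak_poisson f v" and x: "x \<in> S2"
  shows "u x = v x"
proof -
  define W where "W = (\<lambda>x. u x - v x)"
  have W: "continuous_on S2 W" unfolding W_def by (intro continuous_intros u v)
  have nx: "norm x = 1" using x by simp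
  have W0: "(LINT y|sphere_measure. W y) = 0"
    using u v by (simp add: W_def zero_mean_def integrable_sphere_measure)
  have "W x = 0"
  proof (rule zero_if_delta_kernel_integrals_zero[OF W x])
    fix n
    define \<phi> where "\<phi> = (\<lambda>y. log_kernel (eps n) (x \<bullet> y))"
    have \<phi>: "smooth_on S2 \<phi>" unfolding \<phi>_def by (rule smooth_log_kernel[OF eps_pos nx])
    have cL: "continuous_on S2 (\<lambda>y. - laplace_beltrami \<phi> y)"
      by (intro smooth_on_S2_continuous smooth_on_S2_uminus smooth_on_S2_laplace_beltrami \<phi>)
    have cd: "continuous_on S2 (\<lambda>y. delta_kernel (eps n) (x \<bullet> y))" by (rule continuous_on_delta_kernel[OF eps_pos nx])
    have "(LINT y|sphere_measure. u y * - laplace_beltrami \<phi> y) = (LINT y|sphere_measure. v y * - laplace_beltrami \<phi> y)"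
      using w \<phi> unfolding weak_poisson_def by metis
    then have "0 = (LINT y|sphere_measure. u y * - laplace_beltrami \<phi> y) - (LINT y|sphere_measure. v y * - laplace_beltrami \<phi> y)"
      by simp
    also have "\<dots> = (LINT y|sphere_measure. u y * - laplace_beltrami \<phi> y - v y * - laplace_beltrami \<phi> y)"
      by (intro Bochner_Integration.integral_diff[symmetric] integrable_sphere_measure continuous_on_mult u v cL)
    also have "\<dots> = (LINT y|sphere_measure. W y * delta_kernel (eps n) (x \<bullet> y) - W y / area)"
    proof (rule sphere_integral_cong)
      fix y assume "y \<in> S2"
      then have "- laplace_beltrami \<phi> y = delta_kernel (eps n) (x \<bullet> y) - 1 / area"
        unfolding \<phi>_def by (rule log_kernel_laplace[OF eps_pos nx])
      then show "u y * - laplace_beltrami \<phi> y - v y * - laplace_beltrami \<phi> y = W y * delta_kernel (eps n) (x \<bullet> y) - W y / area"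
      proof -
        have "u y * - laplace_beltrami \<phi> y - v y * - laplace_beltrami \<phi> y = W y * - laplace_beltrami \<phi> y"
          unfolding W_def by (simp only: left_diff_distrib)
        also have "\<dots> = W y * (delta_kernel (eps n) (x \<bullet> y) - 1 / area)"
          by (simp only: \<open>- laplace_beltrami \<phi> y = _\<close>)
        finally show ?thesis by (simp add: right_diff_distrib)
      qed
    qed
    also have "\<dots> = (LINT y|sphere_measure. W y * delta_kernel (eps n) (x \<bullet> y)) - (LINT y|sphere_measure. W y / area)"
      using area_pos by (intro Bochner_Integration.integral_diff integrable_sphere_measure continuous_intros W cd) simp
    finally show "(LINT y|sphere_measure. W y * delta_kernel (eps n) (x \<bullet> y)) = 0" using W0 by simp
  qed
  then show ?thesis by (simp add: W_def)
qed

text \<open>The potential, set to 0 off the sphere, meets the defining conditions with exponent 2: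
  its weak equation is symmetry of the kernel combined with \<open>log_potential_laplace\<close> for
  the test function. Uniqueness is \<open>weak_poisson_unique\<close>.\<close>

lemma green_eq_log_potential:
  assumes f: "smooth_on S2 f" "zero_mean f" and x: "x \<in> S2"
  shows "green f x = log_potential f x"
proof -
  define u where "u = (\<lambda>x. if x \<in> S2 then log_potential f x else 0)"
  have cf: "continuous_on S2 f" by (rule smooth_on_S2_continuous[OF f(1)])
  have us: "smooth_on S2 u"
    using smooth_on_S2_log_potential[OF f(1)] smooth_on_S2_cong[of u "log_potential f"] by (simp add: u_def)
  have cu: "continuous_on S2 u" by (rule smooth_on_S2_continuous[OF us])
  have zu: "zero_mean u"
    using zero_mean_log_potential[OF cf f(2)] sphere_integral_cong[of u "log_potential f"] by (simp add: zero_mean_def u_def)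
  \<comment> \<open>Since \<open>u\<close> is itself smooth, the constant sequence witnesses
    membership in the completion.\<close>
  have uW: "u \<in> W2 2"
    unfolding W2_def
  proof (intro CollectI conjI exI[of _ "\<lambda>_. u"] allI impI)
    show "u \<in> Lp 2" by (rule Lp_continuous[OF cu]) simp
    show "(\<lambda>n. Lp_norm 2 (\<lambda>x. u x - u x)) \<longlonglongrightarrow> 0" by (simp add: Lp_norm_zero)
    show "\<exists>N. \<forall>m\<ge>N. \<forall>n\<ge>N. W2_norm 2 (\<lambda>x. u x - u x) < e" if "e > 0" for e
      using that by (simp add: W2_norm_zero)
  qed (rule us)
  have wu: "weak_poisson f u"
    unfolding weak_poisson_def
  proof (intro allI impI)
    fix \<phi> assume \<phi>: "smooth_on S2 \<phi>"
    have cL: "continuous_on S2 (\<lambda>y. - laplace_beltrami \<phi> y)"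
      by (intro smooth_on_S2_continuous smooth_on_S2_uminus smooth_on_S2_laplace_beltrami \<phi>)
    have c\<phi>: "continuous_on S2 \<phi>" by (rule smooth_on_S2_continuous[OF \<phi>])
    have "(LINT x|sphere_measure. u x * - laplace_beltrami \<phi> x) = (LINT x|sphere_measure. log_potential f x * - laplace_beltrami \<phi> x)"
      by (rule sphere_integral_cong) (simp add: u_def)
    also have "\<dots> = (LINT x|sphere_measure. f x * log_potential (\<lambda>y. - laplace_beltrami \<phi> y) x)"
      by (rule log_potential_symmetric[OF cf cL])
    also have "\<dots> = (LINT x|sphere_measure. f x * \<phi> x - f x * ((LINT y|sphere_measure. \<phi> y) / area))"
      by (rule sphere_integral_cong) (simp only: log_potential_laplace[OF \<phi>] right_diff_distrib)
    also have "\<dots> = (LINT x|sphere_measure. f x * \<phi> x) - (LINT x|sphere_measure. f x * ((LINT y|sphere_measure. \<phi> y) / area))"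
      by (intro Bochner_Integration.integral_diff integrable_sphere_measure continuous_on_mult continuous_on_const cf c\<phi>)
    finally show "(LINT x|sphere_measure. u x * - laplace_beltrami \<phi> x) = (LINT x|sphere_measure. f x * \<phi> x)"
      using f(2) by (simp add: zero_mean_def)
  qed
  have "green f = u"
    unfolding green_def
  proof (rule the_equality)
    show "continuous_on S2 u \<and> (\<forall>x. x \<notin> S2 \<longrightarrow> u x = 0) \<and> zero_mean u \<and> (\<exists>r>1. f \<in> Lp r \<and> u \<in> W2 r) \<and> weak_poisson f u"
      using cu zu wu uW Lp_continuous[OF cf, of 2] by (intro conjI exI[of _ 2]) (auto simp: u_def)
    fix v assume v: "continuous_on S2 v \<and> (\<forall>x. x \<notin> S2 \<longrightarrow> v x = 0) \<and> zero_mean v \<and> (\<exists>r>1. f \<in> Lp r \<and> v \<in> W2 r) \<and> weak_poisson f v"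
    show "v = u"
    proof
      fix x show "v x = u x"
      proof (cases "x \<in> S2")
        case True then show ?thesis using weak_poisson_unique[of v u f x] v cu zu wu by blast
      next
        case False then show ?thesis using v by (simp add: u_def)
      qed
    qed
  qed
  then show ?thesis using x by (simp add: u_def)
qed

text \<open>The kernel depends on \<open>x \<bullet> y\<close> only, so the potential commutes with
  rotations; this is the derivative of that covariance in the angle at 0.\<close>

lemma log_potential_rotational:
  assumes f: "smooth_on S2 f" and a: "norm a = 1" and x: "x \<in> S2"
  shows "sphere_deriv (log_potential f) x (cross3 a x) = log_potential (\<lambda>y. sphere_deriv f y (cross3 a y)) x"
proof -
  have cf: "continuous_on S2 f" by (rule smooth_on_S2_continuous[OF f])
  define L where "L = (\<lambda>y. sphere_deriv f y (cross3 a y))"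
  have cL: "continuous_on S2 L" unfolding L_def
    by (intro smooth_on_S2_continuous smooth_on_S2_sphere_deriv smooth_on_S2_cross f)
  have curve: "((\<lambda>s. g (axis_rot a s y)) has_real_derivative sphere_deriv g (axis_rot a s y) (cross3 a (axis_rot a s y))) (at s)"
    if g: "smooth_on S2 g" and y: "y \<in> S2" for g y s
  proof -
    have nz: "axis_rot a s y \<noteq> 0" using norm_axis_rot[OF a, of s y] y by auto
    from vector_derivative_diff_chain_within[of "\<lambda>s. axis_rot a s y", OF axis_rot_deriv[OF a] has_derivative_at_withinI[OF has_sphere_deriv[OF g nz]]]
    show ?thesis using y by (simp add: o_def has_real_derivative_iff_has_vector_derivative norm_axis_rot[OF a])
  qed
  have rot: "log_potential f (axis_rot a s x) = (LINT y|sphere_measure. log_kernel 0 (x \<bullet> y) * f (axis_rot a s y))" for s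
  proof -
    have m: "(\<lambda>y. log_kernel 0 (axis_rot a s x \<bullet> y) * f y) \<in> borel_measurable sphere_measure"
      by (intro borel_measurable_times log_kernel_inner_measurable borel_measurable_sphere_measure cf)
    have "orthogonal_transformation (axis_rot a s)"
      unfolding orthogonal_transformation using linear_axis_rot norm_axis_rot[OF a] by blast
    then have "axis_rot a s x \<bullet> axis_rot a s y = x \<bullet> y" for y by (simp add: orthogonal_transformation_def)
    then show ?thesis
      unfolding log_potential_def sphere_integral_axis_rot[OF a m, of s, symmetric] by simp
  qed
  have "((\<lambda>s. LINT y|sphere_measure. log_kernel 0 (x \<bullet> y) * f (axis_rot a s y)) has_real_derivative
      (LINT y|sphere_measure. log_kernel 0 (x \<bullet> y) * L (axis_rot a 0 y))) (at 0)"
  proof (rule has_real_derivative_sphere_integral[OF _ open_UNIV UNIV_I])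
    show "integrable sphere_measure (\<lambda>y. log_kernel 0 (x \<bullet> y))" using x by (intro log_kernel_integrable) simp
    show "continuous_on S2 (\<lambda>y. f (axis_rot a s y))" for s
      by (rule continuous_on_compose2[OF cf continuous_on_axis_rot]) (auto simp: norm_axis_rot[OF a])
    show "((\<lambda>s. f (axis_rot a s y)) has_real_derivative L (axis_rot a s y)) (at s)" if "y \<in> S2" for s y
      unfolding L_def by (rule curve[OF f that])
    have cr: "continuous_on (UNIV \<times> S2) (\<lambda>z. axis_rot a (fst z) (snd z))"
      unfolding axis_rot_def by (intro continuous_intros continuous_on_cross)
    have "continuous_on (UNIV \<times> S2) (\<lambda>z. L (axis_rot a (fst z) (snd z)))"
      by (rule continuous_on_compose2[OF cL cr]) (auto simp: norm_axis_rot[OF a])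
    then show "continuous_on (UNIV \<times> S2) (\<lambda>(s, y). L (axis_rot a s y))" by (simp add: case_prod_beta')
  qed
  then have "((\<lambda>s. log_potential f (axis_rot a s x)) has_real_derivative log_potential L x) (at 0)"
    unfolding rot by (simp add: log_potential_def[of L])
  moreover have "((\<lambda>s. log_potential f (axis_rot a s x)) has_real_derivative sphere_deriv (log_potential f) x (cross3 a x)) (at 0)"
    using curve[OF smooth_on_S2_log_potential[OF f] x, of 0] by simp
  ultimately show ?thesis using DERIV_unique unfolding L_def by blast
qed

text \<open>The potential is symmetric, the rotational derivative antisymmetric, and they commute,
  so the integral equals its own negative. This removes the contribution of the planetary rotation
  to the energy and that of the nonlinear term to the momentum.\<close>

lemma log_potential_rotational_orthogonal:
  assumes f: "smooth_on S2 f" and a: "norm a = 1"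
  shows "(LINT x|sphere_measure. log_potential f x * sphere_deriv f x (cross3 a x)) = 0"
proof -
  define L where "L = (\<lambda>y. sphere_deriv f y (cross3 a y))"
  have sL: "smooth_on S2 L" unfolding L_def by (intro smooth_on_S2_sphere_deriv smooth_on_S2_cross f)
  note sG = smooth_on_S2_log_potential[OF f]
  have "(LINT x|sphere_measure. log_potential f x * L x) = (LINT x|sphere_measure. f x * log_potential L x)"
    by (intro log_potential_symmetric smooth_on_S2_continuous f sL)
  also have "\<dots> = (LINT x|sphere_measure. f x * sphere_deriv (log_potential f) x (cross3 a x))"
    by (rule sphere_integral_cong) (simp only: log_potential_rotational[OF f a] L_def)
  also have "\<dots> = - (LINT x|sphere_measure. log_potential f x * sphere_deriv f x (cross3 a x))"
    by (rule sphere_integral_rotational_mult[OF f sG])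
  finally show ?thesis by (simp add: L_def)
qed


section \<open>Spherical harmonics\<close>

text \<open>Characterised by the eigenvalue equation, which matches \<open>E2\<close> for
  \<open>l = 2\<close>; that degrees 0, 1 and 2 give constants, linear forms and traceless quadratic
  forms is derived from it.\<close>

definition spherical_harmonic :: "nat \<Rightarrow> (real^3 \<Rightarrow> real) \<Rightarrow> bool" where
  "spherical_harmonic l f \<longleftrightarrow> smooth_on S2 f \<and> (\<forall>x\<in>S2. laplace_beltrami f x = - real (l * (l + 1)) * f x)"

lemma spherical_harmonicD:
  assumes "spherical_harmonic l f"
  shows "smooth_on S2 f" "x \<in> S2 \<Longrightarrow> laplace_beltrami f x = - real (l * (l + 1)) * f x" "continuous_on S2 f"
  using assms smooth_on_S2_continuous unfolding spherical_harmonic_def by blast+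

lemma spherical_harmonic_sum:
  assumes "\<And>i. i \<in> I \<Longrightarrow> spherical_harmonic l (f i)"
  shows "spherical_harmonic l (\<lambda>x. \<Sum>i\<in>I. f i x)"
  unfolding spherical_harmonic_def
proof (intro conjI ballI)
  show "smooth_on S2 (\<lambda>x. \<Sum>i\<in>I. f i x)"
    by (intro smooth_on_S2_sum spherical_harmonicD(1)[OF assms])
  fix x assume x: "x \<in> S2"
  have "laplace_beltrami (\<lambda>x. \<Sum>i\<in>I. f i x) x = (\<Sum>i\<in>I. laplace_beltrami (f i) x)"
    by (rule laplace_beltrami_sum[OF spherical_harmonicD(1)[OF assms] x])
  also have "\<dots> = (\<Sum>i\<in>I. - real (l * (l + 1)) * f i x)"
    by (intro sum.cong refl spherical_harmonicD(2)[OF assms x])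
  finally show "laplace_beltrami (\<lambda>x. \<Sum>i\<in>I. f i x) x = - real (l * (l + 1)) * (\<Sum>i\<in>I. f i x)"
    by (simp only: sum_distrib_left)
qed

lemma spherical_harmonic_add:
  assumes "spherical_harmonic l f" "spherical_harmonic l g"
  shows "spherical_harmonic l (\<lambda>x. f x + g x)"
  using spherical_harmonic_sum[of "UNIV :: bool set" l "\<lambda>b. if b then f else g"] assms by (simp add: UNIV_bool add.commute)

lemma spherical_harmonic_cmult:
  assumes "spherical_harmonic l f"
  shows "spherical_harmonic l (\<lambda>x. c * f x)"
  unfolding spherical_harmonic_def
  using spherical_harmonicD(1,2)[OF assms] laplace_beltrami_cmult[OF spherical_harmonicD(1)[OF assms]] smooth_on_S2_cmult
  by (simp add: mult.left_commute)

lemma spherical_harmonic_orthogonal: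
  assumes f: "spherical_harmonic l f" and g: "spherical_harmonic m g" and "l \<noteq> m"
  shows "(LINT x|sphere_measure. f x * g x) = 0"
proof -
  define c d where "c = real (l * (l + 1))" and "d = real (m * (m + 1))"
  define I where "I = (LINT x|sphere_measure. f x * g x)"
  have "(LINT x|sphere_measure. g x * laplace_beltrami f x) = (LINT x|sphere_measure. f x * laplace_beltrami g x)"
    by (intro laplace_beltrami_self_adjoint spherical_harmonicD(1)[OF f] spherical_harmonicD(1)[OF g])
  moreover have "(LINT x|sphere_measure. g x * laplace_beltrami f x) = (LINT x|sphere_measure. - c * (f x * g x))"
    by (rule sphere_integral_cong) (simp only: spherical_harmonicD(2)[OF f] c_def mult_ac)
  moreover have "(LINT x|sphere_measure. f x * laplace_beltrami g x) = (LINT x|sphere_measure. - d * (f x * g x))"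
    by (rule sphere_integral_cong) (simp only: spherical_harmonicD(2)[OF g] d_def mult_ac)
  ultimately have "- c * I = - d * I" unfolding I_def integral_mult_right_zero by (simp only:)
  then have "c * I = d * I" by simp
  moreover have "l * (l + 1) \<noteq> m * (m + 1)"
  proof
    assume e: "l * (l + 1) = m * (m + 1)"
    consider "l < m" | "m < l" using assms(3) by linarith
    then show False
    proof cases
      case 1 then have "l * (l + 1) < m * (m + 1)" by (intro mult_strict_mono) auto
      then show False using e by simp
    next
      case 2 then have "m * (m + 1) < l * (l + 1)" by (intro mult_strict_mono) auto
      then show False using e by simp
    qed
  qed
  then have "c \<noteq> d" unfolding c_def d_def of_nat_eq_iff .
  ultimately show ?thesis unfolding I_def[symmetric] by simp
qed

lemma spherical_harmonic_const: "spherical_harmonic 0 (\<lambda>x. c)"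
  unfolding spherical_harmonic_def using laplace_beltrami_const smooth_on_S2_const by simp

lemma log_potential_spherical_harmonic:
  assumes f: "spherical_harmonic l f" and l: "l \<noteq> 0" and x: "x \<in> S2"
  shows "log_potential f x = f x / real (l * (l + 1))"
proof -
  define c where "c = real (l * (l + 1))"
  have c: "c \<noteq> 0" using l unfolding c_def of_nat_eq_0_iff by simp
  have z: "(LINT y|sphere_measure. f y) = 0"
    using spherical_harmonic_orthogonal[OF f spherical_harmonic_const[of 1] l] by simp
  have "f x = log_potential (\<lambda>y. - laplace_beltrami f y) x"
    using log_potential_laplace[OF spherical_harmonicD(1)[OF f] x] z by simp
  also have "\<dots> = (LINT y|sphere_measure. c * (log_kernel 0 (x \<bullet> y) * f y))"
    unfolding log_potential_def
    by (rule sphere_integral_cong) (simp only: spherical_harmonicD(2)[OF f] c_def[symmetric], simp)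
  also have "\<dots> = c * log_potential f x" by (simp add: log_potential_def)
  finally show ?thesis using c unfolding c_def[symmetric] by simp
qed

section \<open>Legendre polynomials and zonal harmonics\<close>

definition legendre_op :: "real poly \<Rightarrow> real poly" where
  "legendre_op p = pderiv (pderiv p) - pCons 0 (pCons 0 (pderiv (pderiv p))) - smult 2 (pCons 0 (pderiv p))"

lemma poly_legendre_op: "poly (legendre_op p) z = (1 - z\<^sup>2) * poly (pderiv (pderiv p)) z - 2 * z * poly (pderiv p) z"
  by (simp add: legendre_op_def power2_eq_square algebra_simps)

text \<open>In monomials the operator is triangular with the distinct diagonal entries - i (i + 1);
  this is why every polynomial is a sum of eigenvectors.\<close>

lemma coeff_legendre_op:
  "coeff (legendre_op p) i = real ((i + 1) * (i + 2)) * coeff p (i + 2) - real (i * (i + 1)) * coeff p i"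
proof -
  consider "i = 0" | "i = 1" | j where "i = Suc (Suc j)" by (metis One_nat_def old.nat.exhaust)
  then show ?thesis
    by cases (simp_all add: legendre_op_def coeff_pderiv algebra_simps numeral_2_eq_2)
qed

text \<open>The zero polynomial is included, so this is the whole line spanned by the Legendre
  polynomial of degree \<open>l\<close>, and degrees absent from a decomposition are simply
  0.\<close>

definition legendre_eigen :: "nat \<Rightarrow> real poly \<Rightarrow> bool" where
  "legendre_eigen l q \<longleftrightarrow> legendre_op q = smult (- real (l * (l + 1))) q \<and> (\<forall>i>l. coeff q i = 0)"

lemma legendre_op_sum: "legendre_op (\<Sum>i\<in>I. f i) = (\<Sum>i\<in>I. legendre_op (f i))"
  by (rule poly_eqI) (simp add: coeff_legendre_op coeff_sum sum_subtractf sum_distrib_left)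

lemma legendre_op_diff: "legendre_op (p - q) = legendre_op p - legendre_op q"
  by (rule poly_eqI) (simp add: coeff_legendre_op algebra_simps)

lemma legendre_op_smult: "legendre_op (smult c p) = smult c (legendre_op p)"
  by (rule poly_eqI) (simp add: coeff_legendre_op algebra_simps)

lemma smult_sum_right: "smult c (\<Sum>i\<in>I. f i) = (\<Sum>i\<in>I. smult c (f i))"
  by (rule poly_eqI) (simp add: coeff_sum sum_distrib_left)

text \<open>Adding n (n + 1) to the operator kills the coefficient of degree \<open>n\<close>, so
  its value on \<open>p\<close> is decomposed by induction. On a component of degree l < n the
  shifted operator is multiplication by n (n + 1) - l (l + 1), which is not 0; dividing by it and
  subtracting from \<open>p\<close> leaves an eigenvector for \<open>n\<close>.\<close>

lemma legendre_decomposition: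
  assumes "\<And>i. i \<ge> n \<Longrightarrow> coeff p i = 0"
  shows "\<exists>q. (\<forall>l. legendre_eigen l (q l)) \<and> (\<forall>l\<ge>n. q l = 0) \<and> p = (\<Sum>l<n. q l)"
  using assms
proof (induction n arbitrary: p)
  case 0
  then have "p = 0" by (intro poly_eqI) simp
  then show ?case by (intro exI[of _ "\<lambda>_. 0"]) (simp add: legendre_eigen_def legendre_op_def)
next
  case (Suc n)
  define lam where "lam = (\<lambda>l::nat. real (l * (l + 1)))"
  define r where "r = legendre_op p + smult (lam n) p"
  have r0: "coeff r i = 0" if "i \<ge> n" for i
    using that Suc.prems[of "i + 2"] Suc.prems[of i] by (cases "i = n") (auto simp: r_def coeff_legendre_op lam_def)
  from Suc.IH[OF this] obtain s where s: "\<And>l. legendre_eigen l (s l)" "\<And>l. l \<ge> n \<Longrightarrow> s l = 0" "r = (\<Sum>l<n. s l)" by blast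
  have ne: "lam n - lam l \<noteq> 0" if "l < n" for l
  proof -
    have "l * (l + 1) < n * (n + 1)" using that by (intro mult_strict_mono) auto
    then show ?thesis unfolding lam_def by linarith
  qed
  define t where "t = (\<lambda>l. smult (inverse (lam n - lam l)) (s l))"
  define u where "u = p - (\<Sum>l<n. t l)"
  have s': "legendre_op (s l) = smult (- lam l) (s l)" for l using s(1)[of l] by (simp add: legendre_eigen_def lam_def)
  have t: "legendre_eigen l (t l)" for l
    using s(1)[of l] by (simp add: t_def legendre_eigen_def legendre_op_smult mult.commute)
  have "legendre_op u + smult (lam n) u = r - (\<Sum>l<n. legendre_op (t l) + smult (lam n) (t l))"
    by (simp add: u_def r_def legendre_op_diff legendre_op_sum smult_diff_right smult_sum_right sum.distrib)
  also have "(\<Sum>l<n. legendre_op (t l) + smult (lam n) (t l)) = (\<Sum>l<n. s l)"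
  proof (rule sum.cong[OF refl])
    fix l assume "l \<in> {..<n}"
    then have l: "l < n" by simp
    have "legendre_op (t l) + smult (lam n) (t l) = smult (inverse (lam n - lam l) * (lam n - lam l)) (s l)"
      by (simp add: t_def legendre_op_smult s' smult_add_left[symmetric] algebra_simps)
    then show "legendre_op (t l) + smult (lam n) (t l) = s l" using ne[OF l] by simp
  qed
  finally have "legendre_op u + smult (lam n) u = 0" using s(3) by simp
  then have u1: "legendre_op u = smult (- lam n) u" by (simp add: eq_neg_iff_add_eq_0)
  have "coeff (t l) i = 0" if "l < n" "i > n" for l i
    using t[of l] that by (simp add: legendre_eigen_def)
  then have u2: "coeff u i = 0" if "i > n" for i
    using that Suc.prems[of i] by (simp add: u_def coeff_sum)
  have u: "legendre_eigen n u" using u1 u2 by (simp add: legendre_eigen_def lam_def)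
  define q where "q = t(n := u)"
  have "p = (\<Sum>l<Suc n. q l)" by (simp add: q_def u_def)
  moreover have "legendre_eigen l (q l)" for l using t u by (simp add: q_def)
  moreover have "q l = 0" if "l \<ge> Suc n" for l using s(2)[of l] that by (simp add: q_def t_def)
  ultimately show ?case by blast
qed

lemma Ck_on_poly: "Ck_on k UNIV (poly p)" for p :: "real poly"
proof (induction k arbitrary: p)
  case 0 then show ?case by (auto intro: continuous_intros)
next
  case (Suc k) then show ?case by (intro Ck_on_real_SucI[where f' = "poly (pderiv p)"] poly_DERIV) auto
qed

lemma ridge_poly: "norm a = 1 \<Longrightarrow> ridge UNIV (poly p) (poly (pderiv p)) (poly (pderiv (pderiv p))) a"
  by unfold_locales (auto intro: Ck_on_poly poly_DERIV)

lemma spherical_harmonic_legendre: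
  assumes "legendre_eigen l q" "norm a = 1"
  shows "spherical_harmonic l (\<lambda>x. poly q (a \<bullet> x))"
  unfolding spherical_harmonic_def
proof (intro conjI ballI)
  show "smooth_on S2 (\<lambda>x. poly q (a \<bullet> x))" by (rule ridge.smooth[OF ridge_poly[OF assms(2)]])
  fix x assume "x \<in> S2"
  then have "laplace_beltrami (\<lambda>x. poly q (a \<bullet> x)) x = poly (legendre_op q) (a \<bullet> x)"
    by (simp only: ridge.laplace[OF ridge_poly[OF assms(2)]] poly_legendre_op)
  also have "legendre_op q = smult (- real (l * (l + 1))) q" using assms(1) by (simp add: legendre_eigen_def)
  finally show "laplace_beltrami (\<lambda>x. poly q (a \<bullet> x)) x = - real (l * (l + 1)) * poly q (a \<bullet> x)" by simp
qed

lemma Weierstrass_poly: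
  fixes g :: "real \<Rightarrow> real"
  assumes "continuous_on {a..b} g" "e > 0"
  obtains p where "\<And>z. z \<in> {a..b} \<Longrightarrow> \<bar>g z - poly p z\<bar> < e"
proof -
  obtain h where h: "real_polynomial_function h" "\<And>x. x \<in> {a..b} \<Longrightarrow> \<bar>g x - h x\<bar> < e"
    using Stone_Weierstrass_real_polynomial_function[OF compact_Icc assms] by blast
  obtain c n where c: "h = (\<lambda>x. \<Sum>i\<le>n. c i * x ^ i)" using h(1) real_polynomial_function_iff_sum by blast
  have "poly (\<Sum>i\<le>n. monom (c i) i) = h" by (rule ext) (simp add: c poly_sum poly_monom)
  then show ?thesis using h(2) that by metis
qed

text \<open>Approximate \<open>delta_kernel\<close> uniformly by a polynomial and split that into
  Legendre components: by orthogonality \<open>Y\<close> sees only the component of degree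
  \<open>l\<close>. As these components all lie on one line, the limit reveals the shape of
  \<open>Y\<close>.\<close>

lemma spherical_harmonic_zonal_limit:
  assumes Y: "spherical_harmonic l Y"
  shows "\<exists>q. (\<forall>n. legendre_eigen l (q n)) \<and>
    (\<forall>x\<in>S2. (\<lambda>n. LINT y|sphere_measure. Y y * poly (q n) (x \<bullet> y)) \<longlonglongrightarrow> Y x)"
proof -
  note cY = spherical_harmonicD(3)[OF Y]
  have "\<exists>q. legendre_eigen l q \<and> (\<forall>x\<in>S2. \<bar>(LINT y|sphere_measure. Y y * delta_kernel (eps n) (x \<bullet> y)) - (LINT y|sphere_measure. Y y * poly q (x \<bullet> y))\<bar> \<le> (LINT y|sphere_measure. \<bar>Y y\<bar>) * eps n)" for n
  proof -
    have "1 + eps n - z \<noteq> 0" if "z \<in> {-1..1}" for z using that eps_pos[of n] by simp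
    then have "continuous_on {-1..1} (delta_kernel (eps n))"
      unfolding delta_kernel_def using area_pos by (intro continuous_intros) auto
    then obtain p where p: "\<And>z. z \<in> {-1..1} \<Longrightarrow> \<bar>delta_kernel (eps n) z - poly p z\<bar> < eps n"
      using Weierstrass_poly[OF _ eps_pos] by metis
    have "coeff p i = 0" if "i \<ge> Suc (degree p)" for i using that by (intro coeff_eq_0) simp
    from legendre_decomposition[OF this] obtain q where
      q: "\<And>l. legendre_eigen l (q l)" "\<And>l. l \<ge> Suc (degree p) \<Longrightarrow> q l = 0" "p = (\<Sum>l<Suc (degree p). q l)" by blast
    show ?thesis
    proof (intro exI[of _ "q l"] conjI ballI q(1))
      fix x assume x: "x \<in> S2"
      then have nx: "norm x = 1" by simp
      have cq: "continuous_on S2 (\<lambda>y. poly (q m) (x \<bullet> y))" for m by (intro continuous_intros)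
      have cp: "continuous_on S2 (\<lambda>y. poly p (x \<bullet> y))" by (intro continuous_intros)
      have orth: "(LINT y|sphere_measure. Y y * poly (q m) (x \<bullet> y)) = (if m = l then LINT y|sphere_measure. Y y * poly (q l) (x \<bullet> y) else 0)" for m
        using spherical_harmonic_orthogonal[OF Y spherical_harmonic_legendre[OF q(1) nx], of m] by auto
      have "(LINT y|sphere_measure. Y y * poly p (x \<bullet> y)) = (LINT y|sphere_measure. (\<Sum>m<Suc (degree p). Y y * poly (q m) (x \<bullet> y)))"
        by (subst q(3)) (simp only: poly_sum sum_distrib_left)
      also have "\<dots> = (\<Sum>m<Suc (degree p). LINT y|sphere_measure. Y y * poly (q m) (x \<bullet> y))"
        by (intro Bochner_Integration.integral_sum integrable_sphere_measure continuous_on_mult cY cq)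
      also have "\<dots> = (if l < Suc (degree p) then LINT y|sphere_measure. Y y * poly (q l) (x \<bullet> y) else 0)"
      proof -
        have "(\<Sum>m<Suc (degree p). LINT y|sphere_measure. Y y * poly (q m) (x \<bullet> y))
          = (\<Sum>m<Suc (degree p). if m = l then LINT y|sphere_measure. Y y * poly (q l) (x \<bullet> y) else 0)"
          by (intro sum.cong refl orth)
        then show ?thesis by (simp del: sum.lessThan_Suc)
      qed
      also have "\<dots> = (LINT y|sphere_measure. Y y * poly (q l) (x \<bullet> y))" using q(2)[of l] by simp
      finally have e: "(LINT y|sphere_measure. Y y * poly p (x \<bullet> y)) = (LINT y|sphere_measure. Y y * poly (q l) (x \<bullet> y))" .
      have cd: "continuous_on S2 (\<lambda>y. delta_kernel (eps n) (x \<bullet> y))" by (rule continuous_on_delta_kernel[OF eps_pos nx])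
      have "(LINT y|sphere_measure. Y y * delta_kernel (eps n) (x \<bullet> y)) - (LINT y|sphere_measure. Y y * poly p (x \<bullet> y))
        = (LINT y|sphere_measure. Y y * (delta_kernel (eps n) (x \<bullet> y) - poly p (x \<bullet> y)))"
        unfolding right_diff_distrib
        by (intro Bochner_Integration.integral_diff[symmetric] integrable_sphere_measure continuous_on_mult cY cd cp)
      also have "\<bar>\<dots>\<bar> \<le> (LINT y|sphere_measure. \<bar>Y y\<bar>) * eps n"
        by (rule sphere_integral_abs_le[OF integrable_sphere_measure[OF cY] continuous_on_diff[OF cd cp]])
          (rule less_imp_le[OF p[OF inner_S2_in[OF nx]]])
      finally show "\<bar>(LINT y|sphere_measure. Y y * delta_kernel (eps n) (x \<bullet> y)) - (LINT y|sphere_measure. Y y * poly (q l) (x \<bullet> y))\<bar> \<le> (LINT y|sphere_measure. \<bar>Y y\<bar>) * eps n"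
        unfolding e .
    qed
  qed
  note ex = this
  let ?P = "\<lambda>n q. legendre_eigen l q \<and> (\<forall>x\<in>S2. \<bar>(LINT y|sphere_measure. Y y * delta_kernel (eps n) (x \<bullet> y)) - (LINT y|sphere_measure. Y y * poly q (x \<bullet> y))\<bar> \<le> (LINT y|sphere_measure. \<bar>Y y\<bar>) * eps n)"
  have "\<exists>q. \<forall>n. ?P n (q n)" by (rule choice) (rule allI, rule ex)
  then obtain q where "\<forall>n. ?P n (q n)" by (rule exE)
  then have q: "legendre_eigen l (q n)"
    "x \<in> S2 \<Longrightarrow> \<bar>(LINT y|sphere_measure. Y y * delta_kernel (eps n) (x \<bullet> y)) - (LINT y|sphere_measure. Y y * poly (q n) (x \<bullet> y))\<bar> \<le> (LINT y|sphere_measure. \<bar>Y y\<bar>) * eps n" for n x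
    by blast+
  have "(\<lambda>n. LINT y|sphere_measure. Y y * poly (q n) (x \<bullet> y)) \<longlonglongrightarrow> Y x" if x: "x \<in> S2" for x
  proof -
    have "(\<lambda>n. (LINT y|sphere_measure. \<bar>Y y\<bar>) * eps n) \<longlonglongrightarrow> (LINT y|sphere_measure. \<bar>Y y\<bar>) * 0"
      by (intro tendsto_intros eps_tendsto)
    then have z: "(\<lambda>n. (LINT y|sphere_measure. \<bar>Y y\<bar>) * eps n) \<longlonglongrightarrow> 0" by (simp only: mult_zero_right)
    have "(\<lambda>n. (LINT y|sphere_measure. Y y * delta_kernel (eps n) (x \<bullet> y)) - (LINT y|sphere_measure. Y y * poly (q n) (x \<bullet> y))) \<longlonglongrightarrow> 0"
      by (rule Lim_null_comparison[OF eventuallyI z]) (unfold real_norm_def, rule q(2)[OF x])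
    from tendsto_diff[OF delta_kernel_tendsto[OF cY x] this] show ?thesis
      by (simp only: diff_diff_eq2 add_diff_cancel_left' diff_zero)
  qed
  then show ?thesis using q(1) by blast
qed

text \<open>A line of functions is closed under pointwise limits: at a point where \<open>S\<close>
  is not 0 the factors must converge, and if \<open>S\<close> vanishes on all of \<open>X\<close> so
  does the limit.\<close>

lemma pointwise_limit_of_multiples:
  fixes S Y :: "'a \<Rightarrow> real"
  assumes "\<And>x. x \<in> X \<Longrightarrow> (\<lambda>n. c n * S x) \<longlonglongrightarrow> Y x"
  shows "\<exists>k. \<forall>x\<in>X. Y x = k * S x"
proof (cases "\<exists>z\<in>X. S z \<noteq> 0")
  case True
  then obtain z where z: "z \<in> X" "S z \<noteq> 0" by blast
  have "(\<lambda>n. c n * S z / S z) \<longlonglongrightarrow> Y z / S z" by (intro tendsto_divide assms z tendsto_const)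
  then have c: "c \<longlonglongrightarrow> Y z / S z" using z(2) by simp
  show ?thesis
  proof (intro exI[of _ "Y z / S z"] ballI)
    fix x assume "x \<in> X"
    then show "Y x = Y z / S z * S x"
      using LIMSEQ_unique[OF assms tendsto_mult_right[OF c, of "S x"]] by blast
  qed
next
  case False
  then have "Y x = 0" if "x \<in> X" for x
    using assms[OF that] that by (simp add: LIMSEQ_const_iff)
  then show ?thesis by (intro exI[of _ 0]) simp
qed

section \<open>Explicit form of the harmonics of degrees 0, 1 and 2\<close>

lemma legendre_eigen_0: "legendre_eigen 0 q \<Longrightarrow> poly q z = coeff q 0"
proof -
  assume q: "legendre_eigen 0 q"
  then have "q = [:coeff q 0:]"
    by (intro poly_eqI) (auto simp: legendre_eigen_def coeff_pCons split: nat.split)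
  then have "poly q z = poly [:coeff q 0:] z" by metis
  then show ?thesis by simp
qed

lemma legendre_eigen_1: "legendre_eigen 1 q \<Longrightarrow> poly q z = coeff q 1 * z"
proof -
  assume q: "legendre_eigen 1 q"
  have "coeff (legendre_op q) 0 = coeff (smult (-2) q) 0" using q by (simp add: legendre_eigen_def)
  then have "coeff q 0 = 0" using q by (simp add: coeff_legendre_op legendre_eigen_def)
  then have "q = [:0, coeff q 1:]"
    using q by (intro poly_eqI) (auto simp: legendre_eigen_def coeff_pCons split: nat.split)
  then have "poly q z = poly [:0, coeff q 1:] z" by metis
  then show ?thesis by simp
qed

lemma legendre_eigen_2: "legendre_eigen 2 q \<Longrightarrow> poly q z = coeff q 2 * (z\<^sup>2 - 1/3)"
proof -
  assume q: "legendre_eigen 2 q"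
  have "coeff (legendre_op q) 0 = coeff (smult (-6) q) 0" "coeff (legendre_op q) 1 = coeff (smult (-6) q) 1"
    using q by (simp_all add: legendre_eigen_def)
  then have c: "coeff q 0 = - coeff q 2 / 3" "coeff q 1 = 0"
    using q by (simp_all add: coeff_legendre_op legendre_eigen_def numeral_2_eq_2)
  have "coeff q i = coeff [:coeff q 0, 0, coeff q 2:] i" for i
  proof -
    consider "i = 0" | "i = 1" | "i = 2" | "i > 2" by linarith
    then show ?thesis using q c(2)
      by cases (auto simp: legendre_eigen_def coeff_pCons numeral_2_eq_2 split: nat.split)
  qed
  then have "q = [:coeff q 0, 0, coeff q 2:]" by (rule poly_eqI)
  then have "poly q z = poly [:coeff q 0, 0, coeff q 2:] z" by metis
  then show ?thesis by (simp add: c power2_eq_square algebra_simps)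
qed

lemma legendre_eigen_2I: "legendre_eigen 2 [:-1/3, 0, 1:]"
  unfolding legendre_eigen_def
  by (auto simp: legendre_op_def pderiv_pCons numeral_2_eq_2 coeff_pCons split: nat.split)

lemma spherical_harmonic_0:
  assumes "spherical_harmonic 0 Y" shows "\<exists>c. \<forall>x\<in>S2. Y x = c"
proof -
  obtain q where q0: "\<forall>n. legendre_eigen 0 (q n)" "\<forall>x\<in>S2. (\<lambda>n. LINT y|sphere_measure. Y y * poly (q n) (x \<bullet> y)) \<longlonglongrightarrow> Y x"
    using spherical_harmonic_zonal_limit[OF assms] by blast
  note q = q0(1)[rule_format] q0(2)[rule_format]
  have "\<exists>k. \<forall>x\<in>S2. Y x = k * (LINT y|sphere_measure. Y y)"
    using q(2) by (intro pointwise_limit_of_multiples[where c = "\<lambda>n. coeff (q n) 0"]) (simp add: legendre_eigen_0[OF q(1)] mult.commute)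
  then show ?thesis by blast
qed

lemma spherical_harmonic_1:
  assumes "spherical_harmonic 1 Y" shows "\<exists>b. \<forall>x\<in>S2. Y x = b \<bullet> x"
proof -
  note cY = spherical_harmonicD(3)[OF assms]
  obtain q where q0: "\<forall>n. legendre_eigen 1 (q n)" "\<forall>x\<in>S2. (\<lambda>n. LINT y|sphere_measure. Y y * poly (q n) (x \<bullet> y)) \<longlonglongrightarrow> Y x"
    using spherical_harmonic_zonal_limit[OF assms] by blast
  note q = q0(1)[rule_format] q0(2)[rule_format]
  have "\<exists>k. \<forall>x\<in>S2. Y x = k * (LINT y|sphere_measure. Y y * (x \<bullet> y))"
  proof (rule pointwise_limit_of_multiples[where c = "\<lambda>n. coeff (q n) 1"])
    fix x :: "real^3" assume "x \<in> S2"
    moreover have "(LINT y|sphere_measure. Y y * poly (q n) (x \<bullet> y)) = coeff (q n) 1 * (LINT y|sphere_measure. Y y * (x \<bullet> y))" for n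
      unfolding legendre_eigen_1[OF q(1)] integral_mult_right_zero[symmetric] by (simp only: mult_ac)
    ultimately show "(\<lambda>n. coeff (q n) 1 * (LINT y|sphere_measure. Y y * (x \<bullet> y))) \<longlonglongrightarrow> Y x"
      using q(2)[of x] by (simp only:)
  qed
  then obtain k where k: "\<forall>x\<in>S2. Y x = k * (LINT y|sphere_measure. Y y * (x \<bullet> y))" by blast
  define b where "b = (\<chi> i. k * (LINT y|sphere_measure. Y y * y $ i))"
  have "k * (LINT y|sphere_measure. Y y * (x \<bullet> y)) = b \<bullet> x" for x
  proof -
    have "(LINT y|sphere_measure. Y y * (x \<bullet> y)) = (LINT y|sphere_measure. (\<Sum>i\<in>UNIV. x $ i * (Y y * y $ i)))"
      by (simp add: inner_vec_def sum_distrib_left mult_ac)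
    also have "\<dots> = (\<Sum>i\<in>UNIV. LINT y|sphere_measure. x $ i * (Y y * y $ i))"
      by (intro Bochner_Integration.integral_sum integrable_sphere_measure continuous_intros cY)
    also have "\<dots> = (\<Sum>i\<in>UNIV. x $ i * (LINT y|sphere_measure. Y y * y $ i))"
      by (simp only: integral_mult_right_zero)
    finally show ?thesis by (simp only:) (simp add: b_def inner_vec_def sum_distrib_left mult_ac)
  qed
  then show ?thesis using k by metis
qed

lemma spherical_harmonic_2:
  assumes "spherical_harmonic 2 Y"
  shows "\<exists>B::real^3^3. transpose B = B \<and> trace B = 0 \<and> (\<forall>x\<in>S2. Y x = x \<bullet> (B *v x))"
proof -
  note cY = spherical_harmonicD(3)[OF assms]
  obtain q where q0: "\<forall>n. legendre_eigen 2 (q n)" "\<forall>x\<in>S2. (\<lambda>n. LINT y|sphere_measure. Y y * poly (q n) (x \<bullet> y)) \<longlonglongrightarrow> Y x"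
    using spherical_harmonic_zonal_limit[OF assms] by blast
  note q = q0(1)[rule_format] q0(2)[rule_format]
  have "\<exists>k. \<forall>x\<in>S2. Y x = k * (LINT y|sphere_measure. Y y * ((x \<bullet> y)\<^sup>2 - 1/3))"
  proof (rule pointwise_limit_of_multiples[where c = "\<lambda>n. coeff (q n) 2"])
    fix x :: "real^3" assume "x \<in> S2"
    moreover have "(LINT y|sphere_measure. Y y * poly (q n) (x \<bullet> y)) = coeff (q n) 2 * (LINT y|sphere_measure. Y y * ((x \<bullet> y)\<^sup>2 - 1/3))" for n
      unfolding legendre_eigen_2[OF q(1)] integral_mult_right_zero[symmetric] by (simp only: mult_ac)
    ultimately show "(\<lambda>n. coeff (q n) 2 * (LINT y|sphere_measure. Y y * ((x \<bullet> y)\<^sup>2 - 1/3))) \<longlonglongrightarrow> Y x"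
      using q(2)[of x] by (simp only:)
  qed
  then obtain k where k: "\<forall>x\<in>S2. Y x = k * (LINT y|sphere_measure. Y y * ((x \<bullet> y)\<^sup>2 - 1/3))" by blast
  \<comment> \<open>Entry by entry this is the kernel (x . y)^2 - 1/3 read as a quadratic form in
    \<open>x\<close>; the diagonal correction 1/3 uses that \<open>x\<close> is a unit vector and
    makes the trace vanish.\<close>
  define B :: "real^3^3" where "B = (\<chi> i j. k * (LINT y|sphere_measure. Y y * (y $ i * y $ j - (if i = j then 1/3 else 0))))"
  have "B $ j $ i = B $ i $ j" for i j
    by (cases "i = j") (simp_all add: B_def mult.commute[of "_ $ j" "_ $ i"])
  then have tB: "transpose B = B" by (simp add: transpose_def vec_eq_iff)
  have "trace B = k * (\<Sum>i\<in>UNIV. LINT y|sphere_measure. Y y * (y $ i * y $ i - 1/3))"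
    by (simp add: trace_def B_def sum_distrib_left)
  also have "(\<Sum>i\<in>UNIV. LINT y|sphere_measure. Y y * (y $ i * y $ i - 1/3)) = (LINT y|sphere_measure. (\<Sum>i\<in>UNIV. Y y * (y $ i * y $ i - 1/3)))"
    by (intro Bochner_Integration.integral_sum[symmetric] integrable_sphere_measure continuous_intros cY)
  also have "\<dots> = (LINT y|sphere_measure. 0)"
  proof (rule sphere_integral_cong)
    fix y :: "real^3" assume "y \<in> S2"
    then have "y \<bullet> y = 1" by (simp add: dot_square_norm)
    then have "(\<Sum>i\<in>UNIV. y $ i * y $ i - 1/3) = 0" by (simp add: inner_vec_def sum_subtractf)
    then show "(\<Sum>i\<in>UNIV. Y y * (y $ i * y $ i - 1/3)) = 0" by (simp only: sum_distrib_left[symmetric])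
  qed
  finally have trB: "trace B = 0" by simp
  have kq: "k * (LINT y|sphere_measure. Y y * ((x \<bullet> y)\<^sup>2 - 1/3)) = x \<bullet> (B *v x)" if x: "x \<in> S2" for x
  proof -
    have xx: "(\<Sum>i\<in>UNIV. x $ i * x $ i) = 1" 
    proof -
      have "x \<bullet> x = 1" using x by (simp add: dot_square_norm)
      then show ?thesis by (simp add: inner_vec_def)
    qed
    have e: "(x \<bullet> y)\<^sup>2 - 1/3 = (\<Sum>i\<in>UNIV. \<Sum>j\<in>UNIV. x $ i * x $ j * (y $ i * y $ j - (if i = j then 1/3 else 0)))" for y
    proof -
      have "(\<Sum>i\<in>UNIV. \<Sum>j\<in>UNIV. x $ i * x $ j * (y $ i * y $ j - (if i = j then 1/3 else 0)))
        = (\<Sum>i\<in>UNIV. \<Sum>j\<in>UNIV. (x $ i * y $ i) * (x $ j * y $ j)) - (\<Sum>i\<in>UNIV. x $ i * x $ i) / 3"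
      proof -
        have t: "x $ i * x $ j * (y $ i * y $ j - (if i = j then 1/3 else 0)) = (x $ i * y $ i) * (x $ j * y $ j) - (if i = j then x $ i * x $ i / 3 else 0)" for i j
          by (simp add: algebra_simps)
        show ?thesis unfolding t by (simp add: sum_subtractf sum_divide_distrib)
      qed
      then show ?thesis unfolding xx by (simp add: inner_vec_def power2_eq_square sum_product)
    qed
    have "(LINT y|sphere_measure. Y y * ((x \<bullet> y)\<^sup>2 - 1/3)) =
        (LINT y|sphere_measure. (\<Sum>i\<in>UNIV. \<Sum>j\<in>UNIV. x $ i * x $ j * (Y y * (y $ i * y $ j - (if i = j then 1/3 else 0)))))"
      unfolding e by (simp add: sum_distrib_left mult_ac)
    also have "\<dots> = (\<Sum>i\<in>UNIV. LINT y|sphere_measure. (\<Sum>j\<in>UNIV. x $ i * x $ j * (Y y * (y $ i * y $ j - (if i = j then 1/3 else 0)))))"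
      by (intro Bochner_Integration.integral_sum integrable_sphere_measure continuous_intros cY)
    also have "\<dots> = (\<Sum>i\<in>UNIV. \<Sum>j\<in>UNIV. LINT y|sphere_measure. x $ i * x $ j * (Y y * (y $ i * y $ j - (if i = j then 1/3 else 0))))"
      by (intro sum.cong refl Bochner_Integration.integral_sum integrable_sphere_measure continuous_intros cY)
    also have "\<dots> = (\<Sum>i\<in>UNIV. \<Sum>j\<in>UNIV. x $ i * x $ j * (LINT y|sphere_measure. Y y * (y $ i * y $ j - (if i = j then 1/3 else 0))))"
      by (simp only: integral_mult_right_zero)
    finally show ?thesis
      by (simp only:) (simp add: B_def inner_vec_def matrix_vector_mult_def sum_distrib_left mult_ac)
  qed
  have "Y x = x \<bullet> (B *v x)" if x: "x \<in> S2" for x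
    unfolding bspec[OF k x] by (rule kq[OF x])
  with tB trB show ?thesis by blast
qed

lemma E2_iff: "Y \<in> E2 \<longleftrightarrow> spherical_harmonic 2 Y"
proof -
  have "(- a = 6 * b) \<longleftrightarrow> (a = - real (2 * (2 + 1)) * b)" for a b :: real by auto
  then show ?thesis unfolding E2_def spherical_harmonic_def by simp
qed


section \<open>The spectral inequality\<close>

text \<open>Components from \<open>N\<close> on are required to vanish so that an expansion can be
  padded, in particular until it contains the degrees 0, 1 and 2.\<close>

definition harmonic_expansion :: "nat \<Rightarrow> (nat \<Rightarrow> real^3 \<Rightarrow> real) \<Rightarrow> (real^3 \<Rightarrow> real) \<Rightarrow> bool" where
  "harmonic_expansion N q f \<longleftrightarrow> (\<forall>l. spherical_harmonic l (q l)) \<and> (\<forall>l\<ge>N. q l = (\<lambda>x. 0)) \<and> (\<forall>x\<in>S2. f x = (\<Sum>l<N. q l x))"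

lemma harmonic_expansion_mono:
  assumes "harmonic_expansion N q f" "N \<le> M"
  shows "harmonic_expansion M q f"
proof -
  have "(\<Sum>l<M. q l x) = (\<Sum>l<N. q l x)" for x
    by (rule sum.mono_neutral_right) (use assms in \<open>auto simp: harmonic_expansion_def\<close>)
  then show ?thesis using assms unfolding harmonic_expansion_def by simp
qed

lemma harmonic_expansion_add:
  assumes "harmonic_expansion N q f" "harmonic_expansion M r g"
  shows "harmonic_expansion (max N M) (\<lambda>l x. q l x + r l x) (\<lambda>x. f x + g x)"
  using harmonic_expansion_mono[OF assms(1), of "max N M"] harmonic_expansion_mono[OF assms(2), of "max N M"]
  unfolding harmonic_expansion_def by (simp add: spherical_harmonic_add sum.distrib)

lemma harmonic_expansion_poly:
  assumes "norm a = 1"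
  shows "\<exists>N q. harmonic_expansion N q (\<lambda>x. poly p (a \<bullet> x))"
proof -
  have "coeff p i = 0" if "i \<ge> Suc (degree p)" for i using that by (intro coeff_eq_0) simp
  from legendre_decomposition[OF this] obtain q where
    q: "\<forall>l. legendre_eigen l (q l)" "\<forall>l\<ge>Suc (degree p). q l = 0" "p = (\<Sum>l<Suc (degree p). q l)" by blast
  have "poly p z = (\<Sum>l<Suc (degree p). poly (q l) z)" for z by (subst q(3)) (simp only: poly_sum)
  then have "harmonic_expansion (Suc (degree p)) (\<lambda>l x. poly (q l) (a \<bullet> x)) (\<lambda>x. poly p (a \<bullet> x))"
    unfolding harmonic_expansion_def using q spherical_harmonic_legendre[OF _ assms] by simp
  then show ?thesis by blast
qed

text \<open>Exponentials of linear forms are zonal, and so are products of them. Their sums form an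
  algebra that separates points, while each generator calls only for Weierstrass approximation in
  one variable followed by the Legendre decomposition.\<close>

inductive_set exp_span :: "(real^3 \<Rightarrow> real) set" where
  exp: "(\<lambda>x. c * exp (a \<bullet> x)) \<in> exp_span"
| add: "f \<in> exp_span \<Longrightarrow> g \<in> exp_span \<Longrightarrow> (\<lambda>x. f x + g x) \<in> exp_span"

lemma exp_span_mult_exp: "g \<in> exp_span \<Longrightarrow> (\<lambda>x. c * exp (a \<bullet> x) * g x) \<in> exp_span"
proof (induction rule: exp_span.induct)
  case (exp d b)
  have "(\<lambda>x. c * exp (a \<bullet> x) * (d * exp (b \<bullet> x))) = (\<lambda>x. (c * d) * exp ((a + b) \<bullet> x))"
    by (simp add: inner_add_left exp_add mult_ac)
  then show ?case using exp_span.exp[of "c * d" "a + b"] by simp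
next
  case (add f g)
  then show ?case using exp_span.add[OF add.IH] by (simp add: distrib_left)
qed

lemma exp_span_mult: "f \<in> exp_span \<Longrightarrow> g \<in> exp_span \<Longrightarrow> (\<lambda>x. f x * g x) \<in> exp_span"
proof (induction rule: exp_span.induct)
  case (exp c a)
  then show ?case by (rule exp_span_mult_exp)
next
  case (add f h)
  then show ?case using exp_span.add[of "\<lambda>x. f x * g x" "\<lambda>x. h x * g x"] by (simp add: distrib_right)
qed

lemma exp_span_approx:
  assumes "f \<in> exp_span" "e > 0"
  shows "\<exists>N q g. harmonic_expansion N q g \<and> (\<forall>x\<in>S2. \<bar>f x - g x\<bar> < e)"
  using assms
proof (induction arbitrary: e rule: exp_span.induct)
  case (exp c a)
  obtain u where u: "norm u = 1" "a = norm a *\<^sub>R u"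
  proof (cases "a = 0")
    case True then show ?thesis using that[of "axis 1 1"] by (simp add: norm_axis_1)
  next
    case False then show ?thesis using that[of "a /\<^sub>R norm a"] by simp
  qed
  have "continuous_on {-1..1} (\<lambda>z. c * exp (norm a * z))" by (intro continuous_intros)
  then obtain p where p: "\<And>z. z \<in> {-1..1} \<Longrightarrow> \<bar>c * exp (norm a * z) - poly p z\<bar> < e"
    using Weierstrass_poly[OF _ exp] by metis
  have "\<bar>c * exp (a \<bullet> x) - poly p (u \<bullet> x)\<bar> < e" if "x \<in> S2" for x
    using p[OF inner_S2_in[OF u(1) that]] by (subst u(2)) simp
  then show ?case using harmonic_expansion_poly[OF u(1), of p] by blast
next
  case (add f g)
  have e: "e / 2 > 0" using add.prems by simp
  obtain N q f' where f': "harmonic_expansion N q f'" "\<forall>x\<in>S2. \<bar>f x - f' x\<bar> < e / 2" using add.IH(1)[OF e] by blast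
  obtain M r g' where g': "harmonic_expansion M r g'" "\<forall>x\<in>S2. \<bar>g x - g' x\<bar> < e / 2" using add.IH(2)[OF e] by blast
  have "\<bar>(f x + g x) - (f' x + g' x)\<bar> < e" if "x \<in> S2" for x
    using bspec[OF f'(2) that] bspec[OF g'(2) that] by linarith
  then show ?case using harmonic_expansion_add[OF f'(1) g'(1)] by blast
qed

lemma exp_span_function_ring: "function_ring_on exp_span S2"
proof
  show "continuous_on S2 f" if "f \<in> exp_span" for f
    using that by induction (intro continuous_intros; assumption?)+
  show "(\<lambda>_. c) \<in> exp_span" for c using exp_span.exp[of c 0] by simp
  fix x y :: "real^3" assume "x \<noteq> y"
  have "(x - y) \<bullet> x \<noteq> (x - y) \<bullet> y"
    using \<open>x \<noteq> y\<close> by (metis eq_iff_diff_eq_0 inner_diff_right inner_eq_zero_iff)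
  then show "\<exists>f\<in>exp_span. f x \<noteq> f y"
    by (intro bexI[OF _ exp_span.exp[of 1 "x - y"]]) simp
qed (auto intro: exp_span.add exp_span_mult)

lemma harmonic_expansion_dense:
  assumes "continuous_on S2 f" "e > 0"
  shows "\<exists>N q g. harmonic_expansion N q g \<and> (\<forall>x\<in>S2. \<bar>f x - g x\<bar> < e)"
proof -
  interpret function_ring_on exp_span S2 by (rule exp_span_function_ring)
  have e: "e / 2 > 0" using assms(2) by simp
  obtain h where h: "h \<in> exp_span" "\<forall>x\<in>S2. \<bar>f x - h x\<bar> < e / 2" using Stone_Weierstrass_basic[OF assms(1) e] by blast
  obtain N q g where g: "harmonic_expansion N q g" "\<forall>x\<in>S2. \<bar>h x - g x\<bar> < e / 2" using exp_span_approx[OF h(1) e] by blast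
  have "\<bar>f x - g x\<bar> < e" if "x \<in> S2" for x
    using bspec[OF h(2) that] bspec[OF g(2) that] by linarith
  then show ?thesis using g(1) by blast
qed

definition energy :: "(real^3 \<Rightarrow> real) \<Rightarrow> real" where
  "energy f = (LINT x|sphere_measure. f x * log_potential f x)"

definition momentum :: "(real^3 \<Rightarrow> real) \<Rightarrow> real^3" where
  "momentum f = (\<chi> i. LINT x|sphere_measure. f x * x $ i)"

lemma inner_momentum:
  assumes "continuous_on S2 f"
  shows "b \<bullet> momentum f = (LINT x|sphere_measure. f x * (b \<bullet> x))"
proof -
  have "(LINT x|sphere_measure. f x * (b \<bullet> x)) = (LINT x|sphere_measure. (\<Sum>i\<in>UNIV. b $ i * (f x * x $ i)))"
    by (simp add: inner_vec_def sum_distrib_left mult_ac)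
  also have "\<dots> = (\<Sum>i\<in>UNIV. LINT x|sphere_measure. b $ i * (f x * x $ i))"
    by (intro Bochner_Integration.integral_sum integrable_sphere_measure continuous_intros assms)
  finally show ?thesis by (simp only: integral_mult_right_zero) (simp add: momentum_def inner_vec_def)
qed

text \<open>The divergence identity for the function \<open>b \<bullet> x\<close>, whose derivative
  along \<open>b\<close> is \<open>(norm b)\<^sup>2 - (b \<bullet> x)\<^sup>2\<close>, is a linear
  equation for the integral.\<close>

lemma sphere_integral_inner_square: "(LINT x|sphere_measure. (b \<bullet> x)\<^sup>2) = (norm b)\<^sup>2 * area / 3"
proof -
  have "2 * (LINT x|sphere_measure. (b \<bullet> x) * (b \<bullet> x)) = (LINT x|sphere_measure. sphere_deriv (\<lambda>x. b \<bullet> x) x b)"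
    by (rule sphere_integral_sphere_deriv[OF smooth_on_S2_inner, symmetric])
  also have "\<dots> = (LINT x|sphere_measure. (norm b)\<^sup>2 - (b \<bullet> x)\<^sup>2)"
    by (rule sphere_integral_cong) (simp add: sphere_deriv_inner dot_square_norm power2_eq_square[of "b \<bullet> _"] inner_commute[of _ b])
  also have "\<dots> = (LINT x|sphere_measure. (norm b)\<^sup>2) - (LINT x|sphere_measure. (b \<bullet> x)\<^sup>2)"
    by (intro Bochner_Integration.integral_diff integrable_sphere_measure continuous_intros)
  finally show ?thesis by (simp add: power2_eq_square[of "b \<bullet> _"] area_def[symmetric] mult.commute)
qed

lemma log_potential_sum:
  assumes "\<And>i. i \<in> I \<Longrightarrow> continuous_on S2 (f i)" "x \<in> S2"
  shows "log_potential (\<lambda>x. \<Sum>i\<in>I. f i x) x = (\<Sum>i\<in>I. log_potential (f i) x)"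
  unfolding log_potential_def sum_distrib_left
  using assms by (intro Bochner_Integration.integral_sum sphere_integrable_mult log_kernel_integrable) auto

lemma log_potential_cong: "(\<And>x. x \<in> S2 \<Longrightarrow> f x = g x) \<Longrightarrow> log_potential f = log_potential g"
  unfolding log_potential_def by (rule ext) (rule sphere_integral_cong, simp)

lemma sum_lessThan_plus3: "(\<Sum>l<M + 3. g l) = g 0 + g 1 + g 2 + (\<Sum>l<M. g (l + 3))" for g :: "nat \<Rightarrow> real"
  by (induction M) (simp_all add: numeral_3_eq_3 numeral_2_eq_2)

text \<open>Parseval: if a l is the squared norm of the component of degree l, the square integral
  is the sum of the a l, and the energy the sum with weights 1 / (l (l + 1)), except for weight
  \<open>k\<close> in degree 0. For l at least 3 the weight is at most 1/12, so it misses 1/6 by at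
  least 1/12, whence the factor 12. Degree 2 cancels, degree 0 is the mean, and degree 1 is bounded
  by the momentum.\<close>

lemma spectral_inequality_harmonic:
  "\<exists>C\<ge>0. \<forall>N q f. harmonic_expansion N q f \<longrightarrow> continuous_on S2 f \<longrightarrow>
    (LINT x|sphere_measure. (f x - q 2 x)\<^sup>2) \<le> 12 * ((LINT x|sphere_measure. (f x)\<^sup>2) / 6 - energy f)
      + C * ((LINT x|sphere_measure. f x)\<^sup>2 + (norm (momentum f))\<^sup>2)"
proof -
  obtain k where k: "\<And>x. x \<in> S2 \<Longrightarrow> log_potential (\<lambda>_. 1) x = k" using log_potential_const by metis
  \<comment> \<open>The first term is the factor of a 0, the squared integral over area. The second
    is 5 times the bound 3 / area for a 1 in terms of the squared momentum, where 5 = 1 + 12 (1/2 -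
    1/6).\<close>
  define C where "C = (1 + 12 * \<bar>k - 1/6\<bar>) / area + 15 / area"
  have C: "C \<ge> 0" using area_pos by (simp add: C_def)
  show ?thesis
  proof (intro exI[of _ C] conjI allI impI C)
    fix N q f assume "harmonic_expansion N q f" and cf: "continuous_on S2 f"
    then have he: "harmonic_expansion (N + 3) q f" using harmonic_expansion_mono by simp
    have q: "spherical_harmonic l (q l)" for l using he by (simp add: harmonic_expansion_def)
    have f: "f x = (\<Sum>l<N + 3. q l x)" if "x \<in> S2" for x using he that by (simp add: harmonic_expansion_def del: sum.lessThan_Suc)
    have cq: "continuous_on S2 (q l)" for l by (rule spherical_harmonicD(3)[OF q])
    define a where "a = (\<lambda>l. LINT x|sphere_measure. q l x * q l x)"
    have a0: "a l \<ge> 0" for l unfolding a_def by (rule Bochner_Integration.integral_nonneg) simp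
    have fh: "(LINT x|sphere_measure. f x * h x) = (\<Sum>l<N + 3. LINT x|sphere_measure. q l x * h x)" if h: "continuous_on S2 h" for h
    proof -
      have "(LINT x|sphere_measure. f x * h x) = (LINT x|sphere_measure. (\<Sum>l<N + 3. q l x * h x))"
        by (rule sphere_integral_cong) (simp only: f sum_distrib_right)
      also have "\<dots> = (\<Sum>l<N + 3. LINT x|sphere_measure. q l x * h x)"
        by (intro Bochner_Integration.integral_sum integrable_sphere_measure continuous_on_mult cq h)
      finally show ?thesis .
    qed
    have fq: "(LINT x|sphere_measure. f x * q m x) = a m" if m: "m < N + 3" for m
    proof -
      have "(LINT x|sphere_measure. f x * q m x) = (\<Sum>l<N + 3. if l = m then a m else 0)"
        unfolding fh[OF cq] using spherical_harmonic_orthogonal[OF q q] by (intro sum.cong) (auto simp: a_def)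
      then show ?thesis using m by (simp del: sum.lessThan_Suc)
    qed
    \<comment> \<open>The formula 1 / (l (l + 1)) does not apply to constants; there the eigenvalue
      is the value \<open>k\<close> from \<open>log_potential_const\<close>.\<close>
    define \<kappa> where "\<kappa> = (\<lambda>l::nat. if l = 0 then k else 1 / real (l * (l + 1)))"
    obtain c where c: "\<forall>x\<in>S2. q 0 x = c" using spherical_harmonic_0[OF q] by blast
    have lq: "log_potential (q l) x = \<kappa> l * q l x" if x: "x \<in> S2" for l x
    proof (cases "l = 0")
      case True
      have "log_potential (q 0) x = c * log_potential (\<lambda>_. 1) x"
      proof -
        have e: "log_potential (q 0) = log_potential (\<lambda>_. c)" by (rule log_potential_cong) (rule bspec[OF c])
        show ?thesis unfolding e by (simp add: log_potential_def)
      qed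
      then show ?thesis using True k[OF x] bspec[OF c x] by (simp add: \<kappa>_def)
    next
      case False
      then show ?thesis using log_potential_spherical_harmonic[OF q False x] by (simp add: \<kappa>_def)
    qed
    have lf: "log_potential f x = (\<Sum>l<N + 3. \<kappa> l * q l x)" if x: "x \<in> S2" for x
    proof -
      have "log_potential f x = log_potential (\<lambda>x. \<Sum>l<N + 3. q l x) x"
        by (rule fun_cong[OF log_potential_cong]) (rule f)
      also have "\<dots> = (\<Sum>l<N + 3. log_potential (q l) x)" by (rule log_potential_sum[OF cq x])
      finally show ?thesis by (simp only: lq[OF x])
    qed
    have sq: "(LINT x|sphere_measure. (f x)\<^sup>2) = (\<Sum>l<N + 3. a l)"
    proof -
      have "(LINT x|sphere_measure. (f x)\<^sup>2) = (\<Sum>l<N + 3. LINT x|sphere_measure. q l x * f x)"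
        unfolding power2_eq_square by (rule fh[OF cf])
      also have "\<dots> = (\<Sum>l<N + 3. a l)" by (intro sum.cong refl) (simp add: fq[symmetric] mult.commute)
      finally show ?thesis .
    qed
    have en: "energy f = (\<Sum>l<N + 3. \<kappa> l * a l)"
    proof -
      have "energy f = (LINT x|sphere_measure. (\<Sum>l<N + 3. \<kappa> l * (f x * q l x)))"
        unfolding energy_def by (rule sphere_integral_cong) (simp only: lf sum_distrib_left mult.left_commute)
      also have "\<dots> = (\<Sum>l<N + 3. LINT x|sphere_measure. \<kappa> l * (f x * q l x))"
        by (intro Bochner_Integration.integral_sum integrable_sphere_measure continuous_on_mult continuous_on_const cq cf)
      also have "\<dots> = (\<Sum>l<N + 3. \<kappa> l * a l)"
        unfolding integral_mult_right_zero by (intro sum.cong refl) (simp add: fq)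
      finally show ?thesis .
    qed
    have d: "(LINT x|sphere_measure. (f x - q 2 x)\<^sup>2) = (\<Sum>l<N + 3. a l) - a 2"
    proof -
      have "(LINT x|sphere_measure. (f x - q 2 x)\<^sup>2) = (LINT x|sphere_measure. (f x)\<^sup>2 - (2 * (f x * q 2 x) - q 2 x * q 2 x))"
        by (rule sphere_integral_cong) (simp add: power2_eq_square algebra_simps)
      also have "\<dots> = (LINT x|sphere_measure. (f x)\<^sup>2) - ((LINT x|sphere_measure. 2 * (f x * q 2 x)) - (LINT x|sphere_measure. q 2 x * q 2 x))"
      proof -
        have i1: "integrable sphere_measure (\<lambda>x. (f x)\<^sup>2)" and i2: "integrable sphere_measure (\<lambda>x. 2 * (f x * q 2 x))"
          and i3: "integrable sphere_measure (\<lambda>x. q 2 x * q 2 x)"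
          by (intro integrable_sphere_measure continuous_intros cf cq)+
        show ?thesis
          by (simp only: Bochner_Integration.integral_diff[OF i1 Bochner_Integration.integrable_diff[OF i2 i3]] Bochner_Integration.integral_diff[OF i2 i3])
      qed
      finally show ?thesis using fq[of 2] by (simp add: sq a_def del: sum.lessThan_Suc)
    qed
    define R where "R = (\<Sum>l<N. a (l + 3))"
    have R0: "R \<ge> 0" unfolding R_def by (intro sum_nonneg a0)
    have s1: "(\<Sum>l<N + 3. a l) = a 0 + a 1 + a 2 + R" unfolding R_def by (rule sum_lessThan_plus3)
    have "(\<Sum>l<N + 3. \<kappa> l * a l) = \<kappa> 0 * a 0 + \<kappa> 1 * a 1 + \<kappa> 2 * a 2 + (\<Sum>l<N. \<kappa> (l + 3) * a (l + 3))"
      by (rule sum_lessThan_plus3)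
    also have "(\<Sum>l<N. \<kappa> (l + 3) * a (l + 3)) \<le> (\<Sum>l<N. (1/12) * a (l + 3))"
    proof (intro sum_mono mult_right_mono a0)
      fix l :: nat
      have "3 * 4 \<le> (l + 3) * (l + 3 + 1)" by (intro mult_mono) auto
      then have "real 12 \<le> real ((l + 3) * (l + 3 + 1))" by (subst of_nat_le_iff) simp
      then have "1 / real ((l + 3) * (l + 3 + 1)) \<le> 1 / 12" by (intro divide_left_mono) simp_all
      then show "\<kappa> (l + 3) \<le> 1/12" by (simp only: \<kappa>_def) simp
    qed
    also have "(\<Sum>l<N. (1/12) * a (l + 3)) = R / 12" unfolding R_def sum_distrib_left[symmetric] by simp
    finally have s2: "energy f \<le> k * a 0 + a 1 / 2 + a 2 / 6 + R / 12"
      unfolding en by (simp add: \<kappa>_def)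
    have b0: "a 0 = (LINT x|sphere_measure. f x)\<^sup>2 / area"
    proof -
      have "(LINT x|sphere_measure. q 0 x) = (LINT x|sphere_measure. c)" by (rule sphere_integral_cong) (use c in blast)
      then have q0: "(LINT x|sphere_measure. q 0 x) = area * c" by (simp add: area_def[symmetric])
      have "(LINT x|sphere_measure. q l x) = 0" if "l \<noteq> 0" for l
        using spherical_harmonic_orthogonal[OF q spherical_harmonic_const[of 1] that] by simp
      then have "(LINT x|sphere_measure. f x * 1) = (\<Sum>l<N + 3. if l = 0 then area * c else 0)"
        unfolding fh[OF continuous_on_const] using q0 by (intro sum.cong) auto
      then have i: "(LINT x|sphere_measure. f x) = area * c" by (simp del: sum.lessThan_Suc)
      have "a 0 = (LINT x|sphere_measure. c * c)" unfolding a_def by (rule sphere_integral_cong) (simp add: bspec[OF c])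
      then have "a 0 = area * (c * c)" by (simp add: area_def[symmetric])
      then show ?thesis unfolding i using area_pos by (simp add: power2_eq_square)
    qed
    have b1: "a 1 \<le> 3 * (norm (momentum f))\<^sup>2 / area"
    proof -
      obtain b where b: "\<forall>x\<in>S2. q 1 x = b \<bullet> x" using spherical_harmonic_1[OF q] by blast
      have "a 1 = (LINT x|sphere_measure. (b \<bullet> x)\<^sup>2)" unfolding a_def by (rule sphere_integral_cong) (simp only: bspec[OF b] power2_eq_square)
      then have e1: "a 1 = (norm b)\<^sup>2 * area / 3" by (simp only: sphere_integral_inner_square)
      have "a 1 = (LINT x|sphere_measure. f x * q 1 x)" by (rule fq[symmetric]) simp
      also have "\<dots> = (LINT x|sphere_measure. f x * (b \<bullet> x))" by (rule sphere_integral_cong) (simp only: bspec[OF b])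
      also have "\<dots> = b \<bullet> momentum f" by (rule inner_momentum[OF cf, symmetric])
      also have "\<dots> \<le> norm b * norm (momentum f)" by (rule norm_cauchy_schwarz)
      finally have e2: "(norm b)\<^sup>2 * area / 3 \<le> norm b * norm (momentum f)" using e1 by simp
      have "norm b * area \<le> 3 * norm (momentum f)"
      proof (cases "norm b = 0")
        case False
        then have "norm b > 0" by simp
        moreover have "norm b * (norm b * area) \<le> norm b * (3 * norm (momentum f))" using e2 by (simp add: power2_eq_square)
        ultimately show ?thesis by (simp only: mult_le_cancel_left_pos)
      qed simp
      then have "(norm b * area)\<^sup>2 \<le> (3 * norm (momentum f))\<^sup>2" using area_pos by (intro power_mono) auto
      then have "a 1 * 3 * area \<le> 9 * (norm (momentum f))\<^sup>2" unfolding e1 by (simp add: power2_eq_square algebra_simps)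
      then show ?thesis using area_pos by (simp add: field_simps)
    qed
    have "R \<le> 12 * ((LINT x|sphere_measure. (f x)\<^sup>2) / 6 - energy f) + 12 * (k - 1/6) * a 0 + 4 * a 1"
      using s2 unfolding sq s1 by (simp add: field_simps)
    moreover have "(k - 1/6) * a 0 \<le> \<bar>k - 1/6\<bar> * a 0" by (intro mult_right_mono a0) simp
    ultimately have "(LINT x|sphere_measure. (f x - q 2 x)\<^sup>2) \<le> 12 * ((LINT x|sphere_measure. (f x)\<^sup>2) / 6 - energy f) + (1 + 12 * \<bar>k - 1/6\<bar>) * a 0 + 5 * a 1"
      unfolding d s1 by (simp add: algebra_simps)
    also have "(1 + 12 * \<bar>k - 1/6\<bar>) * a 0 \<le> C * (LINT x|sphere_measure. f x)\<^sup>2"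
      unfolding b0 C_def using area_pos by (simp add: field_simps)
    also have "5 * a 1 \<le> C * (norm (momentum f))\<^sup>2"
    proof -
      have "5 * a 1 \<le> (15 / area) * (norm (momentum f))\<^sup>2" using b1 by simp
      also have "\<dots> \<le> C * (norm (momentum f))\<^sup>2" unfolding C_def using area_pos by (intro mult_right_mono) simp_all
      finally show ?thesis .
    qed
    finally show "(LINT x|sphere_measure. (f x - q 2 x)\<^sup>2) \<le> 12 * ((LINT x|sphere_measure. (f x)\<^sup>2) / 6 - energy f)
      + C * ((LINT x|sphere_measure. f x)\<^sup>2 + (norm (momentum f))\<^sup>2)" by (simp add: distrib_left)
  qed
qed

section \<open>From finite expansions to continuous functions\<close>

lemma sphere_integral_uniform_limit:
  fixes f :: "nat \<Rightarrow> real^3 \<Rightarrow> real"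
  assumes u: "uniform_limit S2 f g sequentially" and f: "\<And>n. continuous_on S2 (f n)" and g: "continuous_on S2 g"
  shows "(\<lambda>n. LINT x|sphere_measure. f n x) \<longlonglongrightarrow> (LINT x|sphere_measure. g x)"
proof (rule tendstoI)
  fix e :: real assume e: "e > 0"
  have "\<forall>\<^sub>F n in sequentially. \<forall>x\<in>S2. dist (f n x) (g x) < e / (2 * area)"
    by (rule uniform_limitD[OF u]) (use e area_pos in simp)
  then show "\<forall>\<^sub>F n in sequentially. dist (LINT x|sphere_measure. f n x) (LINT x|sphere_measure. g x) < e"
  proof (rule eventually_mono)
    fix n assume n: "\<forall>x\<in>S2. dist (f n x) (g x) < e / (2 * area)"
    have "(LINT x|sphere_measure. f n x) - (LINT x|sphere_measure. g x) = (LINT x|sphere_measure. 1 * (f n x - g x))"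
      by (simp add: integrable_sphere_measure f g)
    also have "\<bar>\<dots>\<bar> \<le> (LINT x|sphere_measure. \<bar>1\<bar>) * (e / (2 * area))"
    proof (rule sphere_integral_abs_le)
      show "integrable sphere_measure (\<lambda>x. 1 :: real)" by simp
      show "continuous_on S2 (\<lambda>x. f n x - g x)" by (intro continuous_on_diff f g)
      show "\<bar>f n x - g x\<bar> \<le> e / (2 * area)" if "x \<in> S2" for x using bspec[OF n that] by (simp add: dist_real_def)
    qed
    also have "\<dots> = e / 2" using area_pos by (simp add: area_def[symmetric])
    also have "\<dots> < e" using e by simp
    finally show "dist (LINT x|sphere_measure. f n x) (LINT x|sphere_measure. g x) < e" by (simp add: dist_real_def)
  qed
qed

lemma log_potential_bound:
  "\<exists>C>0. \<forall>f M. continuous_on S2 f \<longrightarrow> (\<forall>y\<in>S2. \<bar>f y\<bar> \<le> M) \<longrightarrow> (\<forall>x\<in>S2. \<bar>log_potential f x\<bar> \<le> C * M)"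
proof -
  define C :: real where "C = ((2 * 1) powr 1 + 2) / area powr 1 * (4 * area)"
  have C: "C > 0" using area_pos by (simp add: C_def)
  show ?thesis
  proof (intro exI[of _ C] conjI allI impI ballI C)
    fix f :: "real^3 \<Rightarrow> real" and M :: real and x :: "real^3"
    assume f: "continuous_on S2 f" and fM: "\<forall>y\<in>S2. \<bar>f y\<bar> \<le> M" and x: "x \<in> S2"
    have nx: "norm x = 1" using x by simp
    have M: "M \<ge> 0" using order.trans[OF abs_ge_zero bspec[OF fM x]] .
    have "\<bar>log_potential f x\<bar> \<le> (LINT y|sphere_measure. \<bar>log_kernel 0 (x \<bullet> y)\<bar>) * M"
      unfolding log_potential_def by (rule sphere_integral_abs_le[OF log_kernel_integrable[OF nx] f bspec[OF fM]])
    also have "(LINT y|sphere_measure. \<bar>log_kernel 0 (x \<bullet> y)\<bar>) \<le> C"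
      using log_kernel_powr_integrable(2)[OF nx, of 1] by (simp add: C_def)
    finally show "\<bar>log_potential f x\<bar> \<le> C * M" using M by (simp add: mult_right_mono)
  qed
qed

lemma log_potential_uniform_limit:
  fixes f :: "nat \<Rightarrow> real^3 \<Rightarrow> real"
  assumes u: "uniform_limit S2 f g sequentially" and f: "\<And>n. continuous_on S2 (f n)" and g: "continuous_on S2 g"
  shows "uniform_limit S2 (\<lambda>n. log_potential (f n)) (log_potential g) sequentially"
proof (rule uniform_limitI)
  fix e :: real assume e: "e > 0"
  obtain C where C0: "C > 0" "\<forall>f M. continuous_on S2 f \<longrightarrow> (\<forall>y\<in>S2. \<bar>f y\<bar> \<le> M) \<longrightarrow> (\<forall>x\<in>S2. \<bar>log_potential f x\<bar> \<le> C * M)"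
    using log_potential_bound by blast
  note C = C0(1) C0(2)[rule_format]
  have "\<forall>\<^sub>F n in sequentially. \<forall>x\<in>S2. dist (f n x) (g x) < e / (2 * C)"
    by (rule uniform_limitD[OF u]) (use e C(1) in simp)
  then show "\<forall>\<^sub>F n in sequentially. \<forall>x\<in>S2. dist (log_potential (f n) x) (log_potential g x) < e"
  proof (rule eventually_mono, intro ballI)
    fix n x assume n: "\<forall>x\<in>S2. dist (f n x) (g x) < e / (2 * C)" and x: "x \<in> S2"
    have "\<bar>log_potential (\<lambda>y. f n y - g y) x\<bar> \<le> C * (e / (2 * C))"
    proof (rule C(2)[OF _ _ x])
      show "continuous_on S2 (\<lambda>x. f n x - g x)" by (intro continuous_on_diff f g)
      show "\<bar>f n y - g y\<bar> \<le> e / (2 * C)" if "y \<in> S2" for y using bspec[OF n that] by (simp add: dist_real_def)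
    qed
    also have "\<dots> = e / 2" using C(1) by simp
    also have "\<dots> < e" using e by simp
    finally show "dist (log_potential (f n) x) (log_potential g x) < e"
      by (simp only: log_potential_diff[OF f g x] dist_real_def)
  qed
qed

lemma bounded_continuous_S2: "continuous_on S2 f \<Longrightarrow> bounded (f ` S2)" for f :: "real^3 \<Rightarrow> real"
  by (rule compact_imp_bounded[OF compact_continuous_image[OF _ compact_sphere]])

lemma power2_add_le: "(a + b)\<^sup>2 \<le> 2 * a\<^sup>2 + 2 * b\<^sup>2" for a b :: real
  using zero_le_power2[of "a - b"] by (simp add: power2_eq_square algebra_simps)

text \<open>Finite expansions are uniformly dense, and all functionals involved are continuous under
  uniform limits. The factor 24 is twice 12, from splitting the square of a sum; the slack
  \<open>e\<close> absorbs the approximation error, so that no limit of the degree-2 components is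
  taken.\<close>

lemma spectral_inequality:
  "\<exists>C\<ge>0. \<forall>f e. continuous_on S2 f \<longrightarrow> e > 0 \<longrightarrow> (\<exists>h. spherical_harmonic 2 h \<and>
    (LINT x|sphere_measure. (f x - h x)\<^sup>2) \<le> 24 * ((LINT x|sphere_measure. (f x)\<^sup>2) / 6 - energy f)
      + C * ((LINT x|sphere_measure. f x)\<^sup>2 + (norm (momentum f))\<^sup>2) + e)"
proof -
  obtain C where C0: "C \<ge> 0" "\<forall>N q f. harmonic_expansion N q f \<longrightarrow> continuous_on S2 f \<longrightarrow>
    (LINT x|sphere_measure. (f x - q 2 x)\<^sup>2) \<le> 12 * ((LINT x|sphere_measure. (f x)\<^sup>2) / 6 - energy f)
      + C * ((LINT x|sphere_measure. f x)\<^sup>2 + (norm (momentum f))\<^sup>2)"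
    using spectral_inequality_harmonic by blast
  note C = C0(1) C0(2)[rule_format]
  show ?thesis
  proof (intro exI[of _ "2 * C"] conjI allI impI)
    show "2 * C \<ge> 0" using C(1) by simp
    fix f :: "real^3 \<Rightarrow> real" and e :: real assume f: "continuous_on S2 f" and e: "e > 0"
    define B where "B = (\<lambda>f. 12 * ((LINT x|sphere_measure. (f x)\<^sup>2) / 6 - energy f) + C * ((LINT x|sphere_measure. f x)\<^sup>2 + (norm (momentum f))\<^sup>2))"
    have "\<exists>g. \<forall>n. \<exists>N q. harmonic_expansion N q (g n) \<and> (\<forall>x\<in>S2. \<bar>f x - g n x\<bar> < eps n)"
      by (rule choice) (use harmonic_expansion_dense[OF f eps_pos] in blast)
    then obtain g where g: "\<forall>n. \<exists>N q. harmonic_expansion N q (g n) \<and> (\<forall>x\<in>S2. \<bar>f x - g n x\<bar> < eps n)" by (rule exE)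
    have gl: "\<forall>x\<in>S2. \<bar>f x - g n x\<bar> < eps n" for n using g by blast
    have cg: "continuous_on S2 (g n)" for n
    proof -
      obtain N q where q: "harmonic_expansion N q (g n)" using g by blast
      have "continuous_on S2 (\<lambda>x. \<Sum>l<N. q l x)"
      proof (rule continuous_on_sum)
        fix l
        have "spherical_harmonic l (q l)" using q by (simp add: harmonic_expansion_def)
        then show "continuous_on S2 (q l)" by (rule spherical_harmonicD(3))
      qed
      then show ?thesis by (rule continuous_on_eq) (use q in \<open>simp add: harmonic_expansion_def\<close>)
    qed
    have u: "uniform_limit S2 g f sequentially"
    proof (rule uniform_limitI)
      fix r :: real assume "r > 0"
      then have "\<forall>\<^sub>F n in sequentially. eps n < r" using eps_tendsto by (intro order_tendstoD)
      then show "\<forall>\<^sub>F n in sequentially. \<forall>x\<in>S2. dist (g n x) (f x) < r"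
      proof (rule eventually_mono, intro ballI)
        fix n x assume "eps n < r" "x \<in> S2"
        then show "dist (g n x) (f x) < r" using bspec[OF gl, of x n] by (simp add: dist_real_def abs_minus_commute)
      qed
    qed
    note bf = bounded_continuous_S2[OF f]
    have ci: "continuous_on S2 (\<lambda>x. x $ i)" for i :: 3 by (intro continuous_intros)
    have lim2: "(\<lambda>n. LINT x|sphere_measure. (g n x)\<^sup>2) \<longlonglongrightarrow> (LINT x|sphere_measure. (f x)\<^sup>2)"
      unfolding power2_eq_square
      by (intro sphere_integral_uniform_limit uniform_lim_mult u bf continuous_on_mult cg f)
    have limE: "(\<lambda>n. energy (g n)) \<longlonglongrightarrow> energy f"
      unfolding energy_def
      by (intro sphere_integral_uniform_limit uniform_lim_mult log_potential_uniform_limit u bf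
          bounded_continuous_S2 continuous_on_mult continuous_on_log_potential cg f)
    have lim1: "(\<lambda>n. LINT x|sphere_measure. g n x) \<longlonglongrightarrow> (LINT x|sphere_measure. f x)"
      by (rule sphere_integral_uniform_limit[OF u cg f])
    have limm: "(\<lambda>n. momentum (g n)) \<longlonglongrightarrow> momentum f"
      unfolding momentum_def
      by (intro tendsto_vec_lambda sphere_integral_uniform_limit uniform_lim_mult u bf uniform_limit_const bounded_continuous_S2 continuous_on_mult cg f ci)
    have limB: "(\<lambda>n. B (g n)) \<longlonglongrightarrow> B f"
      unfolding B_def by (intro tendsto_intros lim2 limE lim1 limm) simp
    have limd: "(\<lambda>n. LINT x|sphere_measure. (f x - g n x)\<^sup>2) \<longlonglongrightarrow> (LINT x|sphere_measure. (f x - f x)\<^sup>2)"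
      unfolding power2_eq_square
      by (intro sphere_integral_uniform_limit uniform_lim_mult uniform_limit_minus uniform_limit_const u bounded_continuous_S2 continuous_on_mult continuous_on_diff cg f)
    have ev1: "\<forall>\<^sub>F n in sequentially. B (g n) < B f + e / 4" using limB e by (intro order_tendstoD) auto
    have ev2: "\<forall>\<^sub>F n in sequentially. (LINT x|sphere_measure. (f x - g n x)\<^sup>2) < e / 4"
      using limd e by (intro order_tendstoD(2)[OF limd]) simp
    obtain n where n: "B (g n) < B f + e / 4" "(LINT x|sphere_measure. (f x - g n x)\<^sup>2) < e / 4"
      using eventually_happens[OF eventually_conj[OF ev1 ev2]] by auto
    obtain N q where q: "harmonic_expansion N q (g n)" using g by blast
    have h: "spherical_harmonic 2 (q 2)" using q by (simp add: harmonic_expansion_def)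
    note ch = spherical_harmonicD(3)[OF h]
    have i1: "integrable sphere_measure (\<lambda>x. 2 * (f x - g n x)\<^sup>2)" and i2: "integrable sphere_measure (\<lambda>x. 2 * (g n x - q 2 x)\<^sup>2)"
      by (intro integrable_sphere_measure continuous_intros f cg ch)+
    have "(LINT x|sphere_measure. (f x - q 2 x)\<^sup>2) \<le> (LINT x|sphere_measure. 2 * (f x - g n x)\<^sup>2 + 2 * (g n x - q 2 x)\<^sup>2)"
    proof (rule sphere_integral_mono)
      show "continuous_on S2 (\<lambda>x. (f x - q 2 x)\<^sup>2)" by (intro continuous_intros f ch)
      show "continuous_on S2 (\<lambda>x. 2 * (f x - g n x)\<^sup>2 + 2 * (g n x - q 2 x)\<^sup>2)" by (intro continuous_intros f cg ch)
      show "(f x - q 2 x)\<^sup>2 \<le> 2 * (f x - g n x)\<^sup>2 + 2 * (g n x - q 2 x)\<^sup>2" for x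
        using power2_add_le[of "f x - g n x" "g n x - q 2 x"] by simp
    qed
    also have "\<dots> = 2 * (LINT x|sphere_measure. (f x - g n x)\<^sup>2) + 2 * (LINT x|sphere_measure. (g n x - q 2 x)\<^sup>2)"
      unfolding Bochner_Integration.integral_add[OF i1 i2] integral_mult_right_zero ..
    also have "\<dots> \<le> 2 * B f + e"
    proof -
      have "(LINT x|sphere_measure. (g n x - q 2 x)\<^sup>2) \<le> B (g n)" using C(2)[OF q cg] by (simp only: B_def)
      moreover have "2 * u + 2 * v \<le> 2 * b + e" if "v \<le> w" "w < b + e / 4" "u < e / 4" for u v w b :: real
        using that by linarith
      ultimately show ?thesis using n by blast
    qed
    finally show "\<exists>h. spherical_harmonic 2 h \<and>
      (LINT x|sphere_measure. (f x - h x)\<^sup>2) \<le> 24 * ((LINT x|sphere_measure. (f x)\<^sup>2) / 6 - energy f)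
      + 2 * C * ((LINT x|sphere_measure. f x)\<^sup>2 + (norm (momentum f))\<^sup>2) + e"
      using h unfolding B_def by (intro exI[of _ "q 2"]) (simp add: algebra_simps)
  qed
qed

text \<open>With d = f - g and potential G, the difference of energies is the integral of d Gd + 2 d
  Gg. Gd is bounded uniformly by Young's inequality, because the kernel lies in L^q for the
  conjugate exponent and the integral of |d|^p is at most 1; Gg is bounded by a multiple of
  \<open>M\<close>. What remains is linear in the L^1 norm of \<open>d\<close>, with a constant that
  does not see the size of \<open>f\<close>.\<close>

lemma energy_lipschitz:
  assumes p: "p > 1"
  shows "\<exists>C>0. \<forall>f g M. continuous_on S2 f \<longrightarrow> continuous_on S2 g \<longrightarrow> (\<forall>x\<in>S2. \<bar>g x\<bar> \<le> M) \<longrightarrow>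
    (LINT x|sphere_measure. \<bar>f x - g x\<bar> powr p) \<le> 1 \<longrightarrow> \<bar>energy f - energy g\<bar> \<le> (C + C * M) * (LINT x|sphere_measure. \<bar>f x - g x\<bar>)"
proof -
  define q where "q = p / (p - 1)"
  have q: "q \<ge> 1" using p by (simp add: q_def)
  obtain C1 where C10: "C1 > 0" "\<forall>f M. continuous_on S2 f \<longrightarrow> (\<forall>y\<in>S2. \<bar>f y\<bar> \<le> M) \<longrightarrow> (\<forall>x\<in>S2. \<bar>log_potential f x\<bar> \<le> C1 * M)"
    using log_potential_bound by blast
  note C1 = C10(1) C10(2)[rule_format]
  define C2 where "C2 = ((2 * q) powr q + 2) / area powr q * (4 * area)"
  have C2: "C2 \<ge> 0" using area_pos by (simp add: C2_def)
  define C where "C = C2 + 1 + 2 * C1"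
  have C: "C > 0" using C1(1) C2 by (simp add: C_def)
  \<comment> \<open>Young's inequality with constant 1: either u is at most v^(p-1), and u v is at
    most v^p, or v is at most u^(1/(p-1)), and u v is at most u^q.\<close>
  have young: "u * v \<le> u powr q + v powr p" if "u \<ge> 0" "v \<ge> 0" for u v :: real
  proof (cases "u \<le> v powr (p - 1)")
    case True
    have "u * v \<le> v powr (p - 1) * v" using True that by (intro mult_right_mono)
    also have "\<dots> = v powr p" using that by (cases "v = 0") (auto simp: powr_mult_base mult.commute)
    finally show ?thesis by (simp add: add_increasing)
  next
    case False
    then have u: "v powr (p - 1) \<le> u" by simp
    have "(v powr (p - 1)) powr (1 / (p - 1)) \<le> u powr (1 / (p - 1))"
      using u p by (intro powr_mono2) auto
    then have "v \<le> u powr (1 / (p - 1))" using that p by (simp add: powr_powr)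
    then have "u * v \<le> u * u powr (1 / (p - 1))" using that by (intro mult_left_mono)
    also have "\<dots> = u powr q"
    proof (cases "u = 0")
      case False
      then have "u * u powr (1 / (p - 1)) = u powr (1 + 1 / (p - 1))" using that by (simp add: powr_mult_base)
      also have "1 + 1 / (p - 1) = q" using p by (simp add: q_def field_simps)
      finally show ?thesis .
    qed simp
    finally show ?thesis by (simp add: add_increasing2)
  qed
  show ?thesis
  proof (intro exI[of _ C] conjI allI impI C)
    fix f g :: "real^3 \<Rightarrow> real" and M :: real
    assume f: "continuous_on S2 f" and g: "continuous_on S2 g" and M0: "\<forall>x\<in>S2. \<bar>g x\<bar> \<le> M"
      and small: "(LINT x|sphere_measure. \<bar>f x - g x\<bar> powr p) \<le> 1"
    note M = bspec[OF M0]
    define d where "d = (\<lambda>x. f x - g x)"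
    have d: "continuous_on S2 d" unfolding d_def by (intro continuous_on_diff f g)
    have M0: "M \<ge> 0" using order.trans[OF abs_ge_zero M[of "axis 1 1"]] by (simp add: norm_axis_1)
    note cl = continuous_on_log_potential
    have Ld: "\<bar>log_potential d x\<bar> \<le> C2 + 1" if x: "x \<in> S2" for x
    proof -
      have nx: "norm x = 1" using x by simp
      have dp: "integrable sphere_measure (\<lambda>y. \<bar>d y\<bar> powr p)"
        using p by (intro integrable_sphere_measure continuous_on_abs_powr d) simp
      note Kq = log_kernel_powr_integrable[OF nx q]
      note Kd = sphere_integrable_mult[OF log_kernel_integrable[OF nx] d]
      have "\<bar>log_potential d x\<bar> \<le> (LINT y|sphere_measure. \<bar>log_kernel 0 (x \<bullet> y) * d y\<bar>)"
        unfolding log_potential_def using integral_norm_bound[of sphere_measure "\<lambda>y. log_kernel 0 (x \<bullet> y) * d y"] by simp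
      also have "\<dots> \<le> (LINT y|sphere_measure. \<bar>log_kernel 0 (x \<bullet> y)\<bar> powr q + \<bar>d y\<bar> powr p)"
        by (rule integral_mono[OF integrable_abs[OF Kd] Bochner_Integration.integrable_add[OF Kq(1) dp]])
          (simp only: abs_mult young abs_ge_zero)
      also have "\<dots> = (LINT y|sphere_measure. \<bar>log_kernel 0 (x \<bullet> y)\<bar> powr q) + (LINT y|sphere_measure. \<bar>d y\<bar> powr p)"
        by (rule Bochner_Integration.integral_add[OF Kq(1) dp])
      also have "\<dots> \<le> C2 + 1" using Kq(2) small by (simp add: C2_def d_def)
      finally show ?thesis .
    qed
    have Lg: "\<bar>log_potential g x\<bar> \<le> C1 * M" if "x \<in> S2" for x by (rule C1(2)[OF g M that])
    have i: "integrable sphere_measure (\<lambda>x. u x * v x)" if "continuous_on S2 u" "continuous_on S2 v" for u v :: "real^3 \<Rightarrow> real"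
      using that by (intro integrable_sphere_measure continuous_on_mult)
    have Lf: "log_potential f x = log_potential d x + log_potential g x" if "x \<in> S2" for x
      using log_potential_diff[OF f g that] by (simp add: d_def)
    have "energy f = (LINT x|sphere_measure. (d x * log_potential d x + d x * log_potential g x) + (g x * log_potential d x + g x * log_potential g x))"
      unfolding energy_def by (rule sphere_integral_cong) (simp only: Lf, simp add: d_def algebra_simps)
    also have "\<dots> = ((LINT x|sphere_measure. d x * log_potential d x) + (LINT x|sphere_measure. d x * log_potential g x))
       + ((LINT x|sphere_measure. g x * log_potential d x) + (LINT x|sphere_measure. g x * log_potential g x))"
      by (simp only: Bochner_Integration.integral_add[OF Bochner_Integration.integrable_add[OF i i] Bochner_Integration.integrable_add[OF i i]]
          Bochner_Integration.integral_add[OF i i] d g cl)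
    also have "(LINT x|sphere_measure. g x * log_potential d x) = (LINT x|sphere_measure. d x * log_potential g x)"
      using log_potential_symmetric[OF d g] by (simp add: mult.commute)
    finally have "energy f - energy g = (LINT x|sphere_measure. d x * log_potential d x) + 2 * (LINT x|sphere_measure. d x * log_potential g x)"
      by (simp add: energy_def)
    moreover have "\<bar>LINT x|sphere_measure. d x * log_potential d x\<bar> \<le> (LINT x|sphere_measure. \<bar>d x\<bar>) * (C2 + 1)"
      by (rule sphere_integral_abs_le[OF integrable_sphere_measure[OF d] cl[OF d] Ld])
    moreover have "\<bar>LINT x|sphere_measure. d x * log_potential g x\<bar> \<le> (LINT x|sphere_measure. \<bar>d x\<bar>) * (C1 * M)"
      by (rule sphere_integral_abs_le[OF integrable_sphere_measure[OF d] cl[OF g] Lg])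
    ultimately have "\<bar>energy f - energy g\<bar> \<le> (LINT x|sphere_measure. \<bar>d x\<bar>) * (C2 + 1) + 2 * ((LINT x|sphere_measure. \<bar>d x\<bar>) * (C1 * M))"
      by linarith
    also have "\<dots> = (C2 + 1 + 2 * C1 * M) * (LINT x|sphere_measure. \<bar>d x\<bar>)" by (simp add: algebra_simps)
    also have "\<dots> \<le> (C + C * M) * (LINT x|sphere_measure. \<bar>d x\<bar>)"
    proof (rule mult_right_mono)
      have "2 * C1 * M \<le> C * M" using M0 C2 by (intro mult_right_mono) (simp_all add: C_def)
      then show "C2 + 1 + 2 * C1 * M \<le> C + C * M" using C1(1) by (simp add: C_def)
      show "0 \<le> (LINT x|sphere_measure. \<bar>d x\<bar>)" by (rule Bochner_Integration.integral_nonneg) simp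
    qed
    finally show "\<bar>energy f - energy g\<bar> \<le> (C + C * M) * (LINT x|sphere_measure. \<bar>f x - g x\<bar>)"
      by (simp add: d_def)
  qed
qed


section \<open>Conservation laws\<close>

lemma smooth_on_imp_continuous_on:
  assumes "smooth_on S f" shows "continuous_on S f"
proof (rule continuous_on_local)
  fix z assume "z \<in> S"
  with assms have "\<exists>U F. open U \<and> z \<in> U \<and> (\<forall>k. Ck_on k U F) \<and> (\<forall>y\<in>S \<inter> U. F y = f y)"
    unfolding smooth_on_def by (rule bspec)
  then obtain U F where U: "open U" "z \<in> U" "\<forall>k. Ck_on k U F" "\<forall>y\<in>S \<inter> U. F y = f y" by blast
  have "continuous_on U F" using U(3) Ck_on_imp_continuous_on by blast
  then have "continuous_on (S \<inter> U) F" by (rule continuous_on_subset) blast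
  then have "continuous_on (S \<inter> U) f" by (rule continuous_on_eq) (use U(4) in blast)
  then show "\<exists>W. open W \<and> z \<in> W \<and> continuous_on (S \<inter> W) f" using U by blast
qed

lemma Ck_on_fst: "open V \<Longrightarrow> open T \<Longrightarrow> Ck_on k V f \<Longrightarrow> Ck_on k (V \<times> T) (\<lambda>v. f (fst v))"
  for f :: "'a::euclidean_space \<Rightarrow> real" and T :: "'b::euclidean_space set"
proof (rule Ck_on_compose[of "V \<times> T" V])
  assume V: "open V" "open T"
  show "open (V \<times> T)" using V by (rule open_Times)
  then show "Ck_on k (V \<times> T) (\<lambda>v. fst v \<bullet> c)" for c
    by (intro Ck_on_bounded_linear bounded_linear_inner_left_comp bounded_linear_fst)
qed auto

text \<open>The extension constant along rays, now with time. Times are positive because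
  \<open>Ck_on\<close> asks for an open set; time 0 enters through continuity.\<close>

lemma Ck_on_homogeneous_time:
  fixes \<zeta> :: "real \<Rightarrow> real^3 \<Rightarrow> real"
  assumes Z: "smooth_on (S2 \<times> {0..}) (\<lambda>(x, t). \<zeta> t x)"
  shows "Ck_on k ((- {0}) \<times> {0<..}) (\<lambda>v. \<zeta> (snd v) (fst v /\<^sub>R norm (fst v)))"
proof (rule Ck_on_local)
  have V: "open (- {0::real^3})" by auto
  have VT: "open ((- {0::real^3}) \<times> {(0::real)<..})" by (intro open_Times) auto
  then show "open ((- {0::real^3}) \<times> {(0::real)<..})" .
  fix w :: "(real^3) \<times> real" assume w: "w \<in> (- {0}) \<times> {0<..}"
  define n where "n = (\<lambda>v::(real^3) \<times> real. (fst v /\<^sub>R norm (fst v), snd v))"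
  have nS: "n v \<in> S2 \<times> {0..}" if "v \<in> (- {0}) \<times> {0<..}" for v
    using that normalize_in_S2[of "fst v"] by (auto simp: n_def)
  have "\<exists>U F. open U \<and> n w \<in> U \<and> (\<forall>k. Ck_on k U F) \<and> (\<forall>y\<in>(S2 \<times> {0..}) \<inter> U. F y = (\<lambda>(x, t). \<zeta> t x) y)"
    by (rule bspec[OF Z[unfolded smooth_on_def] nS[OF w]])
  then obtain U F where U: "open U" "n w \<in> U" "\<forall>k. Ck_on k U F" "\<forall>y\<in>(S2 \<times> {0..}) \<inter> U. F y = (\<lambda>(x, t). \<zeta> t x) y" by blast
  define W where "W = ((- {0}) \<times> {0<..}) \<inter> n -` U"
  have nc: "continuous_on ((- {0}) \<times> {0<..}) n"
    unfolding n_def by (intro continuous_intros) auto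
  have W: "open W" unfolding W_def by (rule continuous_open_preimage[OF nc VT U(1)])
  have comp: "Ck_on k ((- {0}) \<times> {0<..}) (\<lambda>v. n v \<bullet> c)" for c
  proof -
    have "Ck_on k ((- {0}) \<times> {0<..}) (\<lambda>v::(real^3) \<times> real. (fst v /\<^sub>R norm (fst v)) \<bullet> fst c + snd v * snd c)"
      by (intro Ck_on_add VT Ck_on_fst[OF V open_greaterThan, of k "\<lambda>y. (y /\<^sub>R norm y) \<bullet> fst c"] Ck_on_inner_normalize
          Ck_on_mult Ck_on_const Ck_on_bounded_linear bounded_linear_snd)
    then show ?thesis by (simp add: n_def inner_prod_def)
  qed
  have "Ck_on k W (\<lambda>v. F (n v))"
  proof (rule Ck_on_compose[OF W U(1) _ U(3)[rule_format]])
    show "n ` W \<subseteq> U" by (auto simp: W_def)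
    show "Ck_on k W (\<lambda>v. n v \<bullet> c)" for c by (rule Ck_on_subset[OF comp]) (auto simp: W_def)
  qed
  moreover have "F (n v) = \<zeta> (snd v) (fst v /\<^sub>R norm (fst v))" if "v \<in> W" for v
  proof -
    have "n v \<in> (S2 \<times> {0..}) \<inter> U" using that nS[of v] unfolding W_def by blast
    then have "F (n v) = (\<lambda>(x, t). \<zeta> t x) (n v)" by (rule bspec[OF U(4)])
    then show ?thesis by (simp add: n_def)
  qed
  ultimately have "Ck_on k W (\<lambda>v. \<zeta> (snd v) (fst v /\<^sub>R norm (fst v)))"
    using Ck_on_cong[OF W, of "\<lambda>v. F (n v)" "\<lambda>v. \<zeta> (snd v) (fst v /\<^sub>R norm (fst v))" k] by blast
  then show "\<exists>W. open W \<and> w \<in> W \<and> Ck_on k W (\<lambda>v. \<zeta> (snd v) (fst v /\<^sub>R norm (fst v)))"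
    using W w U(2) unfolding W_def by blast
qed

lemma sphere_grad_cong:
  assumes "\<And>x. x \<in> S2 \<Longrightarrow> f x = g x" "x \<noteq> 0"
  shows "sphere_grad f x = sphere_grad g x"
  unfolding sphere_grad_def using sphere_deriv_cong[OF assms] by simp

text \<open>The equation is imposed for positive times only, so conservation reaches the initial
  time through one-sided continuity.\<close>

lemma constant_if_derivative_zero:
  fixes F :: "real \<Rightarrow> real"
  assumes c: "continuous_on {0..} F" and d: "\<And>t. t > 0 \<Longrightarrow> (F has_real_derivative 0) (at t)" and t: "t \<ge> 0"
  shows "F t = F 0"
proof (cases "t = 0")
  case False
  with t have t0: "0 < t" by simp
  have "continuous_on {0..t} F" by (rule continuous_on_subset[OF c]) auto
  then show ?thesis by (rule DERIV_isconst_end[OF t0 _ d])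
qed simp

locale vorticity_solution =
  fixes \<omega> :: real and \<zeta> :: "real \<Rightarrow> real^3 \<Rightarrow> real"
  assumes sol: "smooth_vorticity_solution \<omega> \<zeta>"
begin

definition Z :: "(real^3) \<times> real \<Rightarrow> real" where "Z v = \<zeta> (snd v) (fst v /\<^sub>R norm (fst v))"

text \<open>Read off from the total derivative of the extension, so that joint continuity in time
  and position is inherited from its smoothness.\<close>

definition \<zeta>' :: "real \<Rightarrow> real^3 \<Rightarrow> real" where "\<zeta>' t x = frechet_derivative Z (at (x, t)) (0, 1)"

lemma smooth: "smooth_on (S2 \<times> {0..}) (\<lambda>(x, t). \<zeta> t x)"
  using sol by (simp add: smooth_vorticity_solution_def)

lemma mean: "t \<ge> 0 \<Longrightarrow> zero_mean (\<zeta> t)"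
  using sol by (simp add: smooth_vorticity_solution_def)

lemma Ck_Z: "Ck_on k ((- {0}) \<times> {0<..}) Z"
  unfolding Z_def[abs_def] by (rule Ck_on_homogeneous_time[OF smooth])

lemma open_dom: "open ((- {0::real^3}) \<times> {(0::real)<..})"
  by (intro open_Times) auto

lemma cont_joint: "continuous_on ({0..} \<times> S2) (\<lambda>v. \<zeta> (fst v) (snd v))"
proof -
  have "continuous_on ({0..} \<times> S2) (\<lambda>v. (\<lambda>(x, t). \<zeta> t x) (snd v, fst v))"
    by (rule continuous_on_compose2[OF smooth_on_imp_continuous_on[OF smooth]]) (auto intro!: continuous_intros)
  then show ?thesis by simp
qed

lemma cont: "t \<ge> 0 \<Longrightarrow> continuous_on S2 (\<zeta> t)"
proof -
  assume t: "t \<ge> 0"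
  have "continuous_on S2 (\<lambda>x. (\<lambda>v. \<zeta> (fst v) (snd v)) (t, x))"
    by (rule continuous_on_compose2[OF cont_joint]) (use t in \<open>auto intro!: continuous_intros\<close>)
  then show ?thesis by simp
qed

lemma smooth_slice:
  assumes t: "t > 0" shows "smooth_on S2 (\<zeta> t)"
  unfolding smooth_on_S2_iff
proof
  fix k
  have "Ck_on k (- {0}) (\<lambda>y. Z (y, t))"
  proof (rule Ck_on_compose[OF _ open_dom _ Ck_Z])
    show "open (- {0::real^3})" by auto
    show "(\<lambda>y. (y, t)) ` (- {0}) \<subseteq> (- {0::real^3}) \<times> {0<..}" using t by auto
    fix c :: "(real^3) \<times> real"
    have "Ck_on k (- {0::real^3}) (\<lambda>y. y \<bullet> fst c + t * snd c)"
      by (intro Ck_on_add Ck_on_inner Ck_on_const) auto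
    then show "Ck_on k (- {0::real^3}) (\<lambda>y. (y, t) \<bullet> c)" by (simp add: inner_prod_def)
  qed
  then show "Ck_on k (- {0}) (\<lambda>y. \<zeta> t (y /\<^sub>R norm y))" by (simp add: Z_def)
qed

lemma deriv_time:
  assumes t: "t > 0" and x: "x \<in> S2"
  shows "((\<lambda>s. \<zeta> s x) has_real_derivative \<zeta>' t x) (at t)"
proof -
  have "(Z has_derivative frechet_derivative Z (at (x, t))) (at (x, t))"
    by (rule Ck_on_has_derivative[OF Ck_Z open_dom]) (use t x in auto)
  moreover have "((\<lambda>s. (x, s)) has_derivative (\<lambda>h. (0, h))) (at t)"
    by (intro has_derivative_Pair has_derivative_const has_derivative_ident)
  ultimately have d: "((\<lambda>s. Z (x, s)) has_derivative (\<lambda>h. frechet_derivative Z (at (x, t)) (0, h))) (at t)"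
    by (rule has_derivative_compose[rotated])
  then interpret l: linear "\<lambda>h. frechet_derivative Z (at (x, t)) (0, h)" by (rule has_derivative_linear)
  have "frechet_derivative Z (at (x, t)) (0, h) = h * frechet_derivative Z (at (x, t)) (0, 1)" for h :: real
    using l.scale[of h 1] by simp
  then have "(\<lambda>h. frechet_derivative Z (at (x, t)) (0, h)) = (*) (frechet_derivative Z (at (x, t)) (0, 1))"
    by (intro ext) (metis mult.commute)
  with d have "((\<lambda>s. Z (x, s)) has_real_derivative frechet_derivative Z (at (x, t)) (0, 1)) (at t)"
    unfolding has_field_derivative_def by (simp only:)
  then show ?thesis using x by (simp add: Z_def \<zeta>'_def)
qed

lemma cont_deriv_joint: "continuous_on (S2 \<times> {0<..}) (\<lambda>(x, t). \<zeta>' t x)"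
proof -
  have b: "(0, 1) \<in> (Basis :: ((real^3) \<times> real) set)" by (simp add: Basis_prod_def)
  have "Ck_on 0 ((- {0}) \<times> {0<..}) (\<lambda>v. frechet_derivative Z (at v) (0, 1))"
    using Ck_Z[of "Suc 0"] b unfolding Ck_on.simps by blast
  then have "continuous_on ((- {0}) \<times> {0<..}) (\<lambda>v. frechet_derivative Z (at v) (0, 1))" by simp
  then have "continuous_on (S2 \<times> {0<..}) (\<lambda>v. frechet_derivative Z (at v) (0, 1))"
    by (rule continuous_on_subset) auto
  then show ?thesis by (simp add: \<zeta>'_def case_prod_beta')
qed

lemma cont_deriv_joint': "continuous_on ({0<..} \<times> S2) (\<lambda>v. \<zeta>' (fst v) (snd v))"
proof -
  have "continuous_on ({0<..} \<times> S2) (\<lambda>v. (\<lambda>(x, t). \<zeta>' t x) (snd v, fst v))"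
    by (rule continuous_on_compose2[OF cont_deriv_joint]) (auto intro!: continuous_intros)
  then show ?thesis by simp
qed

lemma cont_joint_pos: "continuous_on ({0<..} \<times> S2) (\<lambda>v. \<zeta> (fst v) (snd v))"
  by (rule continuous_on_subset[OF cont_joint]) auto

lemma cont_deriv: "t > 0 \<Longrightarrow> continuous_on S2 (\<zeta>' t)"
proof -
  assume t: "t > 0"
  have "continuous_on S2 (\<lambda>x. (\<lambda>v. \<zeta>' (fst v) (snd v)) (t, x))"
    by (rule continuous_on_compose2[OF cont_deriv_joint']) (use t in \<open>auto intro!: continuous_intros\<close>)
  then show ?thesis by simp
qed

text \<open>Separates the linear rotation term from the nonlinear bracket: energy and momentum treat
  the two by different arguments, whereas the Casimirs only use that the right side is a single
  bracket with the solution.\<close>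

lemma equation:
  assumes t: "t > 0" and x: "x \<in> S2"
  shows "\<zeta>' t x = \<omega> * sphere_deriv (\<zeta> t) x (cross3 (axis 3 1) x) + poisson_bracket (log_potential (\<zeta> t)) (\<zeta> t) x"
proof -
  note s = smooth_slice[OF t]
  note sp = smooth_on_S2_log_potential[OF s]
  define \<xi> where "\<xi> = (\<lambda>y. \<omega> * (axis 3 1 \<bullet> y) - log_potential (\<zeta> t) y)"
  have "deriv (\<lambda>s. \<zeta> s x) t + rot_J x (sphere_grad (\<lambda>y. \<omega> * y $ 3 - green (\<zeta> t) y) x) \<bullet> sphere_grad (\<zeta> t) x = 0"
    using sol t x unfolding smooth_vorticity_solution_def by blast
  moreover have "deriv (\<lambda>s. \<zeta> s x) t = \<zeta>' t x" by (rule DERIV_imp_deriv[OF deriv_time[OF t x]])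
  moreover have "sphere_grad (\<lambda>y. \<omega> * y $ 3 - green (\<zeta> t) y) x = sphere_grad \<xi> x"
  proof (rule sphere_grad_cong[OF _ S2_nonzero[OF x]])
    fix y assume y: "y \<in> S2"
    show "\<omega> * y $ 3 - green (\<zeta> t) y = \<xi> y"
      using green_eq_log_potential[OF s mean y] t by (simp add: \<xi>_def inner_axis')
  qed
  ultimately have "\<zeta>' t x = - poisson_bracket \<xi> (\<zeta> t) x" by (simp add: poisson_bracket_def)
  also have "poisson_bracket \<xi> (\<zeta> t) x = \<omega> * poisson_bracket (\<lambda>y. axis 3 1 \<bullet> y) (\<zeta> t) x - poisson_bracket (log_potential (\<zeta> t)) (\<zeta> t) x"
    unfolding \<xi>_def
    by (simp only: poisson_bracket_diff_left[OF smooth_on_S2_cmult[OF smooth_on_S2_inner] sp s x] poisson_bracket_cmult_left[OF smooth_on_S2_inner s x])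
  finally show ?thesis by (simp add: poisson_bracket_inner_left[OF s x])
qed

lemma equation_bracket:
  assumes t: "t > 0"
  obtains \<xi> where "smooth_on S2 \<xi>" "\<And>x. x \<in> S2 \<Longrightarrow> \<zeta>' t x = poisson_bracket \<xi> (\<zeta> t) x"
proof -
  note s = smooth_slice[OF t]
  note sp = smooth_on_S2_log_potential[OF s]
  show ?thesis
  proof (rule that[of "\<lambda>y. log_potential (\<zeta> t) y - \<omega> * (axis 3 1 \<bullet> y)"])
    show "smooth_on S2 (\<lambda>y. log_potential (\<zeta> t) y - \<omega> * (axis 3 1 \<bullet> y))"
      by (intro smooth_on_S2_diff sp smooth_on_S2_cmult smooth_on_S2_inner)
    show "\<zeta>' t x = poisson_bracket (\<lambda>y. log_potential (\<zeta> t) y - \<omega> * (axis 3 1 \<bullet> y)) (\<zeta> t) x" if x: "x \<in> S2" for x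
      by (simp only: poisson_bracket_diff_left[OF sp smooth_on_S2_cmult[OF smooth_on_S2_inner] s x]
          poisson_bracket_cmult_left[OF smooth_on_S2_inner s x] poisson_bracket_inner_left[OF s x] equation[OF t x])
  qed
qed

text \<open>By the Leibniz rule the time derivative of a power of the solution is again a bracket,
  with that power as second argument, and brackets integrate to 0.\<close>

lemma power_conserved:
  assumes "t \<ge> 0" shows "(LINT x|sphere_measure. \<zeta> t x ^ n) = (LINT x|sphere_measure. \<zeta> 0 x ^ n)"
proof -
  define F where "F = (\<lambda>t. LINT x|sphere_measure. 1 * (\<lambda>v. \<zeta> (fst v) (snd v) ^ n) (t, x))"
  have i1: "integrable sphere_measure (\<lambda>x. 1 :: real)" by simp
  have "F t = F 0"
  proof (rule constant_if_derivative_zero[OF _ _ assms])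
    show "continuous_on {0..} F" unfolding F_def
      by (intro continuous_on_sphere_integral[OF i1] continuous_on_power cont_joint)
    fix t :: real assume t: "t > 0"
    have D: "((\<lambda>t. LINT x|sphere_measure. 1 * \<zeta> t x ^ n) has_real_derivative (LINT x|sphere_measure. 1 * (real n * \<zeta> t x ^ (n - 1) * \<zeta>' t x))) (at t)"
    proof (rule has_real_derivative_sphere_integral[OF i1, of "{0<..}"])
      show "continuous_on S2 (\<lambda>x. \<zeta> t x ^ n)" if "t \<in> {0<..}" for t
        using that by (intro continuous_on_power cont) simp
      show "((\<lambda>t. \<zeta> t x ^ n) has_real_derivative real n * \<zeta> t x ^ (n - 1) * \<zeta>' t x) (at t)" if "t \<in> {0<..}" "x \<in> S2" for t x
        using DERIV_power[OF deriv_time[of t x], of n] that by (simp add: mult_ac)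
      have "continuous_on ({0<..} \<times> S2) (\<lambda>v. real n * \<zeta> (fst v) (snd v) ^ (n - 1) * \<zeta>' (fst v) (snd v))"
        by (intro continuous_on_mult continuous_on_const continuous_on_power cont_joint_pos cont_deriv_joint')
      then show "continuous_on ({0<..} \<times> S2) (\<lambda>(t, x). real n * \<zeta> t x ^ (n - 1) * \<zeta>' t x)" by (simp add: case_prod_beta')
    qed (use t in auto)
    obtain \<xi> where \<xi>: "smooth_on S2 \<xi>" "\<And>x. x \<in> S2 \<Longrightarrow> \<zeta>' t x = poisson_bracket \<xi> (\<zeta> t) x"
      using equation_bracket[OF t] by metis
    note s = smooth_slice[OF t]
    have "(LINT x|sphere_measure. 1 * (real n * \<zeta> t x ^ (n - 1) * \<zeta>' t x)) = (LINT x|sphere_measure. poisson_bracket \<xi> (\<lambda>x. \<zeta> t x ^ n) x)"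
      
    proof (rule sphere_integral_cong)
      fix x assume x: "x \<in> S2"
      show "1 * (real n * \<zeta> t x ^ (n - 1) * \<zeta>' t x) = poisson_bracket \<xi> (\<lambda>x. \<zeta> t x ^ n) x"
        unfolding \<xi>(2)[OF x] poisson_bracket_power_right[OF \<xi>(1) s x] by simp
    qed
    also have "\<dots> = 0" by (rule poisson_bracket_integral[OF \<xi>(1) smooth_on_S2_power[OF s]])
    finally show "(F has_real_derivative 0) (at t)" using D by (simp add: F_def)
  qed
  then show ?thesis by (simp add: F_def)
qed

lemma casimir_conserved:
  fixes G :: "real \<Rightarrow> real"
  assumes t: "t \<ge> 0" and G: "continuous_on UNIV G"
  shows "(LINT x|sphere_measure. G (\<zeta> t x)) = (LINT x|sphere_measure. G (\<zeta> 0 x))"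
proof -
  obtain R1 where R1: "\<forall>x\<in>S2. \<bar>\<zeta> t x\<bar> \<le> R1" using bounded_continuous_S2[OF cont[OF t]] by (auto simp: bounded_iff)
  obtain R2 where R2: "\<forall>x\<in>S2. \<bar>\<zeta> 0 x\<bar> \<le> R2" using bounded_continuous_S2[OF cont[of 0]] by (auto simp: bounded_iff)
  define R where "R = max R1 R2"
  have R: "\<zeta> t x \<in> {-R..R}" "\<zeta> 0 x \<in> {-R..R}" if "x \<in> S2" for x
    using bspec[OF R1 that] bspec[OF R2 that] by (auto simp: R_def)
  have cG: "continuous_on {-R..R} G" by (rule continuous_on_subset[OF G]) simp
  have cz: "continuous_on S2 (\<zeta> t)" "continuous_on S2 (\<zeta> 0)" using cont t by auto
  have poly: "(LINT x|sphere_measure. poly p (\<zeta> t x)) = (LINT x|sphere_measure. poly p (\<zeta> 0 x))" for p :: "real poly"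
  proof -
    have e: "(LINT x|sphere_measure. poly p (\<zeta> s x)) = (\<Sum>i\<le>degree p. coeff p i * (LINT x|sphere_measure. \<zeta> s x ^ i))"
      if "continuous_on S2 (\<zeta> s)" for s
    proof -
      have "(LINT x|sphere_measure. poly p (\<zeta> s x)) = (\<Sum>i\<le>degree p. LINT x|sphere_measure. coeff p i * \<zeta> s x ^ i)"
        unfolding poly_altdef
        by (intro Bochner_Integration.integral_sum integrable_sphere_measure continuous_on_mult continuous_on_const continuous_on_power that)
      then show ?thesis by (simp only: integral_mult_right_zero)
    qed
    show ?thesis unfolding e[OF cz(1)] e[OF cz(2)] power_conserved[OF t] ..
  qed
  have "\<bar>(LINT x|sphere_measure. G (\<zeta> t x)) - (LINT x|sphere_measure. G (\<zeta> 0 x))\<bar> \<le> e" if e: "e > 0" for e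
  proof -
    have e': "e / (2 * area) > 0" using e area_pos by simp
    obtain p where p: "\<And>z. z \<in> {-R..R} \<Longrightarrow> \<bar>G z - poly p z\<bar> < e / (2 * area)"
      using Weierstrass_poly[OF cG e'] by metis
    have b: "\<bar>(LINT x|sphere_measure. G (f x)) - (LINT x|sphere_measure. poly p (f x))\<bar> \<le> e / 2"
      if f: "continuous_on S2 f" "\<And>x. x \<in> S2 \<Longrightarrow> f x \<in> {-R..R}" for f :: "real^3 \<Rightarrow> real"
    proof -
      have c1: "continuous_on S2 (\<lambda>x. G (f x))" by (rule continuous_on_compose2[OF G f(1)]) simp
      have c2: "continuous_on S2 (\<lambda>x. poly p (f x))" by (intro continuous_intros f(1))
      have "(LINT x|sphere_measure. G (f x)) - (LINT x|sphere_measure. poly p (f x)) = (LINT x|sphere_measure. 1 * (G (f x) - poly p (f x)))"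
        by (simp add: integrable_sphere_measure c1 c2)
      also have "\<bar>\<dots>\<bar> \<le> (LINT x|sphere_measure. \<bar>1\<bar>) * (e / (2 * area))"
        by (rule sphere_integral_abs_le[OF _ continuous_on_diff[OF c1 c2] less_imp_le[OF p[OF f(2)]]]) simp
      also have "\<dots> = e / 2" using area_pos by (simp add: area_def[symmetric])
      finally show ?thesis .
    qed
    have tri: "\<bar>X - Y\<bar> \<le> e" if "\<bar>X - H\<bar> \<le> e / 2" "\<bar>Y - H\<bar> \<le> e / 2" for X Y H :: real
      using that by linarith
    show ?thesis by (rule tri[OF b[OF cz(1) R(1)] b[OF cz(2) R(2), folded poly]])
  qed
  then have "\<bar>(LINT x|sphere_measure. G (\<zeta> t x)) - (LINT x|sphere_measure. G (\<zeta> 0 x))\<bar> \<le> 0"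
    by (rule field_le_epsilon[where y = 0, simplified])
  then show ?thesis by simp
qed

section \<open>Energy and angular momentum\<close>

lemma potential_joint: "continuous_on ({0..} \<times> S2) (\<lambda>v. log_potential (\<zeta> (fst v)) (snd v))"
proof -
  have "continuous_on ({0..} \<times> S2) (\<lambda>v. (\<lambda>(x, t). log_potential (\<zeta> t) x) (snd v, fst v))"
    by (rule continuous_on_compose2[OF continuous_on_log_potential_param[OF smooth_on_imp_continuous_on[OF smooth]]])
      (auto intro!: continuous_intros)
  then show ?thesis by simp
qed

lemma potential_deriv_joint: "continuous_on ({0<..} \<times> S2) (\<lambda>v. log_potential (\<zeta>' (fst v)) (snd v))"
proof -
  have "continuous_on ({0<..} \<times> S2) (\<lambda>v. (\<lambda>(x, t). log_potential (\<zeta>' t) x) (snd v, fst v))"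
    by (rule continuous_on_compose2[OF continuous_on_log_potential_param[OF cont_deriv_joint]])
      (auto intro!: continuous_intros)
  then show ?thesis by simp
qed

lemma potential_deriv:
  assumes t: "t > 0" and x: "x \<in> S2"
  shows "((\<lambda>s. log_potential (\<zeta> s) x) has_real_derivative log_potential (\<zeta>' t) x) (at t)"
  unfolding log_potential_def
proof (rule has_real_derivative_sphere_integral[of _ "{0<..}"])
  show "integrable sphere_measure (\<lambda>y. log_kernel 0 (x \<bullet> y))" using x by (intro log_kernel_integrable) simp
  show "continuous_on S2 (\<zeta> t)" if "t \<in> {0<..}" for t using that by (intro cont) simp
  show "((\<lambda>t. \<zeta> t y) has_real_derivative \<zeta>' t y) (at t)" if "t \<in> {0<..}" "y \<in> S2" for t y
    using that by (intro deriv_time) auto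
  show "continuous_on ({0<..} \<times> S2) (\<lambda>(t, y). \<zeta>' t y)" using cont_deriv_joint' by (simp add: case_prod_beta')
qed (use t in auto)

text \<open>By symmetry of the potential both terms of the product rule equal the integral of
  \<open>\<zeta>' t x * \<psi> x\<close>. There \<psi> times the bracket of \<psi> and \<zeta> is
  the bracket of \<psi> and their product, and the rotation part vanishes by
  \<open>log_potential_rotational_orthogonal\<close>.\<close>

lemma energy_conserved:
  assumes "t \<ge> 0" shows "energy (\<zeta> t) = energy (\<zeta> 0)"
proof -
  define F where "F = (\<lambda>t. LINT x|sphere_measure. 1 * (\<lambda>v. \<zeta> (fst v) (snd v) * log_potential (\<zeta> (fst v)) (snd v)) (t, x))"
  have i1: "integrable sphere_measure (\<lambda>x. 1 :: real)" by simp
  have "F t = F 0"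
  proof (rule constant_if_derivative_zero[OF _ _ assms])
    show "continuous_on {0..} F" unfolding F_def
      by (intro continuous_on_sphere_integral[OF i1] continuous_on_mult cont_joint potential_joint)
    fix t :: real assume t: "t > 0"
    note s = smooth_slice[OF t]
    define \<psi> where "\<psi> = log_potential (\<zeta> t)"
    have s\<psi>: "smooth_on S2 \<psi>" unfolding \<psi>_def by (rule smooth_on_S2_log_potential[OF s])
    have c: "continuous_on S2 (\<zeta> t)" "continuous_on S2 (\<zeta>' t)" using t cont cont_deriv by auto
    have D: "((\<lambda>t. LINT x|sphere_measure. 1 * (\<zeta> t x * log_potential (\<zeta> t) x)) has_real_derivative
        (LINT x|sphere_measure. 1 * (\<zeta> t x * log_potential (\<zeta>' t) x + \<zeta>' t x * log_potential (\<zeta> t) x))) (at t)"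
    proof (rule has_real_derivative_sphere_integral[OF i1, of "{0<..}"])
      show "continuous_on S2 (\<lambda>x. \<zeta> t x * log_potential (\<zeta> t) x)" if "t \<in> {0<..}" for t
        using that by (intro continuous_on_mult continuous_on_log_potential cont) simp_all
      show "((\<lambda>t. \<zeta> t x * log_potential (\<zeta> t) x) has_real_derivative \<zeta> t x * log_potential (\<zeta>' t) x + \<zeta>' t x * log_potential (\<zeta> t) x) (at t)"
        if "t \<in> {0<..}" "x \<in> S2" for t x
        using DERIV_mult[OF deriv_time[of t x] potential_deriv[of t x]] that by (simp add: add.commute mult.commute)
      have "continuous_on ({0<..} \<times> S2) (\<lambda>v. \<zeta> (fst v) (snd v) * log_potential (\<zeta>' (fst v)) (snd v) + \<zeta>' (fst v) (snd v) * log_potential (\<zeta> (fst v)) (snd v))"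
        by (intro continuous_on_add continuous_on_mult cont_joint_pos cont_deriv_joint' potential_deriv_joint continuous_on_subset[OF potential_joint]) auto
      then show "continuous_on ({0<..} \<times> S2) (\<lambda>(t, x). \<zeta> t x * log_potential (\<zeta>' t) x + \<zeta>' t x * log_potential (\<zeta> t) x)"
        by (simp add: case_prod_beta')
    qed (use t in auto)
    have z: "(LINT x|sphere_measure. \<zeta>' t x * \<psi> x) = 0"
    proof -
      have "(LINT x|sphere_measure. \<zeta>' t x * \<psi> x) = (LINT x|sphere_measure. \<omega> * (\<psi> x * sphere_deriv (\<zeta> t) x (cross3 (axis 3 1) x)) + poisson_bracket \<psi> (\<lambda>x. \<psi> x * \<zeta> t x) x)"
      proof (rule sphere_integral_cong)
        fix x assume x: "x \<in> S2"
        have "poisson_bracket \<psi> \<psi> x = 0" using poisson_bracket_antisym[of \<psi> \<psi> x] by simp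
        then have "poisson_bracket \<psi> (\<lambda>x. \<psi> x * \<zeta> t x) x = \<psi> x * poisson_bracket \<psi> (\<zeta> t) x"
          unfolding poisson_bracket_mult_right[OF s\<psi> s\<psi> s x] by simp
        then show "\<zeta>' t x * \<psi> x = \<omega> * (\<psi> x * sphere_deriv (\<zeta> t) x (cross3 (axis 3 1) x)) + poisson_bracket \<psi> (\<lambda>x. \<psi> x * \<zeta> t x) x"
          unfolding equation[OF t x] \<psi>_def[symmetric] by (simp add: algebra_simps)
      qed
      also have "\<dots> = (LINT x|sphere_measure. \<omega> * (\<psi> x * sphere_deriv (\<zeta> t) x (cross3 (axis 3 1) x))) + (LINT x|sphere_measure. poisson_bracket \<psi> (\<lambda>x. \<psi> x * \<zeta> t x) x)"
        by (intro Bochner_Integration.integral_add sphere_integrable_smooth smooth_on_S2_poisson_bracket smooth_on_S2_cmult smooth_on_S2_mult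
            smooth_on_S2_sphere_deriv smooth_on_S2_cross s s\<psi>)
      also have "(LINT x|sphere_measure. poisson_bracket \<psi> (\<lambda>x. \<psi> x * \<zeta> t x) x) = 0"
        by (intro poisson_bracket_integral smooth_on_S2_mult s s\<psi>)
      also have "(LINT x|sphere_measure. \<omega> * (\<psi> x * sphere_deriv (\<zeta> t) x (cross3 (axis 3 1) x))) = 0"
        using log_potential_rotational_orthogonal[OF s, of "axis 3 1"] by (simp add: norm_axis_1 \<psi>_def)
      finally show ?thesis by simp
    qed
    have "(LINT x|sphere_measure. \<zeta> t x * log_potential (\<zeta>' t) x) = (LINT x|sphere_measure. \<zeta>' t x * \<psi> x)"
      using log_potential_symmetric[OF c] unfolding \<psi>_def by (simp add: mult.commute)
    then have "(LINT x|sphere_measure. 1 * (\<zeta> t x * log_potential (\<zeta>' t) x + \<zeta>' t x * log_potential (\<zeta> t) x)) = 0"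
      using z unfolding \<psi>_def
      by (simp add: integrable_sphere_measure continuous_on_mult continuous_on_log_potential c)
    then show "(F has_real_derivative 0) (at t)" using D by (simp add: F_def)
  qed
  then show ?thesis by (simp add: F_def energy_def)
qed

text \<open>Integrating the nonlinear term against a linear function moves the bracket onto that
  function and leaves the solution times a rotational derivative of its own potential, whose
  integral is 0. Only the planetary rotation survives, and it makes the momentum precess.\<close>

lemma momentum_deriv:
  assumes t: "t > 0" and b: "norm b = 1"
  shows "((\<lambda>t. b \<bullet> momentum (\<zeta> t)) has_real_derivative - \<omega> * (cross3 b (axis 3 1) \<bullet> momentum (\<zeta> t))) (at t)"
proof -
  have i1: "integrable sphere_measure (\<lambda>x. 1 :: real)" by simp
  note s = smooth_slice[OF t]
  define \<psi> where "\<psi> = log_potential (\<zeta> t)"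
  define \<beta> where "\<beta> = (\<lambda>x. b \<bullet> x)"
  have s\<beta>: "smooth_on S2 \<beta>" unfolding \<beta>_def by (rule smooth_on_S2_inner)
  have s\<psi>: "smooth_on S2 \<psi>" unfolding \<psi>_def by (rule smooth_on_S2_log_potential[OF s])
  have c\<beta>: "continuous_on B \<beta>" for B unfolding \<beta>_def by (intro continuous_intros)
  have D: "((\<lambda>t. LINT x|sphere_measure. 1 * (\<zeta> t x * \<beta> x)) has_real_derivative (LINT x|sphere_measure. 1 * (\<zeta>' t x * \<beta> x))) (at t)"
  proof (rule has_real_derivative_sphere_integral[OF i1, of "{0<..}"])
    show "continuous_on S2 (\<lambda>x. \<zeta> t x * \<beta> x)" if "t \<in> {0<..}" for t
      using that by (intro continuous_on_mult c\<beta> cont) simp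
    show "((\<lambda>t. \<zeta> t x * \<beta> x) has_real_derivative \<zeta>' t x * \<beta> x) (at t)" if "t \<in> {0<..}" "x \<in> S2" for t x
      using that by (intro DERIV_cmult_right deriv_time) auto
    have "continuous_on ({0<..} \<times> S2) (\<lambda>v. \<zeta>' (fst v) (snd v) * \<beta> (snd v))"
      by (intro continuous_on_mult cont_deriv_joint' continuous_on_compose2[OF c\<beta>[of UNIV]] continuous_on_snd continuous_on_id) auto
    then show "continuous_on ({0<..} \<times> S2) (\<lambda>(t, x). \<zeta>' t x * \<beta> x)" by (simp add: case_prod_beta')
  qed (use t in auto)
  have r1: "(LINT x|sphere_measure. \<beta> x * sphere_deriv (\<zeta> t) x (cross3 (axis 3 1) x)) = - (cross3 b (axis 3 1) \<bullet> momentum (\<zeta> t))"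
  proof -
    have "(LINT x|sphere_measure. \<beta> x * sphere_deriv (\<zeta> t) x (cross3 (axis 3 1) x)) = - (LINT x|sphere_measure. \<zeta> t x * sphere_deriv \<beta> x (cross3 (axis 3 1) x))"
      by (rule sphere_integral_rotational_mult[OF s\<beta> s])
    also have "(LINT x|sphere_measure. \<zeta> t x * sphere_deriv \<beta> x (cross3 (axis 3 1) x)) = (LINT x|sphere_measure. \<zeta> t x * (cross3 b (axis 3 1) \<bullet> x))"
    proof (rule sphere_integral_cong)
      fix x :: "real^3" assume x: "x \<in> S2"
      have "b \<bullet> cross3 (axis 3 1) x = cross3 b (axis 3 1) \<bullet> x" by (metis cross_triple inner_commute)
      then show "\<zeta> t x * sphere_deriv \<beta> x (cross3 (axis 3 1) x) = \<zeta> t x * (cross3 b (axis 3 1) \<bullet> x)"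
        unfolding \<beta>_def sphere_deriv_inner[OF x] by (simp add: dot_cross_self)
    qed
    finally show ?thesis using t by (simp add: inner_momentum[OF cont])
  qed
  have r2: "(LINT x|sphere_measure. \<beta> x * poisson_bracket \<psi> (\<zeta> t) x) = 0"
  proof -
    have "(LINT x|sphere_measure. \<beta> x * poisson_bracket \<psi> (\<zeta> t) x) = (LINT x|sphere_measure. poisson_bracket \<psi> (\<lambda>x. \<beta> x * \<zeta> t x) x - \<zeta> t x * sphere_deriv \<psi> x (cross3 b x))"
    proof (rule sphere_integral_cong)
      fix x assume x: "x \<in> S2"
      have "poisson_bracket \<psi> \<beta> x = sphere_deriv \<psi> x (cross3 b x)"
        using poisson_bracket_antisym[of \<psi> \<beta> x] poisson_bracket_inner_left[OF s\<psi> x, of b] by (simp add: \<beta>_def)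
      then show "\<beta> x * poisson_bracket \<psi> (\<zeta> t) x = poisson_bracket \<psi> (\<lambda>x. \<beta> x * \<zeta> t x) x - \<zeta> t x * sphere_deriv \<psi> x (cross3 b x)"
        unfolding poisson_bracket_mult_right[OF s\<psi> s\<beta> s x] by simp
    qed
    also have "\<dots> = (LINT x|sphere_measure. poisson_bracket \<psi> (\<lambda>x. \<beta> x * \<zeta> t x) x) - (LINT x|sphere_measure. \<zeta> t x * sphere_deriv \<psi> x (cross3 b x))"
      by (intro Bochner_Integration.integral_diff sphere_integrable_smooth smooth_on_S2_poisson_bracket smooth_on_S2_mult
          smooth_on_S2_sphere_deriv smooth_on_S2_cross s s\<psi> s\<beta>)
    also have "(LINT x|sphere_measure. poisson_bracket \<psi> (\<lambda>x. \<beta> x * \<zeta> t x) x) = 0"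
      by (intro poisson_bracket_integral smooth_on_S2_mult s\<beta> s s\<psi>)
    also have "(LINT x|sphere_measure. \<zeta> t x * sphere_deriv \<psi> x (cross3 b x)) = - (LINT x|sphere_measure. \<psi> x * sphere_deriv (\<zeta> t) x (cross3 b x))"
      by (rule sphere_integral_rotational_mult[OF s s\<psi>])
    also have "(LINT x|sphere_measure. \<psi> x * sphere_deriv (\<zeta> t) x (cross3 b x)) = 0"
      unfolding \<psi>_def by (rule log_potential_rotational_orthogonal[OF s b])
    finally show ?thesis by simp
  qed
  have "(LINT x|sphere_measure. 1 * (\<zeta>' t x * \<beta> x)) = (LINT x|sphere_measure. \<omega> * (\<beta> x * sphere_deriv (\<zeta> t) x (cross3 (axis 3 1) x)) + \<beta> x * poisson_bracket \<psi> (\<zeta> t) x)"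
    by (rule sphere_integral_cong) (simp only: equation[OF t] \<psi>_def, simp add: algebra_simps)
  also have "\<dots> = (LINT x|sphere_measure. \<omega> * (\<beta> x * sphere_deriv (\<zeta> t) x (cross3 (axis 3 1) x))) + (LINT x|sphere_measure. \<beta> x * poisson_bracket \<psi> (\<zeta> t) x)"
    by (intro Bochner_Integration.integral_add sphere_integrable_smooth smooth_on_S2_poisson_bracket smooth_on_S2_mult smooth_on_S2_cmult
        smooth_on_S2_sphere_deriv smooth_on_S2_cross s s\<psi> s\<beta>)
  also have "\<dots> = - \<omega> * (cross3 b (axis 3 1) \<bullet> momentum (\<zeta> t))"
    unfolding integral_mult_right_zero r1 r2 by simp
  finally have D': "((\<lambda>t. LINT x|sphere_measure. \<zeta> t x * \<beta> x) has_real_derivative - \<omega> * (cross3 b (axis 3 1) \<bullet> momentum (\<zeta> t))) (at t)"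
    using D by simp
  show ?thesis
  proof (rule has_field_derivative_transform_within_open[OF D', of "{0<..}"])
    show "(LINT x|sphere_measure. \<zeta> s x * \<beta> x) = b \<bullet> momentum (\<zeta> s)" if "s \<in> {0<..}" for s
      using that inner_momentum[OF cont, of s b] by (simp add: \<beta>_def)
  qed (use t in auto)
qed

lemma momentum_conserved:
  assumes "t \<ge> 0" shows "norm (momentum (\<zeta> t)) = norm (momentum (\<zeta> 0))"
proof -
  define m where "m = (\<lambda>i t. axis i 1 \<bullet> momentum (\<zeta> t))"
  define F where "F = (\<lambda>t. (m 1 t)\<^sup>2 + (m 2 t)\<^sup>2 + (m 3 t)\<^sup>2)"
  have i1: "integrable sphere_measure (\<lambda>x. 1 :: real)" by simp
  have FN: "F t = (norm (momentum (\<zeta> t)))\<^sup>2" for t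
    unfolding F_def m_def power2_norm_eq_inner by (simp add: inner_axis' inner_vec_def[of "momentum _"] sum_3 power2_eq_square)
  have mc: "continuous_on {0..} (m i)" for i
  proof -
    have "continuous_on {0..} (\<lambda>t. LINT x|sphere_measure. 1 * (\<lambda>v. \<zeta> (fst v) (snd v) * (axis i 1 \<bullet> snd v)) (t, x))"
      by (intro continuous_on_sphere_integral[OF i1] continuous_on_mult cont_joint continuous_intros)
    then show ?thesis
      by (rule continuous_on_eq) (simp add: m_def inner_momentum[OF cont])
  qed
  have "F t = F 0"
  proof (rule constant_if_derivative_zero[OF _ _ assms])
    show "continuous_on {0..} F" unfolding F_def by (intro continuous_intros mc)
    fix t :: real assume t: "t > 0"
    have d: "((m i) has_real_derivative - \<omega> * (cross3 (axis i 1) (axis 3 1) \<bullet> momentum (\<zeta> t))) (at t)" for i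
      unfolding m_def by (rule momentum_deriv[OF t]) (simp add: norm_axis_1)
    have e: "cross3 (axis 1 1) (axis 3 1) \<bullet> momentum (\<zeta> t) = - m 2 t" "cross3 (axis 2 1) (axis 3 1) \<bullet> momentum (\<zeta> t) = m 1 t"
      "cross3 (axis 3 1) (axis 3 1) \<bullet> momentum (\<zeta> t) = 0"
      by (simp_all add: cross_basis m_def)
    have d1: "(m 1 has_real_derivative \<omega> * m 2 t) (at t)" and d2: "(m 2 has_real_derivative - \<omega> * m 1 t) (at t)"
      and d3: "(m 3 has_real_derivative 0) (at t)"
      using d[of 1] d[of 2] d[of 3] by (simp_all add: e)
    show "(F has_real_derivative 0) (at t)" unfolding F_def
      by (rule derivative_eq_intros d1 d2 d3 refl)+ simp
  qed
  then show ?thesis unfolding FN by simp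
qed

end


section \<open>Degree two harmonics and quadratic forms\<close>

definition sphere_moment :: "nat \<Rightarrow> nat \<Rightarrow> nat \<Rightarrow> real" where
  "sphere_moment m n k = (LINT x|sphere_measure. x $ 1 ^ m * x $ 2 ^ n * x $ 3 ^ k)"

lemma has_bochner_sphere_moment:
  "has_bochner_integral sphere_measure (\<lambda>x. x $ 1 ^ m * x $ 2 ^ n * x $ 3 ^ k) (sphere_moment m n k)"
  unfolding sphere_moment_def
  by (intro has_bochner_integral_integrable integrable_sphere_measure continuous_intros)

lemma Ck_on_nth: "open U \<Longrightarrow> Ck_on k U (\<lambda>x::real^3. x $ i)"
  by (rule Ck_on_bounded_linear) (simp_all add: bounded_linear_vec_nth)

text \<open>The derivative of x1^(m+1) x2^(n+1) x3^k along the rotation about the third axis is a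
  combination of the two monomials, and it integrates to 0. With the analogue for the first axis,
  all even moments of a given degree are multiples of one.\<close>

lemma sphere_moment_12: "real (Suc n) * sphere_moment (m + 2) n k = real (Suc m) * sphere_moment m (n + 2) k"
proof -
  define F where "F = (\<lambda>x::real^3. x $ 1 ^ Suc m * x $ 2 ^ Suc n * x $ 3 ^ k)"
  have d: "(F has_derivative (\<lambda>v. x $ 1 ^ Suc m * x $ 2 ^ Suc n * (real k * v $ 3 * x $ 3 ^ (k - 1))
      + (x $ 1 ^ Suc m * (real (Suc n) * v $ 2 * x $ 2 ^ n) + real (Suc m) * v $ 1 * x $ 1 ^ m * x $ 2 ^ Suc n) * x $ 3 ^ k)) (at x)" for x
    unfolding F_def by (auto intro!: derivative_eq_intros bounded_linear_imp_has_derivative bounded_linear_vec_nth simp del: power_Suc)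
  have "Ck_on 1 UNIV F" unfolding F_def by (intro Ck_on_mult Ck_on_power Ck_on_nth open_UNIV)
  from sphere_integral_tangential[OF open_UNIV subset_UNIV this, of "axis 3 1"]
  have "(LINT x|sphere_measure. real (Suc n) * (x $ 1 ^ (m + 2) * x $ 2 ^ n * x $ 3 ^ k) - real (Suc m) * (x $ 1 ^ m * x $ 2 ^ (n + 2) * x $ 3 ^ k)) = 0"
    by (simp add: frechet_derivative_at[OF d, symmetric] cross3_simps axis_def)
  moreover have "has_bochner_integral sphere_measure (\<lambda>x. real (Suc n) * (x $ 1 ^ (m + 2) * x $ 2 ^ n * x $ 3 ^ k) - real (Suc m) * (x $ 1 ^ m * x $ 2 ^ (n + 2) * x $ 3 ^ k))
      (real (Suc n) * sphere_moment (m + 2) n k - real (Suc m) * sphere_moment m (n + 2) k)"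
    by (intro has_bochner_integral_diff has_bochner_integral_mult_right has_bochner_sphere_moment)
  ultimately show ?thesis using has_bochner_integral_integral_eq by fastforce
qed

lemma sphere_moment_23: "real (Suc k) * sphere_moment m (n + 2) k = real (Suc n) * sphere_moment m n (k + 2)"
proof -
  define F where "F = (\<lambda>x::real^3. x $ 2 ^ Suc n * x $ 3 ^ Suc k * x $ 1 ^ m)"
  have d: "(F has_derivative (\<lambda>v. x $ 2 ^ Suc n * x $ 3 ^ Suc k * (real m * v $ 1 * x $ 1 ^ (m - 1))
      + (x $ 2 ^ Suc n * (real (Suc k) * v $ 3 * x $ 3 ^ k) + real (Suc n) * v $ 2 * x $ 2 ^ n * x $ 3 ^ Suc k) * x $ 1 ^ m)) (at x)" for x
    unfolding F_def by (auto intro!: derivative_eq_intros bounded_linear_imp_has_derivative bounded_linear_vec_nth simp del: power_Suc)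
  have "Ck_on 1 UNIV F" unfolding F_def by (intro Ck_on_mult Ck_on_power Ck_on_nth open_UNIV)
  from sphere_integral_tangential[OF open_UNIV subset_UNIV this, of "axis 1 1"]
  have "(LINT x|sphere_measure. real (Suc k) * (x $ 1 ^ m * x $ 2 ^ (n + 2) * x $ 3 ^ k) - real (Suc n) * (x $ 1 ^ m * x $ 2 ^ n * x $ 3 ^ (k + 2))) = 0"
    by (simp add: frechet_derivative_at[OF d, symmetric] cross3_simps axis_def)
  moreover have "has_bochner_integral sphere_measure (\<lambda>x. real (Suc k) * (x $ 1 ^ m * x $ 2 ^ (n + 2) * x $ 3 ^ k) - real (Suc n) * (x $ 1 ^ m * x $ 2 ^ n * x $ 3 ^ (k + 2)))
      (real (Suc k) * sphere_moment m (n + 2) k - real (Suc n) * sphere_moment m n (k + 2))"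
    by (intro has_bochner_integral_diff has_bochner_integral_mult_right has_bochner_sphere_moment)
  ultimately show ?thesis using has_bochner_integral_integral_eq by fastforce
qed

definition diag_form :: "real^3 \<Rightarrow> real^3 \<Rightarrow> real" where
  "diag_form d x = d $ 1 * (x $ 1)\<^sup>2 + d $ 2 * (x $ 2)\<^sup>2 + d $ 3 * (x $ 3)\<^sup>2"

lemma norm_eq_1_nth: "norm x = 1 \<Longrightarrow> (x $ 1)\<^sup>2 + (x $ 2)\<^sup>2 + (x $ 3)\<^sup>2 = 1" for x :: "real^3"
  by (simp add: norm_eq_1 inner_vec_def sum_3 power2_eq_square)

lemma diag_form_diff_le:
  assumes "x \<in> S2"
  shows "\<bar>diag_form d x - diag_form e x\<bar> \<le> norm (d - e)"
proof -
  have x: "(x $ 1)\<^sup>2 + (x $ 2)\<^sup>2 + (x $ 3)\<^sup>2 = 1" using assms norm_eq_1_nth by simp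
  have "diag_form d x - diag_form e x = (d - e) $ 1 * (x $ 1)\<^sup>2 + (d - e) $ 2 * (x $ 2)\<^sup>2 + (d - e) $ 3 * (x $ 3)\<^sup>2"
    by (simp add: diag_form_def algebra_simps)
  also have "\<bar>\<dots>\<bar> \<le> norm (d - e) * (x $ 1)\<^sup>2 + norm (d - e) * (x $ 2)\<^sup>2 + norm (d - e) * (x $ 3)\<^sup>2"
    by (intro order_trans[OF abs_triangle_ineq] add_mono; unfold abs_mult abs_power2)
      (intro mult_right_mono component_le_norm_cart zero_le_power2)+
  also have "\<dots> = norm (d - e) * ((x $ 1)\<^sup>2 + (x $ 2)\<^sup>2 + (x $ 3)\<^sup>2)" by (simp add: algebra_simps)
  finally show ?thesis by (simp add: x)
qed

lemma sphere_integral_diag_form_square: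
  assumes "d $ 1 + d $ 2 + d $ 3 = 0"
  shows "(LINT x|sphere_measure. (diag_form d x)\<^sup>2) = 2 * area / 15 * ((d $ 1)\<^sup>2 + (d $ 2)\<^sup>2 + (d $ 3)\<^sup>2)"
proof -
  define v where "v = sphere_moment 2 2 0"
  have 12: "sphere_moment 4 0 0 = 3 * v" "sphere_moment 0 4 0 = 3 * v" "sphere_moment 0 2 2 = sphere_moment 2 0 2"
    using sphere_moment_12[of 0 2 0] sphere_moment_12[of 2 0 0] sphere_moment_12[of 0 0 2] by (simp_all add: v_def del: add_2_eq_Suc add_2_eq_Suc')
  have 23: "sphere_moment 0 2 2 = v" "sphere_moment 0 0 4 = 3 * v"
    using sphere_moment_23[of 2 0 0] sphere_moment_23[of 0 0 2] 12 by (simp_all del: add_2_eq_Suc add_2_eq_Suc')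
  have I: "(LINT x|sphere_measure. (diag_form d x)\<^sup>2) = v * (3 * ((d $ 1)\<^sup>2 + (d $ 2)\<^sup>2 + (d $ 3)\<^sup>2) + 2 * (d $ 1 * d $ 2 + d $ 1 * d $ 3 + d $ 2 * d $ 3))" for d
  proof -
    have "has_bochner_integral sphere_measure (\<lambda>x. (d $ 1)\<^sup>2 * (x $ 1 ^ 4 * x $ 2 ^ 0 * x $ 3 ^ 0) + (d $ 2)\<^sup>2 * (x $ 1 ^ 0 * x $ 2 ^ 4 * x $ 3 ^ 0)
       + (d $ 3)\<^sup>2 * (x $ 1 ^ 0 * x $ 2 ^ 0 * x $ 3 ^ 4) + 2 * d $ 1 * d $ 2 * (x $ 1 ^ 2 * x $ 2 ^ 2 * x $ 3 ^ 0)
       + 2 * d $ 1 * d $ 3 * (x $ 1 ^ 2 * x $ 2 ^ 0 * x $ 3 ^ 2) + 2 * d $ 2 * d $ 3 * (x $ 1 ^ 0 * x $ 2 ^ 2 * x $ 3 ^ 2))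
      ((d $ 1)\<^sup>2 * sphere_moment 4 0 0 + (d $ 2)\<^sup>2 * sphere_moment 0 4 0 + (d $ 3)\<^sup>2 * sphere_moment 0 0 4
       + 2 * d $ 1 * d $ 2 * sphere_moment 2 2 0 + 2 * d $ 1 * d $ 3 * sphere_moment 2 0 2 + 2 * d $ 2 * d $ 3 * sphere_moment 0 2 2)"
      by (intro has_bochner_integral_add has_bochner_integral_mult_right has_bochner_sphere_moment)
    moreover have "(diag_form d x)\<^sup>2 = (d $ 1)\<^sup>2 * (x $ 1 ^ 4 * x $ 2 ^ 0 * x $ 3 ^ 0) + (d $ 2)\<^sup>2 * (x $ 1 ^ 0 * x $ 2 ^ 4 * x $ 3 ^ 0)
       + (d $ 3)\<^sup>2 * (x $ 1 ^ 0 * x $ 2 ^ 0 * x $ 3 ^ 4) + 2 * d $ 1 * d $ 2 * (x $ 1 ^ 2 * x $ 2 ^ 2 * x $ 3 ^ 0)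
       + 2 * d $ 1 * d $ 3 * (x $ 1 ^ 2 * x $ 2 ^ 0 * x $ 3 ^ 2) + 2 * d $ 2 * d $ 3 * (x $ 1 ^ 0 * x $ 2 ^ 2 * x $ 3 ^ 2)" for x
      unfolding diag_form_def by (simp, algebra)
    ultimately have "(LINT x|sphere_measure. (diag_form d x)\<^sup>2) = (d $ 1)\<^sup>2 * sphere_moment 4 0 0 + (d $ 2)\<^sup>2 * sphere_moment 0 4 0 + (d $ 3)\<^sup>2 * sphere_moment 0 0 4
       + 2 * d $ 1 * d $ 2 * sphere_moment 2 2 0 + 2 * d $ 1 * d $ 3 * sphere_moment 2 0 2 + 2 * d $ 2 * d $ 3 * sphere_moment 0 2 2"
      using has_bochner_integral_integral_eq by (simp only:)
    then show ?thesis using 12 23 by (simp add: v_def[symmetric] algebra_simps)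
  qed
  \<comment> \<open>With all coefficients 1 the form is the constant 1 on the sphere; this
    calibrates the one free moment.\<close>
  have "area = (LINT x|sphere_measure. (diag_form (\<chi> i. 1) x)\<^sup>2)"
  proof -
    have "(LINT x|sphere_measure. (diag_form (\<chi> i. 1) x)\<^sup>2) = (LINT x|sphere_measure. 1)"
      by (rule sphere_integral_cong) (simp add: diag_form_def norm_eq_1_nth)
    then show ?thesis by (simp add: area_def)
  qed
  then have v: "area = 15 * v" unfolding I by simp
  \<comment> \<open>For trace 0 the sum of products of pairs is minus half the sum of squares, so
    the coefficient is 3 - 1 = 2.\<close>
  have "3 * ((d $ 1)\<^sup>2 + (d $ 2)\<^sup>2 + (d $ 3)\<^sup>2) + 2 * (d $ 1 * d $ 2 + d $ 1 * d $ 3 + d $ 2 * d $ 3) = 2 * ((d $ 1)\<^sup>2 + (d $ 2)\<^sup>2 + (d $ 3)\<^sup>2)"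
    using assms by algebra
  then show ?thesis unfolding I v by simp
qed

lemma sphere_integral_diag_form_cube:
  assumes "d $ 1 + d $ 2 + d $ 3 = 0"
  shows "(LINT x|sphere_measure. (diag_form d x) ^ 3) = 8 * area / 105 * (d $ 1 ^ 3 + d $ 2 ^ 3 + d $ 3 ^ 3)"
proof -
  define u where "u = sphere_moment 2 2 2"
  have a: "sphere_moment 2 4 0 = 3 * u" "sphere_moment 2 0 4 = 3 * u" "sphere_moment 4 0 2 = 3 * u" "sphere_moment 0 4 2 = 3 * u"
    using sphere_moment_23[of 0 2 2] sphere_moment_23[of 2 2 0] sphere_moment_12[of 0 2 2] sphere_moment_12[of 2 0 2] by (simp_all add: u_def del: add_2_eq_Suc add_2_eq_Suc')
  have b: "sphere_moment 4 2 0 = 3 * u" "sphere_moment 6 0 0 = 15 * u" "sphere_moment 0 6 0 = 15 * u"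
    "sphere_moment 0 2 4 = 3 * u" "sphere_moment 0 0 6 = 15 * u"
    using sphere_moment_12[of 2 2 0] sphere_moment_12[of 0 4 0] sphere_moment_12[of 4 0 0] sphere_moment_23[of 2 0 2] sphere_moment_23[of 4 0 0] a by (simp_all del: add_2_eq_Suc add_2_eq_Suc')
  have I: "(LINT x|sphere_measure. (diag_form d x) ^ 3) = u * (15 * (d $ 1 ^ 3 + d $ 2 ^ 3 + d $ 3 ^ 3)
      + 9 * ((d $ 1)\<^sup>2 * d $ 2 + (d $ 1)\<^sup>2 * d $ 3 + (d $ 2)\<^sup>2 * d $ 1 + (d $ 2)\<^sup>2 * d $ 3 + (d $ 3)\<^sup>2 * d $ 1 + (d $ 3)\<^sup>2 * d $ 2) + 6 * (d $ 1 * d $ 2 * d $ 3))" for d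
  proof -
    have "has_bochner_integral sphere_measure (\<lambda>x. d $ 1 ^ 3 * (x $ 1 ^ 6 * x $ 2 ^ 0 * x $ 3 ^ 0) + d $ 2 ^ 3 * (x $ 1 ^ 0 * x $ 2 ^ 6 * x $ 3 ^ 0)
       + d $ 3 ^ 3 * (x $ 1 ^ 0 * x $ 2 ^ 0 * x $ 3 ^ 6)
       + 3 * (d $ 1)\<^sup>2 * d $ 2 * (x $ 1 ^ 4 * x $ 2 ^ 2 * x $ 3 ^ 0) + 3 * (d $ 1)\<^sup>2 * d $ 3 * (x $ 1 ^ 4 * x $ 2 ^ 0 * x $ 3 ^ 2)
       + 3 * (d $ 2)\<^sup>2 * d $ 1 * (x $ 1 ^ 2 * x $ 2 ^ 4 * x $ 3 ^ 0) + 3 * (d $ 2)\<^sup>2 * d $ 3 * (x $ 1 ^ 0 * x $ 2 ^ 4 * x $ 3 ^ 2)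
       + 3 * (d $ 3)\<^sup>2 * d $ 1 * (x $ 1 ^ 2 * x $ 2 ^ 0 * x $ 3 ^ 4) + 3 * (d $ 3)\<^sup>2 * d $ 2 * (x $ 1 ^ 0 * x $ 2 ^ 2 * x $ 3 ^ 4)
       + 6 * d $ 1 * d $ 2 * d $ 3 * (x $ 1 ^ 2 * x $ 2 ^ 2 * x $ 3 ^ 2))
      (d $ 1 ^ 3 * sphere_moment 6 0 0 + d $ 2 ^ 3 * sphere_moment 0 6 0 + d $ 3 ^ 3 * sphere_moment 0 0 6
       + 3 * (d $ 1)\<^sup>2 * d $ 2 * sphere_moment 4 2 0 + 3 * (d $ 1)\<^sup>2 * d $ 3 * sphere_moment 4 0 2
       + 3 * (d $ 2)\<^sup>2 * d $ 1 * sphere_moment 2 4 0 + 3 * (d $ 2)\<^sup>2 * d $ 3 * sphere_moment 0 4 2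
       + 3 * (d $ 3)\<^sup>2 * d $ 1 * sphere_moment 2 0 4 + 3 * (d $ 3)\<^sup>2 * d $ 2 * sphere_moment 0 2 4
       + 6 * d $ 1 * d $ 2 * d $ 3 * sphere_moment 2 2 2)"
      by (intro has_bochner_integral_add has_bochner_integral_mult_right has_bochner_sphere_moment)
    moreover have "(diag_form d x) ^ 3 = d $ 1 ^ 3 * (x $ 1 ^ 6 * x $ 2 ^ 0 * x $ 3 ^ 0) + d $ 2 ^ 3 * (x $ 1 ^ 0 * x $ 2 ^ 6 * x $ 3 ^ 0)
       + d $ 3 ^ 3 * (x $ 1 ^ 0 * x $ 2 ^ 0 * x $ 3 ^ 6)
       + 3 * (d $ 1)\<^sup>2 * d $ 2 * (x $ 1 ^ 4 * x $ 2 ^ 2 * x $ 3 ^ 0) + 3 * (d $ 1)\<^sup>2 * d $ 3 * (x $ 1 ^ 4 * x $ 2 ^ 0 * x $ 3 ^ 2)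
       + 3 * (d $ 2)\<^sup>2 * d $ 1 * (x $ 1 ^ 2 * x $ 2 ^ 4 * x $ 3 ^ 0) + 3 * (d $ 2)\<^sup>2 * d $ 3 * (x $ 1 ^ 0 * x $ 2 ^ 4 * x $ 3 ^ 2)
       + 3 * (d $ 3)\<^sup>2 * d $ 1 * (x $ 1 ^ 2 * x $ 2 ^ 0 * x $ 3 ^ 4) + 3 * (d $ 3)\<^sup>2 * d $ 2 * (x $ 1 ^ 0 * x $ 2 ^ 2 * x $ 3 ^ 4)
       + 6 * d $ 1 * d $ 2 * d $ 3 * (x $ 1 ^ 2 * x $ 2 ^ 2 * x $ 3 ^ 2)" for x
      unfolding diag_form_def by (simp, algebra)
    ultimately have "(LINT x|sphere_measure. (diag_form d x) ^ 3) = d $ 1 ^ 3 * sphere_moment 6 0 0 + d $ 2 ^ 3 * sphere_moment 0 6 0 + d $ 3 ^ 3 * sphere_moment 0 0 6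
       + 3 * (d $ 1)\<^sup>2 * d $ 2 * sphere_moment 4 2 0 + 3 * (d $ 1)\<^sup>2 * d $ 3 * sphere_moment 4 0 2
       + 3 * (d $ 2)\<^sup>2 * d $ 1 * sphere_moment 2 4 0 + 3 * (d $ 2)\<^sup>2 * d $ 3 * sphere_moment 0 4 2
       + 3 * (d $ 3)\<^sup>2 * d $ 1 * sphere_moment 2 0 4 + 3 * (d $ 3)\<^sup>2 * d $ 2 * sphere_moment 0 2 4
       + 6 * d $ 1 * d $ 2 * d $ 3 * sphere_moment 2 2 2"
      using has_bochner_integral_integral_eq by (simp only:)
    then show ?thesis unfolding a b u_def[symmetric] by (simp add: algebra_simps)
  qed
  have "area = (LINT x|sphere_measure. (diag_form (\<chi> i. 1) x) ^ 3)"
  proof -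
    have "(LINT x|sphere_measure. (diag_form (\<chi> i. 1) x) ^ 3) = (LINT x|sphere_measure. 1)"
      by (rule sphere_integral_cong) (simp add: diag_form_def norm_eq_1_nth)
    then show ?thesis by (simp add: area_def)
  qed
  then have u: "area = 105 * u" unfolding I by simp
  \<comment> \<open>For trace 0 the mixed terms sum to minus the sum of cubes, and three times the
    product is the sum of cubes; hence 15 - 9 + 2 = 8.\<close>
  have "d $ 3 = - d $ 1 - d $ 2" using assms by linarith
  then have "(15 * (d $ 1 ^ 3 + d $ 2 ^ 3 + d $ 3 ^ 3)
      + 9 * ((d $ 1)\<^sup>2 * d $ 2 + (d $ 1)\<^sup>2 * d $ 3 + (d $ 2)\<^sup>2 * d $ 1 + (d $ 2)\<^sup>2 * d $ 3 + (d $ 3)\<^sup>2 * d $ 1 + (d $ 3)\<^sup>2 * d $ 2) + 6 * (d $ 1 * d $ 2 * d $ 3))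
     = 8 * (d $ 1 ^ 3 + d $ 2 ^ 3 + d $ 3 ^ 3)" by algebra
  then show ?thesis unfolding I u by simp
qed

text \<open>First-order condition at a maximum of the Rayleigh quotient: along
  \<open>a + t *\<^sub>R v\<close> the term linear in \<open>t\<close> must vanish. The subspace
  \<open>W\<close> lets the same argument serve for the second eigenvector inside the complement of
  the first.\<close>

lemma quadratic_maximum_orthogonal:
  fixes B :: "real^3^3"
  assumes W: "subspace W" and B: "transpose B = B" and a: "a \<in> W" "norm a = 1"
    and m: "\<forall>x\<in>W. norm x = 1 \<longrightarrow> x \<bullet> (B *v x) \<le> a \<bullet> (B *v a)" and v: "v \<in> W" "a \<bullet> v = 0"
  shows "a \<bullet> (B *v v) = 0"
proof (rule ccontr)
  define b c where "b = a \<bullet> (B *v v)" and "c = (a \<bullet> (B *v a)) * (v \<bullet> v) - v \<bullet> (B *v v)"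
  assume "a \<bullet> (B *v v) \<noteq> 0"
  then have b: "b \<noteq> 0" by (simp add: b_def)
  have s: "v \<bullet> (B *v a) = b" using dot_lmul_matrix[of v B a] B unfolding b_def
    by (metis inner_commute transpose_matrix_vector)
  have q: "x \<bullet> (B *v x) \<le> (a \<bullet> (B *v a)) * (x \<bullet> x)" if x: "x \<in> W" for x
  proof (cases "x = 0")
    case False
    have "(x /\<^sub>R norm x) \<bullet> (B *v (x /\<^sub>R norm x)) \<le> a \<bullet> (B *v a)"
      by (rule m[rule_format]) (use subspace_scale[OF W x] False in simp_all)
    moreover have "(x /\<^sub>R norm x) \<bullet> (B *v (x /\<^sub>R norm x)) = (x \<bullet> (B *v x)) / (x \<bullet> x)"
      by (simp add: matrix_vector_mult_scaleR field_simps power2_norm_eq_inner[symmetric] power2_eq_square)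
    ultimately show ?thesis using False by (simp add: divide_le_eq)
  qed simp
  have t: "2 * t * b \<le> t\<^sup>2 * c" for t :: real
  proof -
    have "(a + t *\<^sub>R v) \<bullet> (B *v (a + t *\<^sub>R v)) \<le> (a \<bullet> (B *v a)) * ((a + t *\<^sub>R v) \<bullet> (a + t *\<^sub>R v))"
      by (intro q subspace_add[OF W] subspace_scale[OF W] a v)
    moreover have "(a + t *\<^sub>R v) \<bullet> (B *v (a + t *\<^sub>R v)) = a \<bullet> (B *v a) + 2 * t * b + t\<^sup>2 * (v \<bullet> (B *v v))"
      unfolding matrix_vector_right_distrib matrix_vector_mult_scaleR inner_add_left inner_add_right inner_scaleR_left inner_scaleR_right s b_def[symmetric]
      by (simp add: power2_eq_square algebra_simps)
    moreover have "(a + t *\<^sub>R v) \<bullet> (a + t *\<^sub>R v) = 1 + t\<^sup>2 * (v \<bullet> v)"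
      using a v by (simp add: inner_add_left inner_add_right inner_commute[of v a] norm_eq_1 power2_eq_square)
    ultimately have "a \<bullet> (B *v a) + 2 * t * b + t\<^sup>2 * (v \<bullet> (B *v v)) \<le> (a \<bullet> (B *v a)) * (1 + t\<^sup>2 * (v \<bullet> v))" by (simp only:)
    then show ?thesis by (simp add: c_def algebra_simps)
  qed
  \<comment> \<open>Small enough that the linear term 2 t b beats the quadratic term t^2 c.\<close>
  define t where "t = b / (1 + \<bar>c\<bar>)"
  have bt: "b = t * (1 + \<bar>c\<bar>)" by (simp add: t_def)
  have "2 * t * (t * (1 + \<bar>c\<bar>)) \<le> t\<^sup>2 * c" using t[of t] bt by simp
  then have "t\<^sup>2 * (2 * (1 + \<bar>c\<bar>)) \<le> t\<^sup>2 * c" by (simp add: power2_eq_square algebra_simps)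
  moreover have "t\<^sup>2 > 0" using b bt by auto
  ultimately have "2 * (1 + \<bar>c\<bar>) \<le> c" by (simp only: mult_le_cancel_left_pos)
  then have "2 + 2 * \<bar>c\<bar> \<le> c" by simp
  then show False by linarith
qed

text \<open>Maximise the form on the sphere, then on the circle orthogonal to the first maximiser,
  and complete by the cross product. Successive maxima come out sorted, and the cross product makes
  the determinant 1, so the diagonalising matrix is a rotation.\<close>

lemma spectral_theorem_3:
  fixes B :: "real^3^3"
  assumes B: "transpose B = B"
  shows "\<exists>A d. rotation_matrix A \<and> d $ 1 \<ge> d $ 2 \<and> d $ 2 \<ge> d $ 3 \<and> (\<forall>x. (A *v x) \<bullet> (B *v (A *v x)) = diag_form d x)"
proof -
  define q where "q = (\<lambda>x. x \<bullet> (B *v x))"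
  have cq: "continuous_on S q" for S unfolding q_def
    by (intro continuous_intros linear_continuous_on matrix_vector_mul_bounded_linear)
  have "\<exists>a\<in>S2. \<forall>x\<in>S2. q x \<le> q a"
    using continuous_attains_sup[OF compact_sphere _ cq, of "0::real^3" 1] by simp
  then obtain a where a: "norm a = 1" "\<forall>x. norm x = 1 \<longrightarrow> q x \<le> q a" by auto
  define W where "W = {x. a \<bullet> x = 0}"
  have W: "subspace W" unfolding W_def by (rule subspace_hyperplane)
  have cW: "compact (S2 \<inter> W)" unfolding W_def by (intro compact_Int_closed compact_sphere closed_hyperplane)
  obtain y where y: "y \<noteq> 0" "orthogonal a y" using orthogonal_to_vector_exists[of a] by auto
  then have "y /\<^sub>R norm y \<in> S2 \<inter> W" by (simp add: W_def orthogonal_def)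
  then have "S2 \<inter> W \<noteq> {}" by blast
  from continuous_attains_sup[OF cW this cq]
  obtain b where b: "norm b = 1" "b \<in> W" "\<forall>x\<in>W. norm x = 1 \<longrightarrow> q x \<le> q b" by auto
  define c where "c = cross3 a b"
  have ab: "a \<bullet> b = 0" using b(2) by (simp add: W_def)
  have ac: "a \<bullet> c = 0" and bc: "b \<bullet> c = 0" by (simp_all add: c_def dot_cross_self)
  have c1: "norm c = 1" using norm_cross_dot[of a b] norm_ge_zero[of "cross3 a b"] a(1) b(1) ab unfolding c_def power2_eq_1_iff by (auto simp del: norm_ge_zero simp: power2_eq_1_iff)
  have cW: "c \<in> W" using ac by (simp add: W_def)
  have o: "a \<bullet> (B *v b) = 0" "a \<bullet> (B *v c) = 0" "b \<bullet> (B *v c) = 0"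
    using quadratic_maximum_orthogonal[OF subspace_UNIV B UNIV_I a(1), of b] quadratic_maximum_orthogonal[OF subspace_UNIV B UNIV_I a(1), of c]
      quadratic_maximum_orthogonal[OF W B b(2,1) _ cW bc] a(2) b(3) ab ac unfolding q_def by auto
  have sym: "u \<bullet> (B *v v) = v \<bullet> (B *v u)" for u v
    using dot_lmul_matrix[of u B v] B by (metis inner_commute transpose_matrix_vector)
  define A :: "real^3^3" where "A = transpose (vector [a, b, c])"
  define d :: "real^3" where "d = vector [q a, q b, q c]"
  have Av: "A *v x = x $ 1 *\<^sub>R a + x $ 2 *\<^sub>R b + x $ 3 *\<^sub>R c" for x
    by (simp add: A_def vec_eq_iff matrix_vector_mult_def transpose_def sum_3 mult.commute)
  have col: "column 1 A = a" "column 2 A = b" "column 3 A = c"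
    by (simp_all add: A_def vec_eq_iff column_def transpose_def)
  have "orthogonal_matrix A"
    unfolding orthogonal_matrix_orthonormal_columns using a(1) b(1) c1 ab ac bc
    by (simp add: forall_3 col orthogonal_def inner_commute[of b a] inner_commute[of c a] inner_commute[of c b])
  moreover have "det A = 1"
  proof -
    have "det A = a \<bullet> cross3 b c" by (simp add: A_def dot_cross_det)
    also have "\<dots> = c \<bullet> cross3 a b" by (simp add: cross3_simps)
    also have "\<dots> = 1" using c1 by (simp add: c_def norm_eq_1)
    finally show ?thesis .
  qed
  ultimately have "rotation_matrix A" by (simp add: rotation_matrix_def)
  moreover have "d $ 1 \<ge> d $ 2" "d $ 2 \<ge> d $ 3" using a(2) b(1,3) c1 cW by (simp_all add: d_def)
  moreover have "(A *v x) \<bullet> (B *v (A *v x)) = diag_form d x" for x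
    unfolding Av matrix_vector_right_distrib matrix_vector_mult_scaleR inner_add_left inner_add_right inner_scaleR_left inner_scaleR_right
    by (simp add: o sym[of b a] sym[of c a] sym[of c b] diag_form_def d_def q_def power2_eq_square)
  ultimately show ?thesis by blast
qed

lemma norm_rotation_matrix: "rotation_matrix A \<Longrightarrow> norm (A *v x) = norm x" for A :: "real^'n^'n"
  by (rule orthogonal_transformation_norm[of "(*v) A"]) (simp add: rotation_matrix_def orthogonal_transformation_matrix)

text \<open>The eigenvalues sum to 0 because \<open>h\<close> is orthogonal to constants and the
  squared coordinates all have the same integral.\<close>

lemma spherical_harmonic_2_normal_form:
  assumes h: "spherical_harmonic 2 h"
  shows "\<exists>A d. rotation_matrix A \<and> d $ 1 \<ge> d $ 2 \<and> d $ 2 \<ge> d $ 3 \<and> d $ 1 + d $ 2 + d $ 3 = 0 \<and> (\<forall>x\<in>S2. h (A *v x) = diag_form d x)"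
proof -
  obtain B :: "real^3^3" where B: "transpose B = B" "\<forall>x\<in>S2. h x = x \<bullet> (B *v x)" using spherical_harmonic_2[OF h] by blast
  obtain A d where A: "rotation_matrix A" "d $ 1 \<ge> d $ 2" "d $ 2 \<ge> d $ 3" "\<forall>x. (A *v x) \<bullet> (B *v (A *v x)) = diag_form d x"
    using spectral_theorem_3[OF B(1)] by blast
  have hA: "h (A *v x) = diag_form d x" if x: "x \<in> S2" for x
  proof -
    have "A *v x \<in> S2" using x norm_rotation_matrix[OF A(1)] by simp
    with B(2) have "h (A *v x) = (A *v x) \<bullet> (B *v (A *v x))" by blast
    then show ?thesis using A(4) by simp
  qed
  have "(LINT x|sphere_measure. h x * 1) = 0"
    by (rule spherical_harmonic_orthogonal[OF h spherical_harmonic_const]) simp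
  then have "0 = (LINT x|sphere_measure. h (A *v x))"
    using sphere_integral_rotation_matrix[OF A(1) spherical_harmonicD(3)[OF h]] by simp
  also have "\<dots> = (LINT x|sphere_measure. diag_form d x)" by (rule sphere_integral_cong) (rule hA)
  also have "\<dots> = d $ 1 * (LINT x|sphere_measure. (axis 1 1 \<bullet> x)\<^sup>2) + d $ 2 * (LINT x|sphere_measure. (axis 2 1 \<bullet> x)\<^sup>2) + d $ 3 * (LINT x|sphere_measure. (axis 3 1 \<bullet> x)\<^sup>2)"
  proof -
    have "has_bochner_integral sphere_measure (\<lambda>x. d $ 1 * (axis 1 1 \<bullet> x)\<^sup>2 + d $ 2 * (axis 2 1 \<bullet> x)\<^sup>2 + d $ 3 * (axis 3 1 \<bullet> x)\<^sup>2)
      (d $ 1 * (LINT x|sphere_measure. (axis 1 1 \<bullet> x)\<^sup>2) + d $ 2 * (LINT x|sphere_measure. (axis 2 1 \<bullet> x)\<^sup>2) + d $ 3 * (LINT x|sphere_measure. (axis 3 1 \<bullet> x)\<^sup>2))"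
      by (intro has_bochner_integral_add has_bochner_integral_mult_right has_bochner_integral_integrable integrable_sphere_measure continuous_intros)
    from has_bochner_integral_integral_eq[OF this] show ?thesis by (simp add: diag_form_def inner_axis')
  qed
  also have "\<dots> = (d $ 1 + d $ 2 + d $ 3) * (area / 3)"
    unfolding sphere_integral_inner_square by (simp add: norm_axis_1 algebra_simps)
  finally have "d $ 1 + d $ 2 + d $ 3 = 0" using area_pos by simp
  with A(1,2,3) hA show ?thesis by blast
qed

text \<open>Trace and power sums fix the elementary symmetric functions, so both triples are the
  roots of one cubic. Equal root sets have the same largest and smallest element, and the trace
  fixes the middle entry, also when roots coincide.\<close>

lemma sorted_traceless_determined:
  fixes d e :: "real^3"
  assumes d: "d $ 1 \<ge> d $ 2" "d $ 2 \<ge> d $ 3" "d $ 1 + d $ 2 + d $ 3 = 0"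
    and e: "e $ 1 \<ge> e $ 2" "e $ 2 \<ge> e $ 3" "e $ 1 + e $ 2 + e $ 3 = 0"
    and 2: "(d $ 1)\<^sup>2 + (d $ 2)\<^sup>2 + (d $ 3)\<^sup>2 = (e $ 1)\<^sup>2 + (e $ 2)\<^sup>2 + (e $ 3)\<^sup>2"
    and 3: "d $ 1 ^ 3 + d $ 2 ^ 3 + d $ 3 ^ 3 = e $ 1 ^ 3 + e $ 2 ^ 3 + e $ 3 ^ 3"
  shows "d = e"
proof -
  have e2: "d $ 1 * d $ 2 + d $ 1 * d $ 3 + d $ 2 * d $ 3 = e $ 1 * e $ 2 + e $ 1 * e $ 3 + e $ 2 * e $ 3"
    using d(3) e(3) 2 by algebra
  have e3: "d $ 1 * d $ 2 * d $ 3 = e $ 1 * e $ 2 * e $ 3" using d(3) e(3) 3 by algebra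
  have r: "(s - d $ 1) * (s - d $ 2) * (s - d $ 3) = (s - e $ 1) * (s - e $ 2) * (s - e $ 3)" for s
    using d(3) e(3) e2 e3 by algebra
  have z: "s = d $ 1 \<or> s = d $ 2 \<or> s = d $ 3 \<longleftrightarrow> s = e $ 1 \<or> s = e $ 2 \<or> s = e $ 3" for s
    using arg_cong[OF r[of s], of "\<lambda>t. t = 0"] by (simp only: mult_eq_0_iff right_minus_eq disj_assoc)
  have "d $ 1 \<le> e $ 1" using z[of "d $ 1"] e by linarith
  moreover have "e $ 1 \<le> d $ 1" using z[of "e $ 1"] d by linarith
  moreover have "e $ 3 \<le> d $ 3" using z[of "d $ 3"] e by linarith
  moreover have "d $ 3 \<le> e $ 3" using z[of "e $ 3"] d by linarith
  ultimately have "d $ 1 = e $ 1" "d $ 3 = e $ 3" by linarith+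
  then show ?thesis using d(3) e(3) by (simp add: vec_eq_iff forall_3)
qed

text \<open>Compactness turns uniqueness into stability: on bounded sorted traceless triples at
  distance at least \<epsilon> from \<open>e\<close>, the sum of the two deviations has a positive
  lower bound \<open>m\<close>. Deviations of at most m / 3 each stay below it, and the bound 1 on
  the first one keeps \<open>d\<close> in the compact set.\<close>

lemma sorted_traceless_stable:
  fixes e :: "real^3"
  assumes e: "e $ 1 \<ge> e $ 2" "e $ 2 \<ge> e $ 3" "e $ 1 + e $ 2 + e $ 3 = 0" and \<epsilon>: "\<epsilon> > 0"
  shows "\<exists>\<kappa>>0. \<forall>d. d $ 1 \<ge> d $ 2 \<longrightarrow> d $ 2 \<ge> d $ 3 \<longrightarrow> d $ 1 + d $ 2 + d $ 3 = 0 \<longrightarrow>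
     \<bar>(d $ 1)\<^sup>2 + (d $ 2)\<^sup>2 + (d $ 3)\<^sup>2 - ((e $ 1)\<^sup>2 + (e $ 2)\<^sup>2 + (e $ 3)\<^sup>2)\<bar> \<le> \<kappa> \<longrightarrow>
     \<bar>d $ 1 ^ 3 + d $ 2 ^ 3 + d $ 3 ^ 3 - (e $ 1 ^ 3 + e $ 2 ^ 3 + e $ 3 ^ 3)\<bar> \<le> \<kappa> \<longrightarrow> norm (d - e) < \<epsilon>"
proof -
  define p2 where "p2 = (\<lambda>d::real^3. (d $ 1)\<^sup>2 + (d $ 2)\<^sup>2 + (d $ 3)\<^sup>2)"
  define p3 where "p3 = (\<lambda>d::real^3. d $ 1 ^ 3 + d $ 2 ^ 3 + d $ 3 ^ 3)"
  define R where "R = sqrt (p2 e + 1)"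
  define K where "K = cball 0 R \<inter> {d::real^3. d $ 2 \<le> d $ 1 \<and> d $ 3 \<le> d $ 2 \<and> d $ 1 + d $ 2 + d $ 3 = 0 \<and> \<epsilon> \<le> norm (d - e)}"
  define g where "g = (\<lambda>d. \<bar>p2 d - p2 e\<bar> + \<bar>p3 d - p3 e\<bar>)"
  have K: "compact K" unfolding K_def
    by (intro compact_Int_closed compact_cball closed_Collect_conj closed_Collect_le closed_Collect_eq continuous_intros)
  have cg: "continuous_on K g" unfolding g_def p2_def p3_def by (intro continuous_intros)
  have gpos: "g d > 0" if "d \<in> K" for d
  proof (rule ccontr)
    assume "\<not> g d > 0"
    then have "p2 d = p2 e" "p3 d = p3 e" unfolding g_def by linarith+
    then have "d = e" using sorted_traceless_determined[OF _ _ _ e, of d] that by (simp add: K_def p2_def p3_def)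
    then show False using that \<epsilon> by (simp add: K_def)
  qed
  have "\<exists>m>0. \<forall>d\<in>K. m \<le> g d"
  proof (cases "K = {}")
    case False
    then obtain d where "d \<in> K" "\<forall>x\<in>K. g d \<le> g x" using continuous_attains_inf[OF K _ cg] by blast
    then show ?thesis using gpos by blast
  qed (auto intro: exI[of _ 1])
  then obtain m where m: "m > 0" "\<forall>d\<in>K. m \<le> g d" by blast
  have "norm (d - e) < \<epsilon>"
    if d: "d $ 1 \<ge> d $ 2" "d $ 2 \<ge> d $ 3" "d $ 1 + d $ 2 + d $ 3 = 0" and l: "\<bar>p2 d - p2 e\<bar> \<le> min 1 (m / 3)" "\<bar>p3 d - p3 e\<bar> \<le> min 1 (m / 3)" for d
  proof (rule ccontr)
    assume n: "\<not> norm (d - e) < \<epsilon>"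
    have "norm d = sqrt (p2 d)" by (simp add: norm_eq_sqrt_inner inner_vec_def sum_3 p2_def power2_eq_square)
    also have "\<dots> \<le> R" unfolding R_def using l(1) by (intro real_sqrt_le_mono) linarith
    finally have "d \<in> K" using d n by (simp add: K_def)
    then have "m \<le> g d" using m(2) by blast
    then show False using l m(1) unfolding g_def by linarith
  qed
  moreover have "min 1 (m / 3) > 0" using m(1) by simp
  ultimately show ?thesis unfolding p2_def p3_def by blast
qed

lemma rotation_matrix_mult: "rotation_matrix A \<Longrightarrow> rotation_matrix B \<Longrightarrow> rotation_matrix (A ** B)" for A B :: "real^'n^'n"
  unfolding rotation_matrix_def by (simp add: orthogonal_matrix_mul det_mul)

lemma rotation_matrix_transpose: "rotation_matrix A \<Longrightarrow> rotation_matrix (transpose A)" for A :: "real^'n^'n"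
  unfolding rotation_matrix_def by simp

lemma rotation_matrix_transpose_cancel: "rotation_matrix A \<Longrightarrow> A *v (transpose A *v x) = x" for A :: "real^'n^'n"
  unfolding rotation_matrix_def orthogonal_matrix_def by (simp only: matrix_vector_mul_assoc matrix_vector_mul_lid)

text \<open>Both harmonics are rotated into diagonal form, where the two integrals are multiples of
  the power sums of the eigenvalues. Close eigenvalues give uniformly close forms, and undoing one
  rotation before applying the other yields \<open>Q ** transpose A\<close>.\<close>

lemma spherical_harmonic_2_stable:
  assumes Y: "spherical_harmonic 2 Y" and \<epsilon>: "\<epsilon> > 0"
  shows "\<exists>\<kappa>>0. \<forall>h. spherical_harmonic 2 h \<longrightarrow>
     \<bar>(LINT x|sphere_measure. (h x)\<^sup>2) - (LINT x|sphere_measure. (Y x)\<^sup>2)\<bar> \<le> \<kappa> \<longrightarrow>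
     \<bar>(LINT x|sphere_measure. h x ^ 3) - (LINT x|sphere_measure. Y x ^ 3)\<bar> \<le> \<kappa> \<longrightarrow>
     (\<exists>A. rotation_matrix A \<and> (\<forall>x\<in>S2. \<bar>h x - Y (A *v x)\<bar> \<le> \<epsilon>))"
proof -
  define c2 c3 where "c2 = 2 * area / 15" and "c3 = 8 * area / 105"
  have c: "c2 > 0" "c3 > 0" using area_pos by (simp_all add: c2_def c3_def)
  define P2 where "P2 = (\<lambda>d::real^3. (d $ 1)\<^sup>2 + (d $ 2)\<^sup>2 + (d $ 3)\<^sup>2)"
  define P3 where "P3 = (\<lambda>d::real^3. d $ 1 ^ 3 + d $ 2 ^ 3 + d $ 3 ^ 3)"
  have mom: "(LINT x|sphere_measure. (f x)\<^sup>2) = c2 * P2 d" "(LINT x|sphere_measure. f x ^ 3) = c3 * P3 d"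
    if f: "spherical_harmonic 2 f" and A: "rotation_matrix A" "d $ 1 + d $ 2 + d $ 3 = 0" "\<forall>x\<in>S2. f (A *v x) = diag_form d x" for f A d
  proof -
    note cf = spherical_harmonicD(3)[OF f]
    have *: "(LINT x|sphere_measure. f x ^ n) = (LINT x|sphere_measure. diag_form d x ^ n)" for n
    proof -
      have "(LINT x|sphere_measure. f x ^ n) = (LINT x|sphere_measure. f (A *v x) ^ n)"
        by (rule sphere_integral_rotation_matrix[symmetric, OF A(1) continuous_on_power[OF cf]])
      also have "\<dots> = (LINT x|sphere_measure. diag_form d x ^ n)"
        by (rule sphere_integral_cong) (simp only: A(3)[rule_format])
      finally show ?thesis .
    qed
    show "(LINT x|sphere_measure. (f x)\<^sup>2) = c2 * P2 d" "(LINT x|sphere_measure. f x ^ 3) = c3 * P3 d"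
      unfolding * sphere_integral_diag_form_square[OF A(2)] sphere_integral_diag_form_cube[OF A(2)] c2_def c3_def P2_def P3_def by (rule refl)+
  qed
  obtain Q e where Q: "rotation_matrix Q" "e $ 1 \<ge> e $ 2" "e $ 2 \<ge> e $ 3" "e $ 1 + e $ 2 + e $ 3 = 0" "\<forall>x\<in>S2. Y (Q *v x) = diag_form e x"
    using spherical_harmonic_2_normal_form[OF Y] by blast
  obtain \<kappa> where \<kappa>: "\<kappa> > 0" "\<forall>d. d $ 1 \<ge> d $ 2 \<longrightarrow> d $ 2 \<ge> d $ 3 \<longrightarrow> d $ 1 + d $ 2 + d $ 3 = 0 \<longrightarrow>
     \<bar>P2 d - P2 e\<bar> \<le> \<kappa> \<longrightarrow> \<bar>P3 d - P3 e\<bar> \<le> \<kappa> \<longrightarrow> norm (d - e) < \<epsilon>"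
    using sorted_traceless_stable[OF Q(2,3,4) \<epsilon>] unfolding P2_def P3_def by blast
  have "\<exists>A. rotation_matrix A \<and> (\<forall>x\<in>S2. \<bar>h x - Y (A *v x)\<bar> \<le> \<epsilon>)"
    if h: "spherical_harmonic 2 h" and l2: "\<bar>(LINT x|sphere_measure. (h x)\<^sup>2) - (LINT x|sphere_measure. (Y x)\<^sup>2)\<bar> \<le> min (c2 * \<kappa>) (c3 * \<kappa>)"
      and l3: "\<bar>(LINT x|sphere_measure. h x ^ 3) - (LINT x|sphere_measure. Y x ^ 3)\<bar> \<le> min (c2 * \<kappa>) (c3 * \<kappa>)" for h
  proof -
    obtain A d where A: "rotation_matrix A" "d $ 1 \<ge> d $ 2" "d $ 2 \<ge> d $ 3" "d $ 1 + d $ 2 + d $ 3 = 0" "\<forall>x\<in>S2. h (A *v x) = diag_form d x"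
      using spherical_harmonic_2_normal_form[OF h] by blast
    have "c2 * \<bar>P2 d - P2 e\<bar> = \<bar>c2 * P2 d - c2 * P2 e\<bar>" using c by (simp add: abs_mult right_diff_distrib[symmetric])
    also have "\<dots> \<le> c2 * \<kappa>" using l2 unfolding mom[OF h A(1,4,5)] mom[OF Y Q(1,4,5)] by simp
    finally have 2: "\<bar>P2 d - P2 e\<bar> \<le> \<kappa>" using c by simp
    have "c3 * \<bar>P3 d - P3 e\<bar> = \<bar>c3 * P3 d - c3 * P3 e\<bar>" using c by (simp add: abs_mult right_diff_distrib[symmetric])
    also have "\<dots> \<le> c3 * \<kappa>" using l3 unfolding mom[OF h A(1,4,5)] mom[OF Y Q(1,4,5)] by simp
    finally have 3: "\<bar>P3 d - P3 e\<bar> \<le> \<kappa>" using c by simp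
    have n: "norm (d - e) < \<epsilon>" using \<kappa>(2) A(2,3,4) 2 3 by blast
    have "\<bar>h x - Y ((Q ** transpose A) *v x)\<bar> \<le> \<epsilon>" if x: "x \<in> S2" for x
    proof -
      define y where "y = transpose A *v x"
      have y: "y \<in> S2" using x norm_rotation_matrix[OF rotation_matrix_transpose[OF A(1)], of x] by (simp only: y_def mem_sphere dist_0_norm)
      have "x = A *v y" unfolding y_def by (rule rotation_matrix_transpose_cancel[symmetric, OF A(1)])
      then have "h x = diag_form d y" using bspec[OF A(5) y] by simp
      moreover have "Y ((Q ** transpose A) *v x) = diag_form e y"
        using bspec[OF Q(5) y] by (simp only: y_def matrix_vector_mul_assoc)
      ultimately show ?thesis using diag_form_diff_le[OF y, of d e] n by simp
    qed
    then show ?thesis using rotation_matrix_mult[OF Q(1) rotation_matrix_transpose[OF A(1)]] by blast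
  qed
  moreover have "min (c2 * \<kappa>) (c3 * \<kappa>) > 0" using c \<kappa>(1) by simp
  ultimately show ?thesis by blast
qed


section \<open>Orbits of degree two harmonics\<close>

lemma rotation_matrix_row: "rotation_matrix A \<Longrightarrow> norm (A $ i) = 1" for A :: "real^'n^'n"
  by (simp add: rotation_matrix_def orthogonal_matrix_orthonormal_rows row_def)

lemma compact_rotation_matrices: "compact {A :: real^'n^'n. rotation_matrix A}"
proof -
  have "rotation_matrix A \<longleftrightarrow> (\<forall>i j. A $ i \<bullet> A $ j = (if i = j then 1 else 0)) \<and> det A = 1" for A :: "real^'n^'n"
    by (auto simp: rotation_matrix_def orthogonal_matrix_orthonormal_rows row_def norm_eq_1 orthogonal_def)
  then have "{A :: real^'n^'n. rotation_matrix A} = {A. (\<forall>i j. A $ i \<bullet> A $ j = (if i = j then 1 else 0)) \<and> det A = 1}" by simp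
  moreover have "closed {A :: real^'n^'n. (\<forall>i j. A $ i \<bullet> A $ j = (if i = j then 1 else 0)) \<and> det A = 1}"
    unfolding det_def
    by (intro closed_Collect_conj closed_Collect_all closed_Collect_eq continuous_intros)
  moreover have "bounded {A :: real^'n^'n. rotation_matrix A}"
    unfolding bounded_iff
  proof (intro exI ballI)
    fix A :: "real^'n^'n" assume "A \<in> {A. rotation_matrix A}"
    then have "norm (A $ i) = 1" for i by (simp add: rotation_matrix_row)
    then show "norm A \<le> real CARD('n)"
      using L2_set_le_sum[of UNIV "\<lambda>i. norm (A $ i)"] by (simp add: norm_vec_def)
  qed
  ultimately show ?thesis by (simp add: compact_eq_bounded_closed)
qed

text \<open>The definition by \<open>LEAST\<close> is informative only when a minimum exists;
  compactness of the rotation group and continuity of the L^p distance in the matrix supply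
  it.\<close>

lemma orbit_dist_attained:
  assumes p: "p > 1" and Y: "continuous_on S2 Y" and g: "continuous_on S2 g"
  shows "\<exists>A. rotation_matrix A \<and> orbit_dist p Y g = Lp_norm p (\<lambda>x. Y (A *v x) - g x) \<and>
    (\<forall>B. rotation_matrix B \<longrightarrow> orbit_dist p Y g \<le> Lp_norm p (\<lambda>x. Y (B *v x) - g x))"
proof -
  define K where "K = {A :: real^3^3. rotation_matrix A}"
  define F where "F = (\<lambda>A. Lp_norm p (\<lambda>x. Y (A *v x) - g x))"
  have i1: "integrable sphere_measure (\<lambda>x. 1 :: real)" by simp
  have "rot_orbit Y = (\<lambda>A. Y \<circ> (\<lambda>x. A *v x)) ` K" unfolding rot_orbit_def K_def by blast
  then have D: "(\<lambda>f. Lp_norm p (\<lambda>x. f x - g x)) ` rot_orbit Y = F ` K"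
    by (simp add: image_image F_def)
  have m: "continuous_on (K \<times> S2) (\<lambda>v. fst v *v snd v)"
    unfolding matrix_vector_mult_def by (intro continuous_intros)
  have im: "(\<lambda>v. fst v *v snd v) ` (K \<times> S2) \<subseteq> S2"
  proof
    fix y assume "y \<in> (\<lambda>v. fst v *v snd v) ` (K \<times> S2)"
    then obtain A :: "real^3^3" and x :: "real^3" where "rotation_matrix A" "norm x = 1" "y = A *v x" by (auto simp: K_def)
    then show "y \<in> S2" using norm_rotation_matrix[of A x] by simp
  qed
  have "continuous_on (K \<times> S2) (\<lambda>v. \<bar>Y (fst v *v snd v) - g (snd v)\<bar> powr p)"
    by (intro continuous_on_abs_powr continuous_on_diff continuous_on_compose2[OF Y m im] continuous_on_compose2[OF g continuous_on_snd])
      (use p in \<open>auto intro: continuous_on_id\<close>)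
  from continuous_on_sphere_integral[OF i1 this]
  have "continuous_on K (\<lambda>A. LINT x|sphere_measure. \<bar>Y (A *v x) - g x\<bar> powr p)" by simp
  then have cF: "continuous_on K F" unfolding F_def Lp_norm_def
    by (intro continuous_on_powr' continuous_on_const) (use p in auto)
  have "K \<noteq> {}" using rotation_matrix_def[of "mat 1 :: real^3^3"] by (auto simp: K_def orthogonal_matrix_id)
  from continuous_attains_inf[OF _ this cF] obtain A where A: "A \<in> K" "\<forall>B\<in>K. F A \<le> F B"
    using compact_rotation_matrices unfolding K_def by blast
  have "orbit_dist p Y g = F A" unfolding orbit_dist_def D
    by (rule Least_equality) (use A in auto)
  then show ?thesis using A unfolding K_def F_def by auto
qed

text \<open>Pointwise, |s| is either at most l or at most l^(1-p) |s|^p. The choice l = e / (2 area)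
  spends half of \<open>e\<close> on the first case.\<close>

lemma L1_small_if_Lp_small:
  fixes e p :: real
  assumes e: "e > 0"
  shows "\<exists>\<kappa>>0. \<forall>d. continuous_on S2 d \<longrightarrow> (LINT x|sphere_measure. \<bar>d x\<bar> powr p) \<le> \<kappa> \<longrightarrow> p \<ge> 1 \<longrightarrow> (LINT x|sphere_measure. \<bar>d x\<bar>) \<le> e"
proof -
  define l where "l = e / (2 * area)"
  have l: "l > 0" using e area_pos by (simp add: l_def)
  define c where "c = l powr (1 - p)"
  have c: "c > 0" using l by (simp add: c_def)
  have "(LINT x|sphere_measure. \<bar>d x\<bar>) \<le> e"
    if d: "continuous_on S2 d" and i: "(LINT x|sphere_measure. \<bar>d x\<bar> powr p) \<le> e / (2 * c)" and p: "p \<ge> 1" for d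
  proof -
    have cp: "continuous_on S2 (\<lambda>x. \<bar>d x\<bar> powr p)" using continuous_on_abs_powr[OF d] p by simp
    have pt: "\<bar>s\<bar> \<le> l + c * \<bar>s\<bar> powr p" for s :: real
    proof (cases "\<bar>s\<bar> \<le> l")
      case True
      have "0 \<le> c * \<bar>s\<bar> powr p" using c by simp
      with True show ?thesis by linarith
    next
      case False
      then have s: "\<bar>s\<bar> > 0" using l by linarith
      have "\<bar>s\<bar> = \<bar>s\<bar> powr (1 - p) * \<bar>s\<bar> powr p" using s by (simp add: powr_add[symmetric])
      also have "\<dots> \<le> c * \<bar>s\<bar> powr p" unfolding c_def
        using False l p by (intro mult_right_mono powr_mono2') auto
      finally show ?thesis using l by linarith
    qed
    have "(LINT x|sphere_measure. \<bar>d x\<bar>) \<le> (LINT x|sphere_measure. l + c * \<bar>d x\<bar> powr p)"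
      by (rule sphere_integral_mono) (intro continuous_intros d cp pt)+
    also have "\<dots> = l * area + c * (LINT x|sphere_measure. \<bar>d x\<bar> powr p)"
      using integrable_sphere_measure[OF cp] by (simp add: area_def[symmetric] mult.commute)
    also have "\<dots> \<le> l * area + c * (e / (2 * c))" using i c by (intro add_left_mono mult_left_mono) auto
    also have "\<dots> = e" using c area_pos by (simp add: l_def)
    finally show ?thesis .
  qed
  moreover have "e / (2 * c) > 0" using e c by simp
  ultimately show ?thesis by blast
qed

lemma sphere_integral_diff_le:
  fixes f g k :: "real^3 \<Rightarrow> real"
  assumes "continuous_on S2 f" "continuous_on S2 g" "continuous_on S2 k" "\<And>x. x \<in> S2 \<Longrightarrow> \<bar>f x - g x\<bar> \<le> c * k x"
  shows "\<bar>(LINT x|sphere_measure. f x) - (LINT x|sphere_measure. g x)\<bar> \<le> c * (LINT x|sphere_measure. k x)"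
proof -
  have "(LINT x|sphere_measure. f x) - (LINT x|sphere_measure. g x) = (LINT x|sphere_measure. f x - g x)"
    by (rule Bochner_Integration.integral_diff[symmetric]) (intro integrable_sphere_measure assms)+
  also have "\<bar>\<dots>\<bar> \<le> (LINT x|sphere_measure. \<bar>f x - g x\<bar>)" by (rule integral_abs_bound)
  also have "\<dots> \<le> (LINT x|sphere_measure. c * k x)"
    by (rule sphere_integral_mono) (intro continuous_intros assms | assumption)+
  finally show ?thesis by simp
qed

lemma power2_diff_le: "\<bar>a\<bar> \<le> R \<Longrightarrow> \<bar>b\<bar> \<le> R \<Longrightarrow> \<bar>a\<^sup>2 - b\<^sup>2\<bar> \<le> 2 * R * \<bar>a - b\<bar>" for a b R :: real
proof -
  assume a: "\<bar>a\<bar> \<le> R" and b: "\<bar>b\<bar> \<le> R"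
  have "\<bar>a\<^sup>2 - b\<^sup>2\<bar> = \<bar>a + b\<bar> * \<bar>a - b\<bar>" by (simp add: abs_mult[symmetric] power2_eq_square algebra_simps)
  also have "\<dots> \<le> (2 * R) * \<bar>a - b\<bar>" by (rule mult_right_mono) (use a b in linarith, simp)
  finally show ?thesis .
qed

lemma power3_diff_le: "\<bar>a\<bar> \<le> R \<Longrightarrow> \<bar>b\<bar> \<le> R \<Longrightarrow> \<bar>a ^ 3 - b ^ 3\<bar> \<le> 3 * R\<^sup>2 * \<bar>a - b\<bar>" for a b R :: real
proof -
  assume a: "\<bar>a\<bar> \<le> R" and b: "\<bar>b\<bar> \<le> R"
  have R: "R \<ge> 0" using a by linarith
  have "\<bar>a * a\<bar> \<le> R * R" "\<bar>a * b\<bar> \<le> R * R" "\<bar>b * b\<bar> \<le> R * R"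
    unfolding abs_mult by (intro mult_mono a b R; simp)+
  then have s: "\<bar>a * a + a * b + b * b\<bar> \<le> 3 * R\<^sup>2" unfolding power2_eq_square by linarith
  have "a ^ 3 - b ^ 3 = (a * a + a * b + b * b) * (a - b)" by (simp add: power3_eq_cube algebra_simps)
  then have "\<bar>a ^ 3 - b ^ 3\<bar> = \<bar>a * a + a * b + b * b\<bar> * \<bar>a - b\<bar>" by (simp add: abs_mult)
  also have "\<dots> \<le> 3 * R\<^sup>2 * \<bar>a - b\<bar>" by (rule mult_right_mono[OF s]) simp
  finally show ?thesis .
qed

text \<open>In diagonal form the values are at most the norm of the vector of eigenvalues, and the
  square of that norm is 15 / (2 area) times the square integral.\<close>

lemma spherical_harmonic_2_bound:
  assumes h: "spherical_harmonic 2 h" and x: "x \<in> S2"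
  shows "(h x)\<^sup>2 \<le> 15 / (2 * area) * (LINT x|sphere_measure. (h x)\<^sup>2)"
proof -
  obtain A d where A: "rotation_matrix A" "d $ 1 + d $ 2 + d $ 3 = 0" "\<forall>x\<in>S2. h (A *v x) = diag_form d x"
    using spherical_harmonic_2_normal_form[OF h] by blast
  define y where "y = transpose A *v x"
  have y: "y \<in> S2" using x norm_rotation_matrix[OF rotation_matrix_transpose[OF A(1)], of x] by (simp only: y_def mem_sphere dist_0_norm)
  have xy: "x = A *v y" unfolding y_def by (rule rotation_matrix_transpose_cancel[symmetric, OF A(1)])
  have hx: "h x = diag_form d y" unfolding xy by (rule bspec[OF A(3) y])
  have "\<bar>diag_form d y - diag_form 0 y\<bar> \<le> norm (d - 0)" by (rule diag_form_diff_le[OF y])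
  then have "\<bar>h x\<bar> \<le> norm d" by (simp add: hx diag_form_def)
  then have "(h x)\<^sup>2 \<le> (norm d)\<^sup>2" using power_mono[of "\<bar>h x\<bar>" "norm d" 2] by simp
  also have "(norm d)\<^sup>2 = (d $ 1)\<^sup>2 + (d $ 2)\<^sup>2 + (d $ 3)\<^sup>2"
    unfolding power2_norm_eq_inner by (simp add: inner_vec_def sum_3 power2_eq_square)
  also have "\<dots> = 15 / (2 * area) * (2 * area / 15 * ((d $ 1)\<^sup>2 + (d $ 2)\<^sup>2 + (d $ 3)\<^sup>2))" using area_pos by simp
  also have "2 * area / 15 * ((d $ 1)\<^sup>2 + (d $ 2)\<^sup>2 + (d $ 3)\<^sup>2) = (LINT x|sphere_measure. (diag_form d x)\<^sup>2)"
    by (rule sphere_integral_diag_form_square[OF A(2), symmetric])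
  also have "\<dots> = (LINT x|sphere_measure. (h (A *v x))\<^sup>2)"
    by (rule sphere_integral_cong) (simp only: A(3)[rule_format])
  also have "\<dots> = (LINT x|sphere_measure. (h x)\<^sup>2)"
    by (rule sphere_integral_rotation_matrix[OF A(1) continuous_on_power[OF spherical_harmonicD(3)[OF h]]])
  finally show ?thesis .
qed

text \<open>A rotated diagonal form is a combination of zonal harmonics about the rows of the
  rotation matrix; the terms -1/3 cancel because the coefficients sum to 0.\<close>

lemma spherical_harmonic_2_rotate:
  assumes Y: "spherical_harmonic 2 Y" and A: "rotation_matrix A"
  shows "\<exists>z. spherical_harmonic 2 z \<and> (\<forall>x\<in>S2. z x = Y (A *v x))"
proof -
  obtain Q d where Q: "rotation_matrix Q" "d $ 1 + d $ 2 + d $ 3 = 0" "\<forall>x\<in>S2. Y (Q *v x) = diag_form d x"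
    using spherical_harmonic_2_normal_form[OF Y] by blast
  define R where "R = transpose Q ** A"
  have R: "rotation_matrix R" unfolding R_def by (intro rotation_matrix_mult rotation_matrix_transpose Q A)
  define z where "z = (\<lambda>x. \<Sum>i\<in>UNIV. d $ i * poly [:-1/3, 0, 1:] (R $ i \<bullet> x))"
  have "spherical_harmonic 2 z" unfolding z_def
    by (intro spherical_harmonic_sum spherical_harmonic_cmult spherical_harmonic_legendre legendre_eigen_2I rotation_matrix_row[OF R])
  moreover have "z x = Y (A *v x)" if x: "x \<in> S2" for x
  proof -
    define y where "y = R *v x"
    have y: "y \<in> S2" using x norm_rotation_matrix[OF R, of x] by (simp only: y_def mem_sphere dist_0_norm)
    have "A *v x = Q *v y" unfolding y_def R_def using rotation_matrix_transpose_cancel[OF Q(1), of "A *v x"]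
      by (simp only: matrix_vector_mul_assoc)
    then have "Y (A *v x) = diag_form d y" using bspec[OF Q(3) y] by (simp only:)
    moreover have "R $ i \<bullet> x = y $ i" for i by (simp add: y_def matrix_vector_mul_component)
    ultimately show ?thesis using Q(2) by (simp add: z_def sum_3 diag_form_def power2_eq_square algebra_simps flip: add_divide_distrib)
  qed
  ultimately show ?thesis by blast
qed

text \<open>The harmonic \<open>h\<close> is bounded in terms of \<open>M\<close> and close to
  \<eta> in L^1, so its second and third moments are close to those of \<eta>, hence to those of
  \<open>Y\<close>. Then \<open>h\<close> is uniformly close to a rotated \<open>Y\<close>, and
  \<eta> follows.\<close>

lemma near_orbit_if_moments_close:
  assumes Y: "spherical_harmonic 2 Y" and e: "e > 0" and M: "M \<ge> 1"
  shows "\<exists>\<kappa>>0. \<forall>\<eta> h. continuous_on S2 \<eta> \<longrightarrow> (\<forall>x\<in>S2. \<bar>\<eta> x\<bar> \<le> M) \<longrightarrow> spherical_harmonic 2 h \<longrightarrow>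
     (LINT x|sphere_measure. (\<eta> x - h x)\<^sup>2) \<le> \<kappa> \<longrightarrow>
     \<bar>(LINT x|sphere_measure. (\<eta> x)\<^sup>2) - (LINT x|sphere_measure. (Y x)\<^sup>2)\<bar> \<le> \<kappa> \<longrightarrow>
     \<bar>(LINT x|sphere_measure. \<eta> x ^ 3) - (LINT x|sphere_measure. Y x ^ 3)\<bar> \<le> \<kappa> \<longrightarrow>
     (\<exists>A. rotation_matrix A \<and> (LINT x|sphere_measure. \<bar>\<eta> x - Y (A *v x)\<bar>) \<le> e)"
proof -
  define e2 where "e2 = e / (2 * area)"
  have e2: "e2 > 0" using e area_pos by (simp add: e2_def)
  obtain \<kappa>2 where \<kappa>2: "\<kappa>2 > 0" "\<forall>h. spherical_harmonic 2 h \<longrightarrow>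
     \<bar>(LINT x|sphere_measure. (h x)\<^sup>2) - (LINT x|sphere_measure. (Y x)\<^sup>2)\<bar> \<le> \<kappa>2 \<longrightarrow>
     \<bar>(LINT x|sphere_measure. h x ^ 3) - (LINT x|sphere_measure. Y x ^ 3)\<bar> \<le> \<kappa>2 \<longrightarrow>
     (\<exists>A. rotation_matrix A \<and> (\<forall>x\<in>S2. \<bar>h x - Y (A *v x)\<bar> \<le> e2))"
    using spherical_harmonic_2_stable[OF Y e2] by blast
  \<comment> \<open>A common bound for \<eta> and \<open>h\<close>: the last term is the sup bound
    for a degree-2 harmonic with square integral at most 2 M^2 area + 2, and the 1 makes R at most
    R^2.\<close>
  define R where "R = 1 + M\<^sup>2 + 15 / (2 * area) * (2 * M\<^sup>2 * area + 2)"
  have MR: "M \<le> R" "1 \<le> R"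
  proof -
    have "M \<le> M\<^sup>2" using M by (simp add: power2_eq_square)
    moreover have "0 \<le> 15 / (2 * area) * (2 * M\<^sup>2 * area + 2)" using area_pos by (intro mult_nonneg_nonneg) auto
    ultimately show "M \<le> R" "1 \<le> R" using M unfolding R_def by linarith+
  qed
  \<comment> \<open>On [-R, R] square and cube have Lipschitz constants 2 R and 3 R^2, both at most
    3 R^2 as R \<ge> 1; half of \<open>\<kappa>2\<close> is spent on passing from \<eta> to
    \<open>h\<close>.\<close>
  define l where "l = min (e / 2) (\<kappa>2 / (2 * (3 * R\<^sup>2)))"
  have l: "l > 0" using e \<kappa>2(1) MR(2) by (simp add: l_def)
  obtain \<kappa>1 where \<kappa>1: "\<kappa>1 > 0" "\<forall>d. continuous_on S2 d \<longrightarrow> (LINT x|sphere_measure. \<bar>d x\<bar> powr 2) \<le> \<kappa>1 \<longrightarrow> (2::real) \<ge> 1 \<longrightarrow> (LINT x|sphere_measure. \<bar>d x\<bar>) \<le> l"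
    using L1_small_if_Lp_small[OF l, of 2] by blast
  define \<kappa> where "\<kappa> = min 1 (min \<kappa>1 (\<kappa>2 / 2))"
  have \<kappa>: "\<kappa> > 0" "\<kappa> \<le> 1" "\<kappa> \<le> \<kappa>1" "\<kappa> \<le> \<kappa>2 / 2" using \<kappa>1(1) \<kappa>2(1) by (auto simp: \<kappa>_def)
  have "\<exists>A. rotation_matrix A \<and> (LINT x|sphere_measure. \<bar>\<eta> x - Y (A *v x)\<bar>) \<le> e"
    if \<eta>: "continuous_on S2 \<eta>" "\<forall>x\<in>S2. \<bar>\<eta> x\<bar> \<le> M" and h: "spherical_harmonic 2 h"
      and d: "(LINT x|sphere_measure. (\<eta> x - h x)\<^sup>2) \<le> \<kappa>"
      and m2: "\<bar>(LINT x|sphere_measure. (\<eta> x)\<^sup>2) - (LINT x|sphere_measure. (Y x)\<^sup>2)\<bar> \<le> \<kappa>"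
      and m3: "\<bar>(LINT x|sphere_measure. \<eta> x ^ 3) - (LINT x|sphere_measure. Y x ^ 3)\<bar> \<le> \<kappa>" for \<eta> h
  proof -
    note ch = spherical_harmonicD(3)[OF h]
    note cY = spherical_harmonicD(3)[OF Y]
    have cd: "continuous_on S2 (\<lambda>x. h x - \<eta> x)" by (intro continuous_intros ch \<eta>)
    have L1: "(LINT x|sphere_measure. \<bar>h x - \<eta> x\<bar>) \<le> l"
    proof (rule \<kappa>1(2)[rule_format, OF cd])
      have "(LINT x|sphere_measure. \<bar>h x - \<eta> x\<bar> powr 2) = (LINT x|sphere_measure. (\<eta> x - h x)\<^sup>2)"
        by (rule sphere_integral_cong) (simp add: power2_commute)
      then show "(LINT x|sphere_measure. \<bar>h x - \<eta> x\<bar> powr 2) \<le> \<kappa>1" using d \<kappa>(3) by simp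
    qed simp
    have "(LINT x|sphere_measure. (h x)\<^sup>2) \<le> (LINT x|sphere_measure. 2 * M\<^sup>2 + 2 * (\<eta> x - h x)\<^sup>2)"
    proof (rule sphere_integral_mono)
      fix x assume "x \<in> S2"
      then have "\<bar>\<eta> x\<bar> \<le> M" by (rule bspec[OF \<eta>(2)])
      then have "(\<eta> x)\<^sup>2 \<le> M\<^sup>2" using power_mono[of "\<bar>\<eta> x\<bar>" M 2] by simp
      then show "(h x)\<^sup>2 \<le> 2 * M\<^sup>2 + 2 * (\<eta> x - h x)\<^sup>2"
        using power2_add_le[of "\<eta> x" "h x - \<eta> x"] power2_commute[of "h x" "\<eta> x"] by simp
    qed (intro continuous_intros ch \<eta>)+
    also have "\<dots> = 2 * M\<^sup>2 * area + 2 * (LINT x|sphere_measure. (\<eta> x - h x)\<^sup>2)"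
      by (subst Bochner_Integration.integral_add) (auto intro!: integrable_sphere_measure continuous_intros ch \<eta> simp: area_def)
    also have "\<dots> \<le> 2 * M\<^sup>2 * area + 2" using d \<kappa>(2) by linarith
    finally have h2: "(LINT x|sphere_measure. (h x)\<^sup>2) \<le> 2 * M\<^sup>2 * area + 2" .
    have hR: "\<bar>h x\<bar> \<le> R" if x: "x \<in> S2" for x
    proof -
      have "(h x)\<^sup>2 \<le> 15 / (2 * area) * (LINT x|sphere_measure. (h x)\<^sup>2)" by (rule spherical_harmonic_2_bound[OF h x])
      also have "\<dots> \<le> 15 / (2 * area) * (2 * M\<^sup>2 * area + 2)" using area_pos by (intro mult_left_mono h2) simp
      also have "\<dots> \<le> R" unfolding R_def by simp
      also have "\<dots> \<le> R\<^sup>2" using MR(2) by (simp add: power2_eq_square)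
      finally show ?thesis using MR(2) abs_le_square_iff[of "h x" R] by simp
    qed
    have \<eta>R: "\<bar>\<eta> x\<bar> \<le> R" if x: "x \<in> S2" for x using bspec[OF \<eta>(2) x] MR(1) by linarith
    have Rl: "3 * R\<^sup>2 * l \<le> \<kappa>2 / 2"
    proof -
      have "3 * R\<^sup>2 * l \<le> 3 * R\<^sup>2 * (\<kappa>2 / (2 * (3 * R\<^sup>2)))" unfolding l_def by (intro mult_left_mono) auto
      also have "\<dots> = \<kappa>2 / 2" using MR(2) by simp
      finally show ?thesis .
    qed
    have "\<bar>(LINT x|sphere_measure. (h x)\<^sup>2) - (LINT x|sphere_measure. (\<eta> x)\<^sup>2)\<bar> \<le> 2 * R * (LINT x|sphere_measure. \<bar>h x - \<eta> x\<bar>)"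
      by (rule sphere_integral_diff_le) (intro continuous_intros ch \<eta> power2_diff_le hR \<eta>R | assumption)+
    also have "\<dots> \<le> 3 * R\<^sup>2 * l"
    proof (rule mult_mono)
      have "R \<le> R\<^sup>2" using MR(2) by (simp add: power2_eq_square)
      then show "2 * R \<le> 3 * R\<^sup>2" using MR(2) by linarith
    qed (use L1 MR in auto)
    finally have 2: "\<bar>(LINT x|sphere_measure. (h x)\<^sup>2) - (LINT x|sphere_measure. (Y x)\<^sup>2)\<bar> \<le> \<kappa>2" using Rl m2 \<kappa>(4) by linarith
    have "\<bar>(LINT x|sphere_measure. h x ^ 3) - (LINT x|sphere_measure. \<eta> x ^ 3)\<bar> \<le> 3 * R\<^sup>2 * (LINT x|sphere_measure. \<bar>h x - \<eta> x\<bar>)"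
      by (rule sphere_integral_diff_le) (intro continuous_intros ch \<eta> power3_diff_le hR \<eta>R | assumption)+
    also have "\<dots> \<le> 3 * R\<^sup>2 * l" by (intro mult_left_mono L1) simp
    finally have 3: "\<bar>(LINT x|sphere_measure. h x ^ 3) - (LINT x|sphere_measure. Y x ^ 3)\<bar> \<le> \<kappa>2" using Rl m3 \<kappa>(4) by linarith
    obtain A where A: "rotation_matrix A" "\<forall>x\<in>S2. \<bar>h x - Y (A *v x)\<bar> \<le> e2" using \<kappa>2(2) h 2 3 by blast
    have cYA: "continuous_on S2 (\<lambda>x. Y (A *v x))"
    proof -
      obtain z where z: "spherical_harmonic 2 z" "\<forall>x\<in>S2. z x = Y (A *v x)" using spherical_harmonic_2_rotate[OF Y A(1)] by blast
      show ?thesis by (rule continuous_on_eq[OF spherical_harmonicD(3)[OF z(1)] z(2)[rule_format]])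
    qed
    have "(LINT x|sphere_measure. \<bar>\<eta> x - Y (A *v x)\<bar>) \<le> (LINT x|sphere_measure. \<bar>h x - \<eta> x\<bar> + e2)"
    proof (rule sphere_integral_mono)
      fix x assume "x \<in> S2"
      then have "\<bar>h x - Y (A *v x)\<bar> \<le> e2" by (rule bspec[OF A(2)])
      then show "\<bar>\<eta> x - Y (A *v x)\<bar> \<le> \<bar>h x - \<eta> x\<bar> + e2" by linarith
    qed (intro continuous_intros ch \<eta> cYA)+
    also have "\<dots> = (LINT x|sphere_measure. \<bar>h x - \<eta> x\<bar>) + e2 * area"
      by (subst Bochner_Integration.integral_add) (auto intro!: integrable_sphere_measure continuous_intros ch \<eta> simp: area_def)
    also have "\<dots> \<le> e / 2 + e / 2"
    proof (rule add_mono)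
      show "(LINT x|sphere_measure. \<bar>h x - \<eta> x\<bar>) \<le> e / 2" using L1 by (simp add: l_def)
      show "e2 * area \<le> e / 2" using area_pos by (simp add: e2_def)
    qed
    finally show ?thesis using A(1) by auto
  qed
  with \<kappa>(1) show ?thesis by blast
qed


section \<open>Stability in the Lp norm\<close>

definition truncate :: "real \<Rightarrow> real \<Rightarrow> real" where "truncate M s = max (- M) (min M s)"

lemma truncate_abs_le: "M \<ge> 0 \<Longrightarrow> \<bar>truncate M s\<bar> \<le> M"
  by (auto simp: truncate_def)

text \<open>Properties of the nearest-point projection onto [-M, M]; with \<open>y\<close> a value
  of the harmonic, the truncation inherits the initial distance.\<close>

lemma truncate_dist: "\<bar>y\<bar> \<le> M \<Longrightarrow> \<bar>truncate M s - y\<bar> \<le> \<bar>s - y\<bar>" "\<bar>y\<bar> \<le> M \<Longrightarrow> \<bar>s - truncate M s\<bar> \<le> \<bar>s - y\<bar>"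
  unfolding truncate_def by linarith+

lemma continuous_on_truncate: "continuous_on U f \<Longrightarrow> continuous_on U (\<lambda>x. truncate M (f x))"
  unfolding truncate_def by (intro continuous_on_max continuous_on_min continuous_intros)

lemma norm_momentum_diff_le:
  assumes f: "continuous_on S2 f" and g: "continuous_on S2 g"
  shows "norm (momentum f - momentum g) \<le> 3 * (LINT x|sphere_measure. \<bar>f x - g x\<bar>)"
proof -
  have "\<bar>(momentum f - momentum g) $ i\<bar> \<le> (LINT x|sphere_measure. \<bar>f x - g x\<bar>)" for i
  proof -
    have "\<bar>(LINT x|sphere_measure. f x * x $ i) - (LINT x|sphere_measure. g x * x $ i)\<bar> \<le> 1 * (LINT x|sphere_measure. \<bar>f x - g x\<bar>)"
    proof (rule sphere_integral_diff_le)
      fix x :: "real^3" assume "x \<in> S2"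
      then have "\<bar>x $ i\<bar> \<le> 1" using component_le_norm_cart[of x i] by simp
      then have "\<bar>f x - g x\<bar> * \<bar>x $ i\<bar> \<le> \<bar>f x - g x\<bar> * 1" by (intro mult_left_mono) simp_all
      then show "\<bar>f x * x $ i - g x * x $ i\<bar> \<le> 1 * \<bar>f x - g x\<bar>" by (simp add: abs_mult[symmetric] algebra_simps)
    qed (intro continuous_intros f g)+
    then show ?thesis by (simp add: momentum_def)
  qed
  then have "(\<Sum>i\<in>UNIV. \<bar>(momentum f - momentum g) $ i\<bar>) \<le> (\<Sum>i\<in>(UNIV::3 set). (LINT x|sphere_measure. \<bar>f x - g x\<bar>))"
    by (intro sum_mono)
  then show ?thesis using norm_le_l1_cart[of "momentum f - momentum g"] by simp
qed

lemma momentum_spherical_harmonic_2: "spherical_harmonic 2 z \<Longrightarrow> momentum z = 0"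
proof -
  assume z: "spherical_harmonic 2 z"
  have "legendre_eigen 1 [:0, 1:]" by (auto simp: legendre_eigen_def legendre_op_def pderiv_pCons coeff_pCons split: nat.split)
  then have "spherical_harmonic 1 (\<lambda>x. poly [:0, 1:] (axis i 1 \<bullet> x))" for i
    by (rule spherical_harmonic_legendre) (simp add: norm_axis_1)
  from spherical_harmonic_orthogonal[OF z this]
  have "(LINT x|sphere_measure. z x * x $ i) = 0" for i by (simp add: inner_axis')
  then show ?thesis by (simp add: momentum_def vec_eq_iff)
qed

lemma energy_spherical_harmonic_2: "spherical_harmonic 2 z \<Longrightarrow> energy z = (LINT x|sphere_measure. (z x)\<^sup>2) / 6"
proof -
  assume z: "spherical_harmonic 2 z"
  have "energy z = (LINT x|sphere_measure. (z x)\<^sup>2 / 6)" unfolding energy_def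
    by (rule sphere_integral_cong) (subst log_potential_spherical_harmonic[OF z], simp_all add: power2_eq_square)
  then show ?thesis by simp
qed

text \<open>Carries the closeness at time 0 over to the truncated solution at time \<open>t\<close>.
  The moments of \<eta> and its distance to the solution are integrals of continuous functions of
  the solution, hence equal to their initial values, which are compared with \<open>z\<close>.
  Energy, mean and momentum are conserved for the solution itself and pass to \<eta> through the L^1
  distance.\<close>

lemma (in vorticity_solution) truncation_estimates:
  assumes p: "p > 1" and t: "t \<ge> 0" and M: "M \<ge> 0" and C: "C \<ge> 0"
    and z: "spherical_harmonic 2 z" and zM: "\<forall>x\<in>S2. \<bar>z x\<bar> \<le> M"
    and lip: "\<forall>f g M. continuous_on S2 f \<longrightarrow> continuous_on S2 g \<longrightarrow> (\<forall>x\<in>S2. \<bar>g x\<bar> \<le> M) \<longrightarrow>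
      (LINT x|sphere_measure. \<bar>f x - g x\<bar> powr p) \<le> 1 \<longrightarrow> \<bar>energy f - energy g\<bar> \<le> (C + C * M) * (LINT x|sphere_measure. \<bar>f x - g x\<bar>)"
    and k: "(LINT x|sphere_measure. \<bar>\<zeta> 0 x - z x\<bar> powr p) \<le> \<kappa>" "\<kappa> \<le> 1"
    and L: "\<forall>d. continuous_on S2 d \<longrightarrow> (LINT x|sphere_measure. \<bar>d x\<bar> powr p) \<le> \<kappa> \<longrightarrow> (LINT x|sphere_measure. \<bar>d x\<bar>) \<le> l"
    and \<eta>_def: "\<eta> = (\<lambda>x. truncate M (\<zeta> t x))"
  shows "(LINT x|sphere_measure. \<bar>\<zeta> t x - \<eta> x\<bar> powr p) \<le> \<kappa>"
    and "\<bar>(LINT x|sphere_measure. (\<eta> x)\<^sup>2) - (LINT x|sphere_measure. (z x)\<^sup>2)\<bar> \<le> 2 * M * l"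
    and "\<bar>(LINT x|sphere_measure. \<eta> x ^ 3) - (LINT x|sphere_measure. z x ^ 3)\<bar> \<le> 3 * M\<^sup>2 * l"
    and "\<bar>energy \<eta> - (LINT x|sphere_measure. (z x)\<^sup>2) / 6\<bar> \<le> 2 * (C + C * M) * l"
    and "\<bar>LINT x|sphere_measure. \<eta> x\<bar> \<le> l"
    and "norm (momentum \<eta>) \<le> 6 * l"
proof -
  note cz = spherical_harmonicD(3)[OF z]
  note c0 = cont[of 0, simplified]
  note ct = cont[OF t]
  have cT: "continuous_on UNIV (truncate M)" using continuous_on_truncate[OF continuous_on_id, of UNIV M] by simp
  have c\<eta>: "continuous_on S2 \<eta>" unfolding \<eta>_def by (rule continuous_on_truncate[OF ct])
  have c\<eta>0: "continuous_on S2 (\<lambda>x. truncate M (\<zeta> 0 x))" by (rule continuous_on_truncate[OF c0])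
  have p0: "p > 0" using p by simp
  show a: "(LINT x|sphere_measure. \<bar>\<zeta> t x - \<eta> x\<bar> powr p) \<le> \<kappa>"
  proof -
    have "(LINT x|sphere_measure. \<bar>\<zeta> t x - \<eta> x\<bar> powr p) = (LINT x|sphere_measure. \<bar>\<zeta> 0 x - truncate M (\<zeta> 0 x)\<bar> powr p)"
      unfolding \<eta>_def by (rule casimir_conserved[OF t continuous_on_abs_powr[OF continuous_on_diff[OF continuous_on_id cT] p0]])
    also have "\<dots> \<le> (LINT x|sphere_measure. \<bar>\<zeta> 0 x - z x\<bar> powr p)"
    proof (rule sphere_integral_mono)
      fix x assume x: "x \<in> S2"
      show "\<bar>\<zeta> 0 x - truncate M (\<zeta> 0 x)\<bar> powr p \<le> \<bar>\<zeta> 0 x - z x\<bar> powr p"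
        using truncate_dist(2)[OF bspec[OF zM x], of "\<zeta> 0 x"] p0 by (intro powr_mono2) auto
    qed (intro continuous_on_abs_powr continuous_on_diff c0 cz c\<eta>0 p0)+
    finally show ?thesis using k(1) by linarith
  qed
  have l0: "(LINT x|sphere_measure. \<bar>\<zeta> 0 x - z x\<bar>) \<le> l"
    by (rule L[rule_format, OF continuous_on_diff[OF c0 cz] k(1)])
  have lt: "(LINT x|sphere_measure. \<bar>\<zeta> t x - \<eta> x\<bar>) \<le> l"
    by (rule L[rule_format, OF continuous_on_diff[OF ct c\<eta>] a])
  have trunc: "\<bar>truncate M s\<bar> \<le> M" for s by (rule truncate_abs_le[OF M])
  have l\<eta>0: "(LINT x|sphere_measure. \<bar>truncate M (\<zeta> 0 x) - z x\<bar>) \<le> l"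
  proof -
    have "(LINT x|sphere_measure. \<bar>truncate M (\<zeta> 0 x) - z x\<bar>) \<le> (LINT x|sphere_measure. \<bar>\<zeta> 0 x - z x\<bar>)"
    proof (rule sphere_integral_mono)
      fix x assume x: "x \<in> S2"
      show "\<bar>truncate M (\<zeta> 0 x) - z x\<bar> \<le> \<bar>\<zeta> 0 x - z x\<bar>" by (rule truncate_dist(1)[OF bspec[OF zM x]])
    qed (intro continuous_intros c0 cz c\<eta>0)+
    then show ?thesis using l0 by linarith
  qed
  have casimir: "(LINT x|sphere_measure. \<eta> x ^ n) = (LINT x|sphere_measure. truncate M (\<zeta> 0 x) ^ n)" for n
    unfolding \<eta>_def by (rule casimir_conserved[OF t continuous_on_power[OF cT]])
  show "\<bar>(LINT x|sphere_measure. (\<eta> x)\<^sup>2) - (LINT x|sphere_measure. (z x)\<^sup>2)\<bar> \<le> 2 * M * l"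
  proof -
    have "\<bar>(LINT x|sphere_measure. (\<eta> x)\<^sup>2) - (LINT x|sphere_measure. (z x)\<^sup>2)\<bar> \<le> 2 * M * (LINT x|sphere_measure. \<bar>truncate M (\<zeta> 0 x) - z x\<bar>)"
      unfolding casimir
      by (rule sphere_integral_diff_le) (intro continuous_intros c\<eta>0 cz power2_diff_le trunc zM[rule_format] | assumption)+
    also have "\<dots> \<le> 2 * M * l" using M by (intro mult_left_mono l\<eta>0) simp
    finally show ?thesis .
  qed
  show "\<bar>(LINT x|sphere_measure. \<eta> x ^ 3) - (LINT x|sphere_measure. z x ^ 3)\<bar> \<le> 3 * M\<^sup>2 * l"
  proof -
    have "\<bar>(LINT x|sphere_measure. \<eta> x ^ 3) - (LINT x|sphere_measure. z x ^ 3)\<bar> \<le> 3 * M\<^sup>2 * (LINT x|sphere_measure. \<bar>truncate M (\<zeta> 0 x) - z x\<bar>)"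
      unfolding casimir
      by (rule sphere_integral_diff_le) (intro continuous_intros c\<eta>0 cz power3_diff_le trunc zM[rule_format] | assumption)+
    also have "\<dots> \<le> 3 * M\<^sup>2 * l" by (intro mult_left_mono l\<eta>0) simp
    finally show ?thesis .
  qed
  show "\<bar>energy \<eta> - (LINT x|sphere_measure. (z x)\<^sup>2) / 6\<bar> \<le> 2 * (C + C * M) * l"
  proof -
    have CM: "0 \<le> C + C * M" using C M by simp
    have "\<bar>energy (\<zeta> 0) - energy z\<bar> \<le> (C + C * M) * (LINT x|sphere_measure. \<bar>\<zeta> 0 x - z x\<bar>)"
      by (rule lip[rule_format, OF c0 cz zM[rule_format]]) (use k in auto)
    also have "\<dots> \<le> (C + C * M) * l" by (rule mult_left_mono[OF l0 CM])
    finally have 1: "\<bar>energy (\<zeta> 0) - energy z\<bar> \<le> (C + C * M) * l" .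
    have "\<bar>energy (\<zeta> t) - energy \<eta>\<bar> \<le> (C + C * M) * (LINT x|sphere_measure. \<bar>\<zeta> t x - \<eta> x\<bar>)"
      by (rule lip[rule_format, OF ct c\<eta>]) (use a k(2) trunc in \<open>auto simp: \<eta>_def\<close>)
    also have "\<dots> \<le> (C + C * M) * l" by (rule mult_left_mono[OF lt CM])
    finally have 2: "\<bar>energy (\<zeta> t) - energy \<eta>\<bar> \<le> (C + C * M) * l" .
    have "\<bar>energy \<eta> - energy z\<bar> \<le> (C + C * M) * l + (C + C * M) * l"
      using 1 2 energy_conserved[OF t] by linarith
    then show ?thesis unfolding energy_spherical_harmonic_2[OF z] by (simp add: algebra_simps)
  qed
  show "\<bar>LINT x|sphere_measure. \<eta> x\<bar> \<le> l"
  proof -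
    have "\<bar>(LINT x|sphere_measure. \<eta> x) - (LINT x|sphere_measure. \<zeta> t x)\<bar> \<le> 1 * (LINT x|sphere_measure. \<bar>\<zeta> t x - \<eta> x\<bar>)"
      by (rule sphere_integral_diff_le) (intro continuous_intros c\<eta> ct | simp)+
    then show ?thesis using lt mean[OF t] by (simp add: zero_mean_def)
  qed
  \<comment> \<open>One share of 3 l for the initial distance to \<open>z\<close>, whose momentum
    vanishes, and one for the distance to the truncation.\<close>
  show "norm (momentum \<eta>) \<le> 6 * l"
  proof -
    have "norm (momentum \<eta>) \<le> norm (momentum (\<zeta> t)) + norm (momentum (\<zeta> t) - momentum \<eta>)"
      using norm_triangle_ineq4[of "momentum (\<zeta> t)" "momentum (\<zeta> t) - momentum \<eta>"] by simp
    also have "norm (momentum (\<zeta> t) - momentum \<eta>) \<le> 3 * (LINT x|sphere_measure. \<bar>\<zeta> t x - \<eta> x\<bar>)"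
      by (rule norm_momentum_diff_le[OF ct c\<eta>])
    also have "norm (momentum (\<zeta> t)) \<le> 3 * (LINT x|sphere_measure. \<bar>\<zeta> 0 x - z x\<bar>)"
      using norm_momentum_diff_le[OF c0 cz] by (simp add: momentum_conserved[OF t] momentum_spherical_harmonic_2[OF z])
    finally show ?thesis using l0 lt by linarith
  qed
qed

theorem theorem2p3:
  fixes p \<omega> :: real and Y :: "real^3 \<Rightarrow> real"
  assumes "1 < p"
    and "Y \<in> E2"
    and "\<exists>x\<in>S2. Y x \<noteq> 0"
  shows "\<forall>\<epsilon>>0. \<exists>\<delta>>0. \<forall>\<zeta>. smooth_vorticity_solution \<omega> \<zeta> \<longrightarrow>
           orbit_dist p Y (\<zeta> 0) < \<delta> \<longrightarrow> (\<forall>t>0. orbit_dist p Y (\<zeta> t) < \<epsilon>)"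
proof (intro allI impI)
  fix \<epsilon> :: real assume \<epsilon>: "\<epsilon> > 0"
  note p = assms(1)
  have p0: "p > 0" using p by simp
  have Y: "spherical_harmonic 2 Y" using assms(2) by (simp add: E2_iff)
  note cY = spherical_harmonicD(3)[OF Y]
  have "\<exists>M\<ge>1. \<forall>x\<in>S2. \<bar>Y x\<bar> \<le> M"
  proof -
    obtain B where B: "\<forall>x\<in>S2. \<bar>Y x\<bar> \<le> B" using bounded_continuous_S2[OF cY] by (auto simp: bounded_iff)
    have "\<forall>x\<in>S2. \<bar>Y x\<bar> \<le> max 1 B"
    proof
      fix x assume "x \<in> S2"
      then have "\<bar>Y x\<bar> \<le> B" by (rule bspec[OF B])
      then show "\<bar>Y x\<bar> \<le> max 1 B" by simp
    qed
    then show ?thesis by (intro exI[of _ "max 1 B"]) simp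
  qed
  then obtain M where M: "M \<ge> 1" "\<forall>x\<in>S2. \<bar>Y x\<bar> \<le> M" by blast
  obtain C where C: "C > 0" "\<forall>f g M. continuous_on S2 f \<longrightarrow> continuous_on S2 g \<longrightarrow> (\<forall>x\<in>S2. \<bar>g x\<bar> \<le> M) \<longrightarrow>
      (LINT x|sphere_measure. \<bar>f x - g x\<bar> powr p) \<le> 1 \<longrightarrow> \<bar>energy f - energy g\<bar> \<le> (C + C * M) * (LINT x|sphere_measure. \<bar>f x - g x\<bar>)"
    using energy_lipschitz[OF p] by blast
  obtain D where D: "D \<ge> 0" "\<forall>f e. continuous_on S2 f \<longrightarrow> e > 0 \<longrightarrow> (\<exists>h. spherical_harmonic 2 h \<and>
    (LINT x|sphere_measure. (f x - h x)\<^sup>2) \<le> 24 * ((LINT x|sphere_measure. (f x)\<^sup>2) / 6 - energy f)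
      + D * ((LINT x|sphere_measure. f x)\<^sup>2 + (norm (momentum f))\<^sup>2) + e)"
    using spectral_inequality by blast
  \<comment> \<open>The p-th power of a sum of two terms costs a factor 2^p; two contributions of
    \<open>e\<close> then give half of \<epsilon>^p, which leaves a strict inequality.\<close>
  define e where "e = \<epsilon> powr p / (4 * 2 powr p)"
  have e: "e > 0" using \<epsilon> by (simp add: e_def)
  \<comment> \<open>Between functions bounded by \<open>M\<close>, the p-th power of the difference
    is at most (2 M)^(p-1) times the difference. Truncation is what makes this return from L^1 to
    L^p possible.\<close>
  define B where "B = (2 * M) powr (p - 1)"
  have B: "B > 0" using M(1) by (simp add: B_def)
  have eB: "e / B > 0" using e B by simp
  obtain \<kappa> where \<kappa>: "\<kappa> > 0" "\<forall>\<eta> h. continuous_on S2 \<eta> \<longrightarrow> (\<forall>x\<in>S2. \<bar>\<eta> x\<bar> \<le> M) \<longrightarrow> spherical_harmonic 2 h \<longrightarrow>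
     (LINT x|sphere_measure. (\<eta> x - h x)\<^sup>2) \<le> \<kappa> \<longrightarrow>
     \<bar>(LINT x|sphere_measure. (\<eta> x)\<^sup>2) - (LINT x|sphere_measure. (Y x)\<^sup>2)\<bar> \<le> \<kappa> \<longrightarrow>
     \<bar>(LINT x|sphere_measure. \<eta> x ^ 3) - (LINT x|sphere_measure. Y x ^ 3)\<bar> \<le> \<kappa> \<longrightarrow>
     (\<exists>A. rotation_matrix A \<and> (LINT x|sphere_measure. \<bar>\<eta> x - Y (A *v x)\<bar>) \<le> e / B)"
    using near_orbit_if_moments_close[OF Y eB M(1)] by blast
  \<comment> \<open>The sum of the factors of \<open>l\<close> in the estimates to come: the terms
    up to 1 bound the square integral of \<eta> - h, the last two the deviations of the moments.
    Here M / 3 is one sixth of 2 M, 37 = 1 + 6^2 comes from mean and momentum, and 1 from the slack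
    of \<open>spectral_inequality\<close>, which is taken to be \<open>l\<close>.\<close>
  define K where "K = 24 * (M / 3 + 2 * (C + C * M)) + D * 37 + 1 + 2 * M + 3 * M\<^sup>2"
  have K1: "K \<ge> 24 * (M / 3 + 2 * (C + C * M)) + D * 37 + 1" "K \<ge> 2 * M" "K \<ge> 3 * M\<^sup>2" "K > 0"
  proof -
    have "0 \<le> C + C * M" using C(1) M(1) by simp
    then show "K \<ge> 24 * (M / 3 + 2 * (C + C * M)) + D * 37 + 1" "K \<ge> 2 * M" "K \<ge> 3 * M\<^sup>2" "K > 0"
      using M(1) D(1) zero_le_power2[of M] unfolding K_def by (smt (verit) divide_nonneg_nonneg)+
  qed
  \<comment> \<open>The bound 1 gives l^2 \<le> l, so that the squares of mean and momentum are
    linear in \<open>l\<close> as well.\<close>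
  define l where "l = min 1 (\<kappa> / K)"
  have l: "0 < l" "l \<le> 1" "K * l \<le> \<kappa>"
  proof -
    show "0 < l" "l \<le> 1" using \<kappa>(1) K1(4) by (simp_all add: l_def)
    have "K * l \<le> K * (\<kappa> / K)" using K1(4) by (intro mult_left_mono) (auto simp: l_def)
    then show "K * l \<le> \<kappa>" using K1(4) by simp
  qed
  obtain \<mu> where \<mu>: "\<mu> > 0" "\<forall>d. continuous_on S2 d \<longrightarrow> (LINT x|sphere_measure. \<bar>d x\<bar> powr p) \<le> \<mu> \<longrightarrow> p \<ge> 1 \<longrightarrow> (LINT x|sphere_measure. \<bar>d x\<bar>) \<le> l"
    using L1_small_if_Lp_small[OF l(1), of p] by blast
  \<comment> \<open>The bound 1 is the smallness condition of \<open>energy_lipschitz\<close>, \<mu>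
    yields the L^1 bound \<open>l\<close>, and \<open>e\<close> is the share of the truncation error
    in the final estimate.\<close>
  define \<mu>' where "\<mu>' = min 1 (min \<mu> e)"
  have \<mu>': "\<mu>' > 0" "\<mu>' \<le> 1" "\<mu>' \<le> \<mu>" "\<mu>' \<le> e" using \<mu>(1) e by (auto simp: \<mu>'_def)
  define \<delta> where "\<delta> = \<mu>' powr (1 / p)"
  have \<delta>: "\<delta> > 0" using \<mu>'(1) by (simp add: \<delta>_def)
  have "orbit_dist p Y (\<zeta> t) < \<epsilon>" if sol: "smooth_vorticity_solution \<omega> \<zeta>" and d0: "orbit_dist p Y (\<zeta> 0) < \<delta>" and t: "t > 0" for \<zeta> t
  proof -
    interpret vorticity_solution \<omega> \<zeta> by standard (rule sol)
    have t0: "t \<ge> 0" using t by simp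
    note c0 = cont[of 0, simplified]
    note ct = cont[OF t0]
    obtain A where A: "rotation_matrix A" "orbit_dist p Y (\<zeta> 0) = Lp_norm p (\<lambda>x. Y (A *v x) - \<zeta> 0 x)"
      using orbit_dist_attained[OF p cY c0] by blast
    \<comment> \<open>A nearest point of the orbit at time 0; being a rotated \<open>Y\<close>, it
      has the same bound and the same moments.\<close>
    obtain z where z: "spherical_harmonic 2 z" "\<forall>x\<in>S2. z x = Y (A *v x)" using spherical_harmonic_2_rotate[OF Y A(1)] by blast
    note cz = spherical_harmonicD(3)[OF z(1)]
    have zM: "\<forall>x\<in>S2. \<bar>z x\<bar> \<le> M"
    proof
      fix x assume x: "x \<in> S2"
      have "A *v x \<in> S2" using x norm_rotation_matrix[OF A(1), of x] by simp
      then show "\<bar>z x\<bar> \<le> M" using bspec[OF M(2)] bspec[OF z(2) x] by simp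
    qed
    have zY: "(LINT x|sphere_measure. z x ^ n) = (LINT x|sphere_measure. Y x ^ n)" for n
    proof -
      have "(LINT x|sphere_measure. z x ^ n) = (LINT x|sphere_measure. Y (A *v x) ^ n)"
        by (rule sphere_integral_cong) (simp only: z(2)[rule_format])
      then show ?thesis using sphere_integral_rotation_matrix[OF A(1) continuous_on_power[OF cY]] by simp
    qed
    have k: "(LINT x|sphere_measure. \<bar>\<zeta> 0 x - z x\<bar> powr p) \<le> \<mu>'"
    proof -
      define I where "I = (LINT x|sphere_measure. \<bar>\<zeta> 0 x - z x\<bar> powr p)"
      have "I = (LINT x|sphere_measure. \<bar>Y (A *v x) - \<zeta> 0 x\<bar> powr p)" unfolding I_def
        by (rule sphere_integral_cong) (simp only: z(2)[rule_format] abs_minus_commute)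
      then have "I powr (1 / p) < \<mu>' powr (1 / p)" using d0 unfolding A(2) Lp_norm_def \<delta>_def by simp
      then show ?thesis using powr_mono2[of "1 / p" \<mu>' I] p0 \<mu>'(1) unfolding I_def by force
    qed
    have L: "\<forall>d. continuous_on S2 d \<longrightarrow> (LINT x|sphere_measure. \<bar>d x\<bar> powr p) \<le> \<mu>' \<longrightarrow> (LINT x|sphere_measure. \<bar>d x\<bar>) \<le> l"
      using \<mu>(2) \<mu>'(3) p by (meson less_imp_le order_trans)
    have M0: "M \<ge> 0" using M(1) by simp
    define \<eta> where "\<eta> = (\<lambda>x. truncate M (\<zeta> t x))"
    note est = truncation_estimates[OF p t0 M0 less_imp_le[OF C(1)] z(1) zM C(2) k \<mu>'(2) L \<eta>_def, unfolded zY]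
    have c\<eta>: "continuous_on S2 \<eta>" unfolding \<eta>_def by (rule continuous_on_truncate[OF ct])
    have \<eta>M: "\<forall>x\<in>S2. \<bar>\<eta> x\<bar> \<le> M" using truncate_abs_le[OF M0] by (simp add: \<eta>_def)
    obtain h where h: "spherical_harmonic 2 h" "(LINT x|sphere_measure. (\<eta> x - h x)\<^sup>2) \<le> 24 * ((LINT x|sphere_measure. (\<eta> x)\<^sup>2) / 6 - energy \<eta>)
      + D * ((LINT x|sphere_measure. \<eta> x)\<^sup>2 + (norm (momentum \<eta>))\<^sup>2) + l"
      using D(2) c\<eta> l(1) by blast
    have "(LINT x|sphere_measure. (\<eta> x - h x)\<^sup>2) \<le> K * l"
    proof -
      have 1: "(LINT x|sphere_measure. (\<eta> x)\<^sup>2) / 6 - energy \<eta> \<le> (M / 3 + 2 * (C + C * M)) * l"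
      proof -
        have "a / 6 - b \<le> (M / 3 + N) * l" if "\<bar>a - c\<bar> \<le> 2 * M * l" "\<bar>b - c / 6\<bar> \<le> N * l" for a b c N :: real
        proof -
          have "(M / 3 + N) * l = 2 * M * l / 6 + N * l" by (simp add: algebra_simps)
          with that show ?thesis by linarith
        qed
        from this[OF est(2,4)] show ?thesis .
      qed
      have 2: "(LINT x|sphere_measure. \<eta> x)\<^sup>2 + (norm (momentum \<eta>))\<^sup>2 \<le> 37 * l"
      proof -
        have ll: "l\<^sup>2 \<le> l" using l(1,2) by (simp add: power2_eq_square mult_left_le)
        have "(LINT x|sphere_measure. \<eta> x)\<^sup>2 \<le> l\<^sup>2" using power_mono[OF est(5), of 2] by simp
        moreover have "(norm (momentum \<eta>))\<^sup>2 \<le> (6 * l)\<^sup>2" using est(6) by (intro power_mono) auto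
        ultimately show ?thesis using ll by (simp add: power_mult_distrib)
      qed
      have "24 * ((LINT x|sphere_measure. (\<eta> x)\<^sup>2) / 6 - energy \<eta>) + D * ((LINT x|sphere_measure. \<eta> x)\<^sup>2 + (norm (momentum \<eta>))\<^sup>2) + l
          \<le> 24 * ((M / 3 + 2 * (C + C * M)) * l) + D * (37 * l) + l"
        by (intro add_mono mult_left_mono 1 2 D(1)) simp_all
      also have "\<dots> = (24 * (M / 3 + 2 * (C + C * M)) + D * 37 + 1) * l" by (simp add: algebra_simps)
      also have "\<dots> \<le> K * l" using K1(1) l(1) by (intro mult_right_mono) simp_all
      finally show ?thesis using h(2) by linarith
    qed
    then have h2: "(LINT x|sphere_measure. (\<eta> x - h x)\<^sup>2) \<le> \<kappa>" using l(3) by linarith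
    have "2 * M * l \<le> K * l" "3 * M\<^sup>2 * l \<le> K * l" using K1(2,3) l(1) by (intro mult_right_mono; simp)+
    with est(2,3) l(3) have m: "\<bar>(LINT x|sphere_measure. (\<eta> x)\<^sup>2) - (LINT x|sphere_measure. (Y x)\<^sup>2)\<bar> \<le> \<kappa>"
      "\<bar>(LINT x|sphere_measure. \<eta> x ^ 3) - (LINT x|sphere_measure. Y x ^ 3)\<bar> \<le> \<kappa>" by linarith+
    obtain Q where Q: "rotation_matrix Q" "(LINT x|sphere_measure. \<bar>\<eta> x - Y (Q *v x)\<bar>) \<le> e / B"
      using \<kappa>(2) c\<eta> \<eta>M h(1) h2 m by blast
    have QS: "Q *v x \<in> S2" if "x \<in> S2" for x using that norm_rotation_matrix[OF Q(1), of x] by simp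
    obtain w where w: "spherical_harmonic 2 w" "\<forall>x\<in>S2. w x = Y (Q *v x)" using spherical_harmonic_2_rotate[OF Y Q(1)] by blast
    have cQ: "continuous_on S2 (\<lambda>x. Y (Q *v x))"
      by (rule continuous_on_eq[OF spherical_harmonicD(3)[OF w(1)] w(2)[rule_format]])
    have \<eta>p: "(LINT x|sphere_measure. \<bar>\<eta> x - Y (Q *v x)\<bar> powr p) \<le> e"
    proof -
      have "(LINT x|sphere_measure. \<bar>\<eta> x - Y (Q *v x)\<bar> powr p) \<le> (LINT x|sphere_measure. B * \<bar>\<eta> x - Y (Q *v x)\<bar>)"
      proof (rule sphere_integral_mono)
        fix x assume x: "x \<in> S2"
        define s where "s = \<bar>\<eta> x - Y (Q *v x)\<bar>"
        have s: "0 \<le> s" "s \<le> 2 * M" using bspec[OF \<eta>M x] bspec[OF M(2) QS[OF x]] unfolding s_def by linarith+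
        have "s powr p \<le> B * s"
        proof (cases "s = 0")
          case False
          then have "s powr p = s powr (p - 1) * s" using s powr_add[of s "p - 1" 1] by simp
          also have "\<dots> \<le> B * s" unfolding B_def using s p by (intro mult_right_mono powr_mono2) auto
          finally show ?thesis .
        qed simp
        then show "\<bar>\<eta> x - Y (Q *v x)\<bar> powr p \<le> B * \<bar>\<eta> x - Y (Q *v x)\<bar>" by (simp add: s_def)
      qed (intro continuous_intros continuous_on_abs_powr c\<eta> cQ p0)+
      also have "\<dots> = B * (LINT x|sphere_measure. \<bar>\<eta> x - Y (Q *v x)\<bar>)" by simp
      also have "\<dots> \<le> B * (e / B)" using Q(2) B by (intro mult_left_mono) auto
      finally show ?thesis using B by simp
    qed
    have "(LINT x|sphere_measure. \<bar>Y (Q *v x) - \<zeta> t x\<bar> powr p) \<le> (LINT x|sphere_measure. 2 powr p * (\<bar>\<zeta> t x - \<eta> x\<bar> powr p + \<bar>\<eta> x - Y (Q *v x)\<bar> powr p))"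
    proof (rule sphere_integral_mono)
      fix x
      define a b where "a = \<bar>\<zeta> t x - \<eta> x\<bar>" and "b = \<bar>\<eta> x - Y (Q *v x)\<bar>"
      have ab: "0 \<le> a" "0 \<le> b" by (simp_all add: a_def b_def)
      have "\<bar>Y (Q *v x) - \<zeta> t x\<bar> powr p \<le> (2 * max a b) powr p"
      proof (rule powr_mono2)
        have "\<bar>Y (Q *v x) - \<zeta> t x\<bar> \<le> a + b" unfolding a_def b_def by linarith
        then show "\<bar>Y (Q *v x) - \<zeta> t x\<bar> \<le> 2 * max a b" by linarith
      qed (use p0 in auto)
      also have "\<dots> = 2 powr p * (max a b) powr p" using ab by (simp add: powr_mult)
      also have "\<dots> \<le> 2 powr p * (a powr p + b powr p)" by (intro mult_left_mono) (auto simp: max_def)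
      finally show "\<bar>Y (Q *v x) - \<zeta> t x\<bar> powr p \<le> 2 powr p * (\<bar>\<zeta> t x - \<eta> x\<bar> powr p + \<bar>\<eta> x - Y (Q *v x)\<bar> powr p)"
        by (simp add: a_def b_def)
    qed (intro continuous_on_mult continuous_on_add continuous_on_const continuous_on_diff continuous_on_abs_powr c\<eta> ct cQ p0)+
    also have "\<dots> = 2 powr p * ((LINT x|sphere_measure. \<bar>\<zeta> t x - \<eta> x\<bar> powr p) + (LINT x|sphere_measure. \<bar>\<eta> x - Y (Q *v x)\<bar> powr p))"
      unfolding integral_mult_right_zero
      by (subst Bochner_Integration.integral_add)
        (intro integrable_sphere_measure continuous_on_diff continuous_on_abs_powr c\<eta> ct cQ p0 refl)+
    also have "\<dots> \<le> 2 powr p * (e + e)"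
      using est(1) \<mu>'(4) \<eta>p by (intro mult_left_mono add_mono) auto
    also have "\<dots> = \<epsilon> powr p / 2" by (simp add: e_def field_simps)
    also have "\<dots> < \<epsilon> powr p" using \<epsilon> by simp
    finally have I: "(LINT x|sphere_measure. \<bar>Y (Q *v x) - \<zeta> t x\<bar> powr p) < \<epsilon> powr p" .
    have "Lp_norm p (\<lambda>x. Y (Q *v x) - \<zeta> t x) < (\<epsilon> powr p) powr (1 / p)"
      unfolding Lp_norm_def by (rule powr_less_mono2[OF _ _ I]) (use p0 in auto)
    then have "Lp_norm p (\<lambda>x. Y (Q *v x) - \<zeta> t x) < \<epsilon>" using \<epsilon> p0 by (simp add: powr_powr)
    moreover have "orbit_dist p Y (\<zeta> t) \<le> Lp_norm p (\<lambda>x. Y (Q *v x) - \<zeta> t x)"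
      using orbit_dist_attained[OF p cY ct] Q(1) by blast
    ultimately show ?thesis by linarith
  qed
  with \<delta> show "\<exists>\<delta>>0. \<forall>\<zeta>. smooth_vorticity_solution \<omega> \<zeta> \<longrightarrow> orbit_dist p Y (\<zeta> 0) < \<delta> \<longrightarrow> (\<forall>t>0. orbit_dist p Y (\<zeta> t) < \<epsilon>)"
    by blast
qed

end
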